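(* The multi-virtual quandle $Q(K)$ associated with an oriented multi-virtual link diagram $K$ is invariant, up to isomorphism, under the classical Reidemeister moves and all detour moves. Hence $Q(K)$ is an invariant of multi-virtual links.
   Context: A quandle is a set $Q$ with binary operations $\star,\sharp$ such that for all $a,b,c\in Q$: (1) $a\star a=a$ and $a\sharp a=a$; (2) $(a\star b)\sharp b=a$ and $(a\sharp b)\star b=a$; (3) $(a\star b)\star c=(a\star c)\star(b\star c)$ and $(a\sharp b)\sharp c=(a\sharp c)\sharp(b\sharp c)$. Fix an index set $\mathcal{A}$ of virtual crossing types. An oriented multi-virtual link diagram is a generic immersion of finitely many oriented circles in the plane in which each double point is either a classical crossing (with over/under information) or a virtual crossing labeled by an element of $\mathcal{A}$. Detour move: a segment of the diagram containing only a consecutive sequence of virtual crossings, all of the same type $\alpha\in\mathcal{A}$ (possibly an empty sequence), is excised, and its endpoints are reconnected by any other arc in the plane meeting the rest of the diagram (and itself) transversally, every new crossing being declared virtual of type $\alpha$; if the excised segment has no crossings, any single type may be used. Multi-virtual links are equivalence classes of diagrams under planar isotopy, classical Reidemeister moves and detour moves. *The multi-virtual quandle $Q(K)$.* An arc of $K$ is a maximal portion of the diagram whose ends are undercrossings or virtual crossings and which contains none in its interior (it may pass through overcrossings). $Q(K)$ is the quandle generated by one symbol for each arc of $K$ together with one variable $v_\alpha$ for each $\alpha\in\mathcal{A}$, subject to the following relations. (i) At each classical crossing with overcrossing arc $b$, incoming under-arc $a$ and outgoing under-arc $c$ (with respect to the orientation): $c=a\star b$ if the crossing is positive, $c=a\sharp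 b$ if the crossing is negative. (ii) At each virtual crossing of type $\alpha$, the two strands have incoming and outgoing arcs $a,c$ and $b,d$ respectively, where the strand $a\to c$ crosses the other strand from that strand's right to its left and the strand $b\to d$ crosses the first from left to right: $c=a\star v_\alpha$ and $d=b\sharp v_\alpha$. (The same convention is fixed for all virtual crossings.) (iii) The automorphisms $x\mapsto x\star v_\alpha$ of the quandle commute with one another: $(x\star v_\alpha)\star v_\beta=(x\star v_\beta)\star v_\alpha$ for all $x$ and all $\alpha,\beta\in\mathcal{A}$. *)

theory Defs
  imports "HOL-Analysis.Analysis"
begin

section \<open>Quandles and quandle presentations\<close>

record 'q quandle =
  qcarrier :: "'q set"
  qstar :: "'q \<Rightarrow> 'q \<Rightarrow> 'q"
  qsharp :: "'q \<Rightarrow> 'q \<Rightarrow> 'q"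

definition is_quandle :: "'q quandle \<Rightarrow> bool" where
  "is_quandle Q \<longleftrightarrow>
    (\<forall>a\<in>qcarrier Q. \<forall>b\<in>qcarrier Q. qstar Q a b \<in> qcarrier Q \<and> qsharp Q a b \<in> qcarrier Q) \<and>
    (\<forall>a\<in>qcarrier Q. qstar Q a a = a \<and> qsharp Q a a = a) \<and>
    (\<forall>a\<in>qcarrier Q. \<forall>b\<in>qcarrier Q.
        qsharp Q (qstar Q a b) b = a \<and> qstar Q (qsharp Q a b) b = a) \<and>
    (\<forall>a\<in>qcarrier Q. \<forall>b\<in>qcarrier Q. \<forall>c\<in>qcarrier Q.
        qstar Q (qstar Q a b) c = qstar Q (qstar Q a c) (qstar Q b c) \<and>
        qsharp Q (qsharp Q a b) c = qsharp Q (qsharp Q a c) (qsharp Q b c))"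

definition quandle_iso :: "'p quandle \<Rightarrow> 'q quandle \<Rightarrow> bool" where
  "quandle_iso P Q \<longleftrightarrow>
    (\<exists>f. bij_betw f (qcarrier P) (qcarrier Q) \<and>
      (\<forall>x\<in>qcarrier P. \<forall>y\<in>qcarrier P.
         f (qstar P x y) = qstar Q (f x) (f y) \<and> f (qsharp P x y) = qsharp Q (f x) (f y)))"

datatype 'g qterm = Gen 'g | Star "'g qterm" "'g qterm" | Sharp "'g qterm" "'g qterm"

inductive_set qterms :: "'g set \<Rightarrow> 'g qterm set" for X where
  "x \<in> X \<Longrightarrow> Gen x \<in> qterms X"
| "s \<in> qterms X \<Longrightarrow> t \<in> qterms X \<Longrightarrow> Star s t \<in> qterms X"
| "s \<in> qterms X \<Longrightarrow> t \<in> qterms X \<Longrightarrow> Sharp s t \<in> qterms X"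

text \<open>The least congruence on the terms over \<open>X\<close> that contains the relations \<open>R\<close> and all instances
  of the quandle axioms.\<close>

inductive_set qcong :: "'g set \<Rightarrow> ('g qterm \<times> 'g qterm) set \<Rightarrow> ('g qterm \<times> 'g qterm) set"
  for X R where
  rel: "(s, t) \<in> R \<Longrightarrow> s \<in> qterms X \<Longrightarrow> t \<in> qterms X \<Longrightarrow> (s, t) \<in> qcong X R"
| refl: "s \<in> qterms X \<Longrightarrow> (s, s) \<in> qcong X R"
| sym: "(s, t) \<in> qcong X R \<Longrightarrow> (t, s) \<in> qcong X R"
| trans: "(s, t) \<in> qcong X R \<Longrightarrow> (t, u) \<in> qcong X R \<Longrightarrow> (s, u) \<in> qcong X R"
| star: "(s, s') \<in> qcong X R \<Longrightarrow> (t, t') \<in> qcong X R \<Longrightarrow> (Star s t, Star s' t') \<in> qcong X R"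
| sharp: "(s, s') \<in> qcong X R \<Longrightarrow> (t, t') \<in> qcong X R \<Longrightarrow> (Sharp s t, Sharp s' t') \<in> qcong X R"
| idem_star: "s \<in> qterms X \<Longrightarrow> (Star s s, s) \<in> qcong X R"
| idem_sharp: "s \<in> qterms X \<Longrightarrow> (Sharp s s, s) \<in> qcong X R"
| sharp_star: "s \<in> qterms X \<Longrightarrow> t \<in> qterms X \<Longrightarrow> (Sharp (Star s t) t, s) \<in> qcong X R"
| star_sharp: "s \<in> qterms X \<Longrightarrow> t \<in> qterms X \<Longrightarrow> (Star (Sharp s t) t, s) \<in> qcong X R"
| distrib_star: "s \<in> qterms X \<Longrightarrow> t \<in> qterms X \<Longrightarrow> u \<in> qterms X \<Longrightarrow>
    (Star (Star s t) u, Star (Star s u) (Star t u)) \<in> qcong X R"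
| distrib_sharp: "s \<in> qterms X \<Longrightarrow> t \<in> qterms X \<Longrightarrow> u \<in> qterms X \<Longrightarrow>
    (Sharp (Sharp s t) u, Sharp (Sharp s u) (Sharp t u)) \<in> qcong X R"

definition presented_quandle ::
    "'g set \<Rightarrow> ('g qterm \<times> 'g qterm) set \<Rightarrow> 'g qterm set quandle" where
  "presented_quandle X R =
    \<lparr> qcarrier = qterms X // qcong X R,
      qstar = (\<lambda>P Q. \<Union>s\<in>P. \<Union>t\<in>Q. qcong X R `` {Star s t}),
      qsharp = (\<lambda>P Q. \<Union>s\<in>P. \<Union>t\<in>Q. qcong X R `` {Sharp s t}) \<rparr>"

lemma qcong_terms: "(s, t) \<in> qcong X R \<Longrightarrow> s \<in> qterms X \<and> t \<in> qterms X"
  by (induction rule: qcong.induct) (auto intro: qterms.intros)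

lemma equiv_qcong: "equiv (qterms X) (qcong X R)"
proof (rule equivI)
  show "qcong X R \<subseteq> qterms X \<times> qterms X" using qcong_terms by auto
  show "refl_on (qterms X) (qcong X R)" by (rule refl_onI) (rule qcong.refl)
  show "Relation.sym (qcong X R)" by (rule symI) (rule qcong.sym)
  show "Relation.trans (qcong X R)" by (rule transI) (rule qcong.trans)
qed

lemma presented_star:
  assumes "s \<in> qterms X" "t \<in> qterms X"
  shows "qstar (presented_quandle X R) (qcong X R `` {s}) (qcong X R `` {t}) = qcong X R `` {Star s t}"
proof -
  have "congruent2 (qcong X R) (qcong X R) (\<lambda>s t. qcong X R `` {Star s t})"
    by (rule congruent2I') (auto intro!: equiv_class_eq[OF equiv_qcong] qcong.star)
  from UN_equiv_class2[OF equiv_qcong equiv_qcong this assms]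
  show ?thesis by (simp add: presented_quandle_def)
qed

lemma presented_sharp:
  assumes "s \<in> qterms X" "t \<in> qterms X"
  shows "qsharp (presented_quandle X R) (qcong X R `` {s}) (qcong X R `` {t}) = qcong X R `` {Sharp s t}"
proof -
  have "congruent2 (qcong X R) (qcong X R) (\<lambda>s t. qcong X R `` {Sharp s t})"
    by (rule congruent2I') (auto intro!: equiv_class_eq[OF equiv_qcong] qcong.sharp)
  from UN_equiv_class2[OF equiv_qcong equiv_qcong this assms]
  show ?thesis by (simp add: presented_quandle_def)
qed

lemma is_quandle_presented: "is_quandle (presented_quandle X R)"
proof -
  have carr: "qcarrier (presented_quandle X R) = (\<lambda>s. qcong X R `` {s}) ` qterms X"
    by (auto simp: presented_quandle_def quotient_def)
  note eq = equiv_class_eq[OF equiv_qcong]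
  show ?thesis
    unfolding is_quandle_def carr ball_simps
    by (auto simp: presented_star presented_sharp qterms.intros
        intro!: eq qcong.intros(7-) imageI qterms.intros(2,3))
qed


section \<open>Oriented multi-virtual link diagrams\<close>

text \<open>A diagram consists of \<open>ncomp\<close> closed curves, the \<open>i\<close>-th one being a 1-periodic map
  \<open>\<lambda>r. pos K (i, r)\<close>; the pair \<open>(i, r)\<close> stands for the point \<open>r mod 1\<close> of the \<open>i\<close>-th circle,
  and the orientation is that of increasing \<open>r\<close>.  The field \<open>strand\<close> tells how the strand
  through \<open>(i, r)\<close> passes the crossing there: over or under at a classical crossing, \<open>Virt \<alpha>\<close>
  at a virtual crossing of type \<open>\<alpha>\<close>.  Its values away from crossings are irrelevant.\<close>

datatype 'v passage = Over | Under | Virt 'v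

type_synonym point = "nat \<times> real"

record 'v diagram =
  ncomp :: nat
  pos :: "point \<Rightarrow> complex"
  strand :: "point \<Rightarrow> 'v passage"

definition same_point :: "point \<Rightarrow> point \<Rightarrow> bool" where
  "same_point p q \<longleftrightarrow> fst p = fst q \<and> snd p - snd q \<in> \<int>"

definition points :: "'v diagram \<Rightarrow> point set" where
  "points K = {p. fst p < ncomp K}"

definition double :: "'v diagram \<Rightarrow> point \<Rightarrow> point \<Rightarrow> bool" where
  "double K p q \<longleftrightarrow> p \<in> points K \<and> q \<in> points K \<and> \<not> same_point p q \<and> pos K p = pos K q"

definition crossing :: "'v diagram \<Rightarrow> point \<Rightarrow> bool" where
  "crossing K p \<longleftrightarrow> (\<exists>q. double K p q)"

definition tangent :: "'v diagram \<Rightarrow> point \<Rightarrow> complex" where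
  "tangent K p = vector_derivative (\<lambda>r. pos K (fst p, r)) (at (snd p))"

text \<open>\<open>det2 u w > 0\<close> iff a strand with direction \<open>w\<close> crosses one with direction \<open>u\<close> from the
  right of the latter to its left.\<close>

definition det2 :: "complex \<Rightarrow> complex \<Rightarrow> real" where
  "det2 u w = Re u * Im w - Im u * Re w"

definition mv_diagram :: "'v set \<Rightarrow> 'v diagram \<Rightarrow> bool" where
  "mv_diagram A K \<longleftrightarrow>
    \<comment> \<open>immersed closed curves\<close>
    (\<forall>i<ncomp K. (\<lambda>r. pos K (i, r)) C1_differentiable_on UNIV \<and>
        (\<forall>r. tangent K (i, r) \<noteq> 0 \<and> pos K (i, r + 1) = pos K (i, r) \<and>
             strand K (i, r + 1) = strand K (i, r))) \<and>
    \<comment> \<open>generic: finitely many transversal double points, no triple points\<close>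
    finite (pos K ` {p. crossing K p}) \<and>
    (\<forall>p q. double K p q \<longrightarrow> det2 (tangent K p) (tangent K q) \<noteq> 0) \<and>
    (\<forall>p q q'. double K p q \<and> double K p q' \<longrightarrow> same_point q q') \<and>
    \<comment> \<open>each double point is a classical crossing, or a virtual one with type in \<open>A\<close>\<close>
    (\<forall>p q. double K p q \<longrightarrow>
        (strand K p = Over \<and> strand K q = Under) \<or>
        (strand K p = Under \<and> strand K q = Over) \<or>
        (\<exists>\<alpha>\<in>A. strand K p = Virt \<alpha> \<and> strand K q = Virt \<alpha>))"


section \<open>The multi-virtual quandle\<close>

text \<open>The points at which arcs end: undercrossings and virtual crossings.\<close>

definition cut :: "'v diagram \<Rightarrow> point \<Rightarrow> bool" where
  "cut K p \<longleftrightarrow> crossing K p \<and> strand K p \<noteq> Over"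

text \<open>An arc is represented by the set of the points in its interior.  A component without
  undercrossings and virtual crossings is a single arc.\<close>

definition arc_of :: "'v diagram \<Rightarrow> point \<Rightarrow> point set" where
  "arc_of K p = {(fst p, x) | x. \<exists>k::int. \<forall>y\<in>closed_segment x (snd p + of_int k). \<not> cut K (fst p, y)}"

definition arcs :: "'v diagram \<Rightarrow> point set set" where
  "arcs K = {arc_of K p | p. p \<in> points K \<and> \<not> cut K p}"

definition incoming :: "'v diagram \<Rightarrow> point \<Rightarrow> point set \<Rightarrow> bool" where
  "incoming K p a \<longleftrightarrow> a \<in> arcs K \<and> (\<forall>\<^sub>F x in at_left (snd p). (fst p, x) \<in> a)"

definition outgoing :: "'v diagram \<Rightarrow> point \<Rightarrow> point set \<Rightarrow> bool" where
  "outgoing K p c \<longleftrightarrow> c \<in> arcs K \<and> (\<forall>\<^sub>F x in at_right (snd p). (fst p, x) \<in> c)"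

datatype 'v generator = Arc "point set" | Var 'v

abbreviation garc :: "point set \<Rightarrow> 'v generator qterm" where
  "garc a \<equiv> Gen (Arc a)"

abbreviation gvar :: "'v \<Rightarrow> 'v generator qterm" where
  "gvar \<alpha> \<equiv> Gen (Var \<alpha>)"

definition mv_generators :: "'v set \<Rightarrow> 'v diagram \<Rightarrow> 'v generator set" where
  "mv_generators A K = Arc ` arcs K \<union> Var ` A"

text \<open>At a classical crossing with over-strand at \<open>p\<close> and under-strand at \<open>q\<close>, the crossing is
  positive iff \<open>det2 (tangent K p) (tangent K q) > 0\<close>.\<close>

definition classical_relations :: "'v diagram \<Rightarrow> ('v generator qterm \<times> 'v generator qterm) set" where
  "classical_relations K =
    {(garc c, if det2 (tangent K p) (tangent K q) > 0 then Star (garc a) (garc b)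
                                                     else Sharp (garc a) (garc b)) | a b c p q.
       double K p q \<and> strand K p = Over \<and> strand K q = Under \<and>
       b \<in> arcs K \<and> p \<in> b \<and> incoming K q a \<and> outgoing K q c}"

text \<open>At a virtual crossing, the strand at \<open>p\<close> is the one that crosses the other strand, at \<open>q\<close>,
  from the right of the latter to its left.\<close>

definition virtual_relations :: "'v diagram \<Rightarrow> ('v generator qterm \<times> 'v generator qterm) set" where
  "virtual_relations K =
    {(garc c, Star (garc a) (gvar \<alpha>)) | a c \<alpha> p q.
       double K p q \<and> strand K p = Virt \<alpha> \<and> det2 (tangent K q) (tangent K p) > 0 \<and>
       incoming K p a \<and> outgoing K p c} \<union>
    {(garc d, Sharp (garc b) (gvar \<alpha>)) | b d \<alpha> p q.
       double K p q \<and> strand K p = Virt \<alpha> \<and> det2 (tangent K q) (tangent K p) > 0 \<and>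
       incoming K q b \<and> outgoing K q d}"

definition commuting_relations ::
    "'v set \<Rightarrow> 'v diagram \<Rightarrow> ('v generator qterm \<times> 'v generator qterm) set" where
  "commuting_relations A K =
    {(Star (Star x (gvar \<alpha>)) (gvar \<beta>), Star (Star x (gvar \<beta>)) (gvar \<alpha>)) | x \<alpha> \<beta>.
       x \<in> qterms (mv_generators A K) \<and> \<alpha> \<in> A \<and> \<beta> \<in> A}"

definition mv_quandle :: "'v set \<Rightarrow> 'v diagram \<Rightarrow> 'v generator qterm set quandle" where
  "mv_quandle A K = presented_quandle (mv_generators A K)
     (classical_relations K \<union> virtual_relations K \<union> commuting_relations A K)"


section \<open>Planar isotopy\<close>

definition diffeotopy :: "(real \<Rightarrow> complex \<Rightarrow> complex) \<Rightarrow> bool" where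
  "diffeotopy H \<longleftrightarrow>
    (\<forall>z. H 0 z = z) \<and>
    (\<forall>t\<in>{0..1}. bij (H t)) \<and>
    continuous_on ({0..1} \<times> UNIV) (\<lambda>(t, z). H t z) \<and>
    (\<exists>H'. (\<forall>t\<in>{0..1}. \<forall>z. (H t has_derivative H' t z) (at z) \<and> bij (H' t z)) \<and>
          (\<forall>w. continuous_on ({0..1} \<times> UNIV) (\<lambda>(t, z). H' t z w)))"

text \<open>Since a diagram is not regarded as parametrised and its components are not numbered, an
  isotopy may also renumber the components and reparametrise them (preserving orientations).\<close>

definition planar_isotopic :: "'v set \<Rightarrow> 'v diagram \<Rightarrow> 'v diagram \<Rightarrow> bool" where
  "planar_isotopic A K K' \<longleftrightarrow> mv_diagram A K \<and> mv_diagram A K' \<and>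
    (\<exists>H \<sigma> \<phi>. diffeotopy H \<and> bij_betw \<sigma> {..<ncomp K'} {..<ncomp K} \<and>
      (\<forall>i<ncomp K'. \<phi> i C1_differentiable_on UNIV \<and>
         (\<forall>r. vector_derivative (\<phi> i) (at r) > (0::real) \<and> \<phi> i (r + 1) = \<phi> i r + 1 \<and>
              pos K' (i, r) = H 1 (pos K (\<sigma> i, \<phi> i r)) \<and>
              (crossing K' (i, r) \<longrightarrow> strand K' (i, r) = strand K (\<sigma> i, \<phi> i r)))))"


section \<open>Detour moves\<close>

text \<open>The triple \<open>(i, s, t)\<close> stands for the part from \<open>(i, s)\<close> to \<open>(i, t)\<close> of the \<open>i\<close>-th circle.\<close>

type_synonym segment = "nat \<times> real \<times> real"

fun closed_seg :: "segment \<Rightarrow> point set" where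
  "closed_seg (i, s, t) = {(i, r) | r. \<exists>k::int. s \<le> r + of_int k \<and> r + of_int k \<le> t}"

fun open_seg :: "segment \<Rightarrow> point set" where
  "open_seg (i, s, t) = {(i, r) | r. \<exists>k::int. s < r + of_int k \<and> r + of_int k < t}"

fun is_segment :: "'v diagram \<Rightarrow> segment \<Rightarrow> bool" where
  "is_segment K (i, s, t) \<longleftrightarrow>
    i < ncomp K \<and> s < t \<and> t < s + 1 \<and> \<not> crossing K (i, s) \<and> \<not> crossing K (i, t)"

text \<open>The two diagrams differ at most in the interiors of the segments in \<open>S\<close> and in the
  crossings on them.  Reparametrising, one may take the parameter intervals to be the same in both.\<close>

definition agree_off :: "segment set \<Rightarrow> 'v diagram \<Rightarrow> 'v diagram \<Rightarrow> bool" where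
  "agree_off S K K' \<longleftrightarrow> ncomp K = ncomp K' \<and>
    (\<forall>p\<in>points K - \<Union> (open_seg ` S). pos K p = pos K' p) \<and>
    (\<forall>p\<in>points K - \<Union> (open_seg ` S). \<forall>q\<in>points K - \<Union> (open_seg ` S).
        double K p q \<longrightarrow> strand K p = strand K' p)"

definition detour_move :: "'v set \<Rightarrow> 'v diagram \<Rightarrow> 'v diagram \<Rightarrow> bool" where
  "detour_move A K K' \<longleftrightarrow> mv_diagram A K \<and> mv_diagram A K' \<and>
    (\<exists>g. \<exists>\<alpha>\<in>A. is_segment K g \<and> is_segment K' g \<and> agree_off {g} K K' \<and>
      (\<forall>p\<in>open_seg g. crossing K p \<longrightarrow> strand K p = Virt \<alpha>) \<and>
      (\<forall>p\<in>open_seg g. crossing K' p \<longrightarrow> strand K' p = Virt \<alpha>))"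


section \<open>Classical Reidemeister moves\<close>

text \<open>Both diagrams meet the closed disc \<open>D\<close> exactly in the segments in \<open>S\<close>, which run through the
  interior of \<open>D\<close> from boundary to boundary, and they coincide outside \<open>D\<close>.\<close>

definition local_change :: "'v set \<Rightarrow> segment set \<Rightarrow> 'v diagram \<Rightarrow> 'v diagram \<Rightarrow> bool" where
  "local_change A S K K' \<longleftrightarrow> mv_diagram A K \<and> mv_diagram A K' \<and>
    (\<forall>g\<in>S. is_segment K g \<and> is_segment K' g) \<and> agree_off S K K' \<and>
    (\<exists>D. D homeomorphic cball (0::complex) 1 \<and>
      (\<forall>L\<in>{K, K'}. \<forall>p\<in>points L.
         (pos L p \<in> D \<longleftrightarrow> p \<in> \<Union> (closed_seg ` S)) \<and>
         (pos L p \<in> interior D \<longleftrightarrow> p \<in> \<Union> (open_seg ` S))))"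

fun simple_on :: "'v diagram \<Rightarrow> segment \<Rightarrow> bool" where
  "simple_on K (i, s, t) \<longleftrightarrow> inj_on (\<lambda>r. pos K (i, r)) {s..t}"

fun meets :: "'v diagram \<Rightarrow> segment \<Rightarrow> segment \<Rightarrow> (real \<times> real) set" where
  "meets K (i, s, t) (j, u, v) = {(x, y). x \<in> {s..t} \<and> y \<in> {u..v} \<and> pos K (i, x) = pos K (j, y)}"

text \<open>First move: \<open>K\<close> has a kink (of any of the four kinds) where \<open>K'\<close> has a simple arc.\<close>

definition R1 :: "'v set \<Rightarrow> 'v diagram \<Rightarrow> 'v diagram \<Rightarrow> bool" where
  "R1 A K K' \<longleftrightarrow> (\<exists>i s t a b. local_change A {(i, s, t)} K K' \<and>
     {(x, y). x \<in> {s..t} \<and> y \<in> {s..t} \<and> x < y \<and> pos K (i, x) = pos K (i, y)} = {(a, b)} \<and>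
     strand K (i, a) \<in> {Over, Under} \<and>
     simple_on K' (i, s, t))"

text \<open>Second move: in \<open>K\<close> the segment \<open>g\<close> crosses twice over the segment \<open>h\<close>, in \<open>K'\<close> they are
  disjoint.\<close>

definition R2 :: "'v set \<Rightarrow> 'v diagram \<Rightarrow> 'v diagram \<Rightarrow> bool" where
  "R2 A K K' \<longleftrightarrow> (\<exists>g h. local_change A {g, h} K K' \<and> closed_seg g \<inter> closed_seg h = {} \<and>
     (\<forall>L\<in>{K, K'}. simple_on L g \<and> simple_on L h) \<and>
     card (meets K g h) = 2 \<and> (\<forall>(x, y)\<in>meets K g h. strand K (fst g, x) = Over) \<and>
     meets K' g h = {})"

text \<open>Third move: a top segment \<open>g1\<close>, a middle segment \<open>g2\<close> and a bottom segment \<open>g3\<close> cross each other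
  once; \<open>xij\<close> is the parameter on \<open>gi\<close> of its crossing with \<open>gj\<close>.  The move reverses on each of the
  three segments the order of its two crossings.\<close>

definition triangle :: "'v diagram \<Rightarrow> segment \<Rightarrow> segment \<Rightarrow> segment \<Rightarrow>
    real \<Rightarrow> real \<Rightarrow> real \<Rightarrow> real \<Rightarrow> real \<Rightarrow> real \<Rightarrow> bool" where
  "triangle K g1 g2 g3 x12 x21 x13 x31 x23 x32 \<longleftrightarrow>
     simple_on K g1 \<and> simple_on K g2 \<and> simple_on K g3 \<and>
     meets K g1 g2 = {(x12, x21)} \<and> meets K g1 g3 = {(x13, x31)} \<and> meets K g2 g3 = {(x23, x32)} \<and>
     strand K (fst g1, x12) = Over \<and> strand K (fst g1, x13) = Over \<and> strand K (fst g2, x23) = Over"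

definition R3 :: "'v set \<Rightarrow> 'v diagram \<Rightarrow> 'v diagram \<Rightarrow> bool" where
  "R3 A K K' \<longleftrightarrow> (\<exists>g1 g2 g3 x12 x21 x13 x31 x23 x32 y12 y21 y13 y31 y23 y32.
     local_change A {g1, g2, g3} K K' \<and>
     closed_seg g1 \<inter> closed_seg g2 = {} \<and> closed_seg g1 \<inter> closed_seg g3 = {} \<and>
     closed_seg g2 \<inter> closed_seg g3 = {} \<and>
     triangle K g1 g2 g3 x12 x21 x13 x31 x23 x32 \<and>
     triangle K' g1 g2 g3 y12 y21 y13 y31 y23 y32 \<and>
     (x12 < x13 \<longleftrightarrow> y13 < y12) \<and> (x21 < x23 \<longleftrightarrow> y23 < y21) \<and> (x31 < x32 \<longleftrightarrow> y32 < y31))"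

definition reidemeister_move :: "'v set \<Rightarrow> 'v diagram \<Rightarrow> 'v diagram \<Rightarrow> bool" where
  "reidemeister_move A K K' \<longleftrightarrow>
     R1 A K K' \<or> R1 A K' K \<or> R2 A K K' \<or> R2 A K' K \<or> R3 A K K' \<or> R3 A K' K"


section \<open>Multi-virtual links\<close>

definition mv_equivalent :: "'v set \<Rightarrow> 'v diagram \<Rightarrow> 'v diagram \<Rightarrow> bool" where
  "mv_equivalent A =
     equivclp (\<lambda>K K'. planar_isotopic A K K' \<or> reidemeister_move A K K' \<or> detour_move A K K')"

end

(*
  By the quandle axioms, the classical and the virtual relations say alike that the strand q that is
  cut at a crossing is acted on, with a sign read off from the tangents, by the over-strand or by a
  variable.  Homomorphisms from Q(K) to a quandle X are thus the colorings of K in X, and it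
  suffices to match the colorings of K and K', naturally in X.

  Isotopy: an isotopy of the plane preserves orientation, hence signs, so colorings are transported
  along the reparametrisation.

  Reidemeister moves: a coloring is determined by its values off the changed segments, and the
  values on the segments can be filled in on the other side by the quandle axioms.  The signs of the
  crossings on the two sides agree, because the intersection number of two curves in a disc with
  ends on the boundary circle depends only on the ends.

  Detour move of type a: let w be the winding number of the closed curve formed by the old and the
  new segment.  Next to a point off the segment, w changes by the signed number of crossings with the
  two segments there.  Acting on the label of each point p off the segment by the w(p)-th power of
  the translation by v_a therefore turns colorings of K into colorings of K': the translation is an
  automorphism that commutes with the translations by all v_b, so the relations at crossings away
  from the segment survive, and the labels along the new segment are forced.
*)

theory Submission
  imports Defs
begin

section \<open>Quandles\<close>

definition act :: "'q quandle \<Rightarrow> bool \<Rightarrow> 'q \<Rightarrow> 'q \<Rightarrow> 'q" where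
  "act X e x y = (if e then qstar X x y else qsharp X x y)"

lemma act_simps [simp]: "act X True x y = qstar X x y" "act X False x y = qsharp X x y"
  by (simp_all add: act_def)

lemma is_quandleD:
  assumes "is_quandle X" "a \<in> qcarrier X" "b \<in> qcarrier X"
  shows "qstar X a b \<in> qcarrier X" "qsharp X a b \<in> qcarrier X"
    "qstar X a a = a" "qsharp X a a = a"
    "qsharp X (qstar X a b) b = a" "qstar X (qsharp X a b) b = a"
  using assms unfolding is_quandle_def by blast+

lemma is_quandle_distrib:
  assumes "is_quandle X" "a \<in> qcarrier X" "b \<in> qcarrier X" "c \<in> qcarrier X"
  shows "qstar X (qstar X a b) c = qstar X (qstar X a c) (qstar X b c)"
    "qsharp X (qsharp X a b) c = qsharp X (qsharp X a c) (qsharp X b c)"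
  using assms unfolding is_quandle_def by blast+

lemma act_closed:
  assumes "is_quandle X" "a \<in> qcarrier X" "b \<in> qcarrier X"
  shows "act X e a b \<in> qcarrier X"
  using is_quandleD[OF assms] by (simp add: act_def)

lemma act_idem:
  assumes "is_quandle X" "a \<in> qcarrier X"
  shows "act X e a a = a"
  using is_quandleD[OF assms assms(2)] by (simp add: act_def)

lemma act_cancel:
  assumes "is_quandle X" "a \<in> qcarrier X" "b \<in> qcarrier X"
  shows "act X (\<not> e) (act X e a b) b = a" "act X e (act X (\<not> e) a b) b = a"
  using is_quandleD[OF assms] by (simp_all add: act_def)

lemma act_distrib:
  assumes X: "is_quandle X" and a: "a \<in> qcarrier X" and b: "b \<in> qcarrier X" and c: "c \<in> qcarrier X"
  shows "act X e (act X d a b) c = act X d (act X e a c) (act X e b c)"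
proof -
  have same: "act X e (act X e a b) c = act X e (act X e a c) (act X e b c)"
    if "a \<in> qcarrier X" "b \<in> qcarrier X" "c \<in> qcarrier X" for a b c e
    by (cases e) (simp_all add: is_quandle_distrib(1)[OF X that] is_quandle_distrib(2)[OF X that])
  show ?thesis
  proof (cases "d = e")
    case False
    define w where "w = act X (\<not> e) a b"
    have w: "w \<in> qcarrier X" and aw: "a = act X e w b"
      unfolding w_def by (simp_all only: act_closed X a b act_cancel)
    have "act X e a c = act X e (act X e w c) (act X e b c)"
      unfolding aw by (rule same[OF w b c])
    then have "act X (\<not> e) (act X e a c) (act X e b c) = act X e w c"
      by (simp only: act_cancel act_closed X w b c)
    moreover have "d = (\<not> e)" using False by blast
    ultimately show ?thesis by (simp only: w_def)
  qed (use same[OF a b c] in simp)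
qed

definition qpow :: "'q quandle \<Rightarrow> 'q \<Rightarrow> int \<Rightarrow> 'q \<Rightarrow> 'q" where
  "qpow X v n x = (if 0 \<le> n then ((\<lambda>x. qstar X x v) ^^ nat n) x else ((\<lambda>x. qsharp X x v) ^^ nat (- n)) x)"

lemma qpow_0 [simp]: "qpow X v 0 x = x"
  by (simp add: qpow_def)

lemma qpow_closed:
  assumes "is_quandle X" "x \<in> qcarrier X" "v \<in> qcarrier X"
  shows "qpow X v n x \<in> qcarrier X"
proof -
  have "((\<lambda>x. act X e x v) ^^ m) x \<in> qcarrier X" for m e
    by (induction m) (simp_all add: act_closed assms)
  from this[where e = True] this[where e = False] show ?thesis by (simp add: qpow_def)
qed

lemma qpow_succ:
  assumes X: "is_quandle X" and x: "x \<in> qcarrier X" and v: "v \<in> qcarrier X"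
  shows "qpow X v (n + 1) x = qstar X (qpow X v n x) v"
proof (cases "0 \<le> n")
  case True
  then show ?thesis by (simp add: qpow_def nat_add_distrib)
next
  case False
  define m where "m = nat (- n - 1)"
  have n: "nat (- n) = Suc m" "nat (- (n + 1)) = m" using False by (auto simp: m_def)
  have "((\<lambda>x. qsharp X x v) ^^ m) x \<in> qcarrier X" for m
    using act_closed[OF X _ v, of _ False] x by (induction m) auto
  then have "qstar X (qpow X v n x) v = ((\<lambda>x. qsharp X x v) ^^ m) x"
    using act_cancel(2)[OF X _ v, of _ True] False by (simp add: qpow_def n)
  also have "\<dots> = qpow X v (n + 1) x"
    using False n by (cases "n = -1") (auto simp: qpow_def)
  finally show ?thesis ..
qed

lemma qpow_pred:
  assumes X: "is_quandle X" and x: "x \<in> qcarrier X" and v: "v \<in> qcarrier X"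
  shows "qpow X v (n - 1) x = qsharp X (qpow X v n x) v"
  using qpow_succ[OF assms, of "n - 1"] act_cancel(1)[OF X qpow_closed[OF assms] v, of True]
  by simp

lemma qpow_add:
  assumes X: "is_quandle X" and x: "x \<in> qcarrier X" and v: "v \<in> qcarrier X"
  shows "qpow X v (m + n) x = qpow X v m (qpow X v n x)"
proof (induction m rule: int_induct[where k = 0])
  case (step1 i)
  then show ?case using qpow_succ[OF X x v, of "i + n"] qpow_succ[OF X qpow_closed[OF X x v] v, of i]
    by (simp add: algebra_simps)
next
  case (step2 i)
  then show ?case using qpow_pred[OF X x v, of "i + n"] qpow_pred[OF X qpow_closed[OF X x v] v, of i]
    by (simp add: algebra_simps)
qed simp

lemma qpow_act_self:
  assumes X: "is_quandle X" and x: "x \<in> qcarrier X" and v: "v \<in> qcarrier X"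
  shows "act X e (qpow X v n x) v = qpow X v (n + (if e then 1 else -1)) x"
  using qpow_succ[OF assms] qpow_pred[OF assms] by simp

lemma qpow_act:
  assumes X: "is_quandle X" and x: "x \<in> qcarrier X" and y: "y \<in> qcarrier X" and v: "v \<in> qcarrier X"
  shows "qpow X v n (act X e x y) = act X e (qpow X v n x) (qpow X v n y)"
proof (induction n rule: int_induct[where k = 0])
  case (step1 i)
  then show ?case
    using act_distrib[OF X qpow_closed[OF X x v] qpow_closed[OF X y v] v, where e = True]
    by (simp add: qpow_succ X x y v act_closed)
next
  case (step2 i)
  then show ?case
    using act_distrib[OF X qpow_closed[OF X x v] qpow_closed[OF X y v] v, where e = False]
    by (simp add: qpow_pred X x y v act_closed)
qed simp

lemma act_commute:
  assumes X: "is_quandle X" and v: "v \<in> qcarrier X" and w: "w \<in> qcarrier X"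
    and comm: "\<And>x. x \<in> qcarrier X \<Longrightarrow> qstar X (qstar X x v) w = qstar X (qstar X x w) v"
    and x: "x \<in> qcarrier X"
  shows "act X d (act X e x v) w = act X e (act X d x w) v"
proof -
  note cl = act_closed[OF X]
  have 1: "act X True (act X e x v) w = act X e (act X True x w) v" if x: "x \<in> qcarrier X" for x e
  proof (cases e)
    case False
    define y where "y = act X False x v"
    have y: "y \<in> qcarrier X" "x = act X True y v"
      using cl[OF x v] act_cancel(2)[OF X x v, of True] by (auto simp: y_def simp del: act_simps)
    have "act X False (act X True x w) v = act X False (act X True (act X True y w) v) v"
      using comm[OF y(1)] y(2) by simp
    also have "\<dots> = act X True y w"
      using act_cancel(1)[where e = True, OF X cl[where e = True, OF y(1) w] v] by simp
    finally show ?thesis using False by (simp add: y_def)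
  qed (use comm[OF x] in simp)
  show ?thesis
  proof (cases d)
    case False
    define y where "y = act X False x w"
    have y: "y \<in> qcarrier X" "x = act X True y w"
      using cl[OF x w] act_cancel(2)[OF X x w, of True] by (auto simp: y_def simp del: act_simps)
    have "act X False (act X e x v) w = act X False (act X True (act X e y v) w) w"
      using 1[OF y(1), of e] y(2) by (simp del: act_simps)
    also have "\<dots> = act X e y v"
      using act_cancel(1)[where e = True, OF X cl[where e = e, OF y(1) v] w] by (simp del: act_simps)
    finally show ?thesis using False by (simp add: y_def)
  qed (use 1[OF x] in simp)
qed

lemma qpow_act_commute:
  assumes X: "is_quandle X" and v: "v \<in> qcarrier X" and w: "w \<in> qcarrier X"
    and comm: "\<And>x. x \<in> qcarrier X \<Longrightarrow> qstar X (qstar X x v) w = qstar X (qstar X x w) v"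
    and x: "x \<in> qcarrier X"
  shows "qpow X v n (act X e x w) = act X e (qpow X v n x) w"
proof (induction n rule: int_induct[where k = 0])
  case (step1 i)
  then show ?case
    using act_commute[OF X v w comm qpow_closed[OF X x v], where e = True]
    by (simp add: qpow_succ X x v w act_closed)
next
  case (step2 i)
  then show ?case
    using act_commute[OF X v w comm qpow_closed[OF X x v], where e = False]
    by (simp add: qpow_pred X x v w act_closed)
qed simp

definition quandle_hom :: "'p quandle \<Rightarrow> 'q quandle \<Rightarrow> ('p \<Rightarrow> 'q) \<Rightarrow> bool" where
  "quandle_hom P Q f \<longleftrightarrow> (\<forall>x\<in>qcarrier P. f x \<in> qcarrier Q) \<and>
     (\<forall>x\<in>qcarrier P. \<forall>y\<in>qcarrier P.
        f (qstar P x y) = qstar Q (f x) (f y) \<and> f (qsharp P x y) = qsharp Q (f x) (f y))"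

lemma quandle_hom_closed: "quandle_hom P Q f \<Longrightarrow> x \<in> qcarrier P \<Longrightarrow> f x \<in> qcarrier Q"
  by (simp add: quandle_hom_def)

lemma quandle_hom_act:
  "quandle_hom P Q f \<Longrightarrow> x \<in> qcarrier P \<Longrightarrow> y \<in> qcarrier P \<Longrightarrow> f (act P e x y) = act Q e (f x) (f y)"
  by (simp add: quandle_hom_def act_def)

lemma quandle_hom_comp: "quandle_hom P Q f \<Longrightarrow> quandle_hom Q R g \<Longrightarrow> quandle_hom P R (g \<circ> f)"
  by (simp add: quandle_hom_def)

lemma quandle_hom_qpow:
  assumes P: "is_quandle P" and f: "quandle_hom P Q f" and x: "x \<in> qcarrier P" and v: "v \<in> qcarrier P"
    and Q: "is_quandle Q"
  shows "f (qpow P v n x) = qpow Q (f v) n (f x)"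
proof (induction n rule: int_induct[where k = 0])
  case (step1 i)
  then show ?case
    using quandle_hom_act[OF f qpow_closed[OF P x v] v, of True i]
    by (simp add: qpow_succ P Q x v quandle_hom_closed[OF f])
next
  case (step2 i)
  then show ?case
    using quandle_hom_act[OF f qpow_closed[OF P x v] v, of False i]
    by (simp add: qpow_pred P Q x v quandle_hom_closed[OF f])
qed simp

lemma quandle_isoI:
  assumes "quandle_hom P Q f" "quandle_hom Q P g"
    and "\<And>x. x \<in> qcarrier P \<Longrightarrow> g (f x) = x" "\<And>y. y \<in> qcarrier Q \<Longrightarrow> f (g y) = y"
  shows "quandle_iso P Q"
  unfolding quandle_iso_def
proof (intro exI[of _ f] conjI)
  show "bij_betw f (qcarrier P) (qcarrier Q)"
    by (rule bij_betw_byWitness[where f' = g]) (use assms in \<open>auto simp: quandle_hom_closed\<close>)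
qed (use assms in \<open>auto simp: quandle_hom_def\<close>)

lemma quandle_iso_refl: "quandle_iso P P"
  by (rule quandle_isoI[where f = id and g = id]) (auto simp: quandle_hom_def)

lemma quandle_iso_trans:
  assumes "quandle_iso P Q" "quandle_iso Q R"
  shows "quandle_iso P R"
proof -
  obtain f where f: "bij_betw f (qcarrier P) (qcarrier Q)"
    "\<And>x y. x \<in> qcarrier P \<Longrightarrow> y \<in> qcarrier P \<Longrightarrow>
      f (qstar P x y) = qstar Q (f x) (f y) \<and> f (qsharp P x y) = qsharp Q (f x) (f y)"
    using assms(1) by (auto simp: quandle_iso_def)
  obtain g where g: "bij_betw g (qcarrier Q) (qcarrier R)"
    "\<And>x y. x \<in> qcarrier Q \<Longrightarrow> y \<in> qcarrier Q \<Longrightarrow>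
      g (qstar Q x y) = qstar R (g x) (g y) \<and> g (qsharp Q x y) = qsharp R (g x) (g y)"
    using assms(2) by (auto simp: quandle_iso_def)
  show ?thesis unfolding quandle_iso_def
    by (intro exI[of _ "g \<circ> f"] conjI bij_betw_trans[OF f(1) g(1)])
      (use f g bij_betwE[OF f(1)] in auto)
qed

lemma quandle_iso_sym:
  assumes P: "is_quandle P" and "quandle_iso P Q"
  shows "quandle_iso Q P"
proof -
  obtain f where f: "bij_betw f (qcarrier P) (qcarrier Q)"
    and h: "\<And>x y. x \<in> qcarrier P \<Longrightarrow> y \<in> qcarrier P \<Longrightarrow>
      f (qstar P x y) = qstar Q (f x) (f y) \<and> f (qsharp P x y) = qsharp Q (f x) (f y)"
    using assms(2) by (auto simp: quandle_iso_def)
  define g where "g = inv_into (qcarrier P) f"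
  have g: "bij_betw g (qcarrier Q) (qcarrier P)" unfolding g_def by (rule bij_betw_inv_into[OF f])
  have gf: "g (f x) = x" if "x \<in> qcarrier P" for x
    unfolding g_def using f that by (simp add: bij_betw_def)
  have fg: "f (g y) = y" if "y \<in> qcarrier Q" for y
    unfolding g_def using f that by (simp add: bij_betw_inv_into_right)
  have gc: "g y \<in> qcarrier P" if "y \<in> qcarrier Q" for y using g that bij_betwE by blast
  have Pc: "qstar P x y \<in> qcarrier P" "qsharp P x y \<in> qcarrier P"
    if "x \<in> qcarrier P" "y \<in> qcarrier P" for x y
    using act_closed[OF P that, of True] act_closed[OF P that, of False] by simp_all
  show ?thesis unfolding quandle_iso_def
  proof (intro exI[of _ g] conjI g ballI)
    fix x y assume xy: "x \<in> qcarrier Q" "y \<in> qcarrier Q"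
    show "g (qstar Q x y) = qstar P (g x) (g y)"
      using h[OF gc[OF xy(1)] gc[OF xy(2)]] gf[OF Pc(1)[OF gc[OF xy(1)] gc[OF xy(2)]]]
      by (simp add: fg xy)
    show "g (qsharp Q x y) = qsharp P (g x) (g y)"
      using h[OF gc[OF xy(1)] gc[OF xy(2)]] gf[OF Pc(2)[OF gc[OF xy(1)] gc[OF xy(2)]]]
      by (simp add: fg xy)
  qed
qed

primrec qeval :: "'q quandle \<Rightarrow> ('g \<Rightarrow> 'q) \<Rightarrow> 'g qterm \<Rightarrow> 'q" where
  "qeval Q e (Gen x) = e x"
| "qeval Q e (Star s t) = qstar Q (qeval Q e s) (qeval Q e t)"
| "qeval Q e (Sharp s t) = qsharp Q (qeval Q e s) (qeval Q e t)"

lemma qeval_closed: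
  assumes "is_quandle Q" "\<And>x. x \<in> X \<Longrightarrow> e x \<in> qcarrier Q" "s \<in> qterms X"
  shows "qeval Q e s \<in> qcarrier Q"
  using assms(3)
proof induction
  case (2 s t)
  then show ?case using act_closed[OF assms(1), of _ _ True] by simp
next
  case (3 s t)
  then show ?case using act_closed[OF assms(1), of _ _ False] by simp
qed (simp add: assms(2))

lemma qeval_qcong:
  assumes Q: "is_quandle Q" and e: "\<And>x. x \<in> X \<Longrightarrow> e x \<in> qcarrier Q"
    and R: "\<And>s t. (s, t) \<in> R \<Longrightarrow> s \<in> qterms X \<Longrightarrow> t \<in> qterms X \<Longrightarrow> qeval Q e s = qeval Q e t"
    and "(s, t) \<in> qcong X R"
  shows "qeval Q e s = qeval Q e t"
proof -
  have cl: "qeval Q e s \<in> qcarrier Q" if "s \<in> qterms X" for s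
    using qeval_closed[of Q X e, OF Q e that] .
  show ?thesis using assms(4)
  proof induction
    case (rel s t)
    then show ?case by (rule R)
  next
    case (idem_star s)
    then show ?case using act_idem[OF Q cl, where e = True] by simp
  next
    case (idem_sharp s)
    then show ?case using act_idem[OF Q cl, where e = False] by simp
  next
    case (sharp_star s t)
    then show ?case using act_cancel(1)[OF Q cl cl, where e = True] by simp
  next
    case (star_sharp s t)
    then show ?case using act_cancel(1)[OF Q cl cl, where e = False] by simp
  next
    case (distrib_star s t u)
    then show ?case using act_distrib[OF Q cl cl cl, where e = True and d = True] by simp
  next
    case (distrib_sharp s t u)
    then show ?case using act_distrib[OF Q cl cl cl, where e = False and d = False] by simp
  qed simp_all
qed

lemma presented_carrier: "qcarrier (presented_quandle X R) = (\<lambda>s. qcong X R `` {s}) ` qterms X"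
  by (auto simp: presented_quandle_def quotient_def)

lemma presented_hom:
  assumes Q: "is_quandle Q" and e: "\<And>x. x \<in> X \<Longrightarrow> e x \<in> qcarrier Q"
    and R: "\<And>s t. (s, t) \<in> R \<Longrightarrow> s \<in> qterms X \<Longrightarrow> t \<in> qterms X \<Longrightarrow> qeval Q e s = qeval Q e t"
  obtains f where "quandle_hom (presented_quandle X R) Q f"
    "\<And>x. x \<in> X \<Longrightarrow> f (qcong X R `` {Gen x}) = e x"
proof -
  define f where "f = (\<lambda>P. qeval Q e (SOME s. s \<in> P))"
  have f: "f (qcong X R `` {s}) = qeval Q e s" if "s \<in> qterms X" for s
  proof -
    have "s \<in> qcong X R `` {s}" using that by (auto intro: qcong.refl)
    then have "(SOME s'. s' \<in> qcong X R `` {s}) \<in> qcong X R `` {s}" by (rule someI)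
    then have "(s, SOME s'. s' \<in> qcong X R `` {s}) \<in> qcong X R" by simp
    from qeval_qcong[where e = e, OF Q e R this] show ?thesis by (simp add: f_def)
  qed
  show thesis
  proof
    show "quandle_hom (presented_quandle X R) Q f"
      unfolding quandle_hom_def presented_carrier ball_simps
      using qeval_closed[of Q X e, OF Q e]
      by (simp add: presented_star presented_sharp f qterms.intros)
    show "f (qcong X R `` {Gen x}) = e x" if "x \<in> X" for x
      using that by (simp add: f qterms.intros)
  qed
qed

lemma presented_hom_unique:
  assumes "quandle_hom (presented_quandle X R) Q f" "quandle_hom (presented_quandle X R) Q g"
    and "\<And>x. x \<in> X \<Longrightarrow> f (qcong X R `` {Gen x}) = g (qcong X R `` {Gen x})"
    and "x \<in> qcarrier (presented_quandle X R)"
  shows "f x = g x"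
proof -
  obtain s where s: "s \<in> qterms X" "x = qcong X R `` {s}" using assms(4) by (auto simp: presented_carrier)
  have hom: "h (qcong X R `` {Star s t}) = qstar Q (h (qcong X R `` {s})) (h (qcong X R `` {t}))"
    "h (qcong X R `` {Sharp s t}) = qsharp Q (h (qcong X R `` {s})) (h (qcong X R `` {t}))"
    if "quandle_hom (presented_quandle X R) Q h" "s \<in> qterms X" "t \<in> qterms X"
    for h and s t :: "'a qterm"
    using that by (simp_all add: quandle_hom_def presented_carrier presented_star presented_sharp)
  have "f (qcong X R `` {s}) = g (qcong X R `` {s})" using s(1)
    by induction (simp_all add: assms(3) hom[OF assms(1)] hom[OF assms(2)])
  then show ?thesis using s by simp
qed

section \<open>Labels along a curve\<close>

definition left_ok :: "(real \<Rightarrow> 'q) \<Rightarrow> (real \<Rightarrow> 'q) \<Rightarrow> real \<Rightarrow> bool" where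
  "left_ok l r x \<longleftrightarrow> (\<forall>\<^sub>F y in at_left x. l y = l x \<and> r y = l x)"

definition right_ok :: "(real \<Rightarrow> 'q) \<Rightarrow> (real \<Rightarrow> 'q) \<Rightarrow> real \<Rightarrow> bool" where
  "right_ok l r x \<longleftrightarrow> (\<forall>\<^sub>F y in at_right x. l y = r x \<and> r y = r x)"

lemma left_ok_iff: "left_ok l r x \<longleftrightarrow> (\<exists>b<x. \<forall>y. b < y \<and> y < x \<longrightarrow> l y = l x \<and> r y = l x)"
  unfolding left_ok_def eventually_at_left[of "x - 1" x, simplified] by blast

lemma right_ok_iff: "right_ok l r x \<longleftrightarrow> (\<exists>b>x. \<forall>y. x < y \<and> y < b \<longrightarrow> l y = r x \<and> r y = r x)"
  unfolding right_ok_def eventually_at_right[of x "x + 1", simplified] by blast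

lemma left_ok_cong:
  assumes "left_ok l' r' x'" "b < x" and "x' = x + c"
    and "\<And>y. b < y \<Longrightarrow> y \<le> x \<Longrightarrow> l y = l' (y + c)" "\<And>y. b < y \<Longrightarrow> y < x \<Longrightarrow> r y = r' (y + c)"
  shows "left_ok l r x"
proof -
  obtain d where d: "d < x'" "\<And>y. d < y \<Longrightarrow> y < x' \<Longrightarrow> l' y = l' x' \<and> r' y = l' x'"
    using assms(1) by (auto simp: left_ok_iff)
  show ?thesis unfolding left_ok_iff
  proof (intro exI[of _ "max b (d - c)"] conjI allI impI)
    fix y assume y: "max b (d - c) < y \<and> y < x"
    then show "l y = l x" "r y = l x"
      using d(2)[of "y + c"] assms(2-) by auto
  qed (use assms d in auto)
qed

lemma right_ok_cong:
  assumes "right_ok l' r' x'" "x < b" and "x' = x + c"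
    and "\<And>y. x < y \<Longrightarrow> y < b \<Longrightarrow> l y = l' (y + c)" "\<And>y. x \<le> y \<Longrightarrow> y < b \<Longrightarrow> r y = r' (y + c)"
  shows "right_ok l r x"
proof -
  obtain d where d: "d > x'" "\<And>y. x' < y \<Longrightarrow> y < d \<Longrightarrow> l' y = r' x' \<and> r' y = r' x'"
    using assms(1) by (auto simp: right_ok_iff)
  show ?thesis unfolding right_ok_iff
  proof (intro exI[of _ "min b (d - c)"] conjI allI impI)
    fix y assume y: "x < y \<and> y < min b (d - c)"
    then show "l y = r x" "r y = r x"
      using d(2)[of "y + c"] assms(2-) by auto
  qed (use assms d in auto)
qed

lemma steps_unique:
  assumes "a < b"
    and left: "\<And>x. a < x \<Longrightarrow> x \<le> b \<Longrightarrow> left_ok l1 r1 x \<and> left_ok l2 r2 x"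
    and right: "\<And>x. a \<le> x \<Longrightarrow> x < b \<Longrightarrow> right_ok l1 r1 x \<and> right_ok l2 r2 x"
    and start: "r1 a = r2 a"
    and step: "\<And>x. a < x \<Longrightarrow> x < b \<Longrightarrow> l1 x = l2 x \<Longrightarrow> r1 x = r2 x"
    and x: "a \<le> x" "x \<le> b"
  shows "a < x \<Longrightarrow> l1 x = l2 x" "x < b \<Longrightarrow> r1 x = r2 x"
proof -
  define Q where "Q c \<longleftrightarrow> (c = a \<or> l1 c = l2 c) \<and> (c = b \<or> r1 c = r2 c)" for c
  define P where "P c d \<longleftrightarrow> (a \<le> c \<and> d \<le> b \<longrightarrow> Q c \<longrightarrow> Q d)" for c d
  have "P a x" using x(1)
  proof (induction rule: Bolzano)
    case (trans c d e)
    then show ?case by (auto simp: P_def)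
  next
    case (local z)
    show ?case
    proof (cases "z \<le> b")
      case True
      obtain d1 where d1: "d1 < z" "\<And>y. a < z \<Longrightarrow> d1 < y \<Longrightarrow> y < z \<Longrightarrow>
          l1 y = l1 z \<and> r1 y = l1 z \<and> l2 y = l2 z \<and> r2 y = l2 z"
      proof (cases "a < z")
        case True
        then obtain e1 e2 where "e1 < z" "e2 < z"
          "\<And>y. e1 < y \<Longrightarrow> y < z \<Longrightarrow> l1 y = l1 z \<and> r1 y = l1 z"
          "\<And>y. e2 < y \<Longrightarrow> y < z \<Longrightarrow> l2 y = l2 z \<and> r2 y = l2 z"
          using left[of z] \<open>z \<le> b\<close> unfolding left_ok_iff by blast
        then show thesis by (intro that[of "max e1 e2"]) auto
      qed (auto intro: that[of "z - 1"])
      obtain d2 where d2: "z < d2" "\<And>y. z < b \<Longrightarrow> z < y \<Longrightarrow> y < d2 \<Longrightarrow>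
          l1 y = r1 z \<and> r1 y = r1 z \<and> l2 y = r2 z \<and> r2 y = r2 z"
      proof (cases "z < b")
        case True
        then obtain e1 e2 where "z < e1" "z < e2"
          "\<And>y. z < y \<Longrightarrow> y < e1 \<Longrightarrow> l1 y = r1 z \<and> r1 y = r1 z"
          "\<And>y. z < y \<Longrightarrow> y < e2 \<Longrightarrow> l2 y = r2 z \<and> r2 y = r2 z"
          using right[of z] local unfolding right_ok_iff by blast
        then show thesis by (intro that[of "min e1 e2"]) auto
      qed (auto intro: that[of "z + 1"])
      have main: "Q d" if cd: "c \<le> z" "z \<le> d" "d - c < min (z - d1) (d2 - z)" "a \<le> c" "d \<le> b" "Q c" for c d
      proof -
        have Qz: "Q z"
        proof (cases "c < z")
          case True
          then have "r1 c = r2 c" using cd \<open>z \<le> b\<close> by (auto simp: Q_def)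
          then have "l1 z = l2 z" using d1(2)[of c] True cd by auto
          then show ?thesis using step[of z] True cd \<open>z \<le> b\<close> by (cases "z = b") (auto simp: Q_def)
        qed (use cd in auto)
        show ?thesis
        proof (cases "z < d")
          case True
          then have "r1 z = r2 z" using Qz cd by (auto simp: Q_def)
          then show ?thesis using d2(2)[of d] True cd by (auto simp: Q_def)
        qed (use cd Qz in auto)
      qed
      show ?thesis
        by (intro exI[of _ "min (z - d1) (d2 - z)"]) (use d1(1) d2(1) main in \<open>auto simp: P_def\<close>)
    next
      case False
      then show ?thesis using x local by (intro exI[of _ 1]) (auto simp: P_def)
    qed
  qed
  then have "Q x" using x start assms(1) by (auto simp: Q_def P_def)
  then show "a < x \<Longrightarrow> l1 x = l2 x" "x < b \<Longrightarrow> r1 x = r2 x" by (auto simp: Q_def)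
qed

definition seg_l :: "(real \<Rightarrow> 'q \<Rightarrow> 'q) \<Rightarrow> 'q \<Rightarrow> real set \<Rightarrow> real \<Rightarrow> 'q" where
  "seg_l f B G x = fold f (sorted_list_of_set {y \<in> G. y < x}) B"

definition seg_r :: "(real \<Rightarrow> 'q \<Rightarrow> 'q) \<Rightarrow> 'q \<Rightarrow> real set \<Rightarrow> real \<Rightarrow> 'q" where
  "seg_r f B G x = fold f (sorted_list_of_set {y \<in> G. y \<le> x}) B"

lemma finite_gap_left:
  fixes x :: real
  assumes "finite G"
  obtains b where "b < x" "\<And>y. b < y \<Longrightarrow> y < x \<Longrightarrow> y \<notin> G"
proof -
  have "\<forall>\<^sub>F y in at x. y \<notin> G" 
    using islimpt_finite[OF assms, of x] by (simp add: islimpt_iff_eventually)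
  then have "\<forall>\<^sub>F y in at_left x. y \<notin> G" by (simp add: eventually_at_split)
  then show thesis unfolding eventually_at_left[of "x - 1" x, simplified] using that by blast
qed

lemma finite_gap_right:
  fixes x :: real
  assumes "finite G"
  obtains b where "x < b" "\<And>y. x < y \<Longrightarrow> y < b \<Longrightarrow> y \<notin> G"
proof -
  have "\<forall>\<^sub>F y in at x. y \<notin> G" 
    using islimpt_finite[OF assms, of x] by (simp add: islimpt_iff_eventually)
  then have "\<forall>\<^sub>F y in at_right x. y \<notin> G" by (simp add: eventually_at_split)
  then show thesis unfolding eventually_at_right[of x "x + 1", simplified] using that by blast
qed

lemma seg_left_ok:
  assumes "finite G"
  shows "left_ok (seg_l f B G) (seg_r f B G) x"
proof -
  obtain b where b: "b < x" "\<And>y. b < y \<Longrightarrow> y < x \<Longrightarrow> y \<notin> G" using finite_gap_left[OF assms] by blast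
  have "(z < y \<longleftrightarrow> z < x) \<and> (z \<le> y \<longleftrightarrow> z < x)" if "b < y" "y < x" "z \<in> G" for y z
  proof -
    have "\<not> (b < z \<and> z < x)" using b(2) that by blast
    then show ?thesis using that by linarith
  qed
  note key = this
  have "{z \<in> G. z < y} = {z \<in> G. z < x}" "{z \<in> G. z \<le> y} = {z \<in> G. z < x}" if "b < y" "y < x" for y
    using key[OF that] by auto
  then show ?thesis unfolding left_ok_iff seg_l_def seg_r_def using b(1) by (intro exI[of _ b]) simp
qed

lemma seg_right_ok:
  assumes "finite G"
  shows "right_ok (seg_l f B G) (seg_r f B G) x"
proof -
  obtain b where b: "x < b" "\<And>y. x < y \<Longrightarrow> y < b \<Longrightarrow> y \<notin> G" using finite_gap_right[OF assms] by blast
  have "(z < y \<longleftrightarrow> z \<le> x) \<and> (z \<le> y \<longleftrightarrow> z \<le> x)" if "x < y" "y < b" "z \<in> G" for y z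
  proof -
    have "\<not> (x < z \<and> z < b)" using b(2) that by blast
    then show ?thesis using that by linarith
  qed
  note key = this
  have "{z \<in> G. z < y} = {z \<in> G. z \<le> x}" "{z \<in> G. z \<le> y} = {z \<in> G. z \<le> x}" if "x < y" "y < b" for y
    using key[OF that] by auto
  then show ?thesis unfolding right_ok_iff seg_l_def seg_r_def using b(1) by (intro exI[of _ b]) simp
qed

lemma seg_step_notin:
  assumes "x \<notin> G"
  shows "seg_r f B G x = seg_l f B G x"
proof -
  have "{y \<in> G. y \<le> x} = {y \<in> G. y < x}" using assms by (auto simp: less_le)
  then show ?thesis by (simp add: seg_l_def seg_r_def)
qed

lemma sorted_list_of_set_snoc:
  fixes x :: "'a::linorder"
  assumes "finite S" "\<And>y. y \<in> S \<Longrightarrow> y < x"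
  shows "sorted_list_of_set (insert x S) = sorted_list_of_set S @ [x]"
proof -
  have "sorted_list_of_set (set (sorted_list_of_set S @ [x])) = sorted_list_of_set S @ [x]"
    using assms by (intro sorted_list_of_set.idem_if_sorted_distinct)
      (auto simp: sorted_append less_imp_le)
  then show ?thesis using assms by simp
qed

lemma seg_step_in:
  assumes "finite G" "x \<in> G"
  shows "seg_r f B G x = f x (seg_l f B G x)"
proof -
  have *: "{y \<in> G. y \<le> x} = insert x {y \<in> G. y < x}" using assms by force
  have "sorted_list_of_set {y \<in> G. y \<le> x} = sorted_list_of_set {y \<in> G. y < x} @ [x]"
    unfolding * by (rule sorted_list_of_set_snoc) (use assms(1) in auto)
  then show ?thesis by (simp add: seg_l_def seg_r_def)
qed

lemma seg_value:
  assumes "a < b" "finite G" "G \<subseteq> {a<..<b}"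
    and left: "\<And>x. a < x \<Longrightarrow> x \<le> b \<Longrightarrow> left_ok l r x"
    and right: "\<And>x. a \<le> x \<Longrightarrow> x < b \<Longrightarrow> right_ok l r x"
    and step: "\<And>x. a < x \<Longrightarrow> x < b \<Longrightarrow> x \<notin> G \<Longrightarrow> r x = l x" "\<And>x. x \<in> G \<Longrightarrow> r x = f x (l x)"
    and x: "a \<le> x" "x \<le> b"
  shows "a < x \<Longrightarrow> l x = seg_l f (r a) G x" "x < b \<Longrightarrow> r x = seg_r f (r a) G x"
proof -
  have "{y \<in> G. y \<le> a} = {}" using assms(3) by auto
  then have "r a = seg_r f (r a) G a" unfolding seg_r_def by (simp only: sorted_list_of_set.sorted_key_list_of_set_empty fold.simps id_apply)
  note start = this
  have st: "r y = seg_r f (r a) G y" if "a < y" "y < b" "l y = seg_l f (r a) G y" for y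
  proof (cases "y \<in> G")
    case True
    show ?thesis unfolding step(2)[OF True] seg_step_in[OF assms(2) True] that(3) by (rule HOL.refl)
  next
    case False
    show ?thesis unfolding step(1)[OF that(1,2) False] seg_step_notin[OF False] that(3) by (rule HOL.refl)
  qed
  have L: "left_ok l r y \<and> left_ok (seg_l f (r a) G) (seg_r f (r a) G) y" if "a < y" "y \<le> b" for y
    by (intro conjI left that seg_left_ok assms(2))
  have R: "right_ok l r y \<and> right_ok (seg_l f (r a) G) (seg_r f (r a) G) y" if "a \<le> y" "y < b" for y
    by (intro conjI right that seg_right_ok assms(2))
  show "a < x \<Longrightarrow> l x = seg_l f (r a) G x" "x < b \<Longrightarrow> r x = seg_r f (r a) G x"
    by (rule steps_unique[OF assms(1) L R start st x]; assumption)+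
qed

lemma steps_const:
  assumes "a < b"
    and left: "\<And>x. a < x \<Longrightarrow> x \<le> b \<Longrightarrow> left_ok l r x"
    and right: "\<And>x. a \<le> x \<Longrightarrow> x < b \<Longrightarrow> right_ok l r x"
    and step: "\<And>x. a < x \<Longrightarrow> x < b \<Longrightarrow> r x = l x"
    and x: "a \<le> x" "x \<le> b"
  shows "a < x \<Longrightarrow> l x = r a" "x < b \<Longrightarrow> r x = r a"
proof -
  have L: "left_ok l r y \<and> left_ok (\<lambda>_. r a) (\<lambda>_. r a) y" if "a < y" "y \<le> b" for y
    using left[OF that] by (auto simp: left_ok_def)
  have R: "right_ok l r y \<and> right_ok (\<lambda>_. r a) (\<lambda>_. r a) y" if "a \<le> y" "y < b" for y
    using right[OF that] by (auto simp: right_ok_def)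
  have st: "r y = r a" if "a < y" "y < b" "l y = r a" for y
    using step[OF that(1,2)] that(3) by (rule HOL.trans)
  show "a < x \<Longrightarrow> l x = r a" "x < b \<Longrightarrow> r x = r a"
    by (rule steps_unique[of a b l r "\<lambda>_. r a" "\<lambda>_. r a" x, OF assms(1) L R HOL.refl st x]; assumption)+
qed

lemma left_ok_eq:
  assumes "left_ok l' r' x" "b < x"
    and "\<And>y. b < y \<Longrightarrow> y \<le> x \<Longrightarrow> l y = l' y" "\<And>y. b < y \<Longrightarrow> y < x \<Longrightarrow> r y = r' y"
  shows "left_ok l r x"
  by (rule left_ok_cong[OF assms(1,2), of 0]) (simp_all add: assms(3,4))

lemma right_ok_eq:
  assumes "right_ok l' r' x" "x < b"
    and "\<And>y. x < y \<Longrightarrow> y < b \<Longrightarrow> l y = l' y" "\<And>y. x \<le> y \<Longrightarrow> y < b \<Longrightarrow> r y = r' y"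
  shows "right_ok l r x"
  by (rule right_ok_cong[OF assms(1,2), of 0]) (simp_all add: assms(3,4))

definition labelling :: "nat \<Rightarrow> 'q set \<Rightarrow> (point \<Rightarrow> 'q) \<Rightarrow> (point \<Rightarrow> 'q) \<Rightarrow> bool" where
  "labelling n C l r \<longleftrightarrow> (\<forall>i<n. \<forall>x.
     l (i, x) \<in> C \<and> r (i, x) \<in> C \<and> l (i, x + 1) = l (i, x) \<and> r (i, x + 1) = r (i, x) \<and>
     left_ok (\<lambda>y. l (i, y)) (\<lambda>y. r (i, y)) x \<and> right_ok (\<lambda>y. l (i, y)) (\<lambda>y. r (i, y)) x)"

lemma periodic_int:
  fixes f :: "real \<Rightarrow> 'a"
  assumes "\<And>x. f (x + 1) = f x"
  shows "f (x + of_int k) = f x"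
proof (induction k rule: int_induct[where k = 0])
  case (step1 i)
  then show ?case using assms[of "x + of_int i"] by (simp add: add.assoc)
next
  case (step2 i)
  then show ?case using assms[of "x + of_int (i - 1)"] by (simp add: add.assoc)
qed simp

lemma labelling_int:
  assumes "labelling n C l r" "i < n"
  shows "l (i, x + of_int k) = l (i, x)" "r (i, x + of_int k) = r (i, x)"
  using assms periodic_int[of "\<lambda>x. l (i, x)" x k] periodic_int[of "\<lambda>x. r (i, x)" x k]
  by (auto simp: labelling_def)

lemma labelling_same_point:
  assumes "labelling n C l r" "same_point p q" "fst p < n"
  shows "l p = l q" "r p = r q"
proof -
  obtain k where k: "snd p - snd q = of_int k" using assms(2) by (auto simp: same_point_def elim: Ints_cases)
  then have "p = (fst q, snd q + of_int k)" using assms(2) by (cases p) (auto simp: same_point_def)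
  then show "l p = l q" "r p = r q" using labelling_int[OF assms(1), of "fst q" "snd q" k] assms(3) by auto
qed

lemma glue_segment:
  fixes l0 r0 :: "point \<Rightarrow> 'q" and s t :: real
  assumes i: "i < n" and st: "s < t" "t < s + 1"
    and l0: "\<And>j x. j < n \<Longrightarrow> l0 (j, x) \<in> C \<and> r0 (j, x) \<in> C \<and> l0 (j, x + 1) = l0 (j, x) \<and> r0 (j, x + 1) = r0 (j, x)"
    and left0: "\<And>j x. j < n \<Longrightarrow> (\<And>k::int. j = i \<Longrightarrow> \<not> (s < x + k \<and> x + k \<le> t)) \<Longrightarrow>
        left_ok (\<lambda>y. l0 (j, y)) (\<lambda>y. r0 (j, y)) x"
    and right0: "\<And>j x. j < n \<Longrightarrow> (\<And>k::int. j = i \<Longrightarrow> \<not> (s \<le> x + k \<and> x + k < t)) \<Longrightarrow>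
        right_ok (\<lambda>y. l0 (j, y)) (\<lambda>y. r0 (j, y)) x"
    and lg: "\<And>x. s \<le> x \<Longrightarrow> x \<le> t \<Longrightarrow> lg x \<in> C \<and> rg x \<in> C"
    and left: "\<And>x. s < x \<Longrightarrow> x \<le> t \<Longrightarrow> left_ok lg rg x"
    and right: "\<And>x. s \<le> x \<Longrightarrow> x < t \<Longrightarrow> right_ok lg rg x"
    and ends: "lg s = l0 (i, s)" "rg t = r0 (i, t)"
  obtains l r where "labelling n C l r"
    "\<And>p. p \<notin> closed_seg (i, s, t) \<Longrightarrow> l p = l0 p \<and> r p = r0 p"
    "\<And>x. s \<le> x \<Longrightarrow> x \<le> t \<Longrightarrow> l (i, x) = lg x \<and> r (i, x) = rg x"
proof -
  define m where "m x = x - of_int \<lfloor>x - s\<rfloor>" for x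
  have m_eq: "m x = x + of_int k" if "s \<le> x + of_int k" "x + of_int k < s + 1" for x k
  proof -
    have "\<lfloor>x - s\<rfloor> = - k" using that by (intro floor_unique) auto
    then show ?thesis by (simp add: m_def)
  qed
  have m_range: "s \<le> m x" "m x < s + 1" for x unfolding m_def by linarith+
  have m_per: "m (x + 1) = m x" for x
    using m_eq[of "x + 1" "- \<lfloor>x - s\<rfloor> - 1"] m_range[of x] by (simp add: m_def)
  define l where "l p = (if fst p = i \<and> m (snd p) \<le> t then lg (m (snd p)) else l0 p)" for p
  define r where "r p = (if fst p = i \<and> m (snd p) \<le> t then rg (m (snd p)) else r0 p)" for p
  have outside: "l (i, y) = l0 (i, y)" "r (i, y) = r0 (i, y)" if "t < m y" for y
    using that by (simp_all add: l_def r_def)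
  have l0_int: "l0 (j, x + of_int k) = l0 (j, x)" "r0 (j, x + of_int k) = r0 (j, x)" if "j < n" for j x k
    using periodic_int[of "\<lambda>x. l0 (j, x)" x k] periodic_int[of "\<lambda>x. r0 (j, x)" x k] l0[OF that] by auto
  have L: "left_ok (\<lambda>y. l (j, y)) (\<lambda>y. r (j, y)) x" if j: "j < n" for j x
  proof (cases "j = i")
    case False
    then show ?thesis using left0[OF j, of x] by (simp add: l_def r_def)
  next
    case [simp]: True
    define k where "k = - \<lfloor>x - s\<rfloor>"
    have mx: "m x = x + of_int k" by (simp add: m_def k_def)
    note rg = m_range[of x]
    consider (in_seg) "s < m x" "m x \<le> t" | (eq) "m x = s" | (out) "t < m x" using rg by linarith
    then show ?thesis
    proof cases
      case in_seg
      have my: "m y = y + of_int k" if "x - (m x - s) < y" "y \<le> x" for y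
        using that rg by (intro m_eq) (auto simp: mx)
      show ?thesis unfolding True
        by (rule left_ok_cong[OF left[OF in_seg], of "x - (m x - s)" x "of_int k"])
          (use in_seg my in \<open>simp_all add: l_def r_def mx\<close>)
    next
      case eq
      have my: "m y = y + of_int (k + 1)" if "x - (s + 1 - t) < y" "y < x" for y
        using that st eq by (intro m_eq) (auto simp: mx)
      have ok: "left_ok (\<lambda>y. l0 (i, y)) (\<lambda>y. r0 (i, y)) x"
      proof (rule left0[OF i])
        fix k' :: int
        have *: "x + of_int k' = s + of_int (k' - k)" using eq mx by simp
        show "\<not> (s < x + of_int k' \<and> x + of_int k' \<le> t)"
        proof
          assume "s < x + of_int k' \<and> x + of_int k' \<le> t"
          then have "real_of_int (k' - k) > 0" "real_of_int (k' - k) < 1" using * st by linarith+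
          then show False by (simp only: of_int_0_less_iff of_int_less_1_iff)
        qed
      qed
      have lgs: "lg s = l0 (i, x)" using ends eq mx l0_int(1)[OF i, of x k] by simp
      have tm: "t < m y" if "x - (s + 1 - t) < y" "y < x" for y
        using my[OF that] that eq mx by simp
      have ly: "l (i, y) = l0 (i, y)" if "x - (s + 1 - t) < y" "y \<le> x" for y
      proof (cases "y = x")
        case True
        then show ?thesis using eq st lgs by (simp add: l_def)
      next
        case False
        then show ?thesis using outside(1)[OF tm] that by simp
      qed
      show ?thesis unfolding True
        by (rule left_ok_eq[where b = "x - (s + 1 - t)", OF ok _ ly outside(2)[OF tm]]) (use st in simp_all)
    next
      case out
      have my: "m y = y + of_int k" if "x - (m x - t) < y" "y \<le> x" for y
        using that rg out st by (intro m_eq) (auto simp: mx)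
      have tm: "t < m y" if "x - (m x - t) < y" "y \<le> x" for y
        using my[OF that] that mx by simp
      have ok: "left_ok (\<lambda>y. l0 (i, y)) (\<lambda>y. r0 (i, y)) x"
      proof (rule left0[OF i])
        fix k' :: int
        show "\<not> (s < x + of_int k' \<and> x + of_int k' \<le> t)" using m_eq[of x k'] out st by auto
      qed
      show ?thesis unfolding True
        by (rule left_ok_eq[where b = "x - (m x - t)", OF ok _ outside(1)[OF tm] outside(2)[OF tm]])
          (use out in simp_all)
    qed
  qed
  have R: "right_ok (\<lambda>y. l (j, y)) (\<lambda>y. r (j, y)) x" if j: "j < n" for j x
  proof (cases "j = i")
    case False
    then show ?thesis using right0[OF j, of x] by (simp add: l_def r_def)
  next
    case [simp]: True
    define k where "k = - \<lfloor>x - s\<rfloor>"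
    have mx: "m x = x + of_int k" by (simp add: m_def k_def)
    note rg = m_range[of x]
    consider (in_seg) "s \<le> m x" "m x < t" | (eq) "m x = t" | (out) "t < m x" using rg by linarith
    then show ?thesis
    proof cases
      case in_seg
      have my: "m y = y + of_int k" if "x \<le> y" "y < x + (t - m x)" for y
        using that rg st by (intro m_eq) (auto simp: mx)
      show ?thesis unfolding True
        by (rule right_ok_cong[OF right[OF in_seg], of x "x + (t - m x)" "of_int k"])
          (use in_seg my in \<open>auto simp: l_def r_def mx\<close>)
    next
      case eq
      have my: "m y = y + of_int k" if "x < y" "y < x + (s + 1 - t)" for y
        using that st eq by (intro m_eq) (auto simp: mx)
      have ok: "right_ok (\<lambda>y. l0 (i, y)) (\<lambda>y. r0 (i, y)) x"
      proof (rule right0[OF i])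
        fix k' :: int
        show "\<not> (s \<le> x + of_int k' \<and> x + of_int k' < t)" using m_eq[of x k'] eq st by auto
      qed
      have rgt: "rg t = r0 (i, x)" using ends eq mx l0_int(2)[OF i, of x k] by simp
      have tm: "t < m y" if "x < y" "y < x + (s + 1 - t)" for y
        using my[OF that] that eq mx by simp
      have ry: "r (i, y) = r0 (i, y)" if "x \<le> y" "y < x + (s + 1 - t)" for y
      proof (cases "y = x")
        case True
        then show ?thesis using eq st rgt by (simp add: r_def)
      next
        case False
        then show ?thesis using outside(2)[OF tm] that by simp
      qed
      show ?thesis unfolding True
        by (rule right_ok_eq[where b = "x + (s + 1 - t)", OF ok _ outside(1)[OF tm] ry]) (use st in simp_all)
    next
      case out
      have my: "m y = y + of_int k" if "x \<le> y" "y < x + (s + 1 - m x)" for y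
        using that rg out st by (intro m_eq) (auto simp: mx)
      have tm: "t < m y" if "x \<le> y" "y < x + (s + 1 - m x)" for y
        using my[OF that] that mx out by simp
      have ok: "right_ok (\<lambda>y. l0 (i, y)) (\<lambda>y. r0 (i, y)) x"
      proof (rule right0[OF i])
        fix k' :: int
        show "\<not> (s \<le> x + of_int k' \<and> x + of_int k' < t)" using m_eq[of x k'] out st by auto
      qed
      show ?thesis unfolding True
        by (rule right_ok_eq[where b = "x + (s + 1 - m x)", OF ok _ outside(1)[OF tm] outside(2)[OF tm]])
          (use rg in simp_all)
    qed
  qed
  show thesis
  proof
    show "labelling n C l r" unfolding labelling_def
      using L R l0 lg m_range m_per by (simp add: l_def r_def)
    show "l p = l0 p \<and> r p = r0 p" if "p \<notin> closed_seg (i, s, t)" for p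
    proof -
      have "\<not> (fst p = i \<and> m (snd p) \<le> t)"
      proof
        assume *: "fst p = i \<and> m (snd p) \<le> t"
        then have "s \<le> snd p + of_int (- \<lfloor>snd p - s\<rfloor>) \<and> snd p + of_int (- \<lfloor>snd p - s\<rfloor>) \<le> t"
          using m_range[of "snd p"] by (simp add: m_def)
        then have "\<exists>k::int. s \<le> snd p + of_int k \<and> snd p + of_int k \<le> t" by (rule exI)
        then have "p \<in> closed_seg (i, s, t)" using * by (cases p) simp
        then show False using that by blast
      qed
      then show ?thesis by (auto simp: l_def r_def)
    qed
    show "l (i, x) = lg x \<and> r (i, x) = rg x" if "s \<le> x" "x \<le> t" for x
      using m_eq[of x 0] that st by (simp add: l_def r_def)
  qed
qed

section \<open>Diagrams\<close>

lemma same_point_iff: "same_point p q \<longleftrightarrow> (\<exists>k::int. fst p = fst q \<and> snd p = snd q + of_int k)"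
  unfolding same_point_def by (auto elim!: Ints_cases simp: algebra_simps)

lemma same_point_refl [simp]: "same_point p p"
  by (simp add: same_point_def)

lemma same_point_sym: "same_point p q \<Longrightarrow> same_point q p"
  unfolding same_point_def by (metis Ints_minus minus_diff_eq)

lemma same_point_trans: "same_point p q \<Longrightarrow> same_point q r \<Longrightarrow> same_point p r"
  unfolding same_point_def by (metis Ints_add add_diff_eq diff_add_cancel)

lemma same_point_shift: "same_point (i, x + of_int k) (i, x)"
  by (simp add: same_point_def)

lemma double_sym: "double K p q \<Longrightarrow> double K q p"
  by (auto simp: double_def intro: same_point_sym)

lemma double_less: "double K p q \<Longrightarrow> fst p < ncomp K" "double K p q \<Longrightarrow> fst q < ncomp K"
  by (auto simp: double_def points_def)

lemma crossing_less: "crossing K p \<Longrightarrow> fst p < ncomp K"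
  by (auto simp: crossing_def double_def points_def)

context
  fixes A :: "'v set" and K :: "'v diagram"
  assumes K: "mv_diagram A K"
begin

lemma pos_has_derivative:
  assumes "i < ncomp K"
  shows "((\<lambda>r. pos K (i, r)) has_vector_derivative tangent K (i, x)) (at x)"
  using K assms unfolding mv_diagram_def C1_differentiable_on_eq tangent_def
  by (auto simp: vector_derivative_works)

lemma pos_continuous: "i < ncomp K \<Longrightarrow> continuous_on S (\<lambda>r. pos K (i, r))"
  by (intro continuous_at_imp_continuous_on ballI has_vector_derivative_continuous[OF pos_has_derivative])

lemma pos_int: "i < ncomp K \<Longrightarrow> pos K (i, x + of_int k) = pos K (i, x)"
  using periodic_int[of "\<lambda>x. pos K (i, x)" x k] K by (simp add: mv_diagram_def)

lemma strand_int: "i < ncomp K \<Longrightarrow> strand K (i, x + of_int k) = strand K (i, x)"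
  using periodic_int[of "\<lambda>x. strand K (i, x)" x k] K by (simp add: mv_diagram_def)

lemma tangent_int:
  assumes "i < ncomp K"
  shows "tangent K (i, x + of_int k) = tangent K (i, x)"
proof -
  have "((\<lambda>r. r - of_int k) has_vector_derivative 1) (at (x + of_int k))"
    by (auto intro!: derivative_eq_intros simp flip: has_real_derivative_iff_has_vector_derivative)
  from vector_diff_chain_at[OF this, of "\<lambda>r. pos K (i, r)" "tangent K (i, x)"]
  have "((\<lambda>r. pos K (i, r - of_int k)) has_vector_derivative tangent K (i, x)) (at (x + of_int k))"
    using pos_has_derivative[OF assms, of x] by (simp add: o_def)
  moreover have "pos K (i, r - of_int k) = pos K (i, r)" for r
    using pos_int[OF assms, of "r" "- k"] by simp
  ultimately show ?thesis
    unfolding tangent_def by (simp add: vector_derivative_at)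
qed

lemma same_point_cong:
  assumes "same_point p q" "fst p < ncomp K"
  shows "pos K p = pos K q" "strand K p = strand K q" "tangent K p = tangent K q"
proof -
  obtain k :: int where "p = (fst q, snd q + of_int k)" "fst q < ncomp K"
    using assms by (cases p) (auto simp: same_point_iff)
  then show "pos K p = pos K q" "strand K p = strand K q" "tangent K p = tangent K q"
    using pos_int[of "fst q" "snd q" k] strand_int[of "fst q" "snd q" k] tangent_int[of "fst q" "snd q" k]
    by auto
qed

lemma double_cong:
  assumes "double K p q" "same_point p p'" "same_point q q'"
  shows "double K p' q'"
proof -
  have "fst p < ncomp K" "fst q < ncomp K" using double_less[OF assms(1)] by auto
  then show ?thesis
    using assms same_point_cong(1)[OF assms(2)] same_point_cong(1)[OF assms(3)] unfolding double_def points_def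
    by (auto simp: same_point_def[of p p'] same_point_def[of q q'])
      (meson assms(2,3) same_point_sym same_point_trans)
qed

lemma crossing_cong: "same_point p q \<Longrightarrow> crossing K p \<longleftrightarrow> crossing K q"
  unfolding crossing_def by (meson double_cong same_point_refl same_point_sym)

lemma cut_cong: "same_point p q \<Longrightarrow> cut K p \<longleftrightarrow> cut K q"
  unfolding cut_def using crossing_cong crossing_less same_point_cong(2) by metis

lemma cut_int: "cut K (i, x + of_int k) \<longleftrightarrow> cut K (i, x)"
  by (rule cut_cong) (rule same_point_shift)

lemma crossing_int: "crossing K (i, x + of_int k) \<longleftrightarrow> crossing K (i, x)"
  by (rule crossing_cong) (rule same_point_shift)

lemma double_unique: "double K p q \<Longrightarrow> double K p q' \<Longrightarrow> same_point q q'"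
  using K unfolding mv_diagram_def by blast

lemma double_det: "double K p q \<Longrightarrow> det2 (tangent K p) (tangent K q) \<noteq> 0"
  using K unfolding mv_diagram_def by blast

lemma double_strands:
  assumes "double K p q"
  obtains "strand K p = Over" "strand K q = Under" | "strand K p = Under" "strand K q = Over"
    | \<alpha> where "\<alpha> \<in> A" "strand K p = Virt \<alpha>" "strand K q = Virt \<alpha>"
  using K assms unfolding mv_diagram_def by blast

lemma finite_same_points:
  fixes a b y :: real
  shows "finite {x. a \<le> x \<and> x \<le> b \<and> same_point (i, x) (j, y)}"
proof -
  have "{x. a \<le> x \<and> x \<le> b \<and> same_point (i, x) (j, y)} \<subseteq> (\<lambda>k::int. y + of_int k) ` {\<lfloor>a - y\<rfloor>..\<lceil>b - y\<rceil>}"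
    by (auto simp: same_point_iff image_iff) linarith+
  then show ?thesis by (rule finite_subset) simp
qed

lemma finite_crossings: "finite {x. a \<le> x \<and> x \<le> b \<and> crossing K (i, x)}"
proof -
  define X where "X z = {x. a \<le> x \<and> x \<le> b \<and> crossing K (i, x) \<and> pos K (i, x) = z}" for z
  have "finite (X z)" for z
  proof (cases "X z = {}")
    case False
    then obtain x0 where "x0 \<in> X z" by blast
    moreover from this obtain q where "double K (i, x0) q" unfolding X_def crossing_def by blast
    ultimately have x0: "x0 \<in> X z" "double K (i, x0) q" by simp_all
    have "X z \<subseteq> {x. a \<le> x \<and> x \<le> b \<and> same_point (i, x) (i, x0)} \<union>
        {x. a \<le> x \<and> x \<le> b \<and> same_point (i, x) (fst q, snd q)}"
    proof
      fix x assume x: "x \<in> X z"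
      have "same_point (i, x) q" if "\<not> same_point (i, x) (i, x0)"
      proof -
        have "double K (i, x0) (i, x)"
          using that x x0 crossing_less same_point_sym by (fastforce simp: X_def double_def points_def)
        then show ?thesis using double_unique x0(2) by blast
      qed
      then show "x \<in> {x. a \<le> x \<and> x \<le> b \<and> same_point (i, x) (i, x0)} \<union>
        {x. a \<le> x \<and> x \<le> b \<and> same_point (i, x) (fst q, snd q)}"
        using x by (auto simp: X_def)
    qed
    then show ?thesis by (rule finite_subset) (intro finite_UnI finite_same_points)
  qed simp
  moreover have *: "{x. a \<le> x \<and> x \<le> b \<and> crossing K (i, x)} = (\<Union>z\<in>pos K ` {p. crossing K p}. X z)"
    by (auto simp: X_def)
  moreover have "finite (pos K ` {p. crossing K p})" using K by (simp add: mv_diagram_def)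
  ultimately show ?thesis unfolding * by (intro finite_UN_I)
qed

lemma no_crossing_left:
  obtains b where "b < x" "\<And>y. b < y \<Longrightarrow> y < x \<Longrightarrow> \<not> crossing K (i, y)"
proof -
  obtain b where "b < x" "\<And>y. b < y \<Longrightarrow> y < x \<Longrightarrow> y \<notin> {y. x - 1 \<le> y \<and> y \<le> x \<and> crossing K (i, y)}"
    using finite_gap_left[OF finite_crossings[of "x - 1" x i]] by metis
  then show thesis by (intro that[of "max b (x - 1)"]) auto
qed

lemma no_crossing_right:
  obtains b where "x < b" "\<And>y. x < y \<Longrightarrow> y < b \<Longrightarrow> \<not> crossing K (i, y)"
proof -
  obtain b where "x < b" "\<And>y. x < y \<Longrightarrow> y < b \<Longrightarrow> y \<notin> {y. x \<le> y \<and> y \<le> x + 1 \<and> crossing K (i, y)}"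
    using finite_gap_right[OF finite_crossings[of x "x + 1" i]] by metis
  then show thesis by (intro that[of "min b (x + 1)"]) auto
qed

section \<open>Arcs\<close>

lemma arc_of_iff:
  "(j, x) \<in> arc_of K (i, y) \<longleftrightarrow> j = i \<and> (\<exists>k::int. \<forall>z\<in>closed_segment x (y + of_int k). \<not> cut K (i, z))"
  by (auto simp: arc_of_def)

lemma arc_of_sym:
  assumes "(i, x) \<in> arc_of K (i, y)"
  shows "(i, y) \<in> arc_of K (i, x)"
proof -
  obtain k :: int where k: "\<forall>z\<in>closed_segment x (y + of_int k). \<not> cut K (i, z)"
    using assms by (auto simp: arc_of_iff)
  have "\<not> cut K (i, z)" if "z \<in> closed_segment y (x + of_int (- k))" for z
  proof -
    have "z + of_int k \<in> closed_segment x (y + of_int k)"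
      using that by (auto simp: closed_segment_eq_real_ivl split: if_splits)
    then show ?thesis using k cut_int[of i z k] by blast
  qed
  then show ?thesis unfolding arc_of_iff by blast
qed

lemma arc_of_trans:
  assumes "(i, x) \<in> arc_of K (i, y)" "(i, y) \<in> arc_of K (i, w)"
  shows "(i, x) \<in> arc_of K (i, w)"
proof -
  obtain k l :: int where k: "\<forall>z\<in>closed_segment x (y + of_int k). \<not> cut K (i, z)"
    and l: "\<forall>z\<in>closed_segment y (w + of_int l). \<not> cut K (i, z)"
    using assms by (auto simp: arc_of_iff)
  have "\<not> cut K (i, z)" if "z \<in> closed_segment x (w + of_int (k + l))" for z
  proof (cases "z \<in> closed_segment x (y + of_int k)")
    case False
    then have "z - of_int k \<in> closed_segment y (w + of_int l)"
      using that by (auto simp: closed_segment_eq_real_ivl split: if_splits)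
    then show ?thesis using l cut_int[of i "z - of_int k" k] by auto
  qed (use k in blast)
  then show ?thesis unfolding arc_of_iff by blast
qed

lemma arcs_unique:
  assumes "a \<in> arcs K" "b \<in> arcs K" "p \<in> a" "p \<in> b"
  shows "a = b"
proof -
  obtain i y where a: "a = arc_of K (i, y)" using assms(1) by (auto simp: arcs_def)
  obtain j z where b: "b = arc_of K (j, z)" using assms(2) by (auto simp: arcs_def)
  obtain i' x where "p = (i', x)" by (cases p)
  then have p: "p = (i, x)" "j = i" using assms(3,4) unfolding a b by (auto simp: arc_of_iff)
  have yz: "(i, y) \<in> arc_of K (i, z)" "(i, z) \<in> arc_of K (i, y)"
    using assms(3,4) arc_of_sym[of i x] arc_of_trans[of i _ x] unfolding a b p by blast+
  show ?thesis
  proof (intro set_eqI)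
    fix q :: point
    obtain j' w where q: "q = (j', w)" by (cases q)
    show "q \<in> a \<longleftrightarrow> q \<in> b"
    proof (cases "j' = i")
      case True
      then show ?thesis unfolding a b p q using yz arc_of_trans by blast
    qed (simp add: a b p q arc_of_iff)
  qed
qed

lemma arcs_not_cut:
  assumes "a \<in> arcs K" "p \<in> a"
  shows "p \<in> points K" "\<not> cut K p"
proof -
  obtain i y where a: "a = arc_of K (i, y)" "i < ncomp K" using assms(1) by (auto simp: arcs_def points_def)
  obtain x where p: "p = (i, x)" using assms(2) unfolding a by (cases p) (auto simp: arc_of_iff)
  show "p \<in> points K" using a p by (simp add: points_def)
  show "\<not> cut K p" using assms(2) unfolding a p arc_of_iff by auto
qed

lemma mem_arc_of: "\<not> cut K (i, x) \<Longrightarrow> (i, x) \<in> arc_of K (i, x)"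
  unfolding arc_of_iff by (intro conjI exI[of _ 0]) auto

lemma arc_of_in_arcs: "i < ncomp K \<Longrightarrow> \<not> cut K (i, x) \<Longrightarrow> arc_of K (i, x) \<in> arcs K"
  by (auto simp: arcs_def points_def)

lemma near_arc:
  assumes "\<And>z. z \<in> closed_segment x y \<Longrightarrow> \<not> cut K (i, z)"
  shows "(i, x) \<in> arc_of K (i, y)"
  unfolding arc_of_iff using assms by (intro conjI exI[of _ 0]) auto

lemma eventually_left_iff: "(\<forall>\<^sub>F y in at_left x. P y) \<longleftrightarrow> (\<exists>b<x. \<forall>y. b < y \<and> y < x \<longrightarrow> P (y::real))"
  unfolding eventually_at_left[of "x - 1" x, simplified] by blast

lemma eventually_right_iff: "(\<forall>\<^sub>F y in at_right x. P y) \<longleftrightarrow> (\<exists>b>x. \<forall>y. x < y \<and> y < b \<longrightarrow> P (y::real))"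
  unfolding eventually_at_right[of x "x + 1", simplified] by blast

lemma incoming_exists:
  assumes "i < ncomp K"
  shows "\<exists>a. incoming K (i, x) a"
proof -
  obtain b where b: "b < x" "\<And>y. b < y \<Longrightarrow> y < x \<Longrightarrow> \<not> crossing K (i, y)"
    using no_crossing_left by blast
  define m where "m = (b + x) / 2"
  have m: "b < m" "m < x" using b by (auto simp: m_def)
  have nc: "\<not> cut K (i, y)" if "b < y" "y < x" for y using b(2) that by (simp add: cut_def)
  have "incoming K (i, x) (arc_of K (i, m))"
    unfolding incoming_def eventually_left_iff fst_conv snd_conv
  proof (intro conjI arc_of_in_arcs assms exI[of _ b] b(1) allI impI nc m)
    fix y assume "b < y \<and> y < x"
    then show "(i, y) \<in> arc_of K (i, m)"
      using m by (intro near_arc nc) (auto simp: closed_segment_eq_real_ivl split: if_splits)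
  qed
  then show ?thesis by blast
qed

lemma outgoing_exists:
  assumes "i < ncomp K"
  shows "\<exists>a. outgoing K (i, x) a"
proof -
  obtain b where b: "x < b" "\<And>y. x < y \<Longrightarrow> y < b \<Longrightarrow> \<not> crossing K (i, y)"
    using no_crossing_right by blast
  define m where "m = (b + x) / 2"
  have m: "x < m" "m < b" using b by (auto simp: m_def)
  have nc: "\<not> cut K (i, y)" if "x < y" "y < b" for y using b(2) that by (simp add: cut_def)
  have "outgoing K (i, x) (arc_of K (i, m))"
    unfolding outgoing_def eventually_right_iff fst_conv snd_conv
  proof (intro conjI arc_of_in_arcs assms exI[of _ b] b(1) allI impI nc m)
    fix y assume "x < y \<and> y < b"
    then show "(i, y) \<in> arc_of K (i, m)"
      using m by (intro near_arc nc) (auto simp: closed_segment_eq_real_ivl split: if_splits)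
  qed
  then show ?thesis by blast
qed

lemma incoming_unique:
  assumes "incoming K p a" "incoming K p b"
  shows "a = b"
proof -
  have "\<forall>\<^sub>F x in at_left (snd p). (fst p, x) \<in> a \<and> (fst p, x) \<in> b"
    using assms unfolding incoming_def by (simp add: eventually_conj_iff)
  then have "\<exists>x. (fst p, x) \<in> a \<and> (fst p, x) \<in> b"
    by (rule eventually_happens'[OF trivial_limit_at_left_real])
  then show ?thesis using assms arcs_unique[of a b] unfolding incoming_def by blast
qed

lemma outgoing_unique:
  assumes "outgoing K p a" "outgoing K p b"
  shows "a = b"
proof -
  have "\<forall>\<^sub>F x in at_right (snd p). (fst p, x) \<in> a \<and> (fst p, x) \<in> b"
    using assms unfolding outgoing_def by (simp add: eventually_conj_iff)
  then have "\<exists>x. (fst p, x) \<in> a \<and> (fst p, x) \<in> b"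
    by (rule eventually_happens'[OF trivial_limit_at_right_real])
  then show ?thesis using assms arcs_unique[of a b] unfolding outgoing_def by blast
qed

lemma arc_incoming_outgoing:
  assumes "a \<in> arcs K" "(i, x) \<in> a"
  shows "incoming K (i, x) a" "outgoing K (i, x) a"
proof -
  have nc: "\<not> cut K (i, x)" and i: "i < ncomp K"
    using arcs_not_cut[OF assms] by (auto simp: points_def)
  have a: "a = arc_of K (i, x)"
    using arcs_unique[OF assms(1) arc_of_in_arcs[OF i nc] assms(2) mem_arc_of[OF nc]] .
  obtain b where b: "b < x" "\<And>y. b < y \<Longrightarrow> y < x \<Longrightarrow> \<not> crossing K (i, y)"
    using no_crossing_left by blast
  obtain c where c: "x < c" "\<And>y. x < y \<Longrightarrow> y < c \<Longrightarrow> \<not> crossing K (i, y)"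
    using no_crossing_right by blast
  have nl: "\<not> cut K (i, y)" if "b < y" "y \<le> x" for y
    using b(2)[of y] nc that by (cases "y = x") (auto simp: cut_def)
  have nr: "\<not> cut K (i, y)" if "x \<le> y" "y < c" for y
    using c(2)[of y] nc that by (cases "y = x") (auto simp: cut_def)
  show "incoming K (i, x) a"
    unfolding incoming_def eventually_left_iff fst_conv snd_conv
  proof (intro conjI assms(1) exI[of _ b] b(1) allI impI)
    fix y assume "b < y \<and> y < x"
    then show "(i, y) \<in> a" unfolding a
      by (intro near_arc nl) (auto simp: closed_segment_eq_real_ivl)
  qed
  show "outgoing K (i, x) a"
    unfolding outgoing_def eventually_right_iff fst_conv snd_conv
  proof (intro conjI assms(1) exI[of _ c] c(1) allI impI)
    fix y assume "x < y \<and> y < c"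
    then show "(i, y) \<in> a" unfolding a
      by (intro near_arc nr) (auto simp: closed_segment_eq_real_ivl)
  qed
qed

end

section \<open>Colorings\<close>

definition variables :: "'v set \<Rightarrow> 'q quandle \<Rightarrow> ('v \<Rightarrow> 'q) \<Rightarrow> bool" where
  "variables A X v \<longleftrightarrow> is_quandle X \<and> (\<forall>\<alpha>\<in>A. v \<alpha> \<in> qcarrier X) \<and>
     (\<forall>x\<in>qcarrier X. \<forall>\<alpha>\<in>A. \<forall>\<beta>\<in>A. qstar X (qstar X x (v \<alpha>)) (v \<beta>) = qstar X (qstar X x (v \<beta>)) (v \<alpha>))"

definition passes :: "'v diagram \<Rightarrow> 'q quandle \<Rightarrow> ('v \<Rightarrow> 'q) \<Rightarrow> (point \<Rightarrow> 'q) \<Rightarrow> (point \<Rightarrow> 'q) \<Rightarrow>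
    point \<Rightarrow> point \<Rightarrow> bool" where
  "passes K X v l r p q \<longleftrightarrow>
     r q = act X (0 < det2 (tangent K p) (tangent K q)) (l q)
             (case strand K q of Virt \<alpha> \<Rightarrow> v \<alpha> | _ \<Rightarrow> l p)"

text \<open>\<open>l p\<close> and \<open>r p\<close> are the labels of the arcs that arrive at \<open>p\<close> and leave it.  With signs read
  off from \<open>det2\<close>, the classical and virtual relations take the same form \<^const>\<open>passes\<close>.\<close>

definition coloring :: "'v set \<Rightarrow> 'v diagram \<Rightarrow> 'q quandle \<Rightarrow> ('v \<Rightarrow> 'q) \<Rightarrow>
    (point \<Rightarrow> 'q) \<Rightarrow> (point \<Rightarrow> 'q) \<Rightarrow> bool" where
  "coloring A K X v l r \<longleftrightarrow> variables A X v \<and> labelling (ncomp K) (qcarrier X) l r \<and>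
     (\<forall>p\<in>points K. \<not> cut K p \<longrightarrow> l p = r p) \<and>
     (\<forall>p q. double K p q \<and> strand K q \<noteq> Over \<longrightarrow> passes K X v l r p q)"

lemma labelling_closed:
  assumes "labelling n C l r" "fst p < n"
  shows "l p \<in> C" "r p \<in> C"
  using assms by (cases p; simp add: labelling_def)+

lemma virtual_relationsI:
  assumes "double K p q" "strand K p = Virt \<alpha>" "0 < det2 (tangent K q) (tangent K p)"
  shows "incoming K p a \<Longrightarrow> outgoing K p c \<Longrightarrow> (garc c, Star (garc a) (gvar \<alpha>)) \<in> virtual_relations K"
    "incoming K q b \<Longrightarrow> outgoing K q d \<Longrightarrow> (garc d, Sharp (garc b) (gvar \<alpha>)) \<in> virtual_relations K"
  unfolding virtual_relations_def
  using assms by blast+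

lemma classical_relationsI:
  assumes "double K p q" "strand K p = Over" "strand K q = Under" "b \<in> arcs K" "p \<in> b"
    "incoming K q a" "outgoing K q c"
  shows "(garc c, if 0 < det2 (tangent K p) (tangent K q) then Star (garc a) (garc b)
      else Sharp (garc a) (garc b)) \<in> classical_relations K"
  unfolding classical_relations_def using assms by blast

lemma coloring_closed:
  assumes "coloring A K X v l r" "p \<in> points K"
  shows "l p \<in> qcarrier X" "r p \<in> qcarrier X"
  using assms labelling_closed[of "ncomp K" "qcarrier X" l r p] by (auto simp: coloring_def points_def)

lemma coloring_hom:
  assumes K: "mv_diagram A K" and c: "coloring A K X v l r" and f: "quandle_hom X Y f"
    and w: "variables A Y w" "\<And>\<alpha>. \<alpha> \<in> A \<Longrightarrow> f (v \<alpha>) = w \<alpha>"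
  shows "coloring A K Y w (f \<circ> l) (f \<circ> r)"
  unfolding coloring_def
proof (intro conjI w ballI allI impI)
  have lab: "labelling (ncomp K) (qcarrier X) l r" using c by (simp add: coloring_def)
  have L: "left_ok (\<lambda>y. f (l (i, y))) (\<lambda>y. f (r (i, y))) x" if "left_ok (\<lambda>y. l (i, y)) (\<lambda>y. r (i, y)) x" for i x
    using that unfolding left_ok_def by (rule eventually_mono) simp
  have R: "right_ok (\<lambda>y. f (l (i, y))) (\<lambda>y. f (r (i, y))) x" if "right_ok (\<lambda>y. l (i, y)) (\<lambda>y. r (i, y)) x" for i x
    using that unfolding right_ok_def by (rule eventually_mono) simp
  show "labelling (ncomp K) (qcarrier Y) (f \<circ> l) (f \<circ> r)"
    using lab L R quandle_hom_closed[OF f] unfolding labelling_def by simp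
  show "(f \<circ> l) p = (f \<circ> r) p" if "p \<in> points K" "\<not> cut K p" for p
    using c that by (simp add: coloring_def)
  fix p q assume pq: "double K p q \<and> strand K q \<noteq> Over"
  then have pts: "p \<in> points K" "q \<in> points K" by (auto simp: double_def)
  have P: "passes K X v l r p q" using c pq unfolding coloring_def by blast
  have "\<alpha> \<in> A" if "strand K q = Virt \<alpha>" for \<alpha>
    using double_strands[OF K, of p q] pq that by (metis passage.distinct(3,5) passage.inject)
  then show "passes K Y w (f \<circ> l) (f \<circ> r) p q"
    using P coloring_closed[OF c pts(1)] coloring_closed[OF c pts(2)] c
    by (auto simp: passes_def coloring_def variables_def quandle_hom_act[OF f] w(2) split: passage.splits)
qed

definition arc_in :: "'v diagram \<Rightarrow> point \<Rightarrow> point set" where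
  "arc_in K p = (SOME a. incoming K p a)"

definition arc_out :: "'v diagram \<Rightarrow> point \<Rightarrow> point set" where
  "arc_out K p = (SOME a. outgoing K p a)"

definition mv_rels :: "'v set \<Rightarrow> 'v diagram \<Rightarrow> ('v generator qterm \<times> 'v generator qterm) set" where
  "mv_rels A K = classical_relations K \<union> virtual_relations K \<union> commuting_relations A K"

definition mv_class :: "'v set \<Rightarrow> 'v diagram \<Rightarrow> 'v generator qterm \<Rightarrow> 'v generator qterm set" where
  "mv_class A K s = qcong (mv_generators A K) (mv_rels A K) `` {s}"

lemma mv_quandle_eq: "mv_quandle A K = presented_quandle (mv_generators A K) (mv_rels A K)"
  by (simp add: mv_quandle_def mv_rels_def)

definition ul :: "'v set \<Rightarrow> 'v diagram \<Rightarrow> point \<Rightarrow> 'v generator qterm set" where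
  "ul A K p = mv_class A K (garc (arc_in K p))"

definition ur :: "'v set \<Rightarrow> 'v diagram \<Rightarrow> point \<Rightarrow> 'v generator qterm set" where
  "ur A K p = mv_class A K (garc (arc_out K p))"

definition uv :: "'v set \<Rightarrow> 'v diagram \<Rightarrow> 'v \<Rightarrow> 'v generator qterm set" where
  "uv A K \<alpha> = mv_class A K (gvar \<alpha>)"

lemma mv_class_eqI:
  "(s, t) \<in> mv_rels A K \<Longrightarrow> s \<in> qterms (mv_generators A K) \<Longrightarrow> t \<in> qterms (mv_generators A K) \<Longrightarrow>
    mv_class A K s = mv_class A K t"
  unfolding mv_class_def by (intro equiv_class_eq[OF equiv_qcong] qcong.rel)

lemma mv_class_star:
  assumes "s \<in> qterms (mv_generators A K)" "t \<in> qterms (mv_generators A K)"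
  shows "qstar (mv_quandle A K) (mv_class A K s) (mv_class A K t) = mv_class A K (Star s t)"
    "qsharp (mv_quandle A K) (mv_class A K s) (mv_class A K t) = mv_class A K (Sharp s t)"
  using assms by (simp_all add: mv_class_def mv_quandle_eq presented_star presented_sharp)

lemma mv_carrier: "qcarrier (mv_quandle A K) = mv_class A K ` qterms (mv_generators A K)"
  by (simp add: mv_quandle_eq presented_carrier mv_class_def image_def)

lemma mv_is_quandle: "is_quandle (mv_quandle A K)"
  by (simp add: mv_quandle_eq is_quandle_presented)

lemma variables_universal: "variables A (mv_quandle A K) (uv A K)"
  unfolding variables_def
proof (intro conjI ballI mv_is_quandle)
  have g: "gvar \<alpha> \<in> qterms (mv_generators A K)" if "\<alpha> \<in> A" for \<alpha>
    using that by (auto simp: mv_generators_def intro: qterms.intros)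
  show "uv A K \<alpha> \<in> qcarrier (mv_quandle A K)" if "\<alpha> \<in> A" for \<alpha>
    using g[OF that] by (simp add: uv_def mv_carrier)
  fix x \<alpha> \<beta> assume x: "x \<in> qcarrier (mv_quandle A K)" and ab: "\<alpha> \<in> A" "\<beta> \<in> A"
  obtain s where s: "s \<in> qterms (mv_generators A K)" "x = mv_class A K s" using x by (auto simp: mv_carrier)
  have "(Star (Star s (gvar \<alpha>)) (gvar \<beta>), Star (Star s (gvar \<beta>)) (gvar \<alpha>)) \<in> mv_rels A K"
    using s ab unfolding mv_rels_def commuting_relations_def by blast
  then have "mv_class A K (Star (Star s (gvar \<alpha>)) (gvar \<beta>)) = mv_class A K (Star (Star s (gvar \<beta>)) (gvar \<alpha>))"
    by (rule mv_class_eqI) (simp_all add: s g ab qterms.intros)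
  then show "qstar (mv_quandle A K) (qstar (mv_quandle A K) x (uv A K \<alpha>)) (uv A K \<beta>) =
      qstar (mv_quandle A K) (qstar (mv_quandle A K) x (uv A K \<beta>)) (uv A K \<alpha>)"
    by (simp add: s g ab uv_def mv_class_star qterms.intros)
qed

context
  fixes A :: "'v set" and K :: "'v diagram"
  assumes K: "mv_diagram A K"
begin

lemma incoming_arc_in: "fst p < ncomp K \<Longrightarrow> incoming K p (arc_in K p)"
  unfolding arc_in_def using incoming_exists[OF K, of "fst p" "snd p"] by (intro someI_ex[of "incoming K p"]) simp

lemma outgoing_arc_out: "fst p < ncomp K \<Longrightarrow> outgoing K p (arc_out K p)"
  unfolding arc_out_def using outgoing_exists[OF K, of "fst p" "snd p"] by (intro someI_ex[of "outgoing K p"]) simp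

lemma arc_in_eqI: "incoming K p a \<Longrightarrow> arc_in K p = a"
  unfolding arc_in_def by (rule some_equality) (auto dest: incoming_unique[OF K])

lemma arc_out_eqI: "outgoing K p a \<Longrightarrow> arc_out K p = a"
  unfolding arc_out_def by (rule some_equality) (auto dest: outgoing_unique[OF K])

lemma arc_in_arcs: "fst p < ncomp K \<Longrightarrow> arc_in K p \<in> arcs K"
  using incoming_arc_in by (auto simp: incoming_def)

lemma arc_out_arcs: "fst p < ncomp K \<Longrightarrow> arc_out K p \<in> arcs K"
  using outgoing_arc_out by (auto simp: outgoing_def)

lemma arc_in_out_mem:
  assumes "a \<in> arcs K" "p \<in> a"
  shows "arc_in K p = a" "arc_out K p = a"
  using arc_incoming_outgoing[OF K assms(1), of "fst p" "snd p"] assms(2)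
  by (simp_all add: arc_in_eqI arc_out_eqI)

lemma arc_periodic:
  assumes "a \<in> arcs K" "(i, x) \<in> a"
  shows "(i, x + of_int k) \<in> a"
proof -
  obtain j y where a: "a = arc_of K (j, y)" using assms(1) by (auto simp: arcs_def)
  obtain l :: int where j: "j = i" and l: "\<forall>z\<in>closed_segment x (y + of_int l). \<not> cut K (i, z)"
    using assms(2) unfolding a by (auto simp: arc_of_iff[OF K])
  have "\<not> cut K (i, z)" if "z \<in> closed_segment (x + of_int k) (y + of_int (l + k))" for z
  proof -
    have "z - of_int k \<in> closed_segment x (y + of_int l)"
      using that by (auto simp: closed_segment_eq_real_ivl split: if_splits)
    then show ?thesis using l cut_int[OF K, of i "z - of_int k" k] by auto
  qed
  then show ?thesis unfolding a j arc_of_iff[OF K] by blast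
qed

lemma arc_in_periodic:
  assumes "i < ncomp K"
  shows "arc_in K (i, x + 1) = arc_in K (i, x)"
proof (rule arc_in_eqI)
  have inc: "incoming K (i, x) (arc_in K (i, x))" using incoming_arc_in assms by simp
  then obtain b where b: "b < x" "\<forall>y. b < y \<and> y < x \<longrightarrow> (i, y) \<in> arc_in K (i, x)"
    by (auto simp: incoming_def eventually_left_iff[OF K])
  have "(i, y) \<in> arc_in K (i, x)" if "b + 1 < y \<and> y < x + 1" for y
    using arc_periodic[of "arc_in K (i, x)" i "y - 1" 1] b(2) inc that by (auto simp: incoming_def)
  then show "incoming K (i, x + 1) (arc_in K (i, x))"
    using inc b(1) unfolding incoming_def eventually_left_iff[OF K] fst_conv snd_conv
    by (intro conjI exI[of _ "b + 1"]) auto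
qed

lemma arc_out_periodic:
  assumes "i < ncomp K"
  shows "arc_out K (i, x + 1) = arc_out K (i, x)"
proof (rule arc_out_eqI)
  have inc: "outgoing K (i, x) (arc_out K (i, x))" using outgoing_arc_out assms by simp
  then obtain b where b: "x < b" "\<forall>y. x < y \<and> y < b \<longrightarrow> (i, y) \<in> arc_out K (i, x)"
    by (auto simp: outgoing_def eventually_right_iff[OF K])
  have "(i, y) \<in> arc_out K (i, x)" if "x + 1 < y \<and> y < b + 1" for y
    using arc_periodic[of "arc_out K (i, x)" i "y - 1" 1] b(2) inc that by (auto simp: outgoing_def)
  then show "outgoing K (i, x + 1) (arc_out K (i, x))"
    using inc b(1) unfolding outgoing_def eventually_right_iff[OF K] fst_conv snd_conv
    by (intro conjI exI[of _ "b + 1"]) auto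
qed

lemma garc_terms: "a \<in> arcs K \<Longrightarrow> garc a \<in> qterms (mv_generators A K)"
  by (auto simp: mv_generators_def intro: qterms.intros)

lemma gvar_terms: "\<alpha> \<in> A \<Longrightarrow> gvar \<alpha> \<in> qterms (mv_generators A K)"
  by (auto simp: mv_generators_def intro: qterms.intros)

lemma universal_labelling: "labelling (ncomp K) (qcarrier (mv_quandle A K)) (ul A K) (ur A K)"
  unfolding labelling_def
proof (intro allI impI conjI)
  fix i x assume i: "i < ncomp K"
  show "ul A K (i, x) \<in> qcarrier (mv_quandle A K)" "ur A K (i, x) \<in> qcarrier (mv_quandle A K)"
    using i arc_in_arcs[of "(i, x)"] arc_out_arcs[of "(i, x)"]
    by (auto simp: ul_def ur_def mv_carrier garc_terms)
  show "ul A K (i, x + 1) = ul A K (i, x)" "ur A K (i, x + 1) = ur A K (i, x)"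
    using i by (simp_all add: ul_def ur_def arc_in_periodic arc_out_periodic)
  have "\<forall>\<^sub>F y in at_left x. (i, y) \<in> arc_in K (i, x)"
    using incoming_arc_in[of "(i, x)"] i by (simp add: incoming_def)
  then show "left_ok (\<lambda>y. ul A K (i, y)) (\<lambda>y. ur A K (i, y)) x"
    unfolding left_ok_def
    by (rule eventually_mono) (use i arc_in_arcs[of "(i, x)"] in \<open>simp add: ul_def ur_def arc_in_out_mem\<close>)
  have "\<forall>\<^sub>F y in at_right x. (i, y) \<in> arc_out K (i, x)"
    using outgoing_arc_out[of "(i, x)"] i by (simp add: outgoing_def)
  then show "right_ok (\<lambda>y. ul A K (i, y)) (\<lambda>y. ur A K (i, y)) x"
    unfolding right_ok_def
    by (rule eventually_mono) (use i arc_out_arcs[of "(i, x)"] in \<open>simp add: ul_def ur_def arc_in_out_mem\<close>)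
qed

lemma not_cut_in_out:
  assumes "p \<in> points K" "\<not> cut K p"
  shows "p \<in> arc_in K p" "arc_in K p = arc_out K p"
proof -
  obtain i x where p: "p = (i, x)" by (cases p)
  have "arc_of K (i, x) \<in> arcs K" "(i, x) \<in> arc_of K (i, x)"
    using assms arc_of_in_arcs[OF K] mem_arc_of[OF K] by (auto simp: p points_def)
  from arc_in_out_mem[OF this] this(2) show "p \<in> arc_in K p" "arc_in K p = arc_out K p"
    by (simp_all add: p)
qed

lemma universal_coloring: "coloring A K (mv_quandle A K) (uv A K) (ul A K) (ur A K)"
  unfolding coloring_def
proof (intro conjI variables_universal universal_labelling ballI allI impI)
  show "ul A K p = ur A K p" if "p \<in> points K" "\<not> cut K p" for p
    using not_cut_in_out[OF that] by (simp add: ul_def ur_def)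
  fix p q assume pq: "double K p q \<and> strand K q \<noteq> Over"
  have pts: "fst p < ncomp K" "fst q < ncomp K" using pq double_less[of K p q] by simp_all
  note arcs = arc_in_arcs[OF pts(1)] arc_in_arcs[OF pts(2)] arc_out_arcs[OF pts(2)]
  note inout = incoming_arc_in[OF pts(2)] outgoing_arc_out[OF pts(2)]
  let ?s = "0 < det2 (tangent K p) (tangent K q)"
  consider "strand K p = Over" "strand K q = Under"
    | \<alpha> where "\<alpha> \<in> A" "strand K p = Virt \<alpha>" "strand K q = Virt \<alpha>"
    using double_strands[OF K, of p q] pq by metis
  then show "passes K (mv_quandle A K) (uv A K) (ul A K) (ur A K) p q"
  proof cases
    case 1
    have "p \<in> arc_in K p"
      using not_cut_in_out(1)[of p] pts(1) 1 by (simp add: points_def cut_def)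
    then have "(garc (arc_out K q), if ?s then Star (garc (arc_in K q)) (garc (arc_in K p))
        else Sharp (garc (arc_in K q)) (garc (arc_in K p))) \<in> mv_rels A K"
      using classical_relationsI[of K p q "arc_in K p"] pq 1 arcs(1) inout unfolding mv_rels_def by blast
    then have "mv_class A K (garc (arc_out K q)) = mv_class A K (if ?s then Star (garc (arc_in K q)) (garc (arc_in K p))
        else Sharp (garc (arc_in K q)) (garc (arc_in K p)))"
      by (rule mv_class_eqI) (simp_all add: arcs garc_terms qterms.intros)
    then show ?thesis using 1
      by (simp add: passes_def ul_def ur_def act_def mv_class_star garc_terms arcs)
  next
    case 2
    have "(garc (arc_out K q), if ?s then Star (garc (arc_in K q)) (gvar \<alpha>)
        else Sharp (garc (arc_in K q)) (gvar \<alpha>)) \<in> mv_rels A K"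
    proof (cases ?s)
      case True
      then have "(garc (arc_out K q), Star (garc (arc_in K q)) (gvar \<alpha>)) \<in> virtual_relations K"
        by (intro virtual_relationsI(1)[of K q p]) (use pq double_sym[of K p q] 2 inout in auto)
      then show ?thesis using True by (simp add: mv_rels_def)
    next
      case False
      then have "det2 (tangent K q) (tangent K p) > 0"
        using double_det[OF K, of p q] pq by (auto simp: det2_def algebra_simps)
      then have "(garc (arc_out K q), Sharp (garc (arc_in K q)) (gvar \<alpha>)) \<in> virtual_relations K"
        by (intro virtual_relationsI(2)[of K p q]) (use pq 2 inout in auto)
      then show ?thesis using False by (simp add: mv_rels_def)
    qed
    then have "mv_class A K (garc (arc_out K q)) = mv_class A K (if ?s then Star (garc (arc_in K q)) (gvar \<alpha>)
        else Sharp (garc (arc_in K q)) (gvar \<alpha>))"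
      by (rule mv_class_eqI) (simp_all add: arcs garc_terms gvar_terms 2 qterms.intros)
    then show ?thesis using 2
      by (simp add: passes_def ul_def ur_def uv_def act_def mv_class_star garc_terms gvar_terms arcs)
  qed
qed

lemma coloring_noncut_const:
  assumes c: "coloring A K X v l r" and i: "i < ncomp K" and xy: "x \<le> y"
    and nc: "\<And>z. x \<le> z \<Longrightarrow> z \<le> y \<Longrightarrow> \<not> cut K (i, z)"
  shows "l (i, y) = l (i, x)"
proof (cases "x = y")
  case False
  have eq: "l (i, z) = r (i, z)" if "x \<le> z" "z \<le> y" for z
    using c nc[OF that] i by (auto simp: coloring_def points_def)
  have ok: "left_ok (\<lambda>y. l (i, y)) (\<lambda>y. r (i, y)) z" "right_ok (\<lambda>y. l (i, y)) (\<lambda>y. r (i, y)) z" for z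
    using c i by (auto simp: coloring_def labelling_def)
  have "l (i, y) = r (i, x)"
    by (rule steps_const(1)[of x y "\<lambda>y. l (i, y)" "\<lambda>y. r (i, y)"])
      (use False xy ok eq in auto)
  then show ?thesis using eq[of x] xy by simp
qed simp

lemma coloring_arc_const:
  assumes c: "coloring A K X v l r" and a: "a \<in> arcs K" "p \<in> a" "q \<in> a"
  shows "l p = l q"
proof -
  obtain i x where p: "p = (i, x)" by (cases p)
  have i: "i < ncomp K" "\<not> cut K (i, x)" using arcs_not_cut[OF K a(1,2)] by (auto simp: p points_def)
  have "a = arc_of K (i, x)"
    using arcs_unique[OF K a(1) arc_of_in_arcs[OF K i]] a(2) mem_arc_of[OF K i(2)] p by blast
  then obtain y k where q: "q = (i, y)" and k: "\<forall>z\<in>closed_segment y (x + of_int k). \<not> cut K (i, z)"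
    using a(3) by (cases q) (auto simp: arc_of_iff[OF K])
  have "l (i, y) = l (i, x + of_int k)"
  proof (cases "y \<le> x + of_int k")
    case True
    then show ?thesis
      using coloring_noncut_const[OF c i(1) True] k by (simp add: closed_segment_eq_real_ivl)
  next
    case False
    then show ?thesis
      using coloring_noncut_const[OF c i(1), of "x + of_int k" y] k by (simp add: closed_segment_eq_real_ivl)
  qed
  then show ?thesis using c labelling_int(1)[of "ncomp K" "qcarrier X" l r i x k] i
    by (simp add: p q coloring_def)
qed

lemma coloring_induces_hom:
  assumes c: "coloring A K X v l r"
  obtains f where "quandle_hom (mv_quandle A K) X f"
    "\<And>p. p \<in> points K \<Longrightarrow> f (ul A K p) = l p \<and> f (ur A K p) = r p"
    "\<And>\<alpha>. \<alpha> \<in> A \<Longrightarrow> f (uv A K \<alpha>) = v \<alpha>"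
proof -
  define e where "e g = (case g of Arc a \<Rightarrow> l (SOME p. p \<in> a) | Var \<alpha> \<Rightarrow> v \<alpha>)" for g
  have X: "variables A X v" and lab: "labelling (ncomp K) (qcarrier X) l r" using c by (auto simp: coloring_def)
  have e_mem: "e (Arc a) = l p" if "a \<in> arcs K" "p \<in> a" for a p
  proof -
    have "(SOME p. p \<in> a) \<in> a" using that(2) by (rule someI)
    from coloring_arc_const[OF c that(1) this that(2)] show ?thesis by (simp add: e_def)
  qed
  have e_in: "e (Arc a) = l p" if "incoming K p a" "fst p < ncomp K" for a p
  proof -
    have "left_ok (\<lambda>y. l (fst p, y)) (\<lambda>y. r (fst p, y)) (snd p)" using lab that(2) by (auto simp: labelling_def)
    then have "\<forall>\<^sub>F y in at_left (snd p). l (fst p, y) = l p \<and> (fst p, y) \<in> a"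
      using that(1) by (auto simp: left_ok_def incoming_def eventually_conj_iff)
    then have "\<exists>y. l (fst p, y) = l p \<and> (fst p, y) \<in> a"
      by (rule eventually_happens'[OF trivial_limit_at_left_real])
    then show ?thesis using e_mem that(1) unfolding incoming_def by metis
  qed
  have e_out: "e (Arc a) = r p" if "outgoing K p a" "fst p < ncomp K" for a p
  proof -
    have "right_ok (\<lambda>y. l (fst p, y)) (\<lambda>y. r (fst p, y)) (snd p)" using lab that(2) by (auto simp: labelling_def)
    then have "\<forall>\<^sub>F y in at_right (snd p). l (fst p, y) = r p \<and> (fst p, y) \<in> a"
      using that(1) by (auto simp: right_ok_def outgoing_def eventually_conj_iff)
    then have "\<exists>y. l (fst p, y) = r p \<and> (fst p, y) \<in> a"
      by (rule eventually_happens'[OF trivial_limit_at_right_real])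
    then show ?thesis using e_mem that(1) unfolding outgoing_def by metis
  qed
  have cl: "e g \<in> qcarrier X" if "g \<in> mv_generators A K" for g
    using that unfolding mv_generators_def
  proof
    assume "g \<in> Arc ` arcs K"
    then obtain a where a: "a \<in> arcs K" "g = Arc a" by blast
    then obtain p where "p \<in> a" "p \<in> points K"
      using mem_arc_of[OF K] by (auto simp: arcs_def)
    then show ?thesis using e_mem[OF a(1)] coloring_closed[OF c] a(2) by metis
  next
    assume "g \<in> Var ` A"
    then show ?thesis using X by (auto simp: e_def variables_def)
  qed
  have rels: "qeval X e s = qeval X e t" if st: "(s, t) \<in> mv_rels A K"
    and tm: "s \<in> qterms (mv_generators A K)" "t \<in> qterms (mv_generators A K)" for s t
  proof -
    have pass: "passes K X v l r p q" if "double K p q" "strand K q \<noteq> Over" for p q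
      using c that unfolding coloring_def by blast
    from st consider "(s, t) \<in> classical_relations K" | "(s, t) \<in> virtual_relations K"
      | "(s, t) \<in> commuting_relations A K" by (auto simp: mv_rels_def)
    then show ?thesis
    proof cases
      case 1
      then obtain a b c p q where *: "s = garc c"
          "t = (if det2 (tangent K p) (tangent K q) > 0 then Star (garc a) (garc b) else Sharp (garc a) (garc b))"
          "double K p q" "strand K p = Over" "strand K q = Under" "b \<in> arcs K" "p \<in> b"
          "incoming K q a" "outgoing K q c"
        unfolding classical_relations_def by blast
      show ?thesis using pass[OF *(3)] *(5) e_mem[OF *(6,7)] e_in[OF *(8)] e_out[OF *(9)] double_less[OF *(3)]
        by (simp add: *(1,2) passes_def act_def)
    next
      case 2
      then consider (a) a c \<alpha> p q where "s = garc c" "t = Star (garc a) (gvar \<alpha>)"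
          "double K p q" "strand K p = Virt \<alpha>" "det2 (tangent K q) (tangent K p) > 0"
          "incoming K p a" "outgoing K p c"
        | (b) b d \<alpha> p q where "s = garc d" "t = Sharp (garc b) (gvar \<alpha>)"
          "double K p q" "strand K p = Virt \<alpha>" "det2 (tangent K q) (tangent K p) > 0"
          "incoming K q b" "outgoing K q d"
        unfolding virtual_relations_def by blast
      then show ?thesis
      proof cases
        case a
        show ?thesis using pass[OF double_sym[OF a(3)]] a(4,5) e_in[OF a(6)] e_out[OF a(7)] double_less[OF a(3)]
          by (simp add: a(1,2) passes_def e_def[of "Var _"])
      next
        case b
        have "strand K q = Virt \<alpha>" by (rule double_strands[OF K b(3)]) (use b(4) in auto)
        moreover have "\<not> det2 (tangent K p) (tangent K q) > 0"
          using b(5) by (auto simp: det2_def algebra_simps)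
        ultimately show ?thesis using pass[OF b(3)] e_in[OF b(6)] e_out[OF b(7)] double_less[OF b(3)]
          by (simp add: b(1,2) passes_def e_def[of "Var _"])
      qed
    next
      case 3
      then obtain x \<alpha> \<beta> where *: "s = Star (Star x (gvar \<alpha>)) (gvar \<beta>)" "t = Star (Star x (gvar \<beta>)) (gvar \<alpha>)"
          "x \<in> qterms (mv_generators A K)" "\<alpha> \<in> A" "\<beta> \<in> A"
        unfolding commuting_relations_def by blast
      have Q: "is_quandle X" using X by (simp add: variables_def)
      have "qeval X e x \<in> qcarrier X" by (rule qeval_closed[OF Q cl *(3)])
      then have "qstar X (qstar X (qeval X e x) (v \<alpha>)) (v \<beta>) = qstar X (qstar X (qeval X e x) (v \<beta>)) (v \<alpha>)"
        using X *(4,5) unfolding variables_def by blast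
      then show ?thesis by (simp add: *(1,2) e_def[of "Var _"])
    qed
  qed
  have Q: "is_quandle X" using X by (simp add: variables_def)
  obtain f where f: "quandle_hom (presented_quandle (mv_generators A K) (mv_rels A K)) X f"
    "\<And>x. x \<in> mv_generators A K \<Longrightarrow> f (qcong (mv_generators A K) (mv_rels A K) `` {Gen x}) = e x"
    using presented_hom[of X "mv_generators A K" e "mv_rels A K", OF Q cl rels] by blast
  show thesis
  proof
    show "quandle_hom (mv_quandle A K) X f" using f(1) by (simp add: mv_quandle_eq)
    show "f (ul A K p) = l p \<and> f (ur A K p) = r p" if "p \<in> points K" for p
      using that f(2)[of "Arc (arc_in K p)"] f(2)[of "Arc (arc_out K p)"]
        e_in[OF incoming_arc_in] e_out[OF outgoing_arc_out] arc_in_arcs[of p] arc_out_arcs[of p]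
      by (simp add: ul_def ur_def mv_class_def points_def mv_generators_def)
    show "f (uv A K \<alpha>) = v \<alpha>" if "\<alpha> \<in> A" for \<alpha>
      using that f(2)[of "Var \<alpha>"] by (simp add: uv_def mv_class_def mv_generators_def e_def)
  qed
qed

lemma mv_hom_unique:
  assumes "quandle_hom (mv_quandle A K) Y f" "quandle_hom (mv_quandle A K) Y g"
    and "\<And>p. p \<in> points K \<Longrightarrow> f (ul A K p) = g (ul A K p)"
    and "\<And>\<alpha>. \<alpha> \<in> A \<Longrightarrow> f (uv A K \<alpha>) = g (uv A K \<alpha>)"
    and "x \<in> qcarrier (mv_quandle A K)"
  shows "f x = g x"
proof (rule presented_hom_unique[OF assms(1,2)[unfolded mv_quandle_eq] _ assms(5)[unfolded mv_quandle_eq]])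
  fix s assume "s \<in> mv_generators A K"
  then consider a where "a \<in> arcs K" "s = Arc a" | \<alpha> where "\<alpha> \<in> A" "s = Var \<alpha>"
    by (auto simp: mv_generators_def)
  then have "f (mv_class A K (Gen s)) = g (mv_class A K (Gen s))"
  proof cases
    case 1
    then obtain p where p: "p \<in> a" "p \<in> points K" using mem_arc_of[OF K] by (auto simp: arcs_def)
    then have "mv_class A K (Gen s) = ul A K p" using arc_in_out_mem(1) 1 by (simp add: ul_def)
    then show ?thesis using assms(3)[OF p(2)] by simp
  qed (use assms(4) in \<open>simp add: uv_def\<close>)
  then show "f (qcong (mv_generators A K) (mv_rels A K) `` {Gen s}) = g (qcong (mv_generators A K) (mv_rels A K) `` {Gen s})"
    by (simp add: mv_class_def)
qed

end

text \<open>The quandle represents the functor of colorings, so a natural bijection between the colorings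
  of two diagrams in the same quandle makes their quandles isomorphic.\<close>

lemma iso_by_transfer:
  fixes A :: "'v set" and K K' :: "'v diagram"
    and rel :: "'v generator qterm set quandle \<Rightarrow> ('v \<Rightarrow> 'v generator qterm set) \<Rightarrow>
      (point \<Rightarrow> 'v generator qterm set) \<Rightarrow> (point \<Rightarrow> 'v generator qterm set) \<Rightarrow>
      (point \<Rightarrow> 'v generator qterm set) \<Rightarrow> (point \<Rightarrow> 'v generator qterm set) \<Rightarrow> bool"
  assumes K: "mv_diagram A K" and K': "mv_diagram A K'"
    and E1: "\<And>X v l r. coloring A K X v l r \<Longrightarrow> \<exists>l' r'. coloring A K' X v l' r' \<and> rel X v l r l' r'"
    and E2: "\<And>X v l' r'. coloring A K' X v l' r' \<Longrightarrow> \<exists>l r. coloring A K X v l r \<and> rel X v l r l' r'"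
    and U1: "\<And>X v la ra la' ra' lb rb lb' rb' p. coloring A K X v la ra \<Longrightarrow> coloring A K' X v la' ra' \<Longrightarrow>
      coloring A K X v lb rb \<Longrightarrow> coloring A K' X v lb' rb' \<Longrightarrow> rel X v la ra la' ra' \<Longrightarrow> rel X v lb rb lb' rb' \<Longrightarrow>
      (\<And>p. p \<in> points K' \<Longrightarrow> la' p = lb' p \<and> ra' p = rb' p) \<Longrightarrow> p \<in> points K \<Longrightarrow> la p = lb p"
    and U2: "\<And>X v la ra la' ra' lb rb lb' rb' p. coloring A K X v la ra \<Longrightarrow> coloring A K' X v la' ra' \<Longrightarrow>
      coloring A K X v lb rb \<Longrightarrow> coloring A K' X v lb' rb' \<Longrightarrow> rel X v la ra la' ra' \<Longrightarrow> rel X v lb rb lb' rb' \<Longrightarrow>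
      (\<And>p. p \<in> points K \<Longrightarrow> la p = lb p \<and> ra p = rb p) \<Longrightarrow> p \<in> points K' \<Longrightarrow> la' p = lb' p"
    and N: "\<And>X v l r l' r' Y w f. coloring A K X v l r \<Longrightarrow> coloring A K' X v l' r' \<Longrightarrow> rel X v l r l' r' \<Longrightarrow>
      quandle_hom X Y f \<Longrightarrow> variables A Y w \<Longrightarrow> (\<And>\<alpha>. \<alpha> \<in> A \<Longrightarrow> f (v \<alpha>) = w \<alpha>) \<Longrightarrow>
      rel Y w (f \<circ> l) (f \<circ> r) (f \<circ> l') (f \<circ> r')"
  shows "quandle_iso (mv_quandle A K) (mv_quandle A K')"
proof -
  note u = universal_coloring[OF K] and u' = universal_coloring[OF K']
  obtain l1 r1 where c1: "coloring A K' (mv_quandle A K) (uv A K) l1 r1"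
      "rel (mv_quandle A K) (uv A K) (ul A K) (ur A K) l1 r1"
    using E1[OF u] by blast
  obtain l2 r2 where c2: "coloring A K (mv_quandle A K') (uv A K') l2 r2"
      "rel (mv_quandle A K') (uv A K') l2 r2 (ul A K') (ur A K')"
    using E2[OF u'] by blast
  obtain g where g: "quandle_hom (mv_quandle A K') (mv_quandle A K) g"
      "\<And>p. p \<in> points K' \<Longrightarrow> g (ul A K' p) = l1 p \<and> g (ur A K' p) = r1 p"
      "\<And>\<alpha>. \<alpha> \<in> A \<Longrightarrow> g (uv A K' \<alpha>) = uv A K \<alpha>"
    using coloring_induces_hom[OF K' c1(1)] by blast
  obtain f where f: "quandle_hom (mv_quandle A K) (mv_quandle A K') f"
      "\<And>p. p \<in> points K \<Longrightarrow> f (ul A K p) = l2 p \<and> f (ur A K p) = r2 p"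
      "\<And>\<alpha>. \<alpha> \<in> A \<Longrightarrow> f (uv A K \<alpha>) = uv A K' \<alpha>"
    using coloring_induces_hom[OF K c2(1)] by blast
  have gl2: "g (l2 p) = ul A K p" if "p \<in> points K" for p
  proof -
    have "coloring A K (mv_quandle A K) (uv A K) (g \<circ> l2) (g \<circ> r2)"
      "coloring A K' (mv_quandle A K) (uv A K) (g \<circ> ul A K') (g \<circ> ur A K')"
      "rel (mv_quandle A K) (uv A K) (g \<circ> l2) (g \<circ> r2) (g \<circ> ul A K') (g \<circ> ur A K')"
      by (rule coloring_hom[OF K c2(1) g(1) variables_universal g(3)]
          coloring_hom[OF K' u' g(1) variables_universal g(3)]
          N[OF c2(1) u' c2(2) g(1) variables_universal g(3)]; assumption)+
    from U1[OF this(1,2) u c1(1) this(3) c1(2) _ that] show ?thesis using g(2) by simp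
  qed
  have fl1: "f (l1 p) = ul A K' p" if "p \<in> points K'" for p
  proof -
    have "coloring A K' (mv_quandle A K') (uv A K') (f \<circ> l1) (f \<circ> r1)"
      "coloring A K (mv_quandle A K') (uv A K') (f \<circ> ul A K) (f \<circ> ur A K)"
      "rel (mv_quandle A K') (uv A K') (f \<circ> ul A K) (f \<circ> ur A K) (f \<circ> l1) (f \<circ> r1)"
      by (rule coloring_hom[OF K' c1(1) f(1) variables_universal f(3)]
          coloring_hom[OF K u f(1) variables_universal f(3)]
          N[OF u c1(1) c1(2) f(1) variables_universal f(3)]; assumption)+
    from U2[OF this(2,1) c2(1) u' this(3) c2(2) _ that] show ?thesis using f(2) by simp
  qed
  have idh: "quandle_hom P P (\<lambda>x. x)" for P :: "'v generator qterm set quandle" by (simp add: quandle_hom_def)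
  show ?thesis
  proof (rule quandle_isoI[OF f(1) g(1)])
    show "g (f x) = x" if "x \<in> qcarrier (mv_quandle A K)" for x
      using mv_hom_unique[OF K quandle_hom_comp[OF f(1) g(1)] idh _ _ that] f g(3) gl2 by simp
    show "f (g x) = x" if "x \<in> qcarrier (mv_quandle A K')" for x
      using mv_hom_unique[OF K' quandle_hom_comp[OF g(1) f(1)] idh _ _ that] g f(3) fl1 by simp
  qed
qed

section \<open>Intersection numbers of plane curves\<close>

text \<open>The change of argument of a curve in the punctured plane, in turns.\<close>

definition argch :: "(real \<Rightarrow> complex) \<Rightarrow> real \<Rightarrow> real \<Rightarrow> real" where
  "argch c a b = (let L = SOME L. continuous_on {a..b} L \<and> (\<forall>x\<in>{a..b}. c x = exp (L x))
                  in (Im (L b) - Im (L a)) / (2 * pi))"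

lemma continuous_logs_differ:
  fixes L M :: "real \<Rightarrow> complex"
  assumes "a \<le> b" "continuous_on {a..b} L" "continuous_on {a..b} M"
    and eq: "\<And>x. x \<in> {a..b} \<Longrightarrow> exp (L x) = exp (M x)"
  shows "L b - L a = M b - M a"
proof -
  define d where "d x = L x - M x" for x
  have d: "\<exists>n::int. d x = of_int (2 * n) * pi * \<i>" if "x \<in> {a..b}" for x
  proof -
    have "exp (d x) = 1" using eq[OF that] by (simp add: d_def exp_diff)
    then have *: "Re (d x) = 0 \<and> (\<exists>n::int. Im (d x) = of_int (2 * n) * pi)" by (simp only: exp_eq_1)
    then obtain n :: int where "Im (d x) = of_int (2 * n) * pi" by blast
    then show ?thesis using * by (intro exI[of _ n]) (simp add: complex_eq_iff)
  qed
  have "d constant_on {a..b}"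
  proof (rule continuous_discrete_range_constant)
    show "continuous_on {a..b} d" unfolding d_def by (intro continuous_intros assms)
    fix x assume x: "x \<in> {a..b}"
    obtain n where n: "d x = of_int (2 * n) * pi * \<i>" using d[OF x] by blast
    have "1 \<le> cmod (d y - d x)" if y: "y \<in> {a..b}" "d y \<noteq> d x" for y
    proof -
      obtain m where m: "d y = of_int (2 * m) * pi * \<i>" using d[OF y(1)] by blast
      have "m \<noteq> n" using y(2) m n by auto
      then have "1 \<le> \<bar>real_of_int (m - n)\<bar>" by linarith
      moreover have "d y - d x = of_real (2 * pi * real_of_int (m - n)) * \<i>"
        unfolding m n by (simp add: algebra_simps)
      then have "cmod (d y - d x) = 2 * pi * \<bar>real_of_int (m - n)\<bar>"
        by (simp only: norm_mult norm_of_real) (simp add: abs_mult)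
      ultimately show ?thesis using pi_gt3
        by (smt (verit) mult_less_cancel_left2 mult_le_cancel_left1)
    qed
    then show "\<exists>e>0. \<forall>y. y \<in> {a..b} \<and> d y \<noteq> d x \<longrightarrow> e \<le> cmod (d y - d x)"
      by (intro exI[of _ 1]) auto
  qed simp
  then have "d b = d a" using assms(1) by (auto simp: constant_on_def)
  then show ?thesis by (simp add: d_def algebra_simps)
qed

lemma argch_eqI:
  assumes "a \<le> b" "continuous_on {a..b} L" "\<And>x. x \<in> {a..b} \<Longrightarrow> c x = exp (L x)"
  shows "argch c a b = (Im (L b) - Im (L a)) / (2 * pi)"
proof -
  define M where "M = (SOME M. continuous_on {a..b} M \<and> (\<forall>x\<in>{a..b}. c x = exp (M x)))"
  have "continuous_on {a..b} M \<and> (\<forall>x\<in>{a..b}. c x = exp (M x))"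
    unfolding M_def by (rule someI[of _ L]) (use assms in auto)
  then have "M b - M a = L b - L a"
    using assms by (intro continuous_logs_differ) auto
  then have "Im (M b) - Im (M a) = Im (L b) - Im (L a)"
    by (metis minus_complex.simps(2))
  then show ?thesis by (simp add: argch_def M_def[symmetric] Let_def)
qed

lemma continuous_log_on_interval:
  fixes c :: "real \<Rightarrow> complex"
  assumes "continuous_on {a..b} c" "\<And>x. x \<in> {a..b} \<Longrightarrow> c x \<noteq> 0"
  obtains L where "continuous_on {a..b} L" "\<And>x. x \<in> {a..b} \<Longrightarrow> c x = exp (L x)"
  using continuous_logarithm_on_contractible[OF assms(1) _ assms(2)]
  by (metis convex_imp_contractible convex_real_interval(5))

lemma argch_combine:
  assumes "a \<le> b" "b \<le> d" "continuous_on {a..d} c" "\<And>x. x \<in> {a..d} \<Longrightarrow> c x \<noteq> 0"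
  shows "argch c a b + argch c b d = argch c a d"
proof -
  obtain L where L: "continuous_on {a..d} L" "\<And>x. x \<in> {a..d} \<Longrightarrow> c x = exp (L x)"
    using continuous_log_on_interval[OF assms(3,4)] by blast
  have "argch c a b = (Im (L b) - Im (L a)) / (2 * pi)" "argch c b d = (Im (L d) - Im (L b)) / (2 * pi)"
    "argch c a d = (Im (L d) - Im (L a)) / (2 * pi)"
    by (rule argch_eqI; use assms L in \<open>auto intro: continuous_on_subset\<close>)+
  then show ?thesis by (simp add: diff_divide_distrib)
qed

text \<open>The degree of \<open>(t, u) \<mapsto> p t - q u\<close> on the boundary of \<open>[a, b] \<times> [c, d]\<close>.\<close>

definition boxdeg :: "(real \<Rightarrow> complex) \<Rightarrow> (real \<Rightarrow> complex) \<Rightarrow> real \<Rightarrow> real \<Rightarrow> real \<Rightarrow> real \<Rightarrow> real" where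
  "boxdeg p q a b c d = argch (\<lambda>t. p t - q c) a b + argch (\<lambda>u. p b - q u) c d
                   - argch (\<lambda>t. p t - q d) a b - argch (\<lambda>u. p a - q u) c d"

lemma box_split_right:
  assumes "c \<le> m" "m \<le> d" "continuous_on UNIV q"
    and "\<And>u. c \<le> u \<Longrightarrow> u \<le> d \<Longrightarrow> p a \<noteq> q u" "\<And>u. c \<le> u \<Longrightarrow> u \<le> d \<Longrightarrow> p b \<noteq> q u"
  shows "boxdeg p q a b c d = boxdeg p q a b c m + boxdeg p q a b m d"
proof -
  have q: "continuous_on {c..d} q" by (rule continuous_on_subset[OF assms(3)]) simp
  have "argch (\<lambda>u. p b - q u) c m + argch (\<lambda>u. p b - q u) m d = argch (\<lambda>u. p b - q u) c d"
    "argch (\<lambda>u. p a - q u) c m + argch (\<lambda>u. p a - q u) m d = argch (\<lambda>u. p a - q u) c d"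
    by (rule argch_combine; use assms q in \<open>auto intro!: continuous_intros\<close>)+
  then show ?thesis by (simp add: boxdeg_def)
qed

lemma box_split_left:
  assumes "a \<le> m" "m \<le> b" "continuous_on UNIV p"
    and "\<And>t. a \<le> t \<Longrightarrow> t \<le> b \<Longrightarrow> p t \<noteq> q c" "\<And>t. a \<le> t \<Longrightarrow> t \<le> b \<Longrightarrow> p t \<noteq> q d"
  shows "boxdeg p q a b c d = boxdeg p q a m c d + boxdeg p q m b c d"
proof -
  have p: "continuous_on {a..b} p" by (rule continuous_on_subset[OF assms(3)]) simp
  have "argch (\<lambda>t. p t - q c) a m + argch (\<lambda>t. p t - q c) m b = argch (\<lambda>t. p t - q c) a b"
    "argch (\<lambda>t. p t - q d) a m + argch (\<lambda>t. p t - q d) m b = argch (\<lambda>t. p t - q d) a b"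
    by (rule argch_combine; use assms p in \<open>auto intro!: continuous_intros\<close>)+
  then show ?thesis by (simp add: boxdeg_def)
qed

lemma box_disjoint:
  assumes "a \<le> b" "c \<le> d" "continuous_on UNIV p" "continuous_on UNIV q"
    and nz: "\<And>t u. a \<le> t \<Longrightarrow> t \<le> b \<Longrightarrow> c \<le> u \<Longrightarrow> u \<le> d \<Longrightarrow> p t \<noteq> q u"
  shows "boxdeg p q a b c d = 0"
proof -
  let ?S = "{a..b} \<times> {c..d}"
  have "continuous_on ?S (\<lambda>z. p (fst z) - q (snd z))"
    by (intro continuous_intros continuous_on_compose2[OF assms(3)] continuous_on_compose2[OF assms(4)]) auto
  moreover have "contractible ?S" by (intro convex_imp_contractible convex_Times convex_real_interval)
  ultimately obtain L where L: "continuous_on ?S L" "\<And>z. z \<in> ?S \<Longrightarrow> p (fst z) - q (snd z) = exp (L z)"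
  proof (rule continuous_logarithm_on_contractible)
    show "p (fst z) - q (snd z) \<noteq> 0" if "z \<in> ?S" for z using nz that by auto
  qed blast
  have t: "argch (\<lambda>t. p t - q u) a b = (Im (L (b, u)) - Im (L (a, u))) / (2 * pi)" if "u \<in> {c..d}" for u
    by (rule argch_eqI[where L = "\<lambda>t. L (t, u)"])
      (use assms L(2)[of "(_, u)"] that in \<open>auto intro!: continuous_intros continuous_on_compose2[OF L(1)]\<close>)
  have u: "argch (\<lambda>u. p t - q u) c d = (Im (L (t, d)) - Im (L (t, c))) / (2 * pi)" if "t \<in> {a..b}" for t
    by (rule argch_eqI[where L = "\<lambda>u. L (t, u)"])
      (use assms L(2)[of "(t, _)"] that in \<open>auto intro!: continuous_intros continuous_on_compose2[OF L(1)]\<close>)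
  show ?thesis using assms(1,2) by (simp add: boxdeg_def t u field_simps)
qed

lemma argch_side:
  fixes c r :: "real \<Rightarrow> complex" and P Q :: complex
  assumes "x0 < x1" and P: "P \<noteq> 0" "Im (Q / P) \<noteq> 0"
    and r: "continuous_on {x0..x1} r" "\<And>x. x0 \<le> x \<Longrightarrow> x \<le> x1 \<Longrightarrow> cmod (r x - 1) < 1"
    and c: "\<And>x. x0 \<le> x \<Longrightarrow> x \<le> x1 \<Longrightarrow> c x = (P + of_real ((x - x0) / (x1 - x0)) * (Q - P)) * r x"
  shows "argch c x0 x1 = (Im (Ln (Q / P)) + Im (Ln (r x1)) - Im (Ln (r x0))) / (2 * pi)"
proof -
  define w where "w = Q / P"
  define s where "s x = (x - x0) / (x1 - x0)" for x
  define g where "g x = 1 + of_real (s x) * (w - 1)" for x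
  have s: "0 \<le> s x" "s x \<le> 1" if "x0 \<le> x" "x \<le> x1" for x
    using that assms(1) by (auto simp: s_def field_simps)
  have g: "g x \<notin> \<real>\<^sub>\<le>\<^sub>0" if "x0 \<le> x" "x \<le> x1" for x
  proof (cases "s x = 0")
    case False
    then have "Im (g x) \<noteq> 0" using P by (simp add: g_def w_def)
    then show ?thesis by (auto simp: complex_nonpos_Reals_iff)
  qed (simp add: g_def)
  have rp: "r x \<notin> \<real>\<^sub>\<le>\<^sub>0" if "x0 \<le> x" "x \<le> x1" for x
  proof -
    have "\<bar>Re (r x - 1)\<bar> < 1" using r(2)[OF that] abs_Re_le_cmod[of "r x - 1"] by linarith
    then show ?thesis by (auto simp: complex_nonpos_Reals_iff)
  qed
  define L where "L x = Ln (g x) + Ln P + Ln (r x)" for x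
  have "continuous_on {x0..x1} (\<lambda>x. Ln (g x))"
    by (rule continuous_on_Ln') (use g assms(1) in \<open>auto simp: g_def s_def intro!: continuous_intros\<close>)
  moreover have "continuous_on {x0..x1} (\<lambda>x. Ln (r x))"
    by (rule continuous_on_Ln') (use r rp in auto)
  ultimately have "continuous_on {x0..x1} L" unfolding L_def by (intro continuous_on_add continuous_on_const)
  moreover have "c x = exp (L x)" if "x \<in> {x0..x1}" for x
  proof -
    have "g x \<noteq> 0" "r x \<noteq> 0" using g[of x] rp[of x] that by auto
    then have "exp (L x) = g x * P * r x" using P by (simp add: L_def exp_add)
    also have "g x * P = P + of_real (s x) * (Q - P)" using P by (simp add: g_def w_def field_simps)
    finally show ?thesis using c that by (simp add: s_def)
  qed
  ultimately have "argch c x0 x1 = (Im (L x1) - Im (L x0)) / (2 * pi)"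
    using assms(1) by (intro argch_eqI) auto
  moreover have "g x1 = Q / P" "g x0 = 1" using assms(1) by (simp_all add: g_def s_def w_def)
  ultimately show ?thesis by (simp add: L_def)
qed

lemma det2_bound: "\<bar>det2 x y\<bar> \<le> cmod x * cmod y"
proof -
  have "det2 x y = Im (cnj x * y)" by (simp add: det2_def)
  then show ?thesis using abs_Im_le_cmod[of "cnj x * y"] by (simp add: norm_mult)
qed

lemma Ln_quarter_turns:
  assumes "Im w \<noteq> 0"
  shows "Im (Ln w) + Im (Ln (- inverse w)) - Im (Ln (inverse w)) - Im (Ln (- w)) = 2 * pi * sgn (Im w)"
proof -
  have "w \<notin> \<real>\<^sub>\<le>\<^sub>0" using assms by (auto simp: complex_nonpos_Reals_iff)
  then have inv: "Ln (inverse w) = - Ln w" by (rule Ln_inverse)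
  have w: "w \<noteq> 0" "inverse w \<noteq> 0" using assms by auto
  have "Im (inverse w) = - Im w / (cmod w)\<^sup>2" by (simp add: cmod_power2)
  moreover have "(cmod w)\<^sup>2 > 0" using w by simp
  ultimately have "Im (inverse w) < 0 \<longleftrightarrow> Im w > 0" "Im (inverse w) \<noteq> 0"
    using assms by (simp_all only: divide_less_0_iff divide_eq_0_iff) auto
  then show ?thesis using assms Ln_minus[OF w(1)] Ln_minus[OF w(2)]
    by (cases "Im w > 0") (auto simp: inv)
qed

lemma box_local:
  fixes p q :: "real \<Rightarrow> complex"
  assumes p: "(p has_vector_derivative p') (at t0)" and q: "(q has_vector_derivative q') (at u0)"
    and cont: "continuous_on UNIV p" "continuous_on UNIV q"
    and zero: "p t0 = q u0" and D: "det2 p' q' \<noteq> 0"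
  obtains e where "e > 0"
    "\<And>t u. \<bar>t - t0\<bar> \<le> e \<Longrightarrow> \<bar>u - u0\<bar> \<le> e \<Longrightarrow> p t = q u \<Longrightarrow> t = t0 \<and> u = u0"
    "\<And>d. 0 < d \<Longrightarrow> d \<le> e \<Longrightarrow> boxdeg p q (t0 - d) (t0 + d) (u0 - d) (u0 + d) = - sgn (det2 p' q')"
proof -
  define A where "A a b = of_real a * p' - of_real b * q'" for a b :: real
  define M where "M = max (cmod p') (cmod q')"
  have M: "M > 0" using D by (auto simp: M_def det2_def less_max_iff_disj)
  define m where "m = \<bar>det2 p' q'\<bar> / M"
  have m: "m > 0" using M D by (simp add: m_def)
  have A_lower: "m * max \<bar>a\<bar> \<bar>b\<bar> \<le> cmod (A a b)" for a b
  proof -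
    have "det2 (A a b) q' = a * det2 p' q'" "det2 p' (A a b) = - b * det2 p' q'"
      by (simp_all add: A_def det2_def algebra_simps)
    then have "\<bar>a\<bar> * \<bar>det2 p' q'\<bar> \<le> cmod (A a b) * cmod q'" "\<bar>b\<bar> * \<bar>det2 p' q'\<bar> \<le> cmod p' * cmod (A a b)"
      using det2_bound[of "A a b" q'] det2_bound[of p' "A a b"] by (simp_all add: abs_mult)
    moreover have "cmod (A a b) * cmod q' \<le> cmod (A a b) * M" "cmod (A a b) * cmod p' \<le> cmod (A a b) * M"
      unfolding M_def by (intro mult_left_mono; simp)+
    moreover have "cmod p' * cmod (A a b) = cmod (A a b) * cmod p'" by (rule mult.commute)
    ultimately have "\<bar>a\<bar> * \<bar>det2 p' q'\<bar> \<le> cmod (A a b) * M" "\<bar>b\<bar> * \<bar>det2 p' q'\<bar> \<le> cmod (A a b) * M" by linarith+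
    then show ?thesis using M by (auto simp: m_def field_simps max_def)
  qed
  obtain e1 where e1: "e1 > 0" "\<And>t. \<bar>t - t0\<bar> < e1 \<Longrightarrow> cmod (p t - p t0 - of_real (t - t0) * p') \<le> m / 4 * \<bar>t - t0\<bar>"
    using p m unfolding has_vector_derivative_def has_derivative_at_alt
    by (metis real_norm_def scaleR_conv_of_real zero_less_divide_iff zero_less_numeral)
  obtain e2 where e2: "e2 > 0" "\<And>u. \<bar>u - u0\<bar> < e2 \<Longrightarrow> cmod (q u - q u0 - of_real (u - u0) * q') \<le> m / 4 * \<bar>u - u0\<bar>"
    using q m unfolding has_vector_derivative_def has_derivative_at_alt
    by (metis real_norm_def scaleR_conv_of_real zero_less_divide_iff zero_less_numeral)
  define e where "e = min e1 e2 / 2"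
  have e: "0 < e" "e < e1" "e < e2" using e1 e2 by (auto simp: e_def min_def)
  have err: "cmod (p t - q u - A (t - t0) (u - u0)) \<le> cmod (A (t - t0) (u - u0)) / 2"
    if "\<bar>t - t0\<bar> \<le> e" "\<bar>u - u0\<bar> \<le> e" for t u
  proof -
    have "p t - q u - A (t - t0) (u - u0) =
        (p t - p t0 - of_real (t - t0) * p') - (q u - q u0 - of_real (u - u0) * q')"
      using zero by (simp add: A_def algebra_simps)
    then have "cmod (p t - q u - A (t - t0) (u - u0)) \<le>
        cmod (p t - p t0 - of_real (t - t0) * p') + cmod (q u - q u0 - of_real (u - u0) * q')"
      by (simp only: norm_triangle_ineq4)
    also have "\<dots> \<le> m / 4 * \<bar>t - t0\<bar> + m / 4 * \<bar>u - u0\<bar>"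
      using e1(2)[of t] e2(2)[of u] that e by (intro add_mono) auto
    also have "\<dots> \<le> m / 4 * max \<bar>t - t0\<bar> \<bar>u - u0\<bar> + m / 4 * max \<bar>t - t0\<bar> \<bar>u - u0\<bar>"
      using m by (intro add_mono mult_left_mono) auto
    also have "\<dots> = m * max \<bar>t - t0\<bar> \<bar>u - u0\<bar> / 2" by simp
    also have "\<dots> \<le> cmod (A (t - t0) (u - u0)) / 2" using A_lower by (simp add: divide_right_mono)
    finally show ?thesis .
  qed
  have A_nz: "A a b \<noteq> 0" if "a \<noteq> 0 \<or> b \<noteq> 0" for a b
  proof -
    have "0 < max \<bar>a\<bar> \<bar>b\<bar>" using that by auto
    then have "0 < m * max \<bar>a\<bar> \<bar>b\<bar>" using m by simp
    then show ?thesis using A_lower[of a b] by auto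
  qed
  show thesis
  proof
    show "e > 0" by (rule e)
    fix t u assume tu: "\<bar>t - t0\<bar> \<le> e" "\<bar>u - u0\<bar> \<le> e" "p t = q u"
    then have "A (t - t0) (u - u0) = 0" using err[OF tu(1,2)] by simp
    then show "t = t0 \<and> u = u0" using A_nz[of "t - t0" "u - u0"] by auto
  next
    fix d assume d: "0 < d" "d \<le> e"
    define r where "r t u = (p t - q u) / A (t - t0) (u - u0)" for t u
    define C where "C a b = A (a * d) (b * d)" for a b
    have r1: "cmod (r t u - 1) < 1" and r2: "p t - q u = A (t - t0) (u - u0) * r t u"
      if "\<bar>t - t0\<bar> \<le> d" "\<bar>u - u0\<bar> \<le> d" "t \<noteq> t0 \<or> u \<noteq> u0" for t u
    proof -
      have nz: "A (t - t0) (u - u0) \<noteq> 0" using A_nz that(3) by auto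
      then have "r t u - 1 = (p t - q u - A (t - t0) (u - u0)) / A (t - t0) (u - u0)"
        by (simp add: r_def field_simps)
      moreover have "cmod (p t - q u - A (t - t0) (u - u0)) < cmod (A (t - t0) (u - u0))"
        using err[of t u] that d nz by (smt (verit) field_sum_of_halves zero_less_norm_iff)
      ultimately show "cmod (r t u - 1) < 1" using nz by (simp add: norm_divide)
      show "p t - q u = A (t - t0) (u - u0) * r t u" using nz by (simp add: r_def)
    qed
    have C0: "C a b \<noteq> 0" if "a \<noteq> 0 \<or> b \<noteq> 0" for a b using A_nz[of "a * d" "b * d"] that d by (auto simp: C_def)
    have cp: "continuous_on S p" "continuous_on S q" for S using cont by (auto intro: continuous_on_subset)
    have bottom_top: "argch (\<lambda>t. p t - q (u0 + b * d)) (t0 - d) (t0 + d) =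
        (Im (Ln (C 1 b / C (-1) b)) + Im (Ln (r (t0 + d) (u0 + b * d))) - Im (Ln (r (t0 - d) (u0 + b * d)))) / (2 * pi)"
      if b: "\<bar>b\<bar> = 1" "Im (C 1 b / C (-1) b) \<noteq> 0" for b
    proof (rule argch_side)
      show "C (-1) b \<noteq> 0" using C0 by simp
      have nz: "A (t - t0) (b * d) \<noteq> 0" for t using A_nz[of "t - t0" "b * d"] b(1) d by (cases "b = 0") auto
      show "continuous_on {t0 - d..t0 + d} (\<lambda>t. r t (u0 + b * d))"
        unfolding r_def using nz by (auto intro!: continuous_intros cp simp: A_def)
      fix t assume t: "t0 - d \<le> t" "t \<le> t0 + d"
      have bd: "\<bar>b * d\<bar> = d" "b * d \<noteq> 0" using b d by (auto simp: abs_mult)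
      show "cmod (r t (u0 + b * d) - 1) < 1" using r1[of t "u0 + b * d"] t bd by auto
      have "A (t - t0) (b * d) = C (-1) b + of_real ((t - (t0 - d)) / (t0 + d - (t0 - d))) * (C 1 b - C (-1) b)"
        using d by (simp add: C_def A_def field_simps)
      then show "p t - q (u0 + b * d) =
        (C (-1) b + of_real ((t - (t0 - d)) / (t0 + d - (t0 - d))) * (C 1 b - C (-1) b)) * r t (u0 + b * d)"
        using r2[of t "u0 + b * d"] t bd by auto
    qed (use d b in auto)
    have left_right: "argch (\<lambda>u. p (t0 + a * d) - q u) (u0 - d) (u0 + d) =
        (Im (Ln (C a 1 / C a (-1))) + Im (Ln (r (t0 + a * d) (u0 + d))) - Im (Ln (r (t0 + a * d) (u0 - d)))) / (2 * pi)"
      if a: "\<bar>a\<bar> = 1" "Im (C a 1 / C a (-1)) \<noteq> 0" for a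
    proof (rule argch_side)
      show "C a (-1) \<noteq> 0" using C0 by simp
      have nz: "A (a * d) (u - u0) \<noteq> 0" for u using A_nz[of "a * d" "u - u0"] a(1) d by (cases "a = 0") auto
      show "continuous_on {u0 - d..u0 + d} (\<lambda>u. r (t0 + a * d) u)"
        unfolding r_def using nz by (auto intro!: continuous_intros cp simp: A_def)
      fix u assume u: "u0 - d \<le> u" "u \<le> u0 + d"
      have ad: "\<bar>a * d\<bar> = d" "a * d \<noteq> 0" using a d by (auto simp: abs_mult)
      show "cmod (r (t0 + a * d) u - 1) < 1" using r1[of "t0 + a * d" u] u ad by auto
      have "A (a * d) (u - u0) = C a (-1) + of_real ((u - (u0 - d)) / (u0 + d - (u0 - d))) * (C a 1 - C a (-1))"
        using d by (simp add: C_def A_def field_simps)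
      then show "p (t0 + a * d) - q u =
        (C a (-1) + of_real ((u - (u0 - d)) / (u0 + d - (u0 - d))) * (C a 1 - C a (-1))) * r (t0 + a * d) u"
        using r2[of "t0 + a * d" u] u ad by auto
    qed (use d a in auto)
    define w where "w = C 1 (-1) / C (-1) (-1)"
    have C3: "C 1 1 = - C (-1) (-1)" and C4: "C (-1) 1 = - C 1 (-1)" by (simp_all add: C_def A_def)
    have nz: "C (-1) (-1) \<noteq> 0" "C 1 (-1) \<noteq> 0" using C0 by simp_all
    have ws: "C 1 1 / C 1 (-1) = - inverse w" "C 1 1 / C (-1) 1 = inverse w" "C (-1) 1 / C (-1) (-1) = - w"
      using nz by (simp_all add: w_def C3 C4 field_simps)
    have "Im w = det2 (C (-1) (-1)) (C 1 (-1)) / (cmod (C (-1) (-1)))\<^sup>2"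
      by (simp add: w_def Im_divide det2_def cmod_power2 field_simps)
    also have "det2 (C (-1) (-1)) (C 1 (-1)) = - 2 * d\<^sup>2 * det2 p' q'"
      by (simp add: C_def A_def det2_def algebra_simps power2_eq_square)
    finally have Imw: "Im w = - 2 * d\<^sup>2 / (cmod (C (-1) (-1)))\<^sup>2 * det2 p' q'" by simp
    have pos: "2 * d\<^sup>2 / (cmod (C (-1) (-1)))\<^sup>2 > 0" using nz d by simp
    obtain k where k: "k > 0" "Im w = - (k * det2 p' q')"
      by (rule that[OF pos]) (use Imw in simp)
    have sgn: "sgn (Im w) = - sgn (det2 p' q')" "Im w \<noteq> 0"
      using k D by (auto simp: sgn_mult)
    have "Im (inverse w) = - Im w / (cmod w)\<^sup>2" by (simp add: cmod_power2)
    moreover have "(cmod w)\<^sup>2 \<noteq> 0" using sgn(2) by auto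
    ultimately have Imi: "Im (inverse w) \<noteq> 0" using sgn(2) by (simp only: divide_eq_0_iff neg_equal_0_iff_equal) simp
    have "boxdeg p q (t0 - d) (t0 + d) (u0 - d) (u0 + d) =
      (Im (Ln w) + Im (Ln (- inverse w)) - Im (Ln (inverse w)) - Im (Ln (- w))) / (2 * pi)"
      using bottom_top[of "-1"] bottom_top[of 1] left_right[of 1] left_right[of "-1"] sgn(2) Imi
      unfolding boxdeg_def ws w_def[symmetric] by (simp add: diff_divide_distrib add_divide_distrib)
    also have "\<dots> = - sgn (det2 p' q')" using Ln_quarter_turns[OF sgn(2)] sgn(1) by simp
    finally show "boxdeg p q (t0 - d) (t0 + d) (u0 - d) (u0 + d) = - sgn (det2 p' q')" .
  qed
qed

lemma box_sum:
  fixes p q :: "real \<Rightarrow> complex"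
  assumes p: "\<And>x. (p has_vector_derivative p' x) (at x)" and q: "\<And>x. (q has_vector_derivative q' x) (at x)"
    and "finite Z" and "a < b" "c < d" and Z: "Z = {(t, u). a \<le> t \<and> t \<le> b \<and> c \<le> u \<and> u \<le> d \<and> p t = q u}"
    and inner: "\<And>t u. (t, u) \<in> Z \<Longrightarrow> a < t \<and> t < b \<and> c < u \<and> u < d \<and> det2 (p' t) (q' u) \<noteq> 0"
    and inj: "\<And>t t' u. (t, u) \<in> Z \<Longrightarrow> (t', u) \<in> Z \<Longrightarrow> t = t'"
  shows "boxdeg p q a b c d = - (\<Sum>(t, u)\<in>Z. sgn (det2 (p' t) (q' u)))"
  using assms(3,5) Z inner inj
proof (induction Z arbitrary: c rule: finite_psubset_induct)
  case (psubset Z)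
  have cont: "continuous_on UNIV p" "continuous_on UNIV q"
    using p q by (auto intro!: continuous_at_imp_continuous_on has_vector_derivative_continuous)
  note Z = psubset.prems(2) and inner = psubset.prems(3) and inj = psubset.prems(4)
  show ?case
  proof (cases "Z = {}")
    case True
    then have "boxdeg p q a b c d = 0"
      using Z assms(4) psubset.prems(1) cont by (intro box_disjoint) auto
    then show ?thesis using True by simp
  next
    case False
    define u0 where "u0 = Min (snd ` Z)"
    have "u0 \<in> snd ` Z" unfolding u0_def using psubset.hyps False by (intro Min_in) auto
    then obtain t0 where z0: "(t0, u0) \<in> Z" by force
    have u0_min: "u0 \<le> u" if "(t, u) \<in> Z" for t u
      unfolding u0_def using psubset.hyps that by (intro Min_le) (auto intro: rev_image_eqI)
    note in0 = inner[OF z0]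
    obtain e where e: "e > 0"
      "\<And>d. 0 < d \<Longrightarrow> d \<le> e \<Longrightarrow> boxdeg p q (t0 - d) (t0 + d) (u0 - d) (u0 + d) = - sgn (det2 (p' t0) (q' u0))"
      by (rule box_local[OF p[of t0] q[of u0] cont]) (use in0 z0 Z in auto)
    obtain b' where b': "u0 < b'" "\<And>y. u0 < y \<Longrightarrow> y < b' \<Longrightarrow> y \<notin> snd ` Z"
      using finite_gap_right[of "snd ` Z" u0] psubset.hyps by blast
    obtain h where h: "0 < h" "h \<le> e" "u0 + h < b'" "a < t0 - h" "t0 + h < b" "c < u0 - h" "u0 + h < d"
    proof
      define k where "k = min e (min (b' - u0) (min (t0 - a) (min (b - t0) (min (u0 - c) (d - u0)))))"
      have "0 < k" using e b' in0 by (simp add: k_def)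
      moreover have "k \<le> e" "k \<le> b' - u0" "k \<le> t0 - a" "k \<le> b - t0" "k \<le> u0 - c" "k \<le> d - u0"
        by (simp_all add: k_def min_le_iff_disj)
      ultimately show "0 < k / 2" "k / 2 \<le> e" "u0 + k / 2 < b'" "a < t0 - k / 2" "t0 + k / 2 < b"
        "c < u0 - k / 2" "u0 + k / 2 < d" by linarith+
    qed
    have only: "t = t0 \<and> u = u0" if "a \<le> t" "t \<le> b" "c \<le> u" "u \<le> u0 + h" "p t = q u" for t u
    proof -
      have tu: "(t, u) \<in> Z" using that h Z by auto
      then have "u0 \<le> u" by (rule u0_min)
      moreover have "\<not> (u0 < u \<and> u < b')" using b'(2)[of u] tu by force
      ultimately have "u = u0" using that h by linarith
      then show ?thesis using inj tu z0 by blast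
    qed
    have edge: "p a \<noteq> q u" "p b \<noteq> q u" if "c \<le> u" "u \<le> d" for u
      using inner[of a u] inner[of b u] that Z assms(4) by auto
    have 1: "boxdeg p q a b c d = boxdeg p q a b c (u0 - h) + boxdeg p q a b (u0 - h) d"
      by (rule box_split_right) (use h in0 edge cont in auto)
    have 2: "boxdeg p q a b (u0 - h) d = boxdeg p q a b (u0 - h) (u0 + h) + boxdeg p q a b (u0 + h) d"
      by (rule box_split_right) (use h in0 edge cont in auto)
    have 3: "boxdeg p q a b c (u0 - h) = 0"
      by (rule box_disjoint) (use h assms(4) cont only in fastforce)+
    have nz: "p t \<noteq> q (u0 - h)" "p t \<noteq> q (u0 + h)" if "a \<le> t" "t \<le> b" for t
      using only[of t "u0 - h"] only[of t "u0 + h"] that h in0 by auto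
    have 4: "boxdeg p q a b (u0 - h) (u0 + h) = boxdeg p q a (t0 - h) (u0 - h) (u0 + h) + boxdeg p q (t0 - h) b (u0 - h) (u0 + h)"
      by (rule box_split_left) (use h in0 nz cont in auto)
    have 5: "boxdeg p q (t0 - h) b (u0 - h) (u0 + h) = boxdeg p q (t0 - h) (t0 + h) (u0 - h) (u0 + h) + boxdeg p q (t0 + h) b (u0 - h) (u0 + h)"
      by (rule box_split_left) (use h in0 nz cont in auto)
    have 6: "boxdeg p q a (t0 - h) (u0 - h) (u0 + h) = 0" "boxdeg p q (t0 + h) b (u0 - h) (u0 + h) = 0"
    proof -
      have "p t \<noteq> q u" if "a \<le> t" "t \<le> b" "t \<le> t0 - h \<or> t0 + h \<le> t" "u0 - h \<le> u" "u \<le> u0 + h" for t u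
        using only[of t u] that h by auto
      then show "boxdeg p q a (t0 - h) (u0 - h) (u0 + h) = 0" "boxdeg p q (t0 + h) b (u0 - h) (u0 + h) = 0"
        by (intro box_disjoint; use h cont in0 in auto)+
    qed
    let ?Z = "Z - {(t0, u0)}"
    have 7: "boxdeg p q a b (u0 + h) d = - (\<Sum>(t, u)\<in>?Z. sgn (det2 (p' t) (q' u)))"
    proof (rule psubset.IH)
      show "?Z \<subset> Z" using z0 by blast
      show "u0 + h < d" by (rule h)
      have gt: "u0 + h < u" if "(t, u) \<in> ?Z" for t u
        using only[of t u] that Z by force
      show "?Z = {(t, u). a \<le> t \<and> t \<le> b \<and> u0 + h \<le> u \<and> u \<le> d \<and> p t = q u}"
      proof (intro set_eqI iffI)
        fix x assume x: "x \<in> ?Z"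
        then have "(fst x, snd x) \<in> ?Z" by simp
        from gt[OF this] x show "x \<in> {(t, u). a \<le> t \<and> t \<le> b \<and> u0 + h \<le> u \<and> u \<le> d \<and> p t = q u}"
          unfolding Z by (cases x) simp
      next
        fix x assume "x \<in> {(t, u). a \<le> t \<and> t \<le> b \<and> u0 + h \<le> u \<and> u \<le> d \<and> p t = q u}"
        then show "x \<in> ?Z" unfolding Z using h in0 by (cases x) simp
      qed
      show "a < t \<and> t < b \<and> u0 + h < u \<and> u < d \<and> det2 (p' t) (q' u) \<noteq> 0" if "(t, u) \<in> ?Z" for t u
        using inner gt that by auto
      show "t = t'" if "(t, u) \<in> ?Z" "(t', u) \<in> ?Z" for t t' u using inj that by auto
    qed
    have "(\<Sum>(t, u)\<in>Z. sgn (det2 (p' t) (q' u))) = sgn (det2 (p' t0) (q' u0)) + (\<Sum>(t, u)\<in>?Z. sgn (det2 (p' t) (q' u)))"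
      using psubset.hyps z0 by (simp add: sum.remove)
    then show ?thesis using 1 2 3 4 5 6 7 e(2)[OF h(1,2)] by simp
  qed
qed

lemma contractible_disc_minus_boundary:
  fixes D :: "complex set"
  assumes "D homeomorphic cball (0::complex) 1" and z: "z \<in> D" "z \<notin> interior D"
  shows "contractible (D - {z})"
proof -
  obtain f g where fg: "homeomorphism D (cball (0::complex) 1) f g"
    using assms(1) by (auto simp: homeomorphic_def)
  have gf: "\<And>x. x \<in> D \<Longrightarrow> g (f x) = x" and fgi: "\<And>y. y \<in> cball 0 1 \<Longrightarrow> f (g y) = y"
    and fD: "f ` D = cball 0 1" and gD: "g ` cball 0 1 = D" and cg: "continuous_on (cball 0 1) g"
    using fg by (auto simp: homeomorphism_def)
  have fz: "norm (f z) = 1"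
  proof (rule ccontr)
    assume "norm (f z) \<noteq> 1"
    moreover have "f z \<in> cball 0 1" using fD z(1) by blast
    ultimately have fz: "f z \<in> ball 0 1" by (simp add: order_less_le)
    have "inj_on g (ball 0 1)" by (rule inj_on_inverseI[of _ f]) (use fgi in auto)
    then have "open (g ` ball 0 1)"
      by (intro invariance_of_domain_gen continuous_on_subset[OF cg]) auto
    moreover have "g ` ball 0 1 \<subseteq> D" using gD by auto
    moreover have "z \<in> g ` ball 0 1" using fz gf[OF z(1)] by (metis imageI)
    ultimately show False using z(2) by (auto simp: interior_def)
  qed
  have "starlike (cball 0 1 - {f z})" unfolding starlike_def
  proof (intro bexI[of _ 0] ballI)
    show "0 \<in> cball 0 1 - {f z}" using fz by auto
    fix x assume x: "x \<in> cball 0 1 - {f z}"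
    show "closed_segment 0 x \<subseteq> cball 0 1 - {f z}"
    proof
      fix y assume "y \<in> closed_segment 0 x"
      then obtain u where u: "0 \<le> u" "u \<le> 1" "y = u *\<^sub>R x" by (auto simp: closed_segment_def)
      have ny: "norm y = u * norm x" using u by simp
      have "u * norm x \<le> 1" using u x by (simp add: mult_le_one)
      moreover have "y \<noteq> f z"
      proof
        assume "y = f z"
        then have "u * norm x = 1" using ny fz by simp
        then have "u = 1" using u x mult_left_le[of "norm x" u] by (auto simp: mult.commute)
        then show False using \<open>y = f z\<close> u x by simp
      qed
      ultimately show "y \<in> cball 0 1 - {f z}" using ny by simp
    qed
  qed
  then have "contractible (cball 0 1 - {f z})" by (rule starlike_imp_contractible)
  moreover have "homeomorphism (D - {z}) (cball 0 1 - {f z}) f g"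
  proof (rule homeomorphism_of_subsets[OF fg])
    show "f ` (D - {z}) = cball 0 1 - {f z}"
      using fD gf z(1) by (auto simp: image_iff) (metis gf)+
  qed auto
  ultimately show ?thesis
    using homeomorphic_contractible_eq[of "D - {z}" "cball 0 1 - {f z}"] by (auto simp: homeomorphic_def)
qed

text \<open>On a disc, the change of argument around a boundary point depends only on the end points of
  a curve: \<open>\<Theta> z\<close> is an angular coordinate around the boundary point \<open>z\<close>.\<close>

definition disc_angle :: "complex set \<Rightarrow> (complex \<Rightarrow> complex \<Rightarrow> real) \<Rightarrow> bool" where
  "disc_angle D \<Theta> \<longleftrightarrow> (\<forall>z\<in>D - interior D. \<forall>c a b. a \<le> b \<longrightarrow> continuous_on {a..b} c \<longrightarrow>
     (\<forall>x\<in>{a..b}. c x \<in> D \<and> c x \<noteq> z) \<longrightarrow>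
     argch (\<lambda>x. c x - z) a b = \<Theta> z (c b) - \<Theta> z (c a) \<and>
     argch (\<lambda>x. z - c x) a b = \<Theta> z (c b) - \<Theta> z (c a))"

lemma disc_angle_exists:
  assumes "D homeomorphic cball (0::complex) 1"
  obtains \<Theta> where "disc_angle D \<Theta>"
proof -
  have "\<exists>L. continuous_on (D - {z}) L \<and> (\<forall>w\<in>D - {z}. w - z = exp (L w))" if "z \<in> D - interior D" for z
  proof -
    have con: "contractible (D - {z})" using contractible_disc_minus_boundary[OF assms] that by blast
    have cont: "continuous_on (D - {z}) (\<lambda>w. w - z)" by (intro continuous_intros)
    obtain L where "continuous_on (D - {z}) L" "\<And>w. w \<in> D - {z} \<Longrightarrow> w - z = exp (L w)"
    proof (rule continuous_logarithm_on_contractible[OF cont con])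
      show "w - z \<noteq> 0" if "w \<in> D - {z}" for w using that by simp
    qed blast
    then show ?thesis by blast
  qed
  then obtain L where L: "\<And>z. z \<in> D - interior D \<Longrightarrow> continuous_on (D - {z}) (L z)"
    "\<And>z w. z \<in> D - interior D \<Longrightarrow> w \<in> D - {z} \<Longrightarrow> w - z = exp (L z w)"
    by metis
  define \<Theta> where "\<Theta> z w = Im (L z w) / (2 * pi)" for z w
  have "disc_angle D \<Theta>" unfolding disc_angle_def
  proof (intro ballI allI impI conjI)
    fix z c and a b :: real
    assume z: "z \<in> D - interior D" and ab: "a \<le> b" and c: "continuous_on {a..b} c"
      and cD: "\<forall>x\<in>{a..b}. c x \<in> D \<and> c x \<noteq> z"
    have cont: "continuous_on {a..b} (\<lambda>x. L z (c x))"
      by (rule continuous_on_compose2[OF L(1)[OF z] c]) (use cD in auto)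
    have e: "c x - z = exp (L z (c x))" if "x \<in> {a..b}" for x using L(2)[OF z] cD that by blast
    show "argch (\<lambda>x. c x - z) a b = \<Theta> z (c b) - \<Theta> z (c a)"
      using argch_eqI[OF ab cont, of "\<lambda>x. c x - z"] e by (simp add: \<Theta>_def diff_divide_distrib)
    have "z - c x = exp (L z (c x) + \<i> * pi)" if "x \<in> {a..b}" for x
      using e[OF that, symmetric] by (simp add: exp_add)
    moreover have "continuous_on {a..b} (\<lambda>x. L z (c x) + \<i> * pi)" by (intro continuous_intros cont)
    ultimately show "argch (\<lambda>x. z - c x) a b = \<Theta> z (c b) - \<Theta> z (c a)"
      using argch_eqI[OF ab, of "\<lambda>x. L z (c x) + \<i> * pi" "\<lambda>x. z - c x"]
      by (simp add: \<Theta>_def diff_divide_distrib)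
  qed
  then show thesis by (rule that)
qed

lemma disc_angle_argch:
  assumes "disc_angle D \<Theta>" "z \<in> D" "z \<notin> interior D" "a \<le> b" "continuous_on UNIV c"
    and "\<And>x. a \<le> x \<Longrightarrow> x \<le> b \<Longrightarrow> c x \<in> D \<and> c x \<noteq> z"
  shows "argch (\<lambda>x. c x - z) a b = \<Theta> z (c b) - \<Theta> z (c a)"
    "argch (\<lambda>x. z - c x) a b = \<Theta> z (c b) - \<Theta> z (c a)"
  using assms continuous_on_subset[OF assms(5), of "{a..b}"] unfolding disc_angle_def by auto

lemma disc_box:
  assumes "disc_angle D \<Theta>" "a \<le> b" "c \<le> d" "continuous_on UNIV p" "continuous_on UNIV q"
    and "\<And>x. a \<le> x \<Longrightarrow> x \<le> b \<Longrightarrow> p x \<in> D \<and> p x \<noteq> q c \<and> p x \<noteq> q d"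
    and "\<And>x. c \<le> x \<Longrightarrow> x \<le> d \<Longrightarrow> q x \<in> D \<and> q x \<noteq> p a \<and> q x \<noteq> p b"
    and "p a \<notin> interior D" "p b \<notin> interior D" "q c \<notin> interior D" "q d \<notin> interior D"
  shows "boxdeg p q a b c d = (\<Theta> (q c) (p b) - \<Theta> (q c) (p a)) + (\<Theta> (p b) (q d) - \<Theta> (p b) (q c))
     - (\<Theta> (q d) (p b) - \<Theta> (q d) (p a)) - (\<Theta> (p a) (q d) - \<Theta> (p a) (q c))"
  unfolding boxdeg_def using assms by (simp add: disc_angle_argch)

lemma disc_half_boxes:
  assumes "disc_angle D \<Theta>" "a \<le> b" "c \<le> d" "c' \<le> d'"
    and "continuous_on UNIV p" "continuous_on UNIV q" "continuous_on UNIV q'"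
    and "\<And>x. a \<le> x \<Longrightarrow> x \<le> b \<Longrightarrow> p x \<in> D \<and> p x \<noteq> q c \<and> p x \<noteq> q' c'"
    and "\<And>x. c \<le> x \<Longrightarrow> x \<le> d \<Longrightarrow> q x \<in> D \<and> q x \<noteq> p a \<and> q x \<noteq> p b"
    and "\<And>x. c' \<le> x \<Longrightarrow> x \<le> d' \<Longrightarrow> q' x \<in> D \<and> q' x \<noteq> p a \<and> q' x \<noteq> p b"
    and "p a \<notin> interior D" "p b \<notin> interior D" "q c \<notin> interior D" "q' c' \<notin> interior D"
    and "q d = q' d'"
  shows "boxdeg p q a b c d - boxdeg p q' a b c' d' =
     (\<Theta> (q c) (p b) - \<Theta> (q c) (p a)) - (\<Theta> (q' c') (p b) - \<Theta> (q' c') (p a))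
     + (\<Theta> (p b) (q' c') - \<Theta> (p b) (q c)) - (\<Theta> (p a) (q' c') - \<Theta> (p a) (q c))"
  unfolding boxdeg_def using assms by (simp add: disc_angle_argch)

lemma diagram_box:
  assumes K: "mv_diagram A K" and i: "i < ncomp K" and j: "j < ncomp K"
    and st: "s < t" "t < s + 1" and um: "u < m"
    and ends: "\<not> crossing K (i, s)" "\<not> crossing K (i, t)"
    and diff: "\<And>x y. s \<le> x \<Longrightarrow> x \<le> t \<Longrightarrow> u \<le> y \<Longrightarrow> y \<le> m \<Longrightarrow> \<not> same_point (i, x) (j, y)"
    and off: "\<And>x. s \<le> x \<Longrightarrow> x \<le> t \<Longrightarrow> pos K (i, x) \<noteq> pos K (j, u) \<and> pos K (i, x) \<noteq> pos K (j, m)"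
  defines "Z \<equiv> {(x, y). s \<le> x \<and> x \<le> t \<and> u \<le> y \<and> y \<le> m \<and> pos K (i, x) = pos K (j, y)}"
  shows "finite Z"
    and "boxdeg (\<lambda>x. pos K (i, x)) (\<lambda>y. pos K (j, y)) s t u m =
      - (\<Sum>(x, y)\<in>Z. sgn (det2 (tangent K (i, x)) (tangent K (j, y))))"
proof -
  have dbl: "double K (i, x) (j, y)" if "(x, y) \<in> Z" for x y
    using that diff i j by (auto simp: Z_def double_def points_def)
  have "Z \<subseteq> {x. s \<le> x \<and> x \<le> t \<and> crossing K (i, x)} \<times> {y. u \<le> y \<and> y \<le> m \<and> crossing K (j, y)}"
  proof
    fix z assume z: "z \<in> Z"
    obtain x y where [simp]: "z = (x, y)" by (cases z)
    show "z \<in> {x. s \<le> x \<and> x \<le> t \<and> crossing K (i, x)} \<times> {y. u \<le> y \<and> y \<le> m \<and> crossing K (j, y)}"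
      using z dbl[of x y] double_sym[of K "(i, x)" "(j, y)"] unfolding crossing_def by (auto simp: Z_def)
  qed
  then show fin: "finite Z"
    by (rule finite_subset) (intro finite_cartesian_product finite_crossings[OF K])
  show "boxdeg (\<lambda>x. pos K (i, x)) (\<lambda>y. pos K (j, y)) s t u m =
      - (\<Sum>(x, y)\<in>Z. sgn (det2 (tangent K (i, x)) (tangent K (j, y))))"
  proof (rule box_sum)
    show "((\<lambda>x. pos K (i, x)) has_vector_derivative tangent K (i, x)) (at x)" for x
      by (rule pos_has_derivative[OF K i])
    show "((\<lambda>y. pos K (j, y)) has_vector_derivative tangent K (j, x)) (at x)" for x
      by (rule pos_has_derivative[OF K j])
    show "Z = {(x, y). s \<le> x \<and> x \<le> t \<and> u \<le> y \<and> y \<le> m \<and> pos K (i, x) = pos K (j, y)}"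
      by (simp add: Z_def)
    show "s < x \<and> x < t \<and> u < y \<and> y < m \<and> det2 (tangent K (i, x)) (tangent K (j, y)) \<noteq> 0"
      if xy: "(x, y) \<in> Z" for x y
    proof -
      have "crossing K (i, x)" using dbl[OF xy] by (auto simp: crossing_def)
      then have "x \<noteq> s" "x \<noteq> t" using ends by auto
      moreover have "y \<noteq> u" "y \<noteq> m" using xy off[of x] by (auto simp: Z_def)
      ultimately show ?thesis using xy double_det[OF K dbl[OF xy]] by (auto simp: Z_def)
    qed
    show "x = x'" if "(x, y) \<in> Z" "(x', y) \<in> Z" for x x' y
    proof -
      have "same_point (i, x) (i, x')"
        using double_unique[OF K] double_sym dbl[OF that(1)] dbl[OF that(2)] by blast
      then obtain k :: int where k: "x = x' + of_int k" by (auto simp: same_point_iff)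
      have "\<bar>x - x'\<bar> < 1" using that st by (auto simp: Z_def)
      then have "\<bar>real_of_int k\<bar> < 1" using k by simp
      then have "k = 0" by linarith
      then show ?thesis using k by simp
    qed
  qed (use fin st um in auto)
qed

section \<open>Segments\<close>

lemma closed_seg_iff: "p \<in> closed_seg (i, s, t) \<longleftrightarrow> (\<exists>x. s \<le> x \<and> x \<le> t \<and> same_point p (i, x))"
proof
  assume "p \<in> closed_seg (i, s, t)"
  then obtain r and k :: int where "p = (i, r)" "s \<le> r + of_int k" "r + of_int k \<le> t" by auto
  then show "\<exists>x. s \<le> x \<and> x \<le> t \<and> same_point p (i, x)"
    by (intro exI[of _ "r + of_int k"]) (auto intro: same_point_sym same_point_shift)
next
  assume "\<exists>x. s \<le> x \<and> x \<le> t \<and> same_point p (i, x)"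
  then obtain x and k :: int where "s \<le> x" "x \<le> t" "p = (i, x + of_int k)"
    by (cases p) (auto simp: same_point_iff)
  then show "p \<in> closed_seg (i, s, t)" by (auto intro!: exI[of _ "- k"])
qed

lemma open_seg_iff: "p \<in> open_seg (i, s, t) \<longleftrightarrow> (\<exists>x. s < x \<and> x < t \<and> same_point p (i, x))"
proof
  assume "p \<in> open_seg (i, s, t)"
  then obtain r and k :: int where "p = (i, r)" "s < r + of_int k" "r + of_int k < t" by auto
  then show "\<exists>x. s < x \<and> x < t \<and> same_point p (i, x)"
    by (intro exI[of _ "r + of_int k"]) (auto intro: same_point_sym same_point_shift)
next
  assume "\<exists>x. s < x \<and> x < t \<and> same_point p (i, x)"
  then obtain x and k :: int where "s < x" "x < t" "p = (i, x + of_int k)"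
    by (cases p) (auto simp: same_point_iff)
  then show "p \<in> open_seg (i, s, t)" by (auto intro!: exI[of _ "- k"])
qed

declare closed_seg.simps [simp del] open_seg.simps [simp del]

lemma open_seg_subset: "open_seg g \<subseteq> closed_seg g"
proof
  fix p assume "p \<in> open_seg g"
  then show "p \<in> closed_seg g"
    by (cases g) (simp add: closed_seg_iff open_seg_iff, meson less_imp_le)
qed

lemma closed_seg_cong: "same_point p q \<Longrightarrow> p \<in> closed_seg g \<longleftrightarrow> q \<in> closed_seg g"
  by (cases g) (simp add: closed_seg_iff, meson same_point_trans same_point_sym)

lemma mem_closed_seg: "s \<le> x \<Longrightarrow> x \<le> t \<Longrightarrow> (i, x) \<in> closed_seg (i, s, t)"
  by (auto simp: closed_seg_iff intro: same_point_refl)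

lemma mem_open_seg: "s < x \<Longrightarrow> x < t \<Longrightarrow> (i, x) \<in> open_seg (i, s, t)"
  by (auto simp: open_seg_iff intro: same_point_refl)

lemma same_point_close:
  assumes "same_point (i, x) (i, y)" "\<bar>x - y\<bar> < 1"
  shows "x = y"
proof -
  obtain k :: int where k: "x = y + of_int k" using assms(1) by (auto simp: same_point_iff)
  then have "\<bar>real_of_int k\<bar> < 1" using assms(2) by simp
  then have "k = 0" by linarith
  then show ?thesis using k by simp
qed

lemma closed_seg_ends:
  assumes "p \<in> closed_seg (i, s, t)" "p \<notin> open_seg (i, s, t)"
  shows "same_point p (i, s) \<or> same_point p (i, t)"
proof -
  obtain x where x: "s \<le> x" "x \<le> t" "same_point p (i, x)" using assms(1) unfolding closed_seg_iff by blast
  have "\<not> (s < x \<and> x < t)" using assms(2) x(3) unfolding open_seg_iff by blast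
  then have "x = s \<or> x = t" using x by linarith
  then show ?thesis using x(3) by blast
qed

lemma segment_point_unique:
  assumes "t < s + 1" "s \<le> x" "x \<le> t" "s \<le> y" "y \<le> t" "same_point (i, x) (i, y)"
  shows "x = y"
  by (rule same_point_close[OF assms(6)]) (use assms in linarith)

lemma not_closed_seg_near:
  assumes "t < s + 1" "s < t" "(j, x) \<notin> closed_seg (i, s, t)"
  shows "\<forall>\<^sub>F y in nhds x. (j, y) \<notin> closed_seg (i, s, t)"
proof (cases "j = i")
  case False
  then show ?thesis by (auto simp: closed_seg_iff same_point_def)
next
  case [simp]: True
  define k where "k = - \<lfloor>x - s\<rfloor>"
  have k: "s \<le> x + of_int k" "x + of_int k < s + 1" unfolding k_def by linarith+
  have "t < x + of_int k"
  proof (rule ccontr)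
    assume "\<not> t < x + of_int k"
    then have "(j, x) \<in> closed_seg (i, s, t)"
      unfolding closed_seg_iff using k by (intro exI[of _ "x + of_int k"]) (auto intro: same_point_sym same_point_shift)
    then show False using assms(3) by blast
  qed
  then have "x \<in> {t - of_int k<..<s + 1 - of_int k}" using k by auto
  then have "\<forall>\<^sub>F y in nhds x. y \<in> {t - of_int k<..<s + 1 - of_int k}"
    by (intro eventually_nhds_in_open) auto
  then show ?thesis
  proof (rule eventually_mono)
    fix y assume y: "y \<in> {t - of_int k<..<s + 1 - of_int k}"
    show "(j, y) \<notin> closed_seg (i, s, t)"
    proof
      assume "(j, y) \<in> closed_seg (i, s, t)"
      then obtain z and l :: int where z: "s \<le> z" "z \<le> t" "y = z + of_int l"
        by (auto simp: closed_seg_iff same_point_iff)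
      then have "real_of_int (l + k) > 0" "real_of_int (l + k) < 1" using y by auto
      then have "0 < l + k" "l + k < 1" by (simp_all only: of_int_0_less_iff of_int_less_1_iff)
      then show False by linarith
    qed
  qed
qed

lemma passes_cong:
  assumes K: "mv_diagram A K" and lab: "labelling (ncomp K) C l r"
    and "same_point p p'" "same_point q q'" "fst p < ncomp K" "fst q < ncomp K"
  shows "passes K X v l r p q \<longleftrightarrow> passes K X v l r p' q'"
  unfolding passes_def
  using same_point_cong[OF K assms(3,5)] same_point_cong[OF K assms(4,6)]
    labelling_same_point[OF lab assms(3,5)] labelling_same_point[OF lab assms(4,6)]
  by (simp split: passage.split)

lemma seg_agree:
  assumes a: "coloring A K X v la ra" and b: "coloring A K X v lb rb"
    and j: "j < ncomp K" and uv: "u < w" and start: "ra (j, u) = rb (j, u)"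
    and over: "\<And>y q. u < y \<Longrightarrow> y < w \<Longrightarrow> double K q (j, y) \<Longrightarrow> strand K (j, y) = Under \<Longrightarrow> la q = lb q"
    and y: "u \<le> y" "y \<le> w"
  shows "u < y \<Longrightarrow> la (j, y) = lb (j, y)" "y < w \<Longrightarrow> ra (j, y) = rb (j, y)"
proof -
  have ok: "left_ok (\<lambda>y. la (j, y)) (\<lambda>y. ra (j, y)) x \<and> left_ok (\<lambda>y. lb (j, y)) (\<lambda>y. rb (j, y)) x"
    "right_ok (\<lambda>y. la (j, y)) (\<lambda>y. ra (j, y)) x \<and> right_ok (\<lambda>y. lb (j, y)) (\<lambda>y. rb (j, y)) x" for x
    using a b j by (auto simp: coloring_def labelling_def)
  have step: "ra (j, x) = rb (j, x)" if x: "u < x" "x < w" "la (j, x) = lb (j, x)" for x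
  proof (cases "cut K (j, x)")
    case False
    then have "la (j, x) = ra (j, x)" "lb (j, x) = rb (j, x)"
      using a b j by (auto simp: coloring_def points_def)
    then show ?thesis using x(3) by simp
  next
    case True
    then obtain q where q: "double K (j, x) q" "strand K (j, x) \<noteq> Over" by (auto simp: cut_def crossing_def)
    then have "passes K X v la ra q (j, x)" "passes K X v lb rb q (j, x)"
      using a b double_sym unfolding coloring_def by blast+
    then show ?thesis using over[OF x(1,2) double_sym[OF q(1)]] q(2) x(3)
      by (auto simp: passes_def split: passage.splits)
  qed
  show "u < y \<Longrightarrow> la (j, y) = lb (j, y)" "y < w \<Longrightarrow> ra (j, y) = rb (j, y)"
    by (rule steps_unique[of u w "\<lambda>y. la (j, y)" "\<lambda>y. ra (j, y)" "\<lambda>y. lb (j, y)" "\<lambda>y. rb (j, y)" y,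
        OF uv ok(1) ok(2) start step y]; assumption)+
qed

lemma coloring_seg_value:
  assumes c: "coloring A K X v l r" and i: "i < ncomp K" and st: "s < t"
    and G: "finite G" "G \<subseteq> {s<..<t}"
    and nc: "\<And>x. s < x \<Longrightarrow> x < t \<Longrightarrow> x \<notin> G \<Longrightarrow> \<not> cut K (i, x)"
    and step: "\<And>x. x \<in> G \<Longrightarrow> r (i, x) = f x (l (i, x))"
    and x: "s \<le> x" "x \<le> t"
  shows "s < x \<Longrightarrow> l (i, x) = seg_l f (r (i, s)) G x" "x < t \<Longrightarrow> r (i, x) = seg_r f (r (i, s)) G x"
proof -
  have ok: "left_ok (\<lambda>y. l (i, y)) (\<lambda>y. r (i, y)) x" "right_ok (\<lambda>y. l (i, y)) (\<lambda>y. r (i, y)) x" for x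
    using c i by (auto simp: coloring_def labelling_def)
  have n: "r (i, x) = l (i, x)" if "s < x" "x < t" "x \<notin> G" for x
    using c nc[OF that] i by (auto simp: coloring_def points_def)
  show "s < x \<Longrightarrow> l (i, x) = seg_l f (r (i, s)) G x" "x < t \<Longrightarrow> r (i, x) = seg_r f (r (i, s)) G x"
    by (rule seg_value[of s t G "\<lambda>y. l (i, y)" "\<lambda>y. r (i, y)" f x, OF st G ok(1) ok(2) n step x]; assumption)+
qed

lemma seg_closed:
  assumes "finite G" "B \<in> C" "\<And>x z. x \<in> G \<Longrightarrow> z \<in> C \<Longrightarrow> f x z \<in> C"
  shows "seg_l f B G x \<in> C" "seg_r f B G x \<in> C"
proof -
  have *: "fold f xs B \<in> C" if "set xs \<subseteq> G" "B \<in> C" for xs B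
    using that by (induction xs arbitrary: B) (auto intro: assms(3))
  show "seg_l f B G x \<in> C" "seg_r f B G x \<in> C"
    unfolding seg_l_def seg_r_def by (rule *; use assms(1,2) in auto)+
qed

lemma reglue_segment:
  fixes l r :: "point \<Rightarrow> 'q"
  assumes lab: "labelling n C l r" and i: "i < n" and st: "s < t" "t < s + 1"
    and G: "finite G" "G \<subseteq> {s<..<t}" and f: "\<And>x z. x \<in> G \<Longrightarrow> z \<in> C \<Longrightarrow> f x z \<in> C"
    and fin: "seg_l f (l (i, s)) G t = r (i, t)"
  obtains l' r' where "labelling n C l' r'"
    "\<And>p. p \<notin> closed_seg (i, s, t) \<Longrightarrow> l' p = l p \<and> r' p = r p"
    "\<And>x. s \<le> x \<Longrightarrow> x \<le> t \<Longrightarrow> l' (i, x) = seg_l f (l (i, s)) G x \<and> r' (i, x) = seg_r f (l (i, s)) G x"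
proof -
  have B: "l (i, s) \<in> C" using lab i by (simp add: labelling_def)
  have e: "{y \<in> G. y < s} = {}" using G(2) by auto
  have s: "seg_l f (l (i, s)) G s = l (i, s)" unfolding seg_l_def e by simp
  have "t \<notin> G" using G(2) by auto
  then have t: "seg_r f (l (i, s)) G t = r (i, t)" using seg_step_notin[of t G f "l (i, s)"] fin by simp
  have lab': "l (j, x) \<in> C \<and> r (j, x) \<in> C \<and> l (j, x + 1) = l (j, x) \<and> r (j, x + 1) = r (j, x)"
    "left_ok (\<lambda>y. l (j, y)) (\<lambda>y. r (j, y)) x" "right_ok (\<lambda>y. l (j, y)) (\<lambda>y. r (j, y)) x" if "j < n" for j x
    using lab that by (auto simp: labelling_def)
  have cl: "seg_l f (l (i, s)) G x \<in> C \<and> seg_r f (l (i, s)) G x \<in> C" for x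
    using seg_closed[where f = f, OF G(1) B f] by simp
  show thesis
  proof (rule glue_segment[of i n s t l C r "seg_l f (l (i, s)) G" "seg_r f (l (i, s)) G"])
    show "left_ok (seg_l f (l (i, s)) G) (seg_r f (l (i, s)) G) x" for x by (rule seg_left_ok[OF G(1)])
    show "right_ok (seg_l f (l (i, s)) G) (seg_r f (l (i, s)) G) x" for x by (rule seg_right_ok[OF G(1)])
    fix l' r'
    assume "labelling n C l' r'" "\<And>p. p \<notin> closed_seg (i, s, t) \<Longrightarrow> l' p = l p \<and> r' p = r p"
      "\<And>x. s \<le> x \<Longrightarrow> x \<le> t \<Longrightarrow> l' (i, x) = seg_l f (l (i, s)) G x \<and> r' (i, x) = seg_r f (l (i, s)) G x"
    then show thesis by (rule that)
  qed (rule i st s t cl; fail | rule lab'; assumption)+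
qed

section \<open>Local changes of a diagram\<close>

lemma tangent_cong_near:
  assumes "\<forall>\<^sub>F y in nhds x. pos K (i, y) = pos K' (i, y)"
  shows "tangent K (i, x) = tangent K' (i, x)"
  unfolding tangent_def fst_conv snd_conv
  by (rule vector_derivative_cong_eq[OF _ HOL.refl HOL.refl UNIV_I]) (use assms in simp)

lemma tangent_agree_off:
  assumes agree: "agree_off S K K'" and S: "finite S" "\<And>g. g \<in> S \<Longrightarrow> is_segment K g"
    and p: "p \<in> points K" "p \<notin> \<Union> (closed_seg ` S)"
  shows "tangent K p = tangent K' p"
proof -
  obtain i x where [simp]: "p = (i, x)" by (cases p)
  have "\<forall>\<^sub>F y in nhds x. (i, y) \<notin> closed_seg g" if "g \<in> S" for g
    using not_closed_seg_near[of "snd (snd g)" "fst (snd g)" i x "fst g"] S(2)[OF that] p(2) that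
    by (cases g) auto
  then have "\<forall>\<^sub>F y in nhds x. \<forall>g\<in>S. (i, y) \<notin> closed_seg g"
    using S(1) by (simp add: eventually_ball_finite)
  then have "\<forall>\<^sub>F y in nhds x. pos K (i, y) = pos K' (i, y)"
  proof (rule eventually_mono)
    fix y assume "\<forall>g\<in>S. (i, y) \<notin> closed_seg g"
    then have "(i, y) \<in> points K - \<Union> (open_seg ` S)"
      using p(1) open_seg_subset unfolding points_def by fastforce
    then show "pos K (i, y) = pos K' (i, y)" using agree unfolding agree_off_def by blast
  qed
  then show ?thesis by (simp add: tangent_cong_near)
qed

lemma agree_off_points: "agree_off S K K' \<Longrightarrow> points K = points K'"
  by (simp add: agree_off_def points_def)

lemma agree_off_double:
  assumes "agree_off S K K'" "p \<notin> \<Union> (open_seg ` S)" "q \<notin> \<Union> (open_seg ` S)"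
  shows "double K p q \<longleftrightarrow> double K' p q"
proof -
  have "pos K x = pos K' x" if "x \<in> points K" "x \<notin> \<Union> (open_seg ` S)" for x
    using assms(1) that unfolding agree_off_def by blast
  then show ?thesis using assms(2,3) agree_off_points[OF assms(1)] unfolding double_def by metis
qed

lemma agree_off_strand:
  assumes "agree_off S K K'" "p \<notin> \<Union> (open_seg ` S)" "q \<notin> \<Union> (open_seg ` S)" "double K p q"
  shows "strand K p = strand K' p"
proof -
  have "p \<in> points K" "q \<in> points K" using assms(4) by (auto simp: double_def)
  then show ?thesis using assms unfolding agree_off_def by blast
qed

lemma agree_off_sym:
  assumes "agree_off S K K'"
  shows "agree_off S K' K"
  unfolding agree_off_def
proof (intro conjI ballI impI)
  fix p q assume "p \<in> points K' - \<Union> (open_seg ` S)" "q \<in> points K' - \<Union> (open_seg ` S)" "double K' p q"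
  then show "strand K' p = strand K p"
    using agree_off_double[OF assms, of p q] agree_off_strand[OF assms, of p q] by simp
next
  show "ncomp K' = ncomp K" using assms by (simp add: agree_off_def)
  fix p assume "p \<in> points K' - \<Union> (open_seg ` S)"
  then have "p \<in> points K - \<Union> (open_seg ` S)" using agree_off_points[OF assms] by simp
  then have "pos K p = pos K' p" using assms unfolding agree_off_def by blast
  then show "pos K' p = pos K p" by simp
qed

lemma local_change_sym:
  assumes "local_change A S K K'"
  shows "local_change A S K' K"
  using assms agree_off_sym[of S K K'] unfolding local_change_def insert_commute[of K' K "{}"] by blast

locale local_change_data =
  fixes A :: "'v set" and S :: "segment set" and K K' :: "'v diagram"
  assumes lc: "local_change A S K K'" and finS: "finite S"
begin

lemma mvK: "mv_diagram A K" and mvK': "mv_diagram A K'"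
  using lc by (auto simp: local_change_def)

lemma seg: "g \<in> S \<Longrightarrow> is_segment K g \<and> is_segment K' g"
  using lc by (auto simp: local_change_def)

lemma agree: "agree_off S K K'"
  using lc by (simp add: local_change_def)

lemma same_ncomp: "ncomp K' = ncomp K"
  using agree by (simp add: agree_off_def)

lemma same_points: "points K' = points K"
  using agree_off_points[OF agree] by simp

lemma double_stays:
  assumes "L = K \<or> L = K'" "double L p q" "p \<in> \<Union> (open_seg ` S)"
  shows "q \<in> \<Union> (open_seg ` S)"
proof -
  obtain D where D: "\<forall>L\<in>{K, K'}. \<forall>p\<in>points L. (pos L p \<in> D \<longleftrightarrow> p \<in> \<Union> (closed_seg ` S)) \<and>
         (pos L p \<in> interior D \<longleftrightarrow> p \<in> \<Union> (open_seg ` S))"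
    using lc unfolding local_change_def by blast
  have "pos L p \<in> interior D \<longleftrightarrow> p \<in> \<Union> (open_seg ` S)" "pos L q \<in> interior D \<longleftrightarrow> q \<in> \<Union> (open_seg ` S)"
    using D assms(1,2) by (auto simp: double_def)
  then show ?thesis using assms(2,3) by (simp add: double_def)
qed

lemma crossing_not_closed:
  assumes "L = K \<or> L = K'" "crossing L p" "p \<notin> \<Union> (open_seg ` S)"
  shows "p \<notin> \<Union> (closed_seg ` S)"
proof
  assume "p \<in> \<Union> (closed_seg ` S)"
  then obtain g where g: "g \<in> S" "p \<in> closed_seg g" by blast
  obtain i s t where [simp]: "g = (i, s, t)" by (cases g)
  have L: "mv_diagram A L" and sg: "is_segment L g" using assms(1) mvK mvK' seg[OF g(1)] by auto
  have "same_point p (i, s) \<or> same_point p (i, t)" using closed_seg_ends g assms(3) by auto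
  then show False using assms(2) sg crossing_cong[OF L, of p "(i, s)"] crossing_cong[OF L, of p "(i, t)"] by auto
qed

lemma off_relations:
  assumes "double K p q" "q \<notin> \<Union> (open_seg ` S)"
  shows "double K' p q" "strand K' q = strand K q" "tangent K' p = tangent K p" "tangent K' q = tangent K q"
    "p \<notin> \<Union> (closed_seg ` S)" "q \<notin> \<Union> (closed_seg ` S)"
proof -
  have p: "p \<notin> \<Union> (open_seg ` S)" using double_stays[of K p q] assms by blast
  show "double K' p q" using agree_off_double[OF agree p assms(2)] assms(1) by blast
  show "strand K' q = strand K q" using agree_off_strand[OF agree assms(2) p double_sym[OF assms(1)]] by simp
  show nc: "p \<notin> \<Union> (closed_seg ` S)" "q \<notin> \<Union> (closed_seg ` S)"
  proof -
    have "crossing K p" "crossing K q" using assms(1) double_sym unfolding crossing_def by blast+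
    then show "p \<notin> \<Union> (closed_seg ` S)" "q \<notin> \<Union> (closed_seg ` S)"
      using crossing_not_closed[of K] p assms(2) by blast+
  qed
  have "p \<in> points K" "q \<in> points K" using assms by (auto simp: double_def)
  then show "tangent K' p = tangent K p" "tangent K' q = tangent K q"
    using tangent_agree_off[OF agree finS _ _ nc(1)] tangent_agree_off[OF agree finS _ _ nc(2)] seg by auto
qed

end

lemma local_change_data_sym: "local_change_data A S K K' \<Longrightarrow> local_change_data A S K' K"
  unfolding local_change_data_def using local_change_sym by blast

context local_change_data
begin

lemma transfer_coloring:
  assumes c: "coloring A K X v l r" and lab: "labelling (ncomp K') (qcarrier X) l' r'"
    and off: "\<And>p. p \<in> points K \<Longrightarrow> p \<notin> \<Union> (closed_seg ` S) \<Longrightarrow> l' p = l p \<and> r' p = r p"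
    and nc: "\<And>i s t x. (i, s, t) \<in> S \<Longrightarrow> s \<le> x \<Longrightarrow> x \<le> t \<Longrightarrow> \<not> cut K' (i, x) \<Longrightarrow> l' (i, x) = r' (i, x)"
    and rel: "\<And>i s t x q. (i, s, t) \<in> S \<Longrightarrow> s < x \<Longrightarrow> x < t \<Longrightarrow> double K' q (i, x) \<Longrightarrow>
      strand K' (i, x) \<noteq> Over \<Longrightarrow> passes K' X v l' r' q (i, x)"
  shows "coloring A K' X v l' r'"
  unfolding coloring_def
proof (intro conjI ballI allI impI lab)
  interpret sym: local_change_data A S K' K by (rule local_change_data_sym) (rule local_change_data_axioms)
  show "variables A X v" using c by (simp add: coloring_def)
  show "l' p = r' p" if p: "p \<in> points K'" "\<not> cut K' p" for p
  proof (cases "p \<in> \<Union> (closed_seg ` S)")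
    case True
    then obtain i s t where g: "(i, s, t) \<in> S" "p \<in> closed_seg (i, s, t)" by auto
    then obtain x where x: "s \<le> x" "x \<le> t" "same_point p (i, x)" by (auto simp: closed_seg_iff)
    have "\<not> cut K' (i, x)" using p(2) cut_cong[OF mvK' x(3)] by blast
    then have "l' (i, x) = r' (i, x)" by (rule nc[OF g(1) x(1,2)])
    then show ?thesis using labelling_same_point[OF lab x(3)] p(1) by (simp add: points_def)
  next
    case False
    have "\<not> cut K p"
    proof
      assume "cut K p"
      then obtain q where q: "double K p q" "strand K p \<noteq> Over" by (auto simp: cut_def crossing_def)
      have po: "p \<notin> \<Union> (open_seg ` S)" using False open_seg_subset by blast
      have "double K' p q" "strand K' p = strand K p"
        using off_relations[OF double_sym[OF q(1)] po] double_sym by blast+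
      then show False using p(2) q(2) unfolding cut_def crossing_def by metis
    qed
    then show ?thesis using c off[of p] p(1) False same_points by (simp add: coloring_def)
  qed
  fix p q assume pq: "double K' p q \<and> strand K' q \<noteq> Over"
  show "passes K' X v l' r' p q"
  proof (cases "q \<in> \<Union> (open_seg ` S)")
    case True
    then obtain i s t where g: "(i, s, t) \<in> S" "q \<in> open_seg (i, s, t)" by auto
    then obtain x where x: "s < x" "x < t" "same_point q (i, x)" by (auto simp: open_seg_iff)
    have d: "double K' p (i, x)" using double_cong[OF mvK' _ same_point_refl x(3)] pq by blast
    have less: "fst p < ncomp K'" "fst q < ncomp K'" using pq double_less[of K' p q] by auto
    have "strand K' (i, x) \<noteq> Over" using same_point_cong(2)[OF mvK' x(3) less(2)] pq by simp
    then have "passes K' X v l' r' p (i, x)" by (rule rel[OF g(1) x(1,2) d])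
    then show ?thesis using passes_cong[OF mvK' lab same_point_refl x(3) less] by blast
  next
    case False
    note o = sym.off_relations[OF conjunct1[OF pq] False]
    have "strand K q \<noteq> Over" using o(2) pq by simp
    then have "passes K X v l r p q" using c o(1) unfolding coloring_def by blast
    then show ?thesis using o off[of p] off[of q]
      by (simp add: passes_def double_def split: passage.split)
  qed
qed

end

lemma seg_one: "seg_l f B {x} w = (if x < w then f x B else B)"
proof (cases "x < w")
  case True
  then have e: "{y \<in> {x}. y < w} = {x}" by auto
  show ?thesis unfolding seg_l_def e using True by simp
next
  case False
  then have e: "{y \<in> {x}. y < w} = {}" by auto
  show ?thesis unfolding seg_l_def e using False by simp
qed

lemma seg_two:
  assumes "x < y" "y < w"
  shows "seg_l f B {x, y} w = f y (f x B)"
proof -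
  have e: "{z \<in> {x, y}. z < w} = insert y {x}" using assms by auto
  have "sorted_list_of_set (insert y {x}) = [x] @ [y]"
    by (subst sorted_list_of_set_snoc) (use assms in auto)
  then show ?thesis unfolding seg_l_def e by simp
qed

lemma seg_none: "seg_l f B {} w = B" "seg_r f B {} w = B"
  by (simp_all add: seg_l_def seg_r_def)

lemma segment_const:
  assumes L: "mv_diagram A L" and c: "coloring A L X v l r" and g: "is_segment L (i, s, t)"
    and nc: "\<And>x. s < x \<Longrightarrow> x < t \<Longrightarrow> \<not> cut L (i, x)" and x: "s \<le> x" "x \<le> t"
  shows "l (i, x) = l (i, s)" "r (i, x) = l (i, s)"
proof -
  have i: "i < ncomp L" using g by simp
  have nc': "\<not> cut L (i, z)" if "s \<le> z" "z \<le> t" for z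
  proof (cases "z = s \<or> z = t")
    case True
    then show ?thesis using g by (auto simp: cut_def)
  next
    case False
    then show ?thesis using nc[of z] that by linarith
  qed
  show l: "l (i, x) = l (i, s)"
    by (rule coloring_noncut_const[OF L c i x(1)]) (use nc' x in force)
  have "l (i, x) = r (i, x)" using c nc'[OF x] i by (simp add: coloring_def points_def)
  then show "r (i, x) = l (i, s)" using l by simp
qed

lemma segment_end_labels:
  assumes c: "coloring A L X v l r" and g: "is_segment L (i, s, t)"
  shows "l (i, s) = r (i, s)" "l (i, t) = r (i, t)"
  using c g by (auto simp: coloring_def points_def cut_def)

lemma reglue_coloring:
  fixes l r :: "point \<Rightarrow> 'q"
  assumes lab: "labelling (ncomp L) C l r" and g: "is_segment L (i, s, t)"
    and ends: "l (i, s) = r (i, s)" "l (i, t) = r (i, t)"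
    and G: "finite G" "G \<subseteq> {s<..<t}" and f: "\<And>x z. x \<in> G \<Longrightarrow> z \<in> C \<Longrightarrow> f x z \<in> C"
    and fin: "seg_l f (l (i, s)) G t = l (i, t)"
  obtains l' r' where "labelling (ncomp L) C l' r'"
    "\<And>p. fst p < ncomp L \<Longrightarrow> p \<notin> open_seg (i, s, t) \<Longrightarrow> l' p = l p \<and> r' p = r p"
    "\<And>x. s \<le> x \<Longrightarrow> x \<le> t \<Longrightarrow> l' (i, x) = seg_l f (l (i, s)) G x \<and> r' (i, x) = seg_r f (l (i, s)) G x"
proof -
  have i: "i < ncomp L" "s < t" "t < s + 1" using g by simp_all
  have fin': "seg_l f (l (i, s)) G t = r (i, t)" using fin ends by simp
  obtain l' r' where lr: "labelling (ncomp L) C l' r'"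
    "\<And>p. p \<notin> closed_seg (i, s, t) \<Longrightarrow> l' p = l p \<and> r' p = r p"
    "\<And>x. s \<le> x \<Longrightarrow> x \<le> t \<Longrightarrow> l' (i, x) = seg_l f (l (i, s)) G x \<and> r' (i, x) = seg_r f (l (i, s)) G x"
    using reglue_segment[where f = f, OF lab i G f fin'] by metis
  have e: "{y \<in> G. y < s} = {}" "{y \<in> G. y \<le> s} = {}" using G(2) by auto
  have s: "l' (i, s) = l (i, s) \<and> r' (i, s) = r (i, s)"
    using lr(3)[of s] i ends unfolding seg_l_def seg_r_def e by simp
  have "t \<notin> G" using G(2) by auto
  then have t: "l' (i, t) = l (i, t) \<and> r' (i, t) = r (i, t)"
    using lr(3)[of t] i ends fin seg_step_notin[of t G f "l (i, s)"] by simp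
  show thesis
  proof (rule that[OF lr(1) _ lr(3)])
    fix p :: point assume p: "fst p < ncomp L" "p \<notin> open_seg (i, s, t)"
    show "l' p = l p \<and> r' p = r p"
    proof (cases "p \<in> closed_seg (i, s, t)")
      case True
      then consider "same_point p (i, s)" | "same_point p (i, t)" using closed_seg_ends p(2) by blast
      then show ?thesis
        using labelling_same_point[OF lab _ p(1)] labelling_same_point[OF lr(1) _ p(1)] s t by cases simp_all
    qed (use lr(2) in blast)
  qed
qed

lemma meets_sym: "(x, y) \<in> meets L g h \<longleftrightarrow> (y, x) \<in> meets L h g"
  by (cases g; cases h) auto

lemma meets_iff:
  "(x, y) \<in> meets L (i, s, t) (j, u, w) \<longleftrightarrow> s \<le> x \<and> x \<le> t \<and> u \<le> y \<and> y \<le> w \<and> pos L (i, x) = pos L (j, y)"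
  by auto

declare meets.simps [simp del]

locale disjoint_local_change = local_change_data A S K K'
  for A :: "'v set" and S and K K' :: "'v diagram" +
  assumes disj: "\<And>g h. g \<in> S \<Longrightarrow> h \<in> S \<Longrightarrow> g \<noteq> h \<Longrightarrow> closed_seg g \<inter> closed_seg h = {}"
begin

lemma segL: "L = K \<or> L = K' \<Longrightarrow> g \<in> S \<Longrightarrow> is_segment L g"
  using seg by blast

lemma mvL: "L = K \<or> L = K' \<Longrightarrow> mv_diagram A L"
  using mvK mvK' by blast

lemma not_same_point:
  assumes "(i, s, t) \<in> S" "(j, u, w) \<in> S" "(i, s, t) \<noteq> (j, u, w)"
    and "s \<le> x" "x \<le> t" "u \<le> y" "y \<le> w"
  shows "\<not> same_point (i, x) (j, y)"
proof
  assume "same_point (i, x) (j, y)"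
  then have "(i, x) \<in> closed_seg (j, u, w)"
    using closed_seg_cong mem_closed_seg[OF assms(6,7), of j] by blast
  then show False using mem_closed_seg[OF assms(4,5), of i] disj[OF assms(1-3)] by blast
qed

lemma ends_off:
  assumes g: "(i, s, t) \<in> S"
  shows "(i, s) \<notin> \<Union> (open_seg ` S)" "(i, t) \<notin> \<Union> (open_seg ` S)"
proof -
  have st: "s < t" "t < s + 1" using seg[OF g] by simp_all
  have "(i, z) \<notin> open_seg h" if h: "h \<in> S" and z: "z = s \<or> z = t" for h z
  proof (cases "h = (i, s, t)")
    case True
    have "\<not> same_point (i, z) (i, x)" if "s < x" "x < t" for x
      using segment_point_unique[of t s z x i] that z st by auto
    then show ?thesis unfolding True open_seg_iff by blast
  next
    case False
    have "(i, z) \<in> closed_seg (i, s, t)" using z st by (auto intro: mem_closed_seg)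
    then show ?thesis using disj[OF g h] False open_seg_subset[of h] by blast
  qed
  then show "(i, s) \<notin> \<Union> (open_seg ` S)" "(i, t) \<notin> \<Union> (open_seg ` S)" by blast+
qed

lemma segment_partner:
  assumes L: "L = K \<or> L = K'" and g: "(i, s, t) \<in> S" and sim: "simple_on L (i, s, t)"
    and x: "s < x" "x < t" and d: "double L (i, x) q"
  obtains j u w y where "(j, u, w) \<in> S" "(j, u, w) \<noteq> (i, s, t)" "u < y" "y < w" "same_point q (j, y)"
    "(x, y) \<in> meets L (i, s, t) (j, u, w)"
proof -
  have "(i, x) \<in> \<Union> (open_seg ` S)" using mem_open_seg[OF x] g by blast
  then obtain h where h: "h \<in> S" "q \<in> open_seg h" using double_stays[OF L d] by blast
  obtain j u w where hj: "h = (j, u, w)" by (cases h)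
  obtain y where y: "u < y" "y < w" "same_point q (j, y)" using h(2) unfolding hj open_seg_iff by blast
  have q: "fst q < ncomp L" using double_less[OF d] by simp
  have p: "pos L (i, x) = pos L (j, y)"
    using d same_point_cong(1)[OF mvL[OF L] y(3) q] by (simp add: double_def)
  show thesis
  proof (rule that[OF h(1)[unfolded hj] _ y])
    show "(j, u, w) \<noteq> (i, s, t)"
    proof
      assume e: "(j, u, w) = (i, s, t)"
      then have "x = y" using sim p x y by (simp add: inj_on_def)
      then have "same_point q (i, x)" using y e by simp
      then show False using d same_point_sym unfolding double_def by blast
    qed
    show "(x, y) \<in> meets L (i, s, t) (j, u, w)" unfolding meets_iff using x y p by simp
  qed
qed

lemma meets_double:
  assumes L: "L = K \<or> L = K'" and gh: "(i, s, t) \<in> S" "(j, u, w) \<in> S" "(i, s, t) \<noteq> (j, u, w)"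
    and m: "(x, y) \<in> meets L (i, s, t) (j, u, w)"
  shows "double L (i, x) (j, y)" "s < x" "x < t" "u < y" "y < w"
proof -
  have m': "s \<le> x" "x \<le> t" "u \<le> y" "y \<le> w" "pos L (i, x) = pos L (j, y)" using m by (simp_all add: meets_iff)
  have sg: "is_segment L (i, s, t)" "is_segment L (j, u, w)" using segL[OF L] gh by blast+
  show d: "double L (i, x) (j, y)"
    using not_same_point[OF gh m'(1-4)] m' sg by (simp add: double_def points_def)
  have "crossing L (i, x)" "crossing L (j, y)" using d double_sym unfolding crossing_def by blast+
  then have "x \<noteq> s" "x \<noteq> t" "y \<noteq> u" "y \<noteq> w" using sg by auto
  then show "s < x" "x < t" "u < y" "y < w" using m' by simp_all
qed

lemma disc:
  obtains D \<Theta> where "disc_angle D \<Theta>"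
    "\<And>L i s t x. L = K \<or> L = K' \<Longrightarrow> (i, s, t) \<in> S \<Longrightarrow> s \<le> x \<Longrightarrow> x \<le> t \<Longrightarrow> pos L (i, x) \<in> D"
    "\<And>L i s t. L = K \<or> L = K' \<Longrightarrow> (i, s, t) \<in> S \<Longrightarrow> pos L (i, s) \<notin> interior D \<and> pos L (i, t) \<notin> interior D"
proof -
  obtain D where D: "D homeomorphic cball (0::complex) 1" "\<forall>L\<in>{K, K'}. \<forall>p\<in>points L.
      (pos L p \<in> D \<longleftrightarrow> p \<in> \<Union> (closed_seg ` S)) \<and> (pos L p \<in> interior D \<longleftrightarrow> p \<in> \<Union> (open_seg ` S))"
    using lc unfolding local_change_def by blast
  obtain \<Theta> where T: "disc_angle D \<Theta>" using disc_angle_exists[OF D(1)] by blast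
  have pt: "(i, x) \<in> points L" if "L = K \<or> L = K'" "(i, s, t) \<in> S" for L i s t x
    using segL[OF that] by (simp add: points_def)
  show thesis
  proof (rule that[OF T])
    fix L i s t assume L: "L = K \<or> L = K'" and g: "(i, s, t) \<in> S"
    have LK: "L \<in> {K, K'}" using L by blast
    show "pos L (i, x) \<in> D" if "s \<le> x" "x \<le> t" for x
      using D(2) LK pt[OF L g] mem_closed_seg[OF that] g by blast
    show "pos L (i, s) \<notin> interior D \<and> pos L (i, t) \<notin> interior D"
      using D(2) LK pt[OF L g] ends_off[OF g] by blast
  qed
qed

lemma ends_same:
  assumes g: "(i, s, t) \<in> S"
  shows "pos K' (i, s) = pos K (i, s)" "pos K' (i, t) = pos K (i, t)"
proof -
  have "(i, x) \<in> points K" for x using seg[OF g] by (simp add: points_def)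
  then show "pos K' (i, s) = pos K (i, s)" "pos K' (i, t) = pos K (i, t)"
    using agree ends_off[OF g] unfolding agree_off_def by (metis DiffI)+
qed

lemma end_off_curve:
  assumes L: "L = K \<or> L = K'" and gh: "(i, s, t) \<in> S" "(j, u, w) \<in> S" "(i, s, t) \<noteq> (j, u, w)"
    and x: "s \<le> x" "x \<le> t"
  shows "pos L (i, x) \<noteq> pos L (j, u)" "pos L (i, x) \<noteq> pos L (j, w)"
  using meets_double(4,5)[OF L gh, of x u] meets_double(4,5)[OF L gh, of x w] x segL[OF L gh(2)]
  by (auto simp: meets_iff)

definition crossing_sum :: "'v diagram \<Rightarrow> segment \<Rightarrow> segment \<Rightarrow> real" where
  "crossing_sum L g h = (\<Sum>(x, y)\<in>meets L g h. sgn (det2 (tangent L (fst g, x)) (tangent L (fst h, y))))"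

lemma meets_eq: "meets L (i, s, t) (j, u, w) =
    {(x, y). s \<le> x \<and> x \<le> t \<and> u \<le> y \<and> y \<le> w \<and> pos L (i, x) = pos L (j, y)}"
  by (auto simp: meets_iff)

lemma finite_meets_box:
  assumes L: "L = K \<or> L = K'" and gh: "(i, s, t) \<in> S" "(j, u, w) \<in> S" "(i, s, t) \<noteq> (j, u, w)"
  shows "finite (meets L (i, s, t) (j, u, w))"
    "boxdeg (\<lambda>x. pos L (i, x)) (\<lambda>y. pos L (j, y)) s t u w = - crossing_sum L (i, s, t) (j, u, w)"
proof -
  have sg: "is_segment L (i, s, t)" "is_segment L (j, u, w)" using segL[OF L] gh by blast+
  have d: "\<not> same_point (i, x) (j, y)" if "s \<le> x" "x \<le> t" "u \<le> y" "y \<le> w" for x y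
    by (rule not_same_point[OF gh that])
  have o: "pos L (i, x) \<noteq> pos L (j, u) \<and> pos L (i, x) \<noteq> pos L (j, w)" if "s \<le> x" "x \<le> t" for x
    using end_off_curve[OF L gh that] by simp
  have sg': "i < ncomp L" "j < ncomp L" "s < t" "t < s + 1" "u < w" "\<not> crossing L (i, s)" "\<not> crossing L (i, t)"
    using sg by simp_all
  note box = diagram_box[OF mvL[OF L] sg' d o]
  show "finite (meets L (i, s, t) (j, u, w))" unfolding meets_eq using box(1) .
  show "boxdeg (\<lambda>x. pos L (i, x)) (\<lambda>y. pos L (j, y)) s t u w = - crossing_sum L (i, s, t) (j, u, w)"
    unfolding crossing_sum_def meets_eq fst_conv using box(2) .
qed

lemma crossing_sum_invariant:
  assumes gh: "(i, s, t) \<in> S" "(j, u, w) \<in> S" "(i, s, t) \<noteq> (j, u, w)"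
  shows "crossing_sum K (i, s, t) (j, u, w) = crossing_sum K' (i, s, t) (j, u, w)"
proof -
  obtain D \<Theta> where T: "disc_angle D \<Theta>"
    and inD: "\<And>L i s t x. L = K \<or> L = K' \<Longrightarrow> (i, s, t) \<in> S \<Longrightarrow> s \<le> x \<Longrightarrow> x \<le> t \<Longrightarrow> pos L (i, x) \<in> D"
    and bdD: "\<And>L i s t. L = K \<or> L = K' \<Longrightarrow> (i, s, t) \<in> S \<Longrightarrow> pos L (i, s) \<notin> interior D \<and> pos L (i, t) \<notin> interior D"
    using disc by metis
  have box: "boxdeg (\<lambda>x. pos L (i, x)) (\<lambda>y. pos L (j, y)) s t u w =
      (\<Theta> (pos L (j, u)) (pos L (i, t)) - \<Theta> (pos L (j, u)) (pos L (i, s)))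
      + (\<Theta> (pos L (i, t)) (pos L (j, w)) - \<Theta> (pos L (i, t)) (pos L (j, u)))
      - (\<Theta> (pos L (j, w)) (pos L (i, t)) - \<Theta> (pos L (j, w)) (pos L (i, s)))
      - (\<Theta> (pos L (i, s)) (pos L (j, w)) - \<Theta> (pos L (i, s)) (pos L (j, u)))"
    if L: "L = K \<or> L = K'" for L
  proof (rule disc_box[OF T])
    have sg: "is_segment L (i, s, t)" "is_segment L (j, u, w)" using segL[OF L] gh by blast+
    then show "s \<le> t" "u \<le> w" by simp_all
    show "continuous_on UNIV (\<lambda>x. pos L (i, x))" "continuous_on UNIV (\<lambda>y. pos L (j, y))"
      using pos_continuous[OF mvL[OF L]] sg by simp_all
    show "pos L (i, x) \<in> D \<and> pos L (i, x) \<noteq> pos L (j, u) \<and> pos L (i, x) \<noteq> pos L (j, w)" if "s \<le> x" "x \<le> t" for x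
      using inD[OF L gh(1) that] end_off_curve[OF L gh that] by blast
    show "pos L (j, x) \<in> D \<and> pos L (j, x) \<noteq> pos L (i, s) \<and> pos L (j, x) \<noteq> pos L (i, t)" if "u \<le> x" "x \<le> w" for x
      using inD[OF L gh(2) that] end_off_curve[OF L gh(2,1) gh(3)[symmetric] that] by blast
  qed (use bdD[OF L gh(1)] bdD[OF L gh(2)] in blast)+
  have "boxdeg (\<lambda>x. pos K (i, x)) (\<lambda>y. pos K (j, y)) s t u w = boxdeg (\<lambda>x. pos K' (i, x)) (\<lambda>y. pos K' (j, y)) s t u w"
    unfolding box[OF disjI1[OF HOL.refl]] box[OF disjI2[OF HOL.refl]] ends_same[OF gh(1)] ends_same[OF gh(2)] ..
  then show ?thesis
    using finite_meets_box(2)[of K, OF _ gh] finite_meets_box(2)[of K', OF _ gh] by simp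
qed

lemma half_sum_invariant:
  assumes g: "(i, s, t) \<in> S" "(j, u, w) \<in> S" "(k, a, b) \<in> S"
    and ne: "(i, s, t) \<noteq> (j, u, w)" "(i, s, t) \<noteq> (k, a, b)" "(j, u, w) \<noteq> (k, a, b)"
    and m: "(x, y) \<in> meets K (j, u, w) (k, a, b)" and m': "(x', y') \<in> meets K' (j, u, w) (k, a, b)"
  defines "h \<equiv> \<lambda>L j u w x. \<Sum>(p, q)\<in>{(p, q) \<in> meets L (i, s, t) (j, u, w). q < x}.
      sgn (det2 (tangent L (i, p)) (tangent L (j, q)))"
  shows "h K j u w x - h K k a b y = h K' j u w x' - h K' k a b y'"
proof -
  obtain D \<Theta> where T: "disc_angle D \<Theta>"
    and inD: "\<And>L i s t x. L = K \<or> L = K' \<Longrightarrow> (i, s, t) \<in> S \<Longrightarrow> s \<le> x \<Longrightarrow> x \<le> t \<Longrightarrow> pos L (i, x) \<in> D"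
    and bdD: "\<And>L i s t. L = K \<or> L = K' \<Longrightarrow> (i, s, t) \<in> S \<Longrightarrow> pos L (i, s) \<notin> interior D \<and> pos L (i, t) \<notin> interior D"
    using disc by metis
  have no_triple: "pos L (i, z) \<noteq> pos L (j, x)"
    if L: "L = K \<or> L = K'" and m: "(x, y) \<in> meets L (j, u, w) (k, a, b)" and z: "s \<le> z" "z \<le> t" for L x y z
  proof
    assume e: "pos L (i, z) = pos L (j, x)"
    note mm = meets_double[OF L g(2,3) ne(3) m]
    have "(z, x) \<in> meets L (i, s, t) (j, u, w)" using mm z e by (simp add: meets_iff)
    from double_sym[OF meets_double(1)[OF L g(1,2) ne(1) this]] mm(1)
    have "same_point (i, z) (k, y)" using double_unique[OF mvL[OF L]] by blast
    then show False using not_same_point[OF g(1,3) ne(2) z] mm by simp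
  qed
  have half: "boxdeg (\<lambda>x. pos L (i, x)) (\<lambda>y. pos L (j, y)) s t u x = - h L j u w x"
    if L: "L = K \<or> L = K'" and g2: "(j, u, w) \<in> S" "(i, s, t) \<noteq> (j, u, w)" and x: "u < x" "x < w"
      and off: "\<And>z. s \<le> z \<Longrightarrow> z \<le> t \<Longrightarrow> pos L (i, z) \<noteq> pos L (j, x)" for L j u w x
  proof -
    have sg: "i < ncomp L" "j < ncomp L" "s < t" "t < s + 1" "u < x" "\<not> crossing L (i, s)" "\<not> crossing L (i, t)"
      using segL[OF L g(1)] segL[OF L g2(1)] x by simp_all
    have d: "\<not> same_point (i, p) (j, q)" if "s \<le> p" "p \<le> t" "u \<le> q" "q \<le> x" for p q
      by (rule not_same_point[OF g(1) g2]) (use that x in simp_all)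
    have o: "pos L (i, p) \<noteq> pos L (j, u) \<and> pos L (i, p) \<noteq> pos L (j, x)" if "s \<le> p" "p \<le> t" for p
      using end_off_curve[OF L g(1) g2 that] off[OF that] by simp
    have e: "{(p, q) \<in> meets L (i, s, t) (j, u, w). q < x} =
      {(p, q). s \<le> p \<and> p \<le> t \<and> u \<le> q \<and> q \<le> x \<and> pos L (i, p) = pos L (j, q)}" (is "?l = ?r")
    proof
      show "?l \<subseteq> ?r" by (auto simp: meets_iff)
      show "?r \<subseteq> ?l"
      proof
        fix z assume z: "z \<in> ?r"
        obtain p q where [simp]: "z = (p, q)" by (cases z)
        have "q \<noteq> x" using z off[of p] by auto
        then show "z \<in> ?l" using z x by (simp add: meets_iff)
      qed
    qed
    show ?thesis unfolding h_def e using diagram_box(2)[OF mvL[OF L] sg d o] .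
  qed
  have main: "h L j u w x - h L k a b y = 
     - ((\<Theta> (pos L (j, u)) (pos L (i, t)) - \<Theta> (pos L (j, u)) (pos L (i, s)))
     - (\<Theta> (pos L (k, a)) (pos L (i, t)) - \<Theta> (pos L (k, a)) (pos L (i, s)))
     + (\<Theta> (pos L (i, t)) (pos L (k, a)) - \<Theta> (pos L (i, t)) (pos L (j, u)))
     - (\<Theta> (pos L (i, s)) (pos L (k, a)) - \<Theta> (pos L (i, s)) (pos L (j, u))))"
    if L: "L = K \<or> L = K'" and m: "(x, y) \<in> meets L (j, u, w) (k, a, b)" for L x y
  proof -
    note mm = meets_double[OF L g(2,3) ne(3) m]
    have xy: "pos L (j, x) = pos L (k, y)" using m by (simp add: meets_iff)
    have off: "pos L (i, z) \<noteq> pos L (j, x)" "pos L (i, z) \<noteq> pos L (k, y)" if "s \<le> z" "z \<le> t" for z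
      using no_triple[OF L m that] xy by simp_all
    have sg: "is_segment L (i, s, t)" "is_segment L (j, u, w)" "is_segment L (k, a, b)" using segL[OF L] g by blast+
    have "boxdeg (\<lambda>x. pos L (i, x)) (\<lambda>y. pos L (j, y)) s t u x - boxdeg (\<lambda>x. pos L (i, x)) (\<lambda>y. pos L (k, y)) s t a y =
      (\<Theta> (pos L (j, u)) (pos L (i, t)) - \<Theta> (pos L (j, u)) (pos L (i, s)))
     - (\<Theta> (pos L (k, a)) (pos L (i, t)) - \<Theta> (pos L (k, a)) (pos L (i, s)))
     + (\<Theta> (pos L (i, t)) (pos L (k, a)) - \<Theta> (pos L (i, t)) (pos L (j, u)))
     - (\<Theta> (pos L (i, s)) (pos L (k, a)) - \<Theta> (pos L (i, s)) (pos L (j, u)))"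
    proof (rule disc_half_boxes[OF T])
      show "s \<le> t" "u \<le> x" "a \<le> y" using sg mm by simp_all
      show "continuous_on UNIV (\<lambda>x. pos L (i, x))" "continuous_on UNIV (\<lambda>y. pos L (j, y))" "continuous_on UNIV (\<lambda>y. pos L (k, y))"
        using pos_continuous[OF mvL[OF L]] sg by simp_all
      show "pos L (i, z) \<in> D \<and> pos L (i, z) \<noteq> pos L (j, u) \<and> pos L (i, z) \<noteq> pos L (k, a)" if "s \<le> z" "z \<le> t" for z
        using inD[OF L g(1) that] end_off_curve[OF L g(1,2) ne(1) that] end_off_curve[OF L g(1,3) ne(2) that] by blast
      show "pos L (j, z) \<in> D \<and> pos L (j, z) \<noteq> pos L (i, s) \<and> pos L (j, z) \<noteq> pos L (i, t)" if "u \<le> z" "z \<le> x" for z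
        using inD[OF L g(2), of z] end_off_curve[OF L g(2,1) ne(1)[symmetric], of z] that mm by simp
      show "pos L (k, z) \<in> D \<and> pos L (k, z) \<noteq> pos L (i, s) \<and> pos L (k, z) \<noteq> pos L (i, t)" if "a \<le> z" "z \<le> y" for z
        using inD[OF L g(3), of z] end_off_curve[OF L g(3,1) ne(2)[symmetric], of z] that mm by simp
      show "pos L (j, x) = pos L (k, y)" by (rule xy)
    qed (use bdD[OF L g(1)] bdD[OF L g(2)] bdD[OF L g(3)] in blast)+
    then show ?thesis
      using half[OF L g(2) ne(1) mm(2,3) off(1)] half[OF L g(3) ne(2) mm(4,5) off(2)] by simp
  qed
  show ?thesis
    unfolding main[OF disjI1[OF HOL.refl] m] main[OF disjI2[OF HOL.refl] m']
      ends_same[OF g(1)] ends_same[OF g(2)] ends_same[OF g(3)] ..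
qed

lemma iso_local:
  assumes E1: "\<And>(X :: 'v generator qterm set quandle) v l r. coloring A K X v l r \<Longrightarrow>
      \<exists>l' r'. coloring A K' X v l' r' \<and> (\<forall>p\<in>points K. p \<notin> \<Union> (open_seg ` S) \<longrightarrow> l' p = l p \<and> r' p = r p)"
    and E2: "\<And>(X :: 'v generator qterm set quandle) v l' r'. coloring A K' X v l' r' \<Longrightarrow>
      \<exists>l r. coloring A K X v l r \<and> (\<forall>p\<in>points K. p \<notin> \<Union> (open_seg ` S) \<longrightarrow> l' p = l p \<and> r' p = r p)"
    and U: "\<And>L (X :: 'v generator qterm set quandle) v la ra lb rb i s t x. L = K \<or> L = K' \<Longrightarrow>
      coloring A L X v la ra \<Longrightarrow> coloring A L X v lb rb \<Longrightarrow>
      (\<And>p. p \<in> points K \<Longrightarrow> p \<notin> \<Union> (open_seg ` S) \<Longrightarrow> la p = lb p \<and> ra p = rb p) \<Longrightarrow>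
      (i, s, t) \<in> S \<Longrightarrow> s < x \<Longrightarrow> x < t \<Longrightarrow> la (i, x) = lb (i, x)"
  shows "quandle_iso (mv_quandle A K) (mv_quandle A K')"
proof -
  define rel :: "'v generator qterm set quandle \<Rightarrow> ('v \<Rightarrow> 'v generator qterm set) \<Rightarrow>
      (point \<Rightarrow> 'v generator qterm set) \<Rightarrow> (point \<Rightarrow> 'v generator qterm set) \<Rightarrow>
      (point \<Rightarrow> 'v generator qterm set) \<Rightarrow> (point \<Rightarrow> 'v generator qterm set) \<Rightarrow> bool"
    where "rel X v l r l' r' \<longleftrightarrow> (\<forall>p\<in>points K. p \<notin> \<Union> (open_seg ` S) \<longrightarrow> l' p = l p \<and> r' p = r p)" for X v l r l' r'
  have U': "la p = lb p" if L: "L = K \<or> L = K'" and c: "coloring A L X v la ra" "coloring A L X v lb rb"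
    and eq: "\<And>p. p \<in> points K \<Longrightarrow> p \<notin> \<Union> (open_seg ` S) \<Longrightarrow> la p = lb p \<and> ra p = rb p" and p: "p \<in> points K"
    for L p v la ra lb rb and X :: "'v generator qterm set quandle"
  proof (cases "p \<in> \<Union> (open_seg ` S)")
    case True
    then obtain i s t where g: "(i, s, t) \<in> S" "p \<in> open_seg (i, s, t)" by auto
    then obtain x where x: "s < x" "x < t" "same_point p (i, x)" by (auto simp: open_seg_iff)
    have "labelling (ncomp L) (qcarrier X) la ra" "labelling (ncomp L) (qcarrier X) lb rb" "fst p < ncomp L"
      using c p L same_ncomp by (auto simp: coloring_def points_def)
    then have "la p = la (i, x)" "lb p = lb (i, x)" using labelling_same_point x(3) by metis+
    then show ?thesis using U[OF L c eq g(1) x(1,2)] by simp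
  qed (use eq p in blast)
  show ?thesis
  proof (rule iso_by_transfer[where rel = rel, OF mvK mvK'])
    show "la p = lb p" if "coloring A K X v la ra" "coloring A K' X v la' ra'" "coloring A K X v lb rb"
      "coloring A K' X v lb' rb'" "rel X v la ra la' ra'" "rel X v lb rb lb' rb'"
      "\<And>p. p \<in> points K' \<Longrightarrow> la' p = lb' p \<and> ra' p = rb' p" "p \<in> points K" for X v la ra la' ra' lb rb lb' rb' p
    proof (rule U'[OF disjI1[OF HOL.refl] that(1,3) _ that(8)])
      fix p assume "p \<in> points K" "p \<notin> \<Union> (open_seg ` S)"
      then show "la p = lb p \<and> ra p = rb p"
        using that(5,6) that(7)[of p] unfolding rel_def same_points by metis
    qed
    show "la' p = lb' p" if "coloring A K X v la ra" "coloring A K' X v la' ra'" "coloring A K X v lb rb"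
      "coloring A K' X v lb' rb'" "rel X v la ra la' ra'" "rel X v lb rb lb' rb'"
      "\<And>p. p \<in> points K \<Longrightarrow> la p = lb p \<and> ra p = rb p" "p \<in> points K'" for X v la ra la' ra' lb rb lb' rb' p
    proof (rule U'[OF disjI2[OF HOL.refl] that(2,4) _ that(8)[unfolded same_points]])
      fix p assume "p \<in> points K" "p \<notin> \<Union> (open_seg ` S)"
      then show "la' p = lb' p \<and> ra' p = rb' p"
        using that(5,6) that(7)[of p] unfolding rel_def by metis
    qed
    show "rel Y w (f \<circ> l) (f \<circ> r) (f \<circ> l') (f \<circ> r')" if "rel X v l r l' r'" for X v l r l' r' Y w f
      using that by (simp add: rel_def)
  qed (use E1 E2 in \<open>simp_all add: rel_def\<close>)
qed

end

lemma R1_iso: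
  assumes "R1 A K K'"
  shows "quandle_iso (mv_quandle A K) (mv_quandle A K')"
proof -
  obtain i s t a b where lc: "local_change A {(i, s, t)} K K'"
    and kink: "{(x, y). x \<in> {s..t} \<and> y \<in> {s..t} \<and> x < y \<and> pos K (i, x) = pos K (i, y)} = {(a, b)}"
    and str: "strand K (i, a) \<in> {Over, Under}" and sim: "simple_on K' (i, s, t)"
    using assms unfolding R1_def by blast
  interpret disjoint_local_change A "{(i, s, t)}" K K'
    by unfold_locales (use lc in auto)
  interpret sym: disjoint_local_change A "{(i, s, t)}" K' K
    by unfold_locales (use local_change_sym[OF lc] in auto)
  have sg: "is_segment K (i, s, t)" "is_segment K' (i, s, t)" using seg by simp_all
  then have st: "i < ncomp K" "s < t" "t < s + 1" by simp_all
  have ab: "s \<le> a" "a < b" "b \<le> t" "pos K (i, a) = pos K (i, b)" using kink by auto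
  have only: "x = a \<and> y = b" if "s \<le> x" "y \<le> t" "x < y" "pos K (i, x) = pos K (i, y)" for x y
  proof -
    have "(x, y) \<in> {(x, y). x \<in> {s..t} \<and> y \<in> {s..t} \<and> x < y \<and> pos K (i, x) = pos K (i, y)}" using that by simp
    then show ?thesis unfolding kink by simp
  qed
  have dab: "double K (i, a) (i, b)"
    using ab st same_point_close[of i a b] by (auto simp: double_def points_def)
  have "crossing K (i, a)" "crossing K (i, b)" using dab double_sym unfolding crossing_def by blast+
  then have ab': "s < a" "b < t" using sg ab by (auto simp: order_le_less)
  have doubles: "(x = a \<and> same_point q (i, b)) \<or> (x = b \<and> same_point q (i, a))"
    if x: "s < x" "x < t" and d: "double K (i, x) q" for x q
  proof -
    obtain y where y: "s < y" "y < t" "same_point q (i, y)"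
      using double_stays[OF disjI1[OF HOL.refl] d] mem_open_seg[OF x, of i] by (auto simp: open_seg_iff)
    have p: "pos K (i, x) = pos K (i, y)"
      using d same_point_cong(1)[OF mvK y(3)] double_less[OF d] by (simp add: double_def)
    have "x \<noteq> y"
    proof
      assume "x = y"
      then have "same_point (i, x) q" using same_point_sym[OF y(3)] by simp
      then show False using d unfolding double_def by blast
    qed
    then consider "x < y" | "y < x" by linarith
    then show ?thesis
    proof cases
      case 1
      then show ?thesis using only[of x y] x y p by auto
    next
      case 2
      then show ?thesis using only[of y x] x y p by auto
    qed
  qed
  have none: "\<not> crossing K' (i, x)" if x: "s < x" "x < t" for x
  proof
    assume "crossing K' (i, x)"
    then obtain q where d: "double K' (i, x) q" by (auto simp: crossing_def)
    show False
      by (rule segment_partner[OF disjI2[OF HOL.refl] _ sim x d]) auto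
  qed
  have E1: "coloring A K' X v l r" if c: "coloring A K X v l r" for v l r and X :: "'v generator qterm set quandle"
  proof -
    have X: "is_quandle X" and lab: "labelling (ncomp K) (qcarrier X) l r"
      using c by (auto simp: coloring_def variables_def)
    have cl: "l (i, x) \<in> qcarrier X" "r (i, x) \<in> qcarrier X" for x
      using labelling_closed[OF lab, of "(i, x)"] st by simp_all
    have eq: "l (i, x) = r (i, x)" if "s \<le> x" "x \<le> t" "x \<noteq> a" "x \<noteq> b" for x
    proof -
      have "\<not> crossing K (i, x)"
      proof (cases "x = s \<or> x = t")
        case True
        then show ?thesis using sg by auto
      next
        case False
        then have "s < x" "x < t" using that by auto
        then show ?thesis using doubles[of x] that unfolding crossing_def by blast
      qed
      then show ?thesis using c st by (simp add: coloring_def points_def cut_def)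
    qed
    have ok: "left_ok (\<lambda>y. l (i, y)) (\<lambda>y. r (i, y)) x" "right_ok (\<lambda>y. l (i, y)) (\<lambda>y. r (i, y)) x" for x
      using lab st by (auto simp: labelling_def)
    have lb: "l (i, b) = r (i, a)"
      by (rule steps_const(1)[of a b "\<lambda>y. l (i, y)" "\<lambda>y. r (i, y)" b, OF ab(2) ok])
        (use eq ab ab' in auto)
    have pass: "passes K X v l r (i, a) (i, b)" if "strand K (i, b) \<noteq> Over"
      using c dab that unfolding coloring_def by blast
    have pass': "passes K X v l r (i, b) (i, a)" if "strand K (i, a) \<noteq> Over"
      using c double_sym[OF dab] that unfolding coloring_def by blast
    have nc: "l p = r p" if "p \<in> points K" "strand K p = Over" for p
      using c that by (simp add: coloring_def cut_def)
    have "l (i, a) = r (i, a) \<and> l (i, b) = r (i, b)"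
    proof (rule double_strands[OF mvK dab])
      assume s: "strand K (i, a) = Over" "strand K (i, b) = Under"
      have "l (i, a) = r (i, a)" using nc s(1) st by (simp add: points_def)
      moreover have "r (i, b) = l (i, b)"
        using pass s(2) lb \<open>l (i, a) = r (i, a)\<close> act_idem[OF X cl(2)] by (simp add: passes_def)
      ultimately show ?thesis by simp
    next
      assume s: "strand K (i, a) = Under" "strand K (i, b) = Over"
      have bb: "l (i, b) = r (i, b)" using nc s(2) st by (simp add: points_def)
      define e where "e \<longleftrightarrow> 0 < det2 (tangent K (i, b)) (tangent K (i, a))"
      have ra: "r (i, a) = act X e (l (i, a)) (r (i, a))"
        using pass' s(1) lb by (simp add: passes_def e_def)
      have "l (i, a) = act X (\<not> e) (act X e (l (i, a)) (r (i, a))) (r (i, a))"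
        using act_cancel(1)[OF X cl(1) cl(2)] by simp
      also have "\<dots> = act X (\<not> e) (r (i, a)) (r (i, a))" using ra by simp
      also have "\<dots> = r (i, a)" by (rule act_idem[OF X cl(2)])
      finally show ?thesis using bb by simp
    next
      fix \<alpha> assume "strand K (i, a) = Virt \<alpha>"
      then show ?thesis using str by simp
    qed
    then have all: "l (i, x) = r (i, x)" if "s \<le> x" "x \<le> t" for x using eq that by metis
    show ?thesis
    proof (rule transfer_coloring[OF c])
      show "labelling (ncomp K') (qcarrier X) l r" using lab same_ncomp by simp
      show "l (j, x) = r (j, x)" if "(j, u, w) \<in> {(i, s, t)}" "u \<le> x" "x \<le> w" for j u w x
        using that all by simp
      show "passes K' X v l r q (j, x)"
        if "(j, u, w) \<in> {(i, s, t)}" "u < x" "x < w" "double K' q (j, x)" for j u w x q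
      proof -
        have x: "j = i" "s < x" "x < t" using that(1-3) by simp_all
        then have "crossing K' (i, x)" using double_sym[OF that(4)] unfolding crossing_def by blast
        then show ?thesis using none[OF x(2,3)] by blast
      qed
    qed simp
  qed
  have E2: "coloring A K X v l r" if c: "coloring A K' X v l r" for v l r and X :: "'v generator qterm set quandle"
  proof -
    have X: "is_quandle X" and lab: "labelling (ncomp K') (qcarrier X) l r"
      using c by (auto simp: coloring_def variables_def)
    have st': "i < ncomp K'" using st same_ncomp by simp
    have const: "l (i, x) = l (i, s)" "r (i, x) = l (i, s)" if "s \<le> x" "x \<le> t" for x
      using segment_const[OF mvK' c sg(2) _ that] none by (auto simp: cut_def)
    have B: "l (i, s) \<in> qcarrier X" using labelling_closed[OF lab, of "(i, s)"] st' by simp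
    show ?thesis
    proof (rule sym.transfer_coloring[OF c])
      show lab': "labelling (ncomp K) (qcarrier X) l r" using lab same_ncomp by simp
      show "l (j, x) = r (j, x)" if "(j, u, w) \<in> {(i, s, t)}" "u \<le> x" "x \<le> w" for j u w x
        using that const[of x] by simp
      show "passes K X v l r q (j, x)"
        if "(j, u, w) \<in> {(i, s, t)}" "u < x" "x < w" "double K q (j, x)" "strand K (j, x) \<noteq> Over" for j u w x q
      proof -
        have x: "j = i" "s < x" "x < t" using that by simp_all
        have d: "double K (i, x) q" using double_sym[OF that(4)] x by simp
        have "strand K (i, b) \<in> {Over, Under}" by (rule double_strands[OF mvK dab]) (use str in auto)
        moreover have "x = a \<or> x = b" using doubles[OF x(2,3) d] by blast
        ultimately have U: "strand K (i, x) = Under" using that(5) str x by auto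
        obtain y where y: "s \<le> y" "y \<le> t" "same_point q (i, y)"
          using doubles[OF x(2,3) d] ab ab' by (metis less_imp_le order.trans)
        have "l q = l (i, s)"
          using labelling_same_point(1)[OF lab' y(3)] double_less[OF d] const(1)[OF y(1,2)] by simp
        then show ?thesis using U const[of x] x act_idem[OF X B] by (simp add: passes_def)
      qed
    qed simp
  qed
  show ?thesis
  proof (rule iso_by_transfer[where rel = "\<lambda>X v l r l' r'. \<forall>p\<in>points K. l' p = l p \<and> r' p = r p", OF mvK mvK'])
    show "\<exists>l' r'. coloring A K' X v l' r' \<and> (\<forall>p\<in>points K. l' p = l p \<and> r' p = r p)"
      if "coloring A K X v l r" for v l r and X :: "'v generator qterm set quandle" using E1[OF that] by blast
    show "\<exists>l r. coloring A K X v l r \<and> (\<forall>p\<in>points K. l' p = l p \<and> r' p = r p)"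
      if "coloring A K' X v l' r'" for v l' r' and X :: "'v generator qterm set quandle" using E2[OF that] by blast
  qed (auto simp: same_points)
qed

lemma cutI: "double K p q \<Longrightarrow> strand K p \<noteq> Over \<Longrightarrow> cut K p"
  unfolding cut_def crossing_def by blast

lemma R2_iso:
  fixes A :: "'v set" and K K' :: "'v diagram"
  assumes "R2 A K K'"
  shows "quandle_iso (mv_quandle A K) (mv_quandle A K')"
proof -
  obtain i s t j u w where lc: "local_change A {(i, s, t), (j, u, w)} K K'"
    and dj: "closed_seg (i, s, t) \<inter> closed_seg (j, u, w) = {}"
    and sim: "\<And>L. L = K \<or> L = K' \<Longrightarrow> simple_on L (i, s, t) \<and> simple_on L (j, u, w)"
    and two: "card (meets K (i, s, t) (j, u, w)) = 2"
    and over: "\<And>x y. (x, y) \<in> meets K (i, s, t) (j, u, w) \<Longrightarrow> strand K (i, x) = Over"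
    and none: "meets K' (i, s, t) (j, u, w) = {}"
  proof -
    obtain g h where gh: "local_change A {g, h} K K'" "closed_seg g \<inter> closed_seg h = {}"
      "\<forall>L\<in>{K, K'}. simple_on L g \<and> simple_on L h" "card (meets K g h) = 2"
      "\<forall>(x, y)\<in>meets K g h. strand K (fst g, x) = Over" "meets K' g h = {}"
      using assms unfolding R2_def by blast
    obtain i s t j u w where e: "g = (i, s, t)" "h = (j, u, w)" by (cases g; cases h)
    show thesis
      by (rule that[of i s t j u w]) (use gh in \<open>auto simp: e\<close>)
  qed
  let ?g = "(i, s, t)" and ?h = "(j, u, w)"
  have "is_segment K ?g" using lc by (auto simp: local_change_def)
  then have "(i, s) \<in> closed_seg ?g" by (auto intro: mem_closed_seg)
  then have ne: "?g \<noteq> ?h" using dj by auto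
  interpret disjoint_local_change A "{(i, s, t), (j, u, w)}" K K'
    by unfold_locales (use lc dj in auto)
  interpret sym: disjoint_local_change A "{(i, s, t), (j, u, w)}" K' K
    by unfold_locales (use local_change_sym[OF lc] dj in auto)
  have gS: "?g \<in> {?g, ?h}" and hS: "?h \<in> {?g, ?h}" by simp_all
  have K: "K = K \<or> K = K'" and K': "K' = K \<or> K' = K'" by simp_all
  have sgL: "is_segment L ?g" "is_segment L ?h" if "L = K \<or> L = K'" for L using segL[OF that gS] segL[OF that hS] by blast+
  have st: "i < ncomp K" "s < t" "j < ncomp K" "u < w" using sgL[OF K] by simp_all
  note md = meets_double[OF K gS hS ne]
  obtain x1 y1 x2 y2 where M: "meets K ?g ?h = {(x1, y1), (x2, y2)}" and y12: "y1 < y2"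
  proof -
    obtain z1 z2 where z: "meets K ?g ?h = {z1, z2}" "z1 \<noteq> z2" using two by (auto simp: card_2_iff)
    obtain a1 b1 a2 b2 where e: "z1 = (a1, b1)" "z2 = (a2, b2)" by (cases z1; cases z2)
    have m: "(a1, b1) \<in> meets K ?g ?h" "(a2, b2) \<in> meets K ?g ?h" using z e by simp_all
    have "b1 \<noteq> b2"
    proof
      assume b: "b1 = b2"
      have "double K (j, b1) (i, a1)" "double K (j, b1) (i, a2)"
        using md(1)[OF m(1)] md(1)[OF m(2)] b double_sym by blast+
      then have "same_point (i, a1) (i, a2)" by (rule double_unique[OF mvK])
      then have "a1 = a2"
        using segment_point_unique[of t s a1 a2 i] md[OF m(1)] md[OF m(2)] sgL(1)[OF K] by simp
      then show False using z(2) e b by simp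
    qed
    then consider "b1 < b2" | "b2 < b1" by linarith
    then show thesis
    proof cases
      case 1
      then show thesis using that[of a1 b1 a2 b2] z e by simp
    next
      case 2
      then show thesis using that[of a2 b2 a1 b1] z e by (simp add: insert_commute)
    qed
  qed
  have m1: "(x1, y1) \<in> meets K ?g ?h" and m2: "(x2, y2) \<in> meets K ?g ?h" unfolding M by simp_all
  note d1 = md[OF m1] and d2 = md[OF m2]
  define e where "e \<longleftrightarrow> 0 < det2 (tangent K (i, x1)) (tangent K (j, y1))"
  have e2: "0 < det2 (tangent K (i, x2)) (tangent K (j, y2)) \<longleftrightarrow> \<not> e"
  proof -
    have "crossing_sum K' ?g ?h = 0" unfolding crossing_sum_def none by simp
    then have "crossing_sum K ?g ?h = 0" using crossing_sum_invariant[OF gS hS ne] by simp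
    then have "sgn (det2 (tangent K (i, x1)) (tangent K (j, y1))) + sgn (det2 (tangent K (i, x2)) (tangent K (j, y2))) = 0"
      using y12 unfolding crossing_sum_def M by simp
    then show ?thesis using double_det[OF mvK d1(1)] double_det[OF mvK d2(1)]
      by (auto simp: e_def sgn_if split: if_splits)
  qed
  have gdbl: "\<exists>y. (x, y) \<in> meets L ?g ?h" if L: "L = K \<or> L = K'" and x: "s < x" "x < t" "double L (i, x) q" for L x q
    by (rule segment_partner[OF L gS conjunct1[OF sim[OF L]] x]) auto
  have hdbl: "\<exists>x. (x, y) \<in> meets L ?g ?h \<and> same_point q (i, x)"
    if L: "L = K \<or> L = K'" and y: "u < y" "y < w" "double L (j, y) q" for L y q
    by (rule segment_partner[OF L hS conjunct2[OF sim[OF L]] y]) (auto simp: meets_sym)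
  have g_nocut: "\<not> cut L (i, x)" if L: "L = K \<or> L = K'" and x: "s < x" "x < t" for L x
  proof
    assume c: "cut L (i, x)"
    then obtain q where q: "double L (i, x) q" by (auto simp: cut_def crossing_def)
    from gdbl[OF L x this] obtain y where y: "(x, y) \<in> meets L ?g ?h" by blast
    then have "L = K" using L none by auto
    then show False using c over y by (auto simp: cut_def)
  qed
  have h_none: "\<not> crossing K' (j, y)" if "u < y" "y < w" for y
    using hdbl[OF K' that] none unfolding crossing_def by blast
  have g_none: "\<not> crossing K' (i, x)" if "s < x" "x < t" for x
    using gdbl[OF K' that] none unfolding crossing_def by blast
  have hK: "(y = y1 \<and> same_point q (i, x1)) \<or> (y = y2 \<and> same_point q (i, x2))"
    if y: "u < y" "y < w" "double K (j, y) q" for y q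
    using hdbl[OF K y] unfolding M by auto
  have under: "strand K (j, y1) = Under" "strand K (j, y2) = Under"
    using double_strands[OF mvK d1(1)] double_strands[OF mvK d2(1)] over[OF m1] over[OF m2]
    by (metis passage.distinct(1,3,5))+
  define G where "G = {y1, y2}"
  have G: "finite G" "G \<subseteq> {u<..<w}" using d1 d2 by (auto simp: G_def)
  define f where "f X b y z = act X (if y = y1 then e else \<not> e) z b" for X :: "'v generator qterm set quandle" and b y z
  have f_closed: "f X b y z \<in> qcarrier X" if "is_quandle X" "b \<in> qcarrier X" "z \<in> qcarrier X" for X b y z
    unfolding f_def by (rule act_closed[OF that(1,3,2)])
  have f_back: "seg_l (f X b) B G w = B" if X: "is_quandle X" "b \<in> qcarrier X" "B \<in> qcarrier X" for X b B
  proof -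
    have "seg_l (f X b) B G w = f X b y2 (f X b y1 B)" unfolding G_def by (rule seg_two) (use y12 d2 in simp_all)
    also have "\<dots> = B" using y12 act_cancel(1)[OF X(1,3,2)] by (simp add: f_def)
    finally show ?thesis .
  qed
  show ?thesis
  proof (rule iso_local)
    fix X :: "'v generator qterm set quandle" and v l r
    assume c: "coloring A K X v l r"
    have X: "is_quandle X" and lab: "labelling (ncomp K) (qcarrier X) l r"
      using c by (auto simp: coloring_def variables_def)
    define b where "b = l (i, s)"
    have cl: "b \<in> qcarrier X" "l (j, u) \<in> qcarrier X"
      using labelling_closed[OF lab, of "(i, s)"] labelling_closed[OF lab, of "(j, u)"] st by (simp_all add: b_def)
    have gc: "l (i, x) = b" "r (i, x) = b" if "s \<le> x" "x \<le> t" for x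
      using segment_const[OF mvK c sgL(1)[OF K] g_nocut[OF K] that] by (simp_all add: b_def)
    note ends = segment_end_labels[OF c sgL(2)[OF K]]
    have pass: "r (j, y) = f X b y (l (j, y))" if y: "y \<in> G" for y
    proof -
      have "passes K X v l r (i, x1) (j, y1)" "passes K X v l r (i, x2) (j, y2)"
        using c d1(1) d2(1) under unfolding coloring_def by simp_all
      then show ?thesis using y y12 under gc[of x1] gc[of x2] d1 d2 e2
        by (auto simp: G_def f_def passes_def e_def)
    qed
    have "l (j, w) = seg_l (f X b) (r (j, u)) G w"
    proof (rule coloring_seg_value(1)[where f = "f X b", OF c st(3,4) G _ pass])
      show "\<not> cut K (j, y)" if "u < y" "y < w" "y \<notin> G" for y
        using hK[OF that(1,2)] that(3) by (auto simp: G_def cut_def crossing_def)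
    qed (use st in simp_all)
    also have "\<dots> = l (j, u)" using f_back[OF X cl] ends by simp
    finally have fin: "seg_l (f X b) (l (j, u)) {} w = l (j, w)" by (simp add: seg_none)
    obtain l' r' where lr: "labelling (ncomp K) (qcarrier X) l' r'"
      "\<And>p. fst p < ncomp K \<Longrightarrow> p \<notin> open_seg ?h \<Longrightarrow> l' p = l p \<and> r' p = r p"
      "\<And>x. u \<le> x \<Longrightarrow> x \<le> w \<Longrightarrow> l' (j, x) = seg_l (f X b) (l (j, u)) {} x \<and> r' (j, x) = seg_r (f X b) (l (j, u)) {} x"
    proof (rule reglue_coloring[where f = "f X b" and G = "{}", OF lab sgL(2)[OF K] ends _ _ _ fin])
      fix l' r'
      assume "labelling (ncomp K) (qcarrier X) l' r'"
        "\<And>p. fst p < ncomp K \<Longrightarrow> p \<notin> open_seg ?h \<Longrightarrow> l' p = l p \<and> r' p = r p"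
        "\<And>x. u \<le> x \<Longrightarrow> x \<le> w \<Longrightarrow> l' (j, x) = seg_l (f X b) (l (j, u)) {} x \<and> r' (j, x) = seg_r (f X b) (l (j, u)) {} x"
      then show thesis by (rule that)
    qed simp_all
    have "coloring A K' X v l' r'"
    proof (rule transfer_coloring[OF c])
      show "labelling (ncomp K') (qcarrier X) l' r'" using lr(1) same_ncomp by simp
      show "l' p = l p \<and> r' p = r p" if "p \<in> points K" "p \<notin> \<Union> (closed_seg ` {?g, ?h})" for p
        using lr(2)[of p] that open_seg_subset[of ?h] by (auto simp: points_def)
      show "l' (k, x) = r' (k, x)" if k: "(k, c1, c2) \<in> {?g, ?h}" "c1 \<le> x" "x \<le> c2" "\<not> cut K' (k, x)" for k c1 c2 x
      proof (cases "(k, c1, c2) = ?g")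
        case True
        then have x: "k = i" "s \<le> x" "x \<le> t" using k by simp_all
        then have "(i, x) \<notin> open_seg ?h" using mem_closed_seg[of s x t i] dj open_seg_subset[of ?h] by blast
        then show ?thesis using lr(2)[of "(i, x)"] st gc x by simp
      next
        case False
        then have x: "k = j" "u \<le> x" "x \<le> w" using k False by auto
        then show ?thesis using lr(3)[OF x(2,3)] by (simp add: seg_none)
      qed
      show "passes K' X v l' r' q (k, x)" if k: "(k, c1, c2) \<in> {?g, ?h}" "c1 < x" "x < c2" "double K' q (k, x)" for k c1 c2 x q
      proof -
        have "crossing K' (k, x)" using double_sym[OF k(4)] unfolding crossing_def by blast
        then show ?thesis using k(1-3) g_none h_none by auto
      qed
    qed
    then show "\<exists>l' r'. coloring A K' X v l' r' \<and>
        (\<forall>p\<in>points K. p \<notin> \<Union> (open_seg ` {?g, ?h}) \<longrightarrow> l' p = l p \<and> r' p = r p)"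
      using lr(2) unfolding points_def by blast
  next
    fix X :: "'v generator qterm set quandle" and v l r
    assume c: "coloring A K' X v l r"
    have X: "is_quandle X" and lab: "labelling (ncomp K') (qcarrier X) l r"
      using c by (auto simp: coloring_def variables_def)
    have st': "i < ncomp K'" "j < ncomp K'" using st same_ncomp by simp_all
    define b where "b = l (i, s)"
    define B where "B = l (j, u)"
    have cl: "b \<in> qcarrier X" "B \<in> qcarrier X"
      using labelling_closed[OF lab, of "(i, s)"] labelling_closed[OF lab, of "(j, u)"] st' by (simp_all add: b_def B_def)
    have gc: "l (i, x) = b" "r (i, x) = b" if "s \<le> x" "x \<le> t" for x
      using segment_const[OF mvK' c sgL(1)[OF K'] g_nocut[OF K'] that] by (simp_all add: b_def)
    have h_nocut: "\<not> cut K' (j, x)" if "u < x" "x < w" for x using h_none[OF that] by (simp add: cut_def)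
    have hc: "l (j, x) = B" if "u \<le> x" "x \<le> w" for x
      using segment_const(1)[OF mvK' c sgL(2)[OF K'] h_nocut that] by (simp add: B_def)
    note ends = segment_end_labels[OF c sgL(2)[OF K']]
    have fin: "seg_l (f X b) (l (j, u)) G w = l (j, w)"
      using f_back[OF X cl] hc[of w] st by (simp add: B_def)
    obtain l' r' where lr: "labelling (ncomp K') (qcarrier X) l' r'"
      "\<And>p. fst p < ncomp K' \<Longrightarrow> p \<notin> open_seg ?h \<Longrightarrow> l' p = l p \<and> r' p = r p"
      "\<And>x. u \<le> x \<Longrightarrow> x \<le> w \<Longrightarrow> l' (j, x) = seg_l (f X b) (l (j, u)) G x \<and> r' (j, x) = seg_r (f X b) (l (j, u)) G x"
      using reglue_coloring[where f = "f X b", OF lab sgL(2)[OF K'] ends G f_closed[OF X cl(1)] fin] by metis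
    have on_g: "l' (i, x) = b \<and> r' (i, x) = b" if x: "s \<le> x" "x \<le> t" for x
    proof -
      have "(i, x) \<notin> open_seg ?h" using mem_closed_seg[of s x t i] x dj open_seg_subset[of ?h] by blast
      then show ?thesis using lr(2)[of "(i, x)"] st' gc[OF x] by simp
    qed
    have lab': "labelling (ncomp K) (qcarrier X) l' r'" using lr(1) same_ncomp by simp
    have "coloring A K X v l' r'"
    proof (rule sym.transfer_coloring[OF c lab'])
      show "l' p = l p \<and> r' p = r p" if "p \<in> points K'" "p \<notin> \<Union> (closed_seg ` {?g, ?h})" for p
        using lr(2)[of p] that open_seg_subset[of ?h] by (auto simp: points_def)
      show "l' (k, x) = r' (k, x)" if k: "(k, c1, c2) \<in> {?g, ?h}" "c1 \<le> x" "x \<le> c2" "\<not> cut K (k, x)" for k c1 c2 x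
      proof (cases "(k, c1, c2) = ?g")
        case True
        then show ?thesis using on_g[of x] k by simp
      next
        case False
        then have x: "k = j" "u \<le> x" "x \<le> w" using k by auto
        have "cut K (j, y1)" "cut K (j, y2)"
          using double_sym[OF d1(1)] double_sym[OF d2(1)] under unfolding cut_def crossing_def by auto
        then have "x \<notin> G" using k(4) x(1) by (auto simp: G_def)
        then show ?thesis using lr(3)[OF x(2,3)] seg_step_notin[of x G "f X b" "l (j, u)"] x by simp
      qed
      show "passes K X v l' r' q (k, x)"
        if k: "(k, c1, c2) \<in> {?g, ?h}" "c1 < x" "x < c2" "double K q (k, x)" "strand K (k, x) \<noteq> Over" for k c1 c2 x q
      proof (cases "(k, c1, c2) = ?g")
        case True
        then have x: "k = i" "s < x" "x < t" using k by simp_all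
        have "cut K (i, x)" using k(5) double_sym[OF k(4)] x(1) unfolding cut_def crossing_def by blast
        then show ?thesis using g_nocut[OF K x(2,3)] by blast
      next
        case False
        then have x: "k = j" "u < x" "x < w" using k by auto
        have d: "double K (j, x) q" using double_sym[OF k(4)] x(1) by simp
        obtain z where z: "same_point q (i, z)" "(x = y1 \<and> z = x1) \<or> (x = y2 \<and> z = x2)" using hK[OF x(2,3) d] by blast
        have xG: "x \<in> G" using z(2) by (auto simp: G_def)
        have step: "r' (j, x) = f X b x (l' (j, x))"
          using lr(3)[of x] x seg_step_in[OF G(1) xG, of "f X b" "l (j, u)"] by simp
        have "l' (i, z) = b" using on_g[of z] z(2) d1 d2 by auto
        then have "passes K X v l' r' (i, z) (j, x)"
          using step z(2) under y12 e2 by (auto simp: passes_def f_def e_def)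
        then show ?thesis
          using passes_cong[OF mvK lab' z(1) same_point_refl, of "(j, x)" X v] double_less[OF d] x(1) by simp
      qed
    qed
    then show "\<exists>l' r'. coloring A K X v l' r' \<and>
        (\<forall>p\<in>points K. p \<notin> \<Union> (open_seg ` {?g, ?h}) \<longrightarrow> l p = l' p \<and> r p = r' p)"
      using lr(2) same_ncomp unfolding points_def by fastforce
  next
    fix L v la ra lb rb k c1 c2 x and X :: "'v generator qterm set quandle"
    assume L: "L = K \<or> L = K'" and c: "coloring A L X v la ra" "coloring A L X v lb rb"
      and eq: "\<And>p. p \<in> points K \<Longrightarrow> p \<notin> \<Union> (open_seg ` {?g, ?h}) \<Longrightarrow> la p = lb p \<and> ra p = rb p"
      and k: "(k, c1, c2) \<in> {?g, ?h}" "c1 < x" "x < c2"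
    have iL: "i < ncomp L" "j < ncomp L" using sgL[OF L] by simp_all
    have start: "ra (i, s) = rb (i, s)" "ra (j, u) = rb (j, u)"
      using eq ends_off[OF gS] ends_off[OF hS] st unfolding points_def by simp_all
    have on_g: "la (i, x) = lb (i, x)" if "s < x" "x < t" for x
    proof (rule seg_agree(1)[OF c iL(1) st(2) start(1)])
      fix y q assume y: "s < y" "y < t" "double L q (i, y)" "strand L (i, y) = Under"
      have "cut L (i, y)" by (rule cutI[OF double_sym[OF y(3)]]) (simp add: y(4))
      then show "la q = lb q" using g_nocut[OF L y(1,2)] by blast
    qed (use that in simp_all)
    show "la (k, x) = lb (k, x)"
    proof (cases "(k, c1, c2) = ?g")
      case True
      then show ?thesis using on_g[of x] k by simp
    next
      case False
      then have x: "k = j" "u < x" "x < w" using k by auto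
      have "la (j, x) = lb (j, x)"
      proof (rule seg_agree(1)[OF c iL(2) st(4) start(2)])
        fix y q assume y: "u < y" "y < w" "double L q (j, y)" "strand L (j, y) = Under"
        have d: "double L (j, y) q" by (rule double_sym[OF y(3)])
        have LK: "L = K" using L h_none[OF y(1,2)] d unfolding crossing_def by blast
        obtain z where z: "same_point q (i, z)" "z = x1 \<or> z = x2" using hK[OF y(1,2)] d LK by blast
        have lab: "labelling (ncomp L) (qcarrier X) la ra" "labelling (ncomp L) (qcarrier X) lb rb"
          using c by (auto simp: coloring_def)
        have "fst q < ncomp L" using double_less[OF d] by simp
        then have "la q = la (i, z)" "lb q = lb (i, z)"
          using labelling_same_point(1)[OF lab(1) z(1)] labelling_same_point(1)[OF lab(2) z(1)] by simp_all
        then show "la q = lb q" using on_g[of z] z(2) d1 d2 by auto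
      qed (use x in simp_all)
      then show ?thesis using x(1) by simp
    qed
  qed
qed

definition under1 :: "'q quandle \<Rightarrow> bool \<Rightarrow> 'q \<Rightarrow> real \<Rightarrow> 'q \<Rightarrow> 'q" where
  "under1 X e b y z = act X e z b"

definition under2 :: "'q quandle \<Rightarrow> real \<Rightarrow> bool \<Rightarrow> bool \<Rightarrow> 'q \<Rightarrow> 'q \<Rightarrow> real \<Rightarrow> 'q \<Rightarrow> 'q" where
  "under2 X x e e' b M y z = (if y = x then act X e z b else act X e' z M)"

context disjoint_local_change
begin

context
  fixes L i1 s1 t1 i2 s2 t2 i3 s3 t3 x12 x21 x13 x31 x23 x32
  assumes L: "L = K \<or> L = K'" and S: "S = {(i1, s1, t1), (i2, s2, t2), (i3, s3, t3)}"
    and ne: "(i1, s1, t1) \<noteq> (i2, s2, t2)" "(i1, s1, t1) \<noteq> (i3, s3, t3)" "(i2, s2, t2) \<noteq> (i3, s3, t3)"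
    and tri: "triangle L (i1, s1, t1) (i2, s2, t2) (i3, s3, t3) x12 x21 x13 x31 x23 x32"
begin

lemma in_S: "(i1, s1, t1) \<in> S" "(i2, s2, t2) \<in> S" "(i3, s3, t3) \<in> S"
  by (simp_all add: S)

lemma triangle_meets:
  "meets L (i1, s1, t1) (i2, s2, t2) = {(x12, x21)}" "meets L (i1, s1, t1) (i3, s3, t3) = {(x13, x31)}"
  "meets L (i2, s2, t2) (i3, s3, t3) = {(x23, x32)}"
  using tri unfolding triangle_def by auto

lemma triangle_doubles:
  "double L (i1, x12) (i2, x21)" "s1 < x12" "x12 < t1" "s2 < x21" "x21 < t2"
  "double L (i1, x13) (i3, x31)" "s1 < x13" "x13 < t1" "s3 < x31" "x31 < t3"
  "double L (i2, x23) (i3, x32)" "s2 < x23" "x23 < t2" "s3 < x32" "x32 < t3"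
  using meets_double[OF L in_S(1,2) ne(1), of x12 x21] meets_double[OF L in_S(1,3) ne(2), of x13 x31]
    meets_double[OF L in_S(2,3) ne(3), of x23 x32] unfolding triangle_meets by simp_all

lemma triangle_strands:
  "strand L (i1, x12) = Over" "strand L (i1, x13) = Over" "strand L (i2, x23) = Over"
  "strand L (i2, x21) = Under" "strand L (i3, x31) = Under" "strand L (i3, x32) = Under"
proof -
  show o: "strand L (i1, x12) = Over" "strand L (i1, x13) = Over" "strand L (i2, x23) = Over"
    using tri unfolding triangle_def by simp_all
  have under: "strand L q = Under" if "double L p q" "strand L p = Over" for p q
    by (rule double_strands[OF mvL[OF L] that(1)]) (use that(2) in simp_all)
  show "strand L (i2, x21) = Under" "strand L (i3, x31) = Under" "strand L (i3, x32) = Under"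
    using under[OF triangle_doubles(1) o(1)] under[OF triangle_doubles(6) o(2)] under[OF triangle_doubles(11) o(3)] .
qed

lemma triangle_simple: "simple_on L (i1, s1, t1)" "simple_on L (i2, s2, t2)" "simple_on L (i3, s3, t3)"
  using tri unfolding triangle_def by blast+

lemma triangle_distinct: "x21 \<noteq> x23" "x31 \<noteq> x32"
proof -
  show "x21 \<noteq> x23"
  proof
    assume "x21 = x23"
    then have "double L (i2, x23) (i1, x12)" using double_sym[OF triangle_doubles(1)] by simp
    then have "same_point (i1, x12) (i3, x32)" using double_unique[OF mvL[OF L]] triangle_doubles(11) by blast
    then show False using not_same_point[OF in_S(1,3) ne(2), of x12 x32] triangle_doubles by simp
  qed
  show "x31 \<noteq> x32"
  proof
    assume "x31 = x32"
    then have "double L (i3, x32) (i1, x13)" using double_sym[OF triangle_doubles(6)] by simp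
    then have "same_point (i1, x13) (i2, x23)" using double_unique[OF mvL[OF L]] double_sym[OF triangle_doubles(11)] by blast
    then show False using not_same_point[OF in_S(1,2) ne(1), of x13 x23] triangle_doubles by simp
  qed
qed

lemma triangle_top:
  assumes "s1 < x" "x < t1"
  shows "\<not> cut L (i1, x)"
proof
  assume c: "cut L (i1, x)"
  then obtain q where q: "double L (i1, x) q" "strand L (i1, x) \<noteq> Over" by (auto simp: cut_def crossing_def)
  show False
  proof (rule segment_partner[OF L in_S(1) triangle_simple(1) assms q(1)])
    fix j u w y assume "(j, u, w) \<in> S" "(j, u, w) \<noteq> (i1, s1, t1)" "(x, y) \<in> meets L (i1, s1, t1) (j, u, w)"
    then have "x = x12 \<or> x = x13" using triangle_meets unfolding S by auto
    then show False using triangle_strands q(2) by auto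
  qed
qed

lemma triangle_middle:
  assumes y: "s2 < y" "y < t2" and d: "double L q (i2, y)" and s: "strand L (i2, y) \<noteq> Over"
  shows "y = x21 \<and> same_point q (i1, x12)"
proof -
  have d': "double L (i2, y) q" by (rule double_sym[OF d])
  show ?thesis
  proof (rule segment_partner[OF L in_S(2) triangle_simple(2) y d'])
    fix j u w z assume h: "(j, u, w) \<in> S" "(j, u, w) \<noteq> (i2, s2, t2)" "same_point q (j, z)"
      and m: "(y, z) \<in> meets L (i2, s2, t2) (j, u, w)"
    from h(1,2) consider "(j, u, w) = (i1, s1, t1)" | "(j, u, w) = (i3, s3, t3)" unfolding S by blast
    then show ?thesis
    proof cases
      case 1
      then have "(z, y) \<in> meets L (i1, s1, t1) (i2, s2, t2)" using m meets_sym by metis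
      then show ?thesis using h(3) 1 unfolding triangle_meets by auto
    next
      case 2
      then have "y = x23" using m triangle_meets by simp
      then show ?thesis using triangle_strands s by simp
    qed
  qed
qed

lemma triangle_bottom:
  assumes y: "s3 < y" "y < t3" and d: "double L q (i3, y)"
  shows "(y = x31 \<and> same_point q (i1, x13)) \<or> (y = x32 \<and> same_point q (i2, x23))"
proof -
  have d': "double L (i3, y) q" by (rule double_sym[OF d])
  show ?thesis
  proof (rule segment_partner[OF L in_S(3) triangle_simple(3) y d'])
    fix j u w z assume h: "(j, u, w) \<in> S" "(j, u, w) \<noteq> (i3, s3, t3)" "same_point q (j, z)"
      and m: "(y, z) \<in> meets L (i3, s3, t3) (j, u, w)"
    from h(1,2) consider "(j, u, w) = (i1, s1, t1)" | "(j, u, w) = (i2, s2, t2)" unfolding S by blast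
    then show ?thesis
    proof cases
      case 1
      then have "(z, y) \<in> meets L (i1, s1, t1) (i3, s3, t3)" using m meets_sym by metis
      then show ?thesis using h(3) 1 unfolding triangle_meets by auto
    next
      case 2
      then have "(z, y) \<in> meets L (i2, s2, t2) (i3, s3, t3)" using m meets_sym by metis
      then show ?thesis using h(3) 2 unfolding triangle_meets by auto
    qed
  qed
qed

lemma triangle_unique:
  assumes c: "coloring A L X v la ra" "coloring A L X v lb rb"
    and start: "ra (i1, s1) = rb (i1, s1)" "ra (i2, s2) = rb (i2, s2)" "ra (i3, s3) = rb (i3, s3)"
    and g: "(k, a, b) \<in> S" "a < x" "x < b"
  shows "la (k, x) = lb (k, x)"
proof -
  have sg: "is_segment L (i1, s1, t1)" "is_segment L (i2, s2, t2)" "is_segment L (i3, s3, t3)"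
    using segL[OF L] in_S by blast+
  have same: "la q = lb q" if "same_point q p" "la p = lb p" "fst q < ncomp L" for p q
    using labelling_same_point(1)[of "ncomp L" "qcarrier X" la ra q p]
      labelling_same_point(1)[of "ncomp L" "qcarrier X" lb rb q p] c that by (simp add: coloring_def)
  have 1: "la (i1, x) = lb (i1, x)" if "s1 < x" "x < t1" for x
  proof (rule seg_agree(1)[OF c _ _ start(1)])
    fix y q assume y: "s1 < y" "y < t1" "double L q (i1, y)" "strand L (i1, y) = Under"
    have "cut L (i1, y)" by (rule cutI[OF double_sym[OF y(3)]]) (simp add: y(4))
    then show "la q = lb q" using triangle_top[OF y(1,2)] by blast
  qed (use that sg in simp_all)
  have 2: "la (i2, x) = lb (i2, x)" if "s2 < x" "x < t2" for x
  proof (rule seg_agree(1)[OF c _ _ start(2)])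
    fix y q assume y: "s2 < y" "y < t2" "double L q (i2, y)" "strand L (i2, y) = Under"
    have "same_point q (i1, x12)" using triangle_middle[OF y(1-3)] y(4) by simp
    then show "la q = lb q" using same 1[OF triangle_doubles(2,3)] double_less[OF y(3)] by blast
  qed (use that sg in simp_all)
  have 3: "la (i3, x) = lb (i3, x)" if "s3 < x" "x < t3" for x
  proof (rule seg_agree(1)[OF c _ _ start(3)])
    fix y q assume y: "s3 < y" "y < t3" "double L q (i3, y)" "strand L (i3, y) = Under"
    have "same_point q (i1, x13) \<or> same_point q (i2, x23)" using triangle_bottom[OF y(1-3)] by blast
    then show "la q = lb q"
      using same 1[OF triangle_doubles(7,8)] 2[OF triangle_doubles(12,13)] double_less[OF y(3)] by blast
  qed (use that sg in simp_all)
  show ?thesis using g 1 2 3 unfolding S by auto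
qed

abbreviation "e12 \<equiv> 0 < det2 (tangent L (i1, x12)) (tangent L (i2, x21))"
abbreviation "e13 \<equiv> 0 < det2 (tangent L (i1, x13)) (tangent L (i3, x31))"
abbreviation "e23 \<equiv> 0 < det2 (tangent L (i2, x23)) (tangent L (i3, x32))"

lemma triangle_labels:
  assumes c: "coloring A L X v l r"
  defines "b \<equiv> l (i1, s1)" and "M \<equiv> l (i2, x23)"
  shows "s1 \<le> x \<Longrightarrow> x \<le> t1 \<Longrightarrow> l (i1, x) = b \<and> r (i1, x) = b"
    "s2 < x \<Longrightarrow> x \<le> t2 \<Longrightarrow> l (i2, x) = seg_l (under1 X e12 b) (l (i2, s2)) {x21} x"
    "s3 < x \<Longrightarrow> x \<le> t3 \<Longrightarrow> l (i3, x) = seg_l (under2 X x31 e13 e23 b M) (l (i3, s3)) {x31, x32} x"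
proof -
  have sg: "is_segment L (i1, s1, t1)" "is_segment L (i2, s2, t2)" "is_segment L (i3, s3, t3)"
    using segL[OF L] in_S by blast+
  have pass: "passes L X v l r p q" if "double L p q" "strand L q = Under" for p q
  proof -
    have "strand L q \<noteq> Over" using that(2) by simp
    then show ?thesis using c that(1) unfolding coloring_def by blast
  qed
  have 1: "l (i1, x) = b \<and> r (i1, x) = b" if "s1 \<le> x" "x \<le> t1" for x
    using segment_const[OF mvL[OF L] c sg(1) triangle_top that] by (simp add: b_def)
  then show "s1 \<le> x \<Longrightarrow> x \<le> t1 \<Longrightarrow> l (i1, x) = b \<and> r (i1, x) = b" .
  have M: "l (i2, x23) = M" by (simp add: M_def)
  note td = triangle_doubles and ts = triangle_strands
  have b2: "l (i1, x12) = b" "l (i1, x13) = b" using 1[of x12] 1[of x13] td by simp_all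
  have p2: "r (i2, y) = under1 X e12 b y (l (i2, y))" if "y \<in> {x21}" for y
    using pass[OF td(1) ts(4)] that ts(4) b2 by (simp add: passes_def under1_def)
  have n2: "\<not> cut L (i2, y)" if "s2 < y" "y < t2" "y \<notin> {x21}" for y
    using triangle_middle[OF that(1,2)] that(3) double_sym unfolding cut_def crossing_def by blast
  show "l (i2, x) = seg_l (under1 X e12 b) (l (i2, s2)) {x21} x" if "s2 < x" "x \<le> t2"
    using coloring_seg_value(1)[where f = "under1 X e12 b" and G = "{x21}" and s = s2 and t = t2 and i = i2, OF c _ _ _ _ n2 p2, of x]
      that sg(2) td segment_end_labels[OF c sg(2)] by simp
  have p3: "r (i3, y) = under2 X x31 e13 e23 b M y (l (i3, y))" if "y \<in> {x31, x32}" for y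
    using pass[OF td(6) ts(5)] pass[OF td(11) ts(6)] that ts(5,6) b2 M triangle_distinct(2)
    by (auto simp: passes_def under2_def)
  have n3: "\<not> cut L (i3, y)" if "s3 < y" "y < t3" "y \<notin> {x31, x32}" for y
    using triangle_bottom[OF that(1,2)] that(3) double_sym unfolding cut_def crossing_def by blast
  show "l (i3, x) = seg_l (under2 X x31 e13 e23 b M) (l (i3, s3)) {x31, x32} x" if "s3 < x" "x \<le> t3"
    using coloring_seg_value(1)[where f = "under2 X x31 e13 e23 b M" and G = "{x31, x32}" and s = s3 and t = t3 and i = i3, OF c _ _ _ _ n3 p3, of x]
      that sg(3) td segment_end_labels[OF c sg(3)] by simp
qed

lemma seg_under2:
  assumes "x31 < w" "x32 < w"
  shows "seg_l (under2 X x31 e13 e23 b M) B {x31, x32} w = (if x31 < x32 then act X e23 (act X e13 B b) M else act X e13 (act X e23 B M) b)"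
proof (cases "x31 < x32")
  case True
  then show ?thesis using seg_two[OF True assms(2), of "under2 X x31 e13 e23 b M" B] by (simp add: under2_def)
next
  case False
  then have "x32 < x31" using triangle_distinct(2) by simp
  from seg_two[OF this assms(1), of "under2 X x31 e13 e23 b M" B] show ?thesis
    using False triangle_distinct(2) by (simp add: under2_def insert_commute)
qed

end

lemma sum_single_below:
  fixes c :: real
  shows "(\<Sum>(p, q)\<in>{(p, q) \<in> {(a, b)}. q < c}. F p q) = (if b < c then F a b else (0::real))"
proof (cases "b < c")
  case True
  then have e: "{(p, q) \<in> {(a, b)}. q < c} = {(a, b)}" by auto
  show ?thesis unfolding e using True by simp
next
  case False
  then have e: "{(p, q) \<in> {(a, b)}. q < c} = {}" by auto
  show ?thesis unfolding e using False by simp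
qed

lemma R3_transfer:
  assumes S: "S = {(i1, s1, t1), (i2, s2, t2), (i3, s3, t3)}"
    and ne: "(i1, s1, t1) \<noteq> (i2, s2, t2)" "(i1, s1, t1) \<noteq> (i3, s3, t3)" "(i2, s2, t2) \<noteq> (i3, s3, t3)"
    and tri: "triangle K (i1, s1, t1) (i2, s2, t2) (i3, s3, t3) x12 x21 x13 x31 x23 x32"
    and tri': "triangle K' (i1, s1, t1) (i2, s2, t2) (i3, s3, t3) y12 y21 y13 y31 y23 y32"
    and order: "x21 < x23 \<longleftrightarrow> y23 < y21" "x31 < x32 \<longleftrightarrow> y32 < y31"
    and c: "coloring A K X v l r"
  shows "\<exists>l' r'. coloring A K' X v l' r' \<and> (\<forall>p\<in>points K. p \<notin> \<Union> (open_seg ` S) \<longrightarrow> l' p = l p \<and> r' p = r p)"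
proof -
  let ?g1 = "(i1, s1, t1)" and ?g2 = "(i2, s2, t2)" and ?g3 = "(i3, s3, t3)"
  have LK: "K = K \<or> K = K'" and LK': "K' = K \<or> K' = K'" by simp_all
  note T = LK S ne tri and T' = LK' S ne tri'
  note inS = in_S[OF T]
  note td = triangle_doubles[OF T] and td' = triangle_doubles[OF T']
  note ts' = triangle_strands[OF T']
  note tm = triangle_meets[OF T] and tm' = triangle_meets[OF T']
  note dist' = triangle_distinct[OF T'] and dist = triangle_distinct[OF T]
  have sg: "is_segment L ?g1" "is_segment L ?g2" "is_segment L ?g3" if "L = K \<or> L = K'" for L
    using segL[OF that] inS by blast+
  define d12 where "d12 = det2 (tangent K (i1, x12)) (tangent K (i2, x21))"
  define d13 where "d13 = det2 (tangent K (i1, x13)) (tangent K (i3, x31))"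
  define d23 where "d23 = det2 (tangent K (i2, x23)) (tangent K (i3, x32))"
  define f12 where "f12 = det2 (tangent K' (i1, y12)) (tangent K' (i2, y21))"
  define f13 where "f13 = det2 (tangent K' (i1, y13)) (tangent K' (i3, y31))"
  define f23 where "f23 = det2 (tangent K' (i2, y23)) (tangent K' (i3, y32))"
  have sgn: "sgn d12 = sgn f12" "sgn d13 = sgn f13" "sgn d23 = sgn f23"
    using crossing_sum_invariant[OF inS(1,2) ne(1)] crossing_sum_invariant[OF inS(1,3) ne(2)]
      crossing_sum_invariant[OF inS(2,3) ne(3)]
    unfolding crossing_sum_def tm tm' by (simp_all add: d12_def d13_def d23_def f12_def f13_def f23_def)
  have same: "0 < f12 \<longleftrightarrow> 0 < d12" "0 < f13 \<longleftrightarrow> 0 < d13" "0 < f23 \<longleftrightarrow> 0 < d23"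
    using sgn by (metis sgn_1_pos)+
  have nz: "d12 \<noteq> 0" "d13 \<noteq> 0"
    using double_det[OF mvK td(1)] double_det[OF mvK td(6)] by (simp_all add: d12_def d13_def)
  have orders: "y21 < y23 \<longleftrightarrow> \<not> x21 < x23" "y31 < y32 \<longleftrightarrow> \<not> x31 < x32"
    using order dist' by linarith+
  have "(if x21 < x23 then sgn d12 else 0) - (if x31 < x32 then sgn d13 else 0) =
      (if y21 < y23 then sgn f12 else 0) - (if y31 < y32 then sgn f13 else 0)"
  proof -
    have m: "(x23, x32) \<in> meets K ?g2 ?g3" "(y23, y32) \<in> meets K' ?g2 ?g3" unfolding tm tm' by simp_all
    show ?thesis
      using half_sum_invariant[OF inS ne m] unfolding tm tm' sum_single_below
      by (simp only: d12_def d13_def f12_def f13_def)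
  qed
  then have key: "(0 < d12 \<longleftrightarrow> 0 < d13) \<longleftrightarrow> (x21 < x23 \<longleftrightarrow> x31 < x32)"
    unfolding orders sgn[symmetric] using nz by (auto simp: sgn_if split: if_splits)
  have X: "is_quandle X" and lab: "labelling (ncomp K) (qcarrier X) l r"
    using c by (auto simp: coloring_def variables_def)
  define b where "b = l (i1, s1)"
  define B2 where "B2 = l (i2, s2)"
  define B3 where "B3 = l (i3, s3)"
  define M where "M = l (i2, x23)"
  have less: "i1 < ncomp K" "i2 < ncomp K" "i3 < ncomp K" "s2 < t2" "s3 < t3" "s1 < t1" using sg[OF LK] by simp_all
  have cl: "b \<in> qcarrier X" "B2 \<in> qcarrier X" "B3 \<in> qcarrier X" "M \<in> qcarrier X"
    using labelling_closed[OF lab, of "(i1, s1)"] labelling_closed[OF lab, of "(i2, s2)"]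
      labelling_closed[OF lab, of "(i3, s3)"] labelling_closed[OF lab, of "(i2, x23)"] less
    by (simp_all add: b_def B2_def B3_def M_def)
  note labels = triangle_labels[OF T c, folded d12_def d13_def d23_def b_def B2_def B3_def M_def]
  define M' where "M' = (if y21 < y23 then act X (0 < d12) B2 b else B2)"
  have M: "M = (if x21 < x23 then act X (0 < d12) B2 b else B2)"
    using labels(2)[of x23] td unfolding seg_one by (simp add: M_def under1_def)
  have M'c: "M' \<in> qcarrier X" using act_closed[OF X cl(2,1)] cl by (simp add: M'_def)
  have E2: "l (i2, t2) = act X (0 < d12) B2 b"
    using labels(2)[of t2] td less unfolding seg_one by (simp add: under1_def)
  have E3: "l (i3, t3) = (if x31 < x32 then act X (0 < d23) (act X (0 < d13) B3 b) M
      else act X (0 < d13) (act X (0 < d23) B3 M) b)"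
    using labels(3)[of t3] seg_under2[OF T, of t3 X b M B3, folded d13_def d23_def] td less by simp
  have MM: "M = act X (0 < d13) M' b" if "x31 < x32"
    using that key orders M M'_def act_cancel(1)[OF X cl(2,1), of "0 < d12"] by (cases "x21 < x23") auto
  have MM': "M' = act X (0 < d13) M b" if "\<not> x31 < x32"
    using that key orders M M'_def act_cancel(1)[OF X cl(2,1), of "0 < d12"] by (cases "x21 < x23") auto
  define f2 where "f2 = under1 X (0 < d12) b"
  define f3 where "f3 = under2 X y31 (0 < d13) (0 < d23) b M'"
  have f2_closed: "f2 y z \<in> qcarrier X" if "z \<in> qcarrier X" for y z
    unfolding f2_def under1_def by (rule act_closed[OF X that cl(1)])
  have f3_closed: "f3 y z \<in> qcarrier X" if "z \<in> qcarrier X" for y z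
    unfolding f3_def under2_def using act_closed[OF X that cl(1)] act_closed[OF X that M'c] by simp
  have E3': "seg_l f3 B3 {y31, y32} t3 = l (i3, t3)"
  proof -
    have "seg_l f3 B3 {y31, y32} t3 = (if y31 < y32 then act X (0 < d23) (act X (0 < d13) B3 b) M'
      else act X (0 < d13) (act X (0 < d23) B3 M') b)"
      using seg_under2[OF T', of t3 X b M' B3, folded f13_def f23_def, unfolded same] td' by (simp add: f3_def)
    also have "\<dots> = l (i3, t3)"
      using MM MM' act_distrib[OF X cl(3) M'c cl(1), of "0 < d13" "0 < d23"]
        act_distrib[OF X cl(3,4,1), of "0 < d13" "0 < d23"] unfolding E3 orders by (cases "x31 < x32") simp_all
    finally show ?thesis .
  qed
  have lab': "labelling (ncomp K') (qcarrier X) l r" using lab same_ncomp by simp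
  have fin2: "seg_l f2 (l (i2, s2)) {y21} t2 = l (i2, t2)"
    unfolding seg_one using td' E2 by (simp add: f2_def under1_def B2_def)
  have G2: "finite {y21}" "{y21} \<subseteq> {s2<..<t2}" and G3: "finite {y31, y32}" "{y31, y32} \<subseteq> {s3<..<t3}"
    using td' by simp_all
  obtain l1 r1 where lr1: "labelling (ncomp K') (qcarrier X) l1 r1"
    "\<And>p. fst p < ncomp K' \<Longrightarrow> p \<notin> open_seg ?g2 \<Longrightarrow> l1 p = l p \<and> r1 p = r p"
    "\<And>x. s2 \<le> x \<Longrightarrow> x \<le> t2 \<Longrightarrow> l1 (i2, x) = seg_l f2 (l (i2, s2)) {y21} x \<and> r1 (i2, x) = seg_r f2 (l (i2, s2)) {y21} x"
  proof (rule reglue_coloring[where f = f2 and G = "{y21}" and l = l and r = r,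
          OF lab' sg(2)[OF LK'] segment_end_labels[OF c sg(2)[OF LK]] G2 _ fin2], goal_cases)
    case (2 l' r')
    show thesis by (rule 2(1)[OF 2(2) 2(3) 2(4)])
  qed (rule f2_closed)
  have off: "(i, x) \<notin> open_seg h" if "(i, s, t) \<in> S" "h \<in> S" "h \<noteq> (i, s, t)" "s \<le> x" "x \<le> t" for i s t h x
    using disj[OF that(1,2) that(3)[symmetric]] mem_closed_seg[OF that(4,5), of i] open_seg_subset[of h] by blast
  have less': "i1 < ncomp K'" "i2 < ncomp K'" "i3 < ncomp K'" using sg[OF LK'] by simp_all
  have off3: "l1 (i3, x) = l (i3, x)" "r1 (i3, x) = r (i3, x)" if "s3 \<le> x" "x \<le> t3" for x
    using lr1(2)[of "(i3, x)"] off[OF inS(3) inS(2) ne(3) that] less' by simp_all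
  have ends3: "l1 (i3, s3) = r1 (i3, s3)" "l1 (i3, t3) = r1 (i3, t3)"
    using off3[of s3] off3[of t3] less segment_end_labels[OF c sg(3)[OF LK]] by simp_all
  have fin3: "seg_l f3 (l1 (i3, s3)) {y31, y32} t3 = l1 (i3, t3)"
    using E3' off3[of s3] off3[of t3] less by (simp add: B3_def)
  obtain l2 r2 where lr2: "labelling (ncomp K') (qcarrier X) l2 r2"
    "\<And>p. fst p < ncomp K' \<Longrightarrow> p \<notin> open_seg ?g3 \<Longrightarrow> l2 p = l1 p \<and> r2 p = r1 p"
    "\<And>x. s3 \<le> x \<Longrightarrow> x \<le> t3 \<Longrightarrow> l2 (i3, x) = seg_l f3 (l1 (i3, s3)) {y31, y32} x \<and> r2 (i3, x) = seg_r f3 (l1 (i3, s3)) {y31, y32} x"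
  proof (rule reglue_coloring[where f = f3 and G = "{y31, y32}" and l = l1 and r = r1,
          OF lr1(1) sg(3)[OF LK'] ends3 G3 _ fin3], goal_cases)
    case (2 l' r')
    show thesis by (rule 2(1)[OF 2(2) 2(3) 2(4)])
  qed (rule f3_closed)
  have on1: "l2 (i1, x) = b \<and> r2 (i1, x) = b" if x: "s1 \<le> x" "x \<le> t1" for x
    using lr2(2)[of "(i1, x)"] lr1(2)[of "(i1, x)"] off[OF inS(1) inS(3) ne(2)[symmetric] x]
      off[OF inS(1) inS(2) ne(1)[symmetric] x] labels(1)[OF x] less' by simp
  have on2: "l2 (i2, x) = seg_l f2 B2 {y21} x \<and> r2 (i2, x) = seg_r f2 B2 {y21} x" if x: "s2 \<le> x" "x \<le> t2" for x
    using lr2(2)[of "(i2, x)"] lr1(3)[OF x] off[OF inS(2) inS(3) ne(3)[symmetric] x] less'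
    by (simp add: B2_def)
  have on3: "l2 (i3, x) = seg_l f3 (l1 (i3, s3)) {y31, y32} x \<and> r2 (i3, x) = seg_r f3 (l1 (i3, s3)) {y31, y32} x"
    if x: "s3 \<le> x" "x \<le> t3" for x by (rule lr2(3)[OF x])
  have offS: "l2 p = l p \<and> r2 p = r p" if "p \<in> points K" "p \<notin> \<Union> (open_seg ` S)" for p
    using lr1(2)[of p] lr2(2)[of p] that same_ncomp inS unfolding points_def by auto
  have "coloring A K' X v l2 r2"
  proof (rule transfer_coloring[OF c lr2(1)])
    show "l2 p = l p \<and> r2 p = r p" if "p \<in> points K" "p \<notin> \<Union> (closed_seg ` S)" for p
      using offS[OF that(1)] that(2) open_seg_subset by blast
    fix k a a' x assume k: "(k, a, a') \<in> S"
    consider (1) "k = i1" "a = s1" "a' = t1" | (2) "k = i2" "a = s2" "a' = t2" | (3) "k = i3" "a = s3" "a' = t3"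
      using k unfolding S by auto
    note cs = this
    show "l2 (k, x) = r2 (k, x)" if x: "a \<le> x" "x \<le> a'" "\<not> cut K' (k, x)"
    proof (rule cs)
      assume "k = i1" "a = s1" "a' = t1"
      then show ?thesis using on1[of x] x by simp
    next
      assume e: "k = i2" "a = s2" "a' = t2"
      have "cut K' (i2, y21)" by (rule cutI[OF double_sym[OF td'(1)]]) (simp add: ts')
      then have "x \<notin> {y21}" using x(3) e by auto
      then show ?thesis using on2[of x] x e seg_step_notin[of x "{y21}" f2 B2] by simp
    next
      assume e: "k = i3" "a = s3" "a' = t3"
      have "cut K' (i3, y31)" "cut K' (i3, y32)"
        by (rule cutI[OF double_sym[OF td'(6)]], simp add: ts', rule cutI[OF double_sym[OF td'(11)]], simp add: ts')
      then have "x \<notin> {y31, y32}" using x(3) e by auto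
      then show ?thesis using on3[of x] x e seg_step_notin[of x "{y31, y32}" f3 "l1 (i3, s3)"] by simp
    qed
    fix q assume x: "a < x" "x < a'" and d: "double K' q (k, x)" and so: "strand K' (k, x) \<noteq> Over"
    have q: "fst q < ncomp K'" "fst (k, x) < ncomp K'" using double_less[OF d] by simp_all
    have by_rep: "passes K' X v l2 r2 q (k, x)" if "same_point q p" "passes K' X v l2 r2 p (k, x)" for p
      using passes_cong[OF mvK' lr2(1) that(1) same_point_refl q] that(2) by blast
    show "passes K' X v l2 r2 q (k, x)"
    proof (rule cs)
      assume e: "k = i1" "a = s1" "a' = t1"
      have "cut K' (i1, x)" using cutI[OF double_sym[OF d] so] e by simp
      then show ?thesis using triangle_top[OF T'] x e by blast
    next
      assume e: "k = i2" "a = s2" "a' = t2"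
      have m: "x = y21" "same_point q (i1, y12)" using triangle_middle[OF T', of x q] x d so e by simp_all
      have "r2 (i2, y21) = f2 y21 (l2 (i2, y21))"
        using on2[of y21] td' seg_step_in[OF G2(1), of y21 f2 B2] by simp
      then have "passes K' X v l2 r2 (i1, y12) (i2, y21)"
        using on1[of y12] td' ts' by (simp add: passes_def f2_def under1_def same(1)[unfolded f12_def])
      then show ?thesis using by_rep m e by simp
    next
      assume e: "k = i3" "a = s3" "a' = t3"
      have step: "r2 (i3, y) = f3 y (l2 (i3, y))" if "y \<in> {y31, y32}" for y
        using on3[of y] that td' seg_step_in[OF G3(1) that, of f3 "l1 (i3, s3)"] by auto
      have "l2 (i2, y23) = M'"
        using on2[of y23] td' unfolding seg_one by (simp add: f2_def under1_def M'_def)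
      then have "passes K' X v l2 r2 (i1, y13) (i3, y31)" "passes K' X v l2 r2 (i2, y23) (i3, y32)"
        using step[of y31] step[of y32] on1[of y13] td' ts' dist'
        by (simp_all add: passes_def f3_def under2_def same(2)[unfolded f13_def] same(3)[unfolded f23_def])
      moreover have "(x = y31 \<and> same_point q (i1, y13)) \<or> (x = y32 \<and> same_point q (i2, y23))"
        using triangle_bottom[OF T', of x q] x d e by simp
      ultimately show ?thesis using by_rep e by blast
    qed
  qed
  then show ?thesis using offS by blast
qed

end

lemma R3_iso:
  fixes A :: "'v set" and K K' :: "'v diagram"
  assumes "R3 A K K'"
  shows "quandle_iso (mv_quandle A K) (mv_quandle A K')"
proof -
  obtain g1 g2 g3 x12 x21 x13 x31 x23 x32 y12 y21 y13 y31 y23 y32 where lc: "local_change A {g1, g2, g3} K K'"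
     and dj: "closed_seg g1 \<inter> closed_seg g2 = {}" "closed_seg g1 \<inter> closed_seg g3 = {}"
     "closed_seg g2 \<inter> closed_seg g3 = {}"
     and tr: "triangle K g1 g2 g3 x12 x21 x13 x31 x23 x32" "triangle K' g1 g2 g3 y12 y21 y13 y31 y23 y32"
     and ord: "x12 < x13 \<longleftrightarrow> y13 < y12" "x21 < x23 \<longleftrightarrow> y23 < y21" "x31 < x32 \<longleftrightarrow> y32 < y31"
    using assms unfolding R3_def by blast
  obtain i1 s1 t1 i2 s2 t2 i3 s3 t3 where g: "g1 = (i1, s1, t1)" "g2 = (i2, s2, t2)" "g3 = (i3, s3, t3)"
    by (cases g1; cases g2; cases g3)
  define S where "S = {g1, g2, g3}"
  have lcS: "local_change A S K K'" "local_change A S K' K"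
    using lc local_change_sym unfolding S_def by blast+
  have nonempty: "closed_seg h \<noteq> {}" if "h \<in> S" for h
  proof -
    have "is_segment K h" using lcS(1) that by (auto simp: local_change_def)
    moreover obtain i s t where "h = (i, s, t)" by (cases h)
    ultimately show ?thesis using mem_closed_seg[of s s t i] by auto
  qed
  have ne: "g1 \<noteq> g2" "g1 \<noteq> g3" "g2 \<noteq> g3"
    using dj nonempty[of g1] nonempty[of g2] nonempty[of g3] by (auto simp: S_def)
  have disj: "closed_seg g \<inter> closed_seg h = {}" if "g \<in> S" "h \<in> S" "g \<noteq> h" for g h
    using that dj unfolding S_def by auto
  interpret disjoint_local_change A S K K'
    by unfold_locales (use lcS disj in \<open>simp_all add: S_def\<close>)
  interpret sym: disjoint_local_change A S K' K
    by unfold_locales (use lcS disj in \<open>simp_all add: S_def\<close>)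
  note S' = S_def[unfolded g] and ne' = ne[unfolded g] and tr' = tr[unfolded g]
  have LK: "K = K \<or> K = K'" and LK': "K' = K \<or> K' = K'" by simp_all
  have ord': "y21 < y23 \<longleftrightarrow> x23 < x21" "y31 < y32 \<longleftrightarrow> x32 < x31"
    using ord triangle_distinct[OF LK S' ne' tr'(1)] triangle_distinct[OF LK' S' ne' tr'(2)] by linarith+
  show ?thesis
  proof (rule iso_local)
    show "\<exists>l' r'. coloring A K' X v l' r' \<and> (\<forall>p\<in>points K. p \<notin> \<Union> (open_seg ` S) \<longrightarrow> l' p = l p \<and> r' p = r p)"
      if "coloring A K X v l r" for v l r and X :: "'v generator qterm set quandle"
      by (rule R3_transfer[OF S' ne' tr' ord(2,3) that])
    show "\<exists>l r. coloring A K X v l r \<and> (\<forall>p\<in>points K. p \<notin> \<Union> (open_seg ` S) \<longrightarrow> l' p = l p \<and> r' p = r p)"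
      if "coloring A K' X v l' r'" for v l' r' and X :: "'v generator qterm set quandle"
      using sym.R3_transfer[OF S' ne' tr'(2,1) ord' that] same_points by metis
    fix L v la ra lb rb i s t x and X :: "'v generator qterm set quandle"
    assume L: "L = K \<or> L = K'" and c: "coloring A L X v la ra" "coloring A L X v lb rb"
      and eq: "\<And>p. p \<in> points K \<Longrightarrow> p \<notin> \<Union> (open_seg ` S) \<Longrightarrow> la p = lb p \<and> ra p = rb p"
      and x: "(i, s, t) \<in> S" "s < x" "x < t"
    have start: "ra (j, u) = rb (j, u)" if "(j, u, w) \<in> S" for j u w
      using eq[of "(j, u)"] ends_off[OF that] seg[OF that] by (simp add: points_def)
    obtain z12 z21 z13 z31 z23 z32 where "triangle L g1 g2 g3 z12 z21 z13 z31 z23 z32" using L tr by metis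
    note tL = this[unfolded g]
    have inS: "(i1, s1, t1) \<in> S" "(i2, s2, t2) \<in> S" "(i3, s3, t3) \<in> S" by (simp_all add: S')
    show "la (i, x) = lb (i, x)"
      by (rule triangle_unique[OF L S' ne' tL c start[OF inS(1)] start[OF inS(2)] start[OF inS(3)] x])
  qed
qed

lemma reidemeister_iso:
  assumes "reidemeister_move A K K'"
  shows "quandle_iso (mv_quandle A K) (mv_quandle A K')"
proof -
  have "quandle_iso (mv_quandle A K) (mv_quandle A K')" if "quandle_iso (mv_quandle A K') (mv_quandle A K)"
    by (rule quandle_iso_sym[OF mv_is_quandle that])
  then show ?thesis
    using assms R1_iso R2_iso R3_iso unfolding reidemeister_move_def by metis
qed

section \<open>Detour moves\<close>

lemma seg_qpow:
  assumes X: "is_quandle X" and v: "v \<in> qcarrier X" and B: "B \<in> qcarrier X" and G: "finite G"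
    and f: "\<And>x z. x \<in> G \<Longrightarrow> z \<in> qcarrier X \<Longrightarrow> f x z = qpow X v (a x) z"
  shows "seg_l f B G w = qpow X v (\<Sum>x\<in>{x \<in> G. x < w}. a x) B"
proof -
  have "fold f xs B = qpow X v (sum_list (map a xs)) B" if "set xs \<subseteq> G" "B \<in> qcarrier X" for xs B
    using that
  proof (induction xs arbitrary: B)
    case (Cons x xs)
    have "fold f (x # xs) B = fold f xs (qpow X v (a x) B)" using Cons.prems f by simp
    also have "\<dots> = qpow X v (sum_list (map a xs)) (qpow X v (a x) B)"
      using Cons.prems by (intro Cons.IH qpow_closed X v) auto
    also have "\<dots> = qpow X v (sum_list (map a xs) + a x) B"
      by (rule qpow_add[OF X Cons.prems(2) v, symmetric])
    also have "sum_list (map a xs) + a x = sum_list (map a (x # xs))" by simp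
    finally show ?case .
  qed simp
  from this[of "sorted_list_of_set {x \<in> G. x < w}" B] show ?thesis
    using G B unfolding seg_l_def by (simp add: sum_list_distinct_conv_sum_set)
qed

definition crossing_sign :: "'v diagram \<Rightarrow> point \<Rightarrow> int" where
  "crossing_sign L p = (if 0 < det2 (tangent L (SOME q. double L q p)) (tangent L p) then 1 else -1)"

definition seg_sign :: "'v diagram \<Rightarrow> segment \<Rightarrow> point \<Rightarrow> int" where
  "seg_sign L g p = (if \<exists>q\<in>closed_seg g. double L q p then crossing_sign L p else 0)"

definition total_sign :: "'v diagram \<Rightarrow> segment \<Rightarrow> int" where
  "total_sign L g = (\<Sum>x\<in>{x. fst (snd g) < x \<and> x < snd (snd g) \<and> crossing L (fst g, x)}. crossing_sign L (fst g, x))"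

lemma crossing_sign_eq:
  assumes L: "mv_diagram A L" and d: "double L q p"
  shows "crossing_sign L p = (if 0 < det2 (tangent L q) (tangent L p) then 1 else -1)"
proof -
  have d': "double L (SOME q. double L q p) p" using d by (rule someI)
  have "same_point (SOME q. double L q p) q"
    by (rule double_unique[OF L double_sym[OF d'] double_sym[OF d]])
  then have "tangent L (SOME q. double L q p) = tangent L q"
    using same_point_cong(3)[OF L] double_less(1)[OF d'] by blast
  then show ?thesis by (simp add: crossing_sign_def)
qed

lemma det2_antisym: "det2 x y = - det2 y x"
  by (simp add: det2_def)

lemma crossing_sign_antisym:
  assumes L: "mv_diagram A L" and d: "double L p q"
  shows "crossing_sign L p = - crossing_sign L q"
  using crossing_sign_eq[OF L d] crossing_sign_eq[OF L double_sym[OF d]] double_det[OF L d]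
    det2_antisym[of "tangent L p" "tangent L q"] by auto

lemma crossing_sign_sgn:
  assumes L: "mv_diagram A L" and d: "double L q p"
  shows "of_int (crossing_sign L p) = sgn (det2 (tangent L q) (tangent L p))"
  using crossing_sign_eq[OF L d] double_det[OF L d] by (auto simp: sgn_if)

lemma seg_sign_eq: "double L q p \<Longrightarrow> q \<in> closed_seg g \<Longrightarrow> seg_sign L g p = crossing_sign L p"
  by (auto simp: seg_sign_def)

text \<open>A twist assigns to the points off the segment \<open>g\<close> exponents that jump by the sign at each
  crossing with \<open>g\<close>, positively in \<open>K\<close> and negatively in \<open>K'\<close>, and agree on the two strands at
  every other crossing.\<close>

definition twist :: "'v diagram \<Rightarrow> 'v diagram \<Rightarrow> nat \<Rightarrow> real \<Rightarrow> real \<Rightarrow> (point \<Rightarrow> int) \<Rightarrow> (point \<Rightarrow> int) \<Rightarrow> bool" where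
  "twist K K' i s t Nl Nr \<longleftrightarrow>
     (\<forall>j x. j < ncomp K \<longrightarrow> Nl (j, x + 1) = Nl (j, x) \<and> Nr (j, x + 1) = Nr (j, x)) \<and>
     (\<forall>j x. j < ncomp K \<longrightarrow> (\<forall>k::int. j = i \<longrightarrow> \<not> (s < x + of_int k \<and> x + of_int k \<le> t)) \<longrightarrow>
        left_ok (\<lambda>y. Nl (j, y)) (\<lambda>y. Nr (j, y)) x) \<and>
     (\<forall>j x. j < ncomp K \<longrightarrow> (\<forall>k::int. j = i \<longrightarrow> \<not> (s \<le> x + of_int k \<and> x + of_int k < t)) \<longrightarrow>
        right_ok (\<lambda>y. Nl (j, y)) (\<lambda>y. Nr (j, y)) x) \<and>
     (\<forall>p\<in>points K. p \<notin> closed_seg (i, s, t) \<longrightarrow>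
        Nr p = Nl p + seg_sign K (i, s, t) p - seg_sign K' (i, s, t) p) \<and>
     (\<forall>p q. double K p q \<longrightarrow> p \<notin> closed_seg (i, s, t) \<longrightarrow> q \<notin> closed_seg (i, s, t) \<longrightarrow> Nl p = Nl q) \<and>
     Nl (i, s) + total_sign K (i, s, t) = Nr (i, t) + total_sign K' (i, s, t)"

locale detour =
  fixes A :: "'v set" and K K' :: "'v diagram" and i s t and \<alpha> :: 'v
  assumes mvK: "mv_diagram A K" and mvK': "mv_diagram A K'" and alpha: "\<alpha> \<in> A"
    and segK: "is_segment K (i, s, t)" and segK': "is_segment K' (i, s, t)"
    and agree: "agree_off {(i, s, t)} K K'"
    and virt: "\<And>p. p \<in> open_seg (i, s, t) \<Longrightarrow> crossing K p \<Longrightarrow> strand K p = Virt \<alpha>"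
    and virt': "\<And>p. p \<in> open_seg (i, s, t) \<Longrightarrow> crossing K' p \<Longrightarrow> strand K' p = Virt \<alpha>"

lemma detour_sym: "detour A K K' i s t \<alpha> \<Longrightarrow> detour A K' K i s t \<alpha>"
  unfolding detour_def using agree_off_sym by blast

context detour
begin

abbreviation "g \<equiv> (i, s, t)"

lemma st: "i < ncomp K" "i < ncomp K'" "s < t" "t < s + 1"
  using segK segK' by simp_all

lemma same_ncomp: "ncomp K' = ncomp K"
  using agree by (simp add: agree_off_def)

lemma same_points: "points K' = points K"
  using agree_off_points[OF agree] by simp

lemma closed_crossing_open:
  assumes L: "mv_diagram A L" "is_segment L g" and "crossing L p" "p \<in> closed_seg g"
  shows "p \<in> open_seg g"
proof (rule ccontr)
  assume "p \<notin> open_seg g"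
  then have "same_point p (i, s) \<or> same_point p (i, t)" using closed_seg_ends assms(4) by blast
  then show False
    using assms(2,3) crossing_cong[OF L(1), of p "(i, s)"] crossing_cong[OF L(1), of p "(i, t)"] by auto
qed

lemma double_off:
  assumes "p \<notin> closed_seg g" "q \<notin> closed_seg g"
  shows "double K p q \<longleftrightarrow> double K' p q"
  using agree_off_double[OF agree, of p q] assms open_seg_subset[of g] by blast

lemma off_same:
  assumes "p \<in> points K" "p \<notin> closed_seg g"
  shows "pos K' p = pos K p" "tangent K' p = tangent K p"
proof -
  show "tangent K' p = tangent K p"
    using tangent_agree_off[OF agree _ _ assms(1)] segK assms(2) by simp
  have "p \<in> points K - \<Union> (open_seg ` {g})" using assms open_seg_subset[of g] by auto
  then show "pos K' p = pos K p" using agree unfolding agree_off_def by metis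
qed

lemma strand_off:
  assumes "double K p q" "p \<notin> closed_seg g" "q \<notin> closed_seg g"
  shows "strand K' p = strand K p"
proof -
  have "p \<notin> \<Union> (open_seg ` {g})" "q \<notin> \<Union> (open_seg ` {g})" using assms(2,3) open_seg_subset[of g] by blast+
  then show ?thesis using agree_off_strand[OF agree _ _ assms(1)] by simp
qed

lemma virt_partner:
  assumes L: "mv_diagram A L" "is_segment L g" "\<And>p. p \<in> open_seg g \<Longrightarrow> crossing L p \<Longrightarrow> strand L p = Virt \<alpha>"
    and d: "double L q p" and q: "q \<in> closed_seg g"
  shows "strand L p = Virt \<alpha>" "strand L q = Virt \<alpha>"
proof -
  have c: "crossing L q" using d unfolding crossing_def by blast
  show s: "strand L q = Virt \<alpha>" by (rule L(3)[OF closed_crossing_open[OF L(1,2) c q] c])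
  show "strand L p = Virt \<alpha>" by (rule double_strands[OF L(1) d]) (use s in auto)
qed

lemma seg_sign_off:
  assumes L: "mv_diagram A L" and d: "double L p q" and "q \<notin> closed_seg g"
  shows "seg_sign L g p = 0"
proof -
  have "\<not> (\<exists>z\<in>closed_seg g. double L z p)"
  proof
    assume "\<exists>z\<in>closed_seg g. double L z p"
    then obtain z where z: "z \<in> closed_seg g" "double L z p" by blast
    have "same_point z q" by (rule double_unique[OF L double_sym[OF z(2)] d])
    then show False using z(1) assms(3) closed_seg_cong by blast
  qed
  then show ?thesis by (simp add: seg_sign_def)
qed

lemma coloring_off_pass:
  assumes L: "mv_diagram A L" "is_segment L g" "\<And>p. p \<in> open_seg g \<Longrightarrow> crossing L p \<Longrightarrow> strand L p = Virt \<alpha>"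
    and c: "coloring A L X v l r" and q: "q \<in> points L" "q \<notin> closed_seg g"
    and no: "\<And>p. double L p q \<Longrightarrow> p \<in> closed_seg g"
  shows "r q = qpow X (v \<alpha>) (seg_sign L g q) (l q)"
proof (cases "\<exists>p. double L p q")
  case True
  then obtain p where p: "double L p q" by blast
  have pg: "p \<in> closed_seg g" by (rule no[OF p])
  have sq: "strand L q = Virt \<alpha>" by (rule virt_partner(1)[OF L p pg])
  have X: "is_quandle X" "v \<alpha> \<in> qcarrier X" using c alpha by (auto simp: coloring_def variables_def)
  have lq: "l q \<in> qcarrier X" by (rule coloring_closed(1)[OF c q(1)])
  have "strand L q \<noteq> Over" using sq by simp
  then have "passes L X v l r p q" using c p unfolding coloring_def by blast
  then have "r q = act X (0 < det2 (tangent L p) (tangent L q)) (l q) (v \<alpha>)"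
    using sq by (simp add: passes_def)
  also have "\<dots> = qpow X (v \<alpha>) (if 0 < det2 (tangent L p) (tangent L q) then 1 else -1) (l q)"
    using qpow_act_self[OF X(1) lq X(2), of "0 < det2 (tangent L p) (tangent L q)" 0] by simp
  also have "(if 0 < det2 (tangent L p) (tangent L q) then 1 else -1) = seg_sign L g q"
    using seg_sign_eq[OF p pg] crossing_sign_eq[OF L(1) p] by simp
  finally show ?thesis .
next
  case False
  then have "seg_sign L g q = 0" by (auto simp: seg_sign_def)
  moreover have "\<not> cut L q" using False double_sym unfolding cut_def crossing_def by blast
  ultimately show ?thesis using c q by (simp add: coloring_def)
qed

lemma seg_values:
  assumes L: "mv_diagram A L" "is_segment L g" "\<And>p. p \<in> open_seg g \<Longrightarrow> crossing L p \<Longrightarrow> strand L p = Virt \<alpha>"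
    and c: "coloring A L X v l r"
  shows "l (i, t) = qpow X (v \<alpha>) (total_sign L g) (l (i, s))"
proof -
  define G where "G = {x. s < x \<and> x < t \<and> crossing L (i, x)}"
  have fin: "finite G"
    by (rule finite_subset[OF _ finite_crossings[OF L(1), of s t i]]) (auto simp: G_def)
  have X: "is_quandle X" "v \<alpha> \<in> qcarrier X" using c alpha by (auto simp: coloring_def variables_def)
  have iL: "i < ncomp L" "s < t" using L(2) by simp_all
  have step: "r (i, x) = qpow X (v \<alpha>) (crossing_sign L (i, x)) (l (i, x))" if "x \<in> G" for x
  proof -
    have x: "s < x" "x < t" "crossing L (i, x)" using that by (simp_all add: G_def)
    have lx: "l (i, x) \<in> qcarrier X" using coloring_closed(1)[OF c, of "(i, x)"] iL by (simp add: points_def)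
    obtain q where d: "double L q (i, x)" using x(3) double_sym unfolding crossing_def by blast
    have sx: "strand L (i, x) = Virt \<alpha>" by (rule L(3)[OF mem_open_seg[OF x(1,2)] x(3)])
    then have "strand L (i, x) \<noteq> Over" by simp
    then have "passes L X v l r q (i, x)" using c d unfolding coloring_def by blast
    then have "r (i, x) = act X (0 < det2 (tangent L q) (tangent L (i, x))) (l (i, x)) (v \<alpha>)"
      using sx by (simp add: passes_def)
    also have "\<dots> = qpow X (v \<alpha>) (crossing_sign L (i, x)) (l (i, x))"
      using qpow_act_self[OF X(1) lx X(2), of "0 < det2 (tangent L q) (tangent L (i, x))" 0]
      unfolding crossing_sign_eq[OF L(1) d] by simp
    finally show ?thesis .
  qed
  have nc: "\<not> cut L (i, x)" if "s < x" "x < t" "x \<notin> G" for x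
    using that by (simp add: G_def cut_def)
  have sub: "G \<subseteq> {s<..<t}" by (auto simp: G_def)
  have B: "l (i, s) \<in> qcarrier X" using coloring_closed(1)[OF c, of "(i, s)"] iL by (simp add: points_def)
  have "l (i, t) = seg_l (\<lambda>x. qpow X (v \<alpha>) (crossing_sign L (i, x))) (r (i, s)) G t"
    using coloring_seg_value(1)[where f = "\<lambda>x. qpow X (v \<alpha>) (crossing_sign L (i, x))" and G = G
        and s = s and t = t and i = i, OF c iL fin sub nc step, of t] iL by simp
  also have "r (i, s) = l (i, s)" using segment_end_labels(1)[OF c L(2)] by simp
  also have "seg_l (\<lambda>x. qpow X (v \<alpha>) (crossing_sign L (i, x))) (l (i, s)) G t =
      qpow X (v \<alpha>) (\<Sum>x\<in>{x \<in> G. x < t}. crossing_sign L (i, x)) (l (i, s))"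
    by (rule seg_qpow[OF X(1,2) B fin]) simp
  also have "{x \<in> G. x < t} = {x. s < x \<and> x < t \<and> crossing L (i, x)}" by (auto simp: G_def)
  finally show ?thesis by (simp add: total_sign_def)
qed

lemma twist_coloring:
  assumes tw: "twist K K' i s t Nl Nr" and c: "coloring A K' X v l' r'"
  shows "\<exists>l r. coloring A K X v l r \<and> l (i, s) = qpow X (v \<alpha>) (Nl (i, s)) (l' (i, s)) \<and>
    (\<forall>p\<in>points K. p \<notin> closed_seg g \<longrightarrow>
       l p = qpow X (v \<alpha>) (Nl p) (l' p) \<and> r p = qpow X (v \<alpha>) (Nr p) (r' p))"
proof -
  note tw' = tw[unfolded twist_def]
  have var: "variables A X v" and lab': "labelling (ncomp K) (qcarrier X) l' r'"
    using c same_ncomp by (auto simp: coloring_def)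
  have X: "is_quandle X" and va: "v \<alpha> \<in> qcarrier X" using var alpha by (auto simp: variables_def)
  have comm: "qstar X (qstar X x (v \<alpha>)) (v \<beta>) = qstar X (qstar X x (v \<beta>)) (v \<alpha>)"
    if "x \<in> qcarrier X" "\<beta> \<in> A" for x \<beta> using var that alpha unfolding variables_def by blast
  have vb: "v \<beta> \<in> qcarrier X" if "\<beta> \<in> A" for \<beta> using var that by (simp add: variables_def)
  have cl: "l' p \<in> qcarrier X" "r' p \<in> qcarrier X" if "fst p < ncomp K" for p
    using labelling_closed[OF lab' that] .
  define l0 where "l0 p = qpow X (v \<alpha>) (Nl p) (l' p)" for p
  define r0 where "r0 p = qpow X (v \<alpha>) (Nr p) (r' p)" for p
  define G where "G = {x. s < x \<and> x < t \<and> crossing K (i, x)}"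
  define f where "f x = qpow X (v \<alpha>) (crossing_sign K (i, x))" for x
  define B where "B = l0 (i, s)"
  have fin: "finite G"
    by (rule finite_subset[OF _ finite_crossings[OF mvK, of s t i]]) (auto simp: G_def)
  have f_closed: "f x z \<in> qcarrier X" if "z \<in> qcarrier X" for x z
    unfolding f_def by (rule qpow_closed[OF X that va])
  have Bc: "B \<in> qcarrier X" unfolding B_def l0_def by (intro qpow_closed X va cl) (use st in simp)
  have seg_end: "seg_r f B G t = r0 (i, t)"
  proof -
    have "t \<notin> G" by (simp add: G_def)
    then have "seg_r f B G t = seg_l f B G t" by (rule seg_step_notin)
    also have "\<dots> = qpow X (v \<alpha>) (\<Sum>x\<in>{x \<in> G. x < t}. crossing_sign K (i, x)) B"
      by (rule seg_qpow[OF X va Bc fin]) (simp add: f_def)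
    also have "{x \<in> G. x < t} = {x. s < x \<and> x < t \<and> crossing K (i, x)}" by (auto simp: G_def)
    also have "(\<Sum>x\<in>{x. s < x \<and> x < t \<and> crossing K (i, x)}. crossing_sign K (i, x)) = total_sign K g"
      by (simp add: total_sign_def)
    also have "qpow X (v \<alpha>) (total_sign K g) B = qpow X (v \<alpha>) (total_sign K g + Nl (i, s)) (l' (i, s))"
      unfolding B_def l0_def using qpow_add[OF X cl(1) va, of "(i, s)"] st by simp
    also have "total_sign K g + Nl (i, s) = Nr (i, t) + total_sign K' g" using tw' by simp
    also have "qpow X (v \<alpha>) (Nr (i, t) + total_sign K' g) (l' (i, s)) =
        qpow X (v \<alpha>) (Nr (i, t)) (qpow X (v \<alpha>) (total_sign K' g) (l' (i, s)))"
      using qpow_add[OF X cl(1) va, of "(i, s)"] st by simp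
    also have "qpow X (v \<alpha>) (total_sign K' g) (l' (i, s)) = l' (i, t)"
      using seg_values[OF mvK' segK' virt' c] by simp
    also have "l' (i, t) = r' (i, t)" by (rule segment_end_labels(2)[OF c segK'])
    finally show ?thesis by (simp add: r0_def)
  qed
  have e: "{y \<in> G. y < s} = {}" by (auto simp: G_def)
  have seg_start: "seg_l f B G s = l0 (i, s)" unfolding seg_l_def e by (simp add: B_def)
  have ok_l: "left_ok (\<lambda>y. l0 (j, y)) (\<lambda>y. r0 (j, y)) x"
    if j: "j < ncomp K" "\<And>k::int. j = i \<Longrightarrow> \<not> (s < x + of_int k \<and> x + of_int k \<le> t)" for j x
  proof -
    have "left_ok (\<lambda>y. Nl (j, y)) (\<lambda>y. Nr (j, y)) x" using tw' j by blast
    moreover have "left_ok (\<lambda>y. l' (j, y)) (\<lambda>y. r' (j, y)) x" using lab' j(1) by (auto simp: labelling_def)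
    ultimately have "\<forall>\<^sub>F y in at_left x. (Nl (j, y) = Nl (j, x) \<and> Nr (j, y) = Nl (j, x)) \<and>
        (l' (j, y) = l' (j, x) \<and> r' (j, y) = l' (j, x))" unfolding left_ok_def by (rule eventually_conj)
    then show ?thesis unfolding left_ok_def by (rule eventually_mono) (simp add: l0_def r0_def)
  qed
  have ok_r: "right_ok (\<lambda>y. l0 (j, y)) (\<lambda>y. r0 (j, y)) x"
    if j: "j < ncomp K" "\<And>k::int. j = i \<Longrightarrow> \<not> (s \<le> x + of_int k \<and> x + of_int k < t)" for j x
  proof -
    have "right_ok (\<lambda>y. Nl (j, y)) (\<lambda>y. Nr (j, y)) x" using tw' j by blast
    moreover have "right_ok (\<lambda>y. l' (j, y)) (\<lambda>y. r' (j, y)) x" using lab' j(1) by (auto simp: labelling_def)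
    ultimately have "\<forall>\<^sub>F y in at_right x. (Nl (j, y) = Nr (j, x) \<and> Nr (j, y) = Nr (j, x)) \<and>
        (l' (j, y) = r' (j, x) \<and> r' (j, y) = r' (j, x))" unfolding right_ok_def by (rule eventually_conj)
    then show ?thesis unfolding right_ok_def by (rule eventually_mono) (simp add: l0_def r0_def)
  qed
  have per: "l0 (j, x) \<in> qcarrier X \<and> r0 (j, x) \<in> qcarrier X \<and> l0 (j, x + 1) = l0 (j, x) \<and> r0 (j, x + 1) = r0 (j, x)"
    if j: "j < ncomp K" for j x
  proof -
    have "Nl (j, x + 1) = Nl (j, x)" "Nr (j, x + 1) = Nr (j, x)" using tw' j by blast+
    moreover have "l' (j, x + 1) = l' (j, x)" "r' (j, x + 1) = r' (j, x)" using lab' j by (auto simp: labelling_def)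
    moreover have "l0 (j, x) \<in> qcarrier X" "r0 (j, x) \<in> qcarrier X"
      unfolding l0_def r0_def by (intro qpow_closed X va cl; use j in simp)+
    ultimately show ?thesis by (simp add: l0_def r0_def)
  qed
  obtain l r where lab: "labelling (ncomp K) (qcarrier X) l r"
    and off: "\<And>p. p \<notin> closed_seg g \<Longrightarrow> l p = l0 p \<and> r p = r0 p"
    and on: "\<And>x. s \<le> x \<Longrightarrow> x \<le> t \<Longrightarrow> l (i, x) = seg_l f B G x \<and> r (i, x) = seg_r f B G x"
  proof (rule glue_segment[of i "ncomp K" s t l0 "qcarrier X" r0 "seg_l f B G" "seg_r f B G"], goal_cases)
    case (7 x)
    then show ?case using seg_closed[where f = f, OF fin Bc f_closed] by blast
  next
    case (12 l r)
    show thesis by (rule 12(1)[OF 12(2) 12(3) 12(4)])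
  next
    case (5 j x)
    show ?case by (rule ok_l[OF 5(2)]) (rule 5(3))
  next
    case (6 j x)
    show ?case by (rule ok_r[OF 6(2)]) (rule 6(3))
  next
    case (4 j x)
    show ?case by (rule per[OF 4(2)])
  qed (rule st seg_start seg_end seg_left_ok[OF fin] seg_right_ok[OF fin])+
  have offK: "l p = l0 p" "r p = r0 p" if "p \<notin> closed_seg g" for p using off[OF that] by simp_all
  have off_pass: "r0 q = qpow X (v \<alpha>) (seg_sign K g q) (l0 q)"
    if q: "q \<in> points K" "q \<notin> closed_seg g" and no: "\<And>p. double K p q \<Longrightarrow> p \<in> closed_seg g" for q
  proof -
    have no': "p \<in> closed_seg g" if "double K' p q" for p
      using no double_off[OF _ q(2), of p] that by blast
    have r': "r' q = qpow X (v \<alpha>) (seg_sign K' g q) (l' q)"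
      by (rule coloring_off_pass[OF mvK' segK' virt' c _ q(2) no']) (use q same_points in simp_all)
    have lq: "l' q \<in> qcarrier X" using cl q by (simp add: points_def)
    have N: "Nr q = Nl q + seg_sign K g q - seg_sign K' g q" using tw' q by blast
    have "r0 q = qpow X (v \<alpha>) (Nr q + seg_sign K' g q) (l' q)"
      unfolding r0_def r' by (rule qpow_add[OF X lq va, symmetric])
    also have "Nr q + seg_sign K' g q = seg_sign K g q + Nl q" using N by simp
    also have "qpow X (v \<alpha>) (seg_sign K g q + Nl q) (l' q) = qpow X (v \<alpha>) (seg_sign K g q) (l0 q)"
      unfolding l0_def by (rule qpow_add[OF X lq va])
    finally show ?thesis .
  qed
  have off_off: "Nr q = Nl q \<and> Nl p = Nl q" if d: "double K p q" "p \<notin> closed_seg g" "q \<notin> closed_seg g" for p q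
  proof -
    have d': "double K' p q" using double_off[OF d(2,3)] d(1) by blast
    have "seg_sign K g q = 0" "seg_sign K' g q = 0"
      by (rule seg_sign_off[OF mvK double_sym[OF d(1)] d(2)], rule seg_sign_off[OF mvK' double_sym[OF d'] d(2)])
    moreover have "q \<in> points K" using d(1) by (simp add: double_def)
    then have "Nr q = Nl q + seg_sign K g q - seg_sign K' g q" using tw' d(3) by blast
    moreover have "Nl p = Nl q" using tw' d by blast
    ultimately show ?thesis by simp
  qed
  have off_rel: "passes K X v l0 r0 p q"
    if d: "double K p q" "p \<notin> closed_seg g" "q \<notin> closed_seg g" "strand K q \<noteq> Over" for p q
  proof -
    have d': "double K' p q" using double_off[OF d(2,3)] d(1) by blast
    have pts: "p \<in> points K" "q \<in> points K" using d(1) by (auto simp: double_def)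
    have s: "strand K' q = strand K q" by (rule strand_off[OF double_sym[OF d(1)] d(3,2)])
    have "strand K' q \<noteq> Over" using s d(4) by simp
    then have P: "passes K' X v l' r' p q" using c d' unfolding coloring_def by blast
    note N = off_off[OF d(1-3)]
    define e where "e \<longleftrightarrow> 0 < det2 (tangent K p) (tangent K q)"
    have lq: "l' q \<in> qcarrier X" "l' p \<in> qcarrier X" using cl pts by (simp_all add: points_def)
    from d(4) double_strands[OF mvK d(1)] consider "strand K q = Under" | \<beta> where "\<beta> \<in> A" "strand K q = Virt \<beta>"
      by metis
    then show ?thesis
    proof cases
      case 1
      then have "r' q = act X e (l' q) (l' p)"
        using P s off_same(2)[OF pts(1) d(2)] off_same(2)[OF pts(2) d(3)] by (simp add: passes_def e_def)
      then have "r0 q = qpow X (v \<alpha>) (Nl q) (act X e (l' q) (l' p))" using N by (simp add: r0_def)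
      also have "\<dots> = act X e (l0 q) (l0 p)"
        unfolding l0_def using qpow_act[OF X lq va] N by simp
      finally show ?thesis using 1 by (simp add: passes_def e_def)
    next
      case 2
      then have "r' q = act X e (l' q) (v \<beta>)"
        using P s off_same(2)[OF pts(1) d(2)] off_same(2)[OF pts(2) d(3)] by (simp add: passes_def e_def)
      then have "r0 q = qpow X (v \<alpha>) (Nl q) (act X e (l' q) (v \<beta>))" using N by (simp add: r0_def)
      also have "\<dots> = act X e (l0 q) (v \<beta>)"
        unfolding l0_def by (rule qpow_act_commute[OF X va vb[OF 2(1)] comm[OF _ 2(1)] lq(1)])
      finally show ?thesis using 2 by (simp add: passes_def e_def)
    qed
  qed
  have "coloring A K X v l r"
    unfolding coloring_def
  proof (intro conjI var lab ballI allI impI)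
    fix p assume p: "p \<in> points K" "\<not> cut K p"
    show "l p = r p"
    proof (cases "p \<in> closed_seg g")
      case True
      then obtain x where x: "s \<le> x" "x \<le> t" "same_point p (i, x)" by (auto simp: closed_seg_iff)
      have nc: "\<not> cut K (i, x)" using p(2) cut_cong[OF mvK x(3)] by blast
      have "x \<notin> G"
      proof
        assume "x \<in> G"
        then have "s < x" "x < t" "crossing K (i, x)" by (simp_all add: G_def)
        then show False using nc virt[OF mem_open_seg] by (simp add: cut_def)
      qed
      then have "l (i, x) = r (i, x)" using on[OF x(1,2)] seg_step_notin[of x G f B] by simp
      then show ?thesis using labelling_same_point[OF lab x(3)] p(1) by (simp add: points_def)
    next
      case False
      show ?thesis
      proof (cases "\<exists>q. double K q p \<and> q \<notin> closed_seg g")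
        case True
        then obtain q where q: "double K q p" "q \<notin> closed_seg g" by blast
        have q': "double K' q p" using double_off[OF q(2) False] q(1) by blast
        have "strand K p = Over" using p(2) cutI[OF double_sym[OF q(1)]] by blast
        then have "\<not> cut K' p" using strand_off[OF double_sym[OF q(1)] False q(2)] by (simp add: cut_def)
        then have "l' p = r' p" using c p(1) same_points by (simp add: coloring_def)
        then show ?thesis using off_off[OF q(1,2) False] offK[OF False] by (simp add: l0_def r0_def)
      next
        case no: False
        have "seg_sign K g p = 0"
        proof (rule ccontr)
          assume "seg_sign K g p \<noteq> 0"
          then obtain q where q: "q \<in> closed_seg g" "double K q p" by (auto simp: seg_sign_def split: if_splits)
          have "strand K p = Virt \<alpha>" by (rule virt_partner(1)[OF mvK segK virt q(2,1)])
          then show False using p(2) cutI[OF double_sym[OF q(2)]] by simp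
        qed
        moreover have "q \<in> closed_seg g" if "double K q p" for q using no that by blast
        ultimately have "r0 p = l0 p" using off_pass[OF p(1) False] by simp
        then show ?thesis using offK[OF False] by simp
      qed
    qed
  next
    fix p q assume pq: "double K p q \<and> strand K q \<noteq> Over"
    then have d: "double K p q" and sq: "strand K q \<noteq> Over" by simp_all
    have less: "fst p < ncomp K" "fst q < ncomp K" using double_less[OF d] by simp_all
    have pts: "p \<in> points K" "q \<in> points K" using less by (simp_all add: points_def)
    have cq: "crossing K q" using double_sym[OF d] unfolding crossing_def by blast
    show "passes K X v l r p q"
    proof (cases "q \<in> closed_seg g")
      case True
      then have "q \<in> open_seg g" by (rule closed_crossing_open[OF mvK segK cq])
      then obtain x where x: "s < x" "x < t" "same_point q (i, x)" by (auto simp: open_seg_iff)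
      have dx: "double K p (i, x)" by (rule double_cong[OF mvK d same_point_refl x(3)])
      have cx: "crossing K (i, x)" using double_sym[OF dx] unfolding crossing_def by blast
      have sx: "strand K (i, x) = Virt \<alpha>" by (rule virt[OF mem_open_seg[OF x(1,2)] cx])
      have xG: "x \<in> G" using x cx by (simp add: G_def)
      have lx: "l (i, x) \<in> qcarrier X" using labelling_closed[OF lab, of "(i, x)"] st by simp
      have "r (i, x) = f x (l (i, x))" using on[of x] x seg_step_in[OF fin xG, of f B] by simp
      also have "\<dots> = act X (0 < det2 (tangent K p) (tangent K (i, x))) (l (i, x)) (v \<alpha>)"
        using qpow_act_self[OF X lx va, of "0 < det2 (tangent K p) (tangent K (i, x))" 0]
        unfolding f_def crossing_sign_eq[OF mvK dx] by simp
      finally have "passes K X v l r p (i, x)" using sx by (simp add: passes_def)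
      then show ?thesis using passes_cong[OF mvK lab same_point_refl x(3) less] by blast
    next
      case False
      show ?thesis
      proof (cases "p \<in> closed_seg g")
        case True
        have no: "z \<in> closed_seg g" if "double K z q" for z
          using double_unique[OF mvK double_sym[OF that] double_sym[OF d]] True closed_seg_cong by blast
        have s: "strand K q = Virt \<alpha>" by (rule virt_partner(1)[OF mvK segK virt d True])
        have l0q: "l0 q \<in> qcarrier X" using per[of "fst q" "snd q"] less by simp
        have "r0 q = qpow X (v \<alpha>) (seg_sign K g q) (l0 q)" by (rule off_pass[OF pts(2) False no])
        also have "\<dots> = act X (0 < det2 (tangent K p) (tangent K q)) (l0 q) (v \<alpha>)"
          using qpow_act_self[OF X l0q va, of "0 < det2 (tangent K p) (tangent K q)" 0]
          unfolding seg_sign_eq[OF d True] crossing_sign_eq[OF mvK d] by simp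
        finally show ?thesis using s offK[OF False] by (simp add: passes_def)
      next
        case pF: False
        have "passes K X v l0 r0 p q" by (rule off_rel[OF d pF False sq])
        then show ?thesis using offK[OF False] offK[OF pF] by (simp add: passes_def split: passage.split)
      qed
    qed
  qed
  moreover have "l (i, s) = qpow X (v \<alpha>) (Nl (i, s)) (l' (i, s))"
    using on[of s] st seg_start by (simp add: l0_def)
  ultimately show ?thesis using offK unfolding l0_def r0_def by blast
qed

end

lemma twist_sym:
  assumes "detour A K K' i s t \<alpha>" "twist K K' i s t Nl Nr"
  shows "twist K' K i s t (\<lambda>p. - Nl p) (\<lambda>p. - Nr p)"
proof -
  interpret detour A K K' i s t \<alpha> by (rule assms(1))
  note tw = assms(2)[unfolded twist_def]
  have L: "left_ok (\<lambda>y. - Nl (j, y)) (\<lambda>y. - Nr (j, y)) x" if "left_ok (\<lambda>y. Nl (j, y)) (\<lambda>y. Nr (j, y)) x" for j x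
    using that unfolding left_ok_def by (rule eventually_mono) simp
  have R: "right_ok (\<lambda>y. - Nl (j, y)) (\<lambda>y. - Nr (j, y)) x" if "right_ok (\<lambda>y. Nl (j, y)) (\<lambda>y. Nr (j, y)) x" for j x
    using that unfolding right_ok_def by (rule eventually_mono) simp
  show ?thesis unfolding twist_def same_ncomp same_points
  proof (intro conjI allI impI ballI)
    fix p q assume "double K' p q" "p \<notin> closed_seg g" "q \<notin> closed_seg g"
    then have "Nl p = Nl q" using double_off tw by blast
    then show "- Nl p = - Nl q" by simp
  next
    fix p assume "p \<in> points K" "p \<notin> closed_seg g"
    then have "Nr p = Nl p + seg_sign K g p - seg_sign K' g p" using tw by blast
    then show "- Nr p = - Nl p + seg_sign K' g p - seg_sign K g p" by simp
  qed (use tw L R in \<open>auto\<close>)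
qed

lemma twist_iso:
  fixes A :: "'v set" and K K' :: "'v diagram"
  assumes dt: "detour A K K' i s t \<alpha>" and tw: "twist K K' i s t Nl Nr"
  shows "quandle_iso (mv_quandle A K) (mv_quandle A K')"
proof -
  interpret detour A K K' i s t \<alpha> by (rule dt)
  interpret sym: detour A K' K i s t \<alpha> by (rule detour_sym[OF dt])
  define rel :: "'v generator qterm set quandle \<Rightarrow> ('v \<Rightarrow> 'v generator qterm set) \<Rightarrow>
      (point \<Rightarrow> 'v generator qterm set) \<Rightarrow> (point \<Rightarrow> 'v generator qterm set) \<Rightarrow>
      (point \<Rightarrow> 'v generator qterm set) \<Rightarrow> (point \<Rightarrow> 'v generator qterm set) \<Rightarrow> bool"
    where "rel X v l r l' r' \<longleftrightarrow> l (i, s) = qpow X (v \<alpha>) (Nl (i, s)) (l' (i, s)) \<and>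
      (\<forall>p\<in>points K. p \<notin> closed_seg g \<longrightarrow>
         l p = qpow X (v \<alpha>) (Nl p) (l' p) \<and> r p = qpow X (v \<alpha>) (Nr p) (r' p))" for X v l r l' r'
  have cancel: "qpow X u n (qpow X u (- n) x) = x" "qpow X u (- n) (qpow X u n x) = x"
    if "is_quandle X" "u \<in> qcarrier X" "x \<in> qcarrier X" for X u n and x :: "'v generator qterm set"
    using qpow_add[OF that(1,3,2), of n "- n"] qpow_add[OF that(1,3,2), of "- n" n] by simp_all
  have Xv: "is_quandle X" "v \<alpha> \<in> qcarrier X" if "coloring A L X v l r"
    for L X v l r using that alpha by (auto simp: coloring_def variables_def)
  have is_pt: "(i, x) \<in> points K" for x using st by (simp add: points_def)
  have unique: "la p = lb p" if L: "mv_diagram A L" "is_segment L g" "\<And>p. p \<in> open_seg g \<Longrightarrow> crossing L p \<Longrightarrow> strand L p = Virt \<alpha>"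
    and c: "coloring A L X v la ra" "coloring A L X v lb rb"
    and eq: "la (i, s) = lb (i, s)" "\<And>p. p \<in> points L \<Longrightarrow> p \<notin> closed_seg g \<Longrightarrow> la p = lb p" and p: "p \<in> points L"
    for L p v la ra lb rb and X :: "'v generator qterm set quandle"
  proof (cases "p \<in> closed_seg g")
    case True
    then obtain x where x: "s \<le> x" "x \<le> t" "same_point p (i, x)" by (auto simp: closed_seg_iff)
    have iL: "i < ncomp L" "s < t" using L(2) by simp_all
    have "la (i, x) = lb (i, x)"
    proof (cases "x = s")
      case False
      have start: "ra (i, s) = rb (i, s)"
        using segment_end_labels(1)[OF c(1) L(2)] segment_end_labels(1)[OF c(2) L(2)] eq(1) by simp
      show ?thesis
      proof (rule seg_agree(1)[OF c iL start])
        fix y q assume y: "s < y" "y < t" "double L q (i, y)" "strand L (i, y) = Under"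
        have "crossing L (i, y)" using double_sym[OF y(3)] unfolding crossing_def by blast
        then have "strand L (i, y) = Virt \<alpha>" by (rule L(3)[OF mem_open_seg[OF y(1,2)]])
        then show "la q = lb q" using y(4) by simp
      qed (use x False in simp_all)
    qed (simp add: eq(1))
    moreover have "labelling (ncomp L) (qcarrier X) la ra" "labelling (ncomp L) (qcarrier X) lb rb" "fst p < ncomp L"
      using c p by (auto simp: coloring_def points_def)
    ultimately show ?thesis using labelling_same_point(1)[of "ncomp L" "qcarrier X" _ _ p "(i, x)"] x(3) by metis
  qed (use eq p in blast)
  show ?thesis
  proof (rule iso_by_transfer[where rel = rel, OF mvK mvK'])
    fix X :: "'v generator qterm set quandle" and v l r assume c: "coloring A K X v l r"
    obtain l' r' where c': "coloring A K' X v l' r'" and s': "l' (i, s) = qpow X (v \<alpha>) (- Nl (i, s)) (l (i, s))"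
      and o': "\<forall>p\<in>points K'. p \<notin> closed_seg g \<longrightarrow> l' p = qpow X (v \<alpha>) (- Nl p) (l p) \<and> r' p = qpow X (v \<alpha>) (- Nr p) (r p)"
      using sym.twist_coloring[OF twist_sym[OF dt tw] c] by blast
    note q = Xv[OF c]
    have "rel X v l r l' r'" unfolding rel_def
    proof (intro conjI ballI impI)
      show "l (i, s) = qpow X (v \<alpha>) (Nl (i, s)) (l' (i, s))"
        unfolding s' using cancel(1)[OF q coloring_closed(1)[OF c is_pt]] by simp
      fix p assume p: "p \<in> points K" "p \<notin> closed_seg g"
      have *: "l' p = qpow X (v \<alpha>) (- Nl p) (l p)" "r' p = qpow X (v \<alpha>) (- Nr p) (r p)"
        using o' p same_points by simp_all
      show "l p = qpow X (v \<alpha>) (Nl p) (l' p)" "r p = qpow X (v \<alpha>) (Nr p) (r' p)"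
        unfolding * using cancel(1)[OF q coloring_closed(1)[OF c p(1)]] cancel(1)[OF q coloring_closed(2)[OF c p(1)]]
        by simp_all
    qed
    then show "\<exists>l' r'. coloring A K' X v l' r' \<and> rel X v l r l' r'" using c' by blast
  next
    fix X :: "'v generator qterm set quandle" and v l' r' assume c: "coloring A K' X v l' r'"
    show "\<exists>l r. coloring A K X v l r \<and> rel X v l r l' r'"
      using twist_coloring[OF tw c] unfolding rel_def by blast
  next
    fix X :: "'v generator qterm set quandle" and v la ra la' ra' lb rb lb' rb' p
    assume h: "coloring A K X v la ra" "coloring A K' X v la' ra'" "coloring A K X v lb rb"
      "coloring A K' X v lb' rb'" "rel X v la ra la' ra'" "rel X v lb rb lb' rb'"
      and eq: "\<And>p. p \<in> points K' \<Longrightarrow> la' p = lb' p \<and> ra' p = rb' p" and p: "p \<in> points K"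
    show "la p = lb p"
    proof (rule unique[OF mvK segK virt h(1,3) _ _ p])
      show "la (i, s) = lb (i, s)" using h(5,6) eq[of "(i, s)"] is_pt same_points by (simp add: rel_def)
      show "la p = lb p" if "p \<in> points K" "p \<notin> closed_seg g" for p
        using h(5,6) eq[of p] that same_points by (simp add: rel_def)
    qed
  next
    fix X :: "'v generator qterm set quandle" and v la ra la' ra' lb rb lb' rb' p
    assume h: "coloring A K X v la ra" "coloring A K' X v la' ra'" "coloring A K X v lb rb"
      "coloring A K' X v lb' rb'" "rel X v la ra la' ra'" "rel X v lb rb lb' rb'"
      and eq: "\<And>p. p \<in> points K \<Longrightarrow> la p = lb p \<and> ra p = rb p" and p: "p \<in> points K'"
    have untwist: "l' p = qpow X (v \<alpha>) (- Nl p) (l p)" if "coloring A K X v l r" "coloring A K' X v l' r'"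
      "p \<in> points K" "l p = qpow X (v \<alpha>) (Nl p) (l' p)" for l r l' r' p
      unfolding that(4) using cancel(2)[OF Xv[OF that(1)] coloring_closed(1)[OF that(2)]] that(3) same_points by simp
    show "la' p = lb' p"
    proof (rule unique[OF mvK' segK' virt' h(2,4) _ _ p])
      have "la (i, s) = qpow X (v \<alpha>) (Nl (i, s)) (la' (i, s))" "lb (i, s) = qpow X (v \<alpha>) (Nl (i, s)) (lb' (i, s))"
        using h(5,6) by (simp_all add: rel_def)
      from untwist[OF h(1,2) is_pt this(1)] untwist[OF h(3,4) is_pt this(2)] show "la' (i, s) = lb' (i, s)"
        using eq[OF is_pt] by simp
      fix p :: point assume p: "p \<in> points K'" "p \<notin> closed_seg g"
      then have pK: "p \<in> points K" using same_points by simp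
      have "la p = qpow X (v \<alpha>) (Nl p) (la' p)" "lb p = qpow X (v \<alpha>) (Nl p) (lb' p)"
        using h(5,6) p(2) pK by (simp_all add: rel_def)
      from untwist[OF h(1,2) pK this(1)] untwist[OF h(3,4) pK this(2)] show "la' p = lb' p"
        using eq[OF pK] by simp
    qed
  next
    fix X Y :: "'v generator qterm set quandle" and v l r l' r' w f
    assume h: "coloring A K X v l r" "coloring A K' X v l' r'" "rel X v l r l' r'" "quandle_hom X Y f"
      "variables A Y w" "\<And>\<alpha>. \<alpha> \<in> A \<Longrightarrow> f (v \<alpha>) = w \<alpha>"
    have Y: "is_quandle Y" using h(5) by (simp add: variables_def)
    note q = Xv[OF h(1)]
    have hom: "f (qpow X (v \<alpha>) n x) = qpow Y (w \<alpha>) n (f x)" if "x \<in> qcarrier X" for n x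
      using quandle_hom_qpow[OF q(1) h(4) that q(2) Y] h(6)[OF alpha] by simp
    show "rel Y w (f \<circ> l) (f \<circ> r) (f \<circ> l') (f \<circ> r')"
      unfolding rel_def o_apply
    proof (intro conjI ballI impI)
      show "f (l (i, s)) = qpow Y (w \<alpha>) (Nl (i, s)) (f (l' (i, s)))"
        using h(3) hom[OF coloring_closed(1)[OF h(2), of "(i, s)"]] is_pt same_points by (simp add: rel_def)
      fix p assume p: "p \<in> points K" "p \<notin> closed_seg g"
      show "f (l p) = qpow Y (w \<alpha>) (Nl p) (f (l' p))" "f (r p) = qpow Y (w \<alpha>) (Nr p) (f (r' p))"
        using h(3) hom[OF coloring_closed(1)[OF h(2), of p]] hom[OF coloring_closed(2)[OF h(2), of p]] p same_points
        by (simp_all add: rel_def)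
    qed
  qed
qed

subsection \<open>Winding numbers\<close>

lemma argch_cong:
  assumes "\<And>x. a \<le> x \<Longrightarrow> x \<le> b \<Longrightarrow> c x = d x"
  shows "argch c a b = argch d a b"
proof -
  have "(\<lambda>L. continuous_on {a..b} L \<and> (\<forall>x\<in>{a..b}. c x = exp (L x))) =
      (\<lambda>L. continuous_on {a..b} L \<and> (\<forall>x\<in>{a..b}. d x = exp (L x)))"
    using assms by (intro ext conj_cong HOL.refl ball_cong) auto
  then show ?thesis unfolding argch_def by simp
qed

definition seg_meets :: "'v diagram \<Rightarrow> segment \<Rightarrow> nat \<Rightarrow> real \<Rightarrow> real \<Rightarrow> (real \<times> real) set" where
  "seg_meets L g j a b = {(x, y). fst (snd g) \<le> x \<and> x \<le> snd (snd g) \<and> a \<le> y \<and> y \<le> b \<and> pos L (fst g, x) = pos L (j, y)}"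

definition meets_sum :: "'v diagram \<Rightarrow> segment \<Rightarrow> nat \<Rightarrow> real \<Rightarrow> real \<Rightarrow> real" where
  "meets_sum L g j a b = (\<Sum>(x, y)\<in>seg_meets L g j a b. sgn (det2 (tangent L (fst g, x)) (tangent L (j, y))))"

lemma seg_meets_double:
  assumes sg: "is_segment L (i, s, t)" and j: "j < ncomp L"
    and off: "\<And>y. a \<le> y \<Longrightarrow> y \<le> b \<Longrightarrow> (j, y) \<notin> closed_seg (i, s, t)"
    and m: "(x, y) \<in> seg_meets L (i, s, t) j a b"
  shows "double L (i, x) (j, y)" "s < x" "x < t"
proof -
  have m': "s \<le> x" "x \<le> t" "a \<le> y" "y \<le> b" "pos L (i, x) = pos L (j, y)" using m by (simp_all add: seg_meets_def)
  have "\<not> same_point (i, x) (j, y)"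
    using off[OF m'(3,4)] mem_closed_seg[OF m'(1,2), of i] closed_seg_cong by blast
  then show d: "double L (i, x) (j, y)" using m' sg j by (simp add: double_def points_def)
  then have "crossing L (i, x)" unfolding crossing_def by blast
  then have "x \<noteq> s" "x \<noteq> t" using sg by auto
  then show "s < x" "x < t" using m' by simp_all
qed

lemma self_crossing_sum:
  assumes L: "mv_diagram A L" and sg: "is_segment L (i, s, t)"
  shows "(\<Sum>x\<in>{x. s < x \<and> x < t \<and> (\<exists>x'. s < x' \<and> x' < t \<and> double L (i, x) (i, x'))}. crossing_sign L (i, x)) = 0"
    (is "sum ?c ?S = 0")
proof -
  define m where "m x = (THE x'. s < x' \<and> x' < t \<and> double L (i, x) (i, x'))" for x
  have m: "m x = x'" if "s < x'" "x' < t" "double L (i, x) (i, x')" for x x'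
    unfolding m_def
  proof (rule the_equality)
    fix z assume z: "s < z \<and> z < t \<and> double L (i, x) (i, z)"
    have "same_point (i, z) (i, x')" using double_unique[OF L] z that(3) by blast
    then show "z = x'" using segment_point_unique[of t s z x' i] z that sg by simp
  qed (use that in simp)
  have M: "s < m x" "m x < t" "double L (i, x) (i, m x)" if xS: "x \<in> ?S" for x
  proof -
    obtain x' where x': "s < x'" "x' < t" "double L (i, x) (i, x')" using xS by blast
    then show "s < m x" "m x < t" "double L (i, x) (i, m x)" using m[OF x'] by simp_all
  qed
  have mm: "m (m x) = x" if "x \<in> ?S" for x
    by (rule m) (use that double_sym[OF M(3)[OF that]] in auto)
  have mS: "m x \<in> ?S" if "x \<in> ?S" for x
    using M[OF that] double_sym[OF M(3)[OF that]] that by blast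
  have "sum ?c ?S = (\<Sum>x\<in>?S. ?c (m x))"
    by (rule sum.reindex_bij_witness[of _ m m]) (use mm mS in auto)
  also have "\<dots> = (\<Sum>x\<in>?S. - ?c x)"
    by (rule sum.cong[OF HOL.refl]) (use crossing_sign_antisym[OF L double_sym[OF M(3)]] in simp)
  also have "\<dots> = - sum ?c ?S" by (simp add: sum_negf)
  finally show ?thesis by simp
qed

lemma total_sign_eq:
  assumes L: "mv_diagram A L" and sg: "is_segment L (i, s, t)"
    and lohi: "\<And>j. j < ncomp L \<Longrightarrow> lo j < hi j \<and> hi j \<le> lo j + 1 \<and> \<not> crossing L (j, lo j) \<and> \<not> crossing L (j, hi j)"
    and off: "\<And>j y. j < ncomp L \<Longrightarrow> lo j \<le> y \<Longrightarrow> y \<le> hi j \<Longrightarrow> (j, y) \<notin> closed_seg (i, s, t)"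
    and cover: "\<And>j y. j < ncomp L \<Longrightarrow> crossing L (j, y) \<Longrightarrow> (j, y) \<notin> closed_seg (i, s, t) \<Longrightarrow>
      \<exists>z. lo j \<le> z \<and> z \<le> hi j \<and> same_point (j, y) (j, z)"
    and fin: "\<And>j. j < ncomp L \<Longrightarrow> finite (seg_meets L (i, s, t) j (lo j) (hi j))"
  shows "of_int (total_sign L (i, s, t)) = - (\<Sum>j<ncomp L. meets_sum L (i, s, t) j (lo j) (hi j))"
proof -
  define T where "T = {x. s < x \<and> x < t \<and> crossing L (i, x)}"
  define S where "S = {x. s < x \<and> x < t \<and> (\<exists>x'. s < x' \<and> x' < t \<and> double L (i, x) (i, x'))}"
  define Z where "Z = (SIGMA j:{..<ncomp L}. seg_meets L (i, s, t) j (lo j) (hi j))"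
  have finT: "finite T"
    by (rule finite_subset[OF _ finite_crossings[OF L, of s t i]]) (auto simp: T_def)
  have ST: "S \<subseteq> T" unfolding S_def T_def crossing_def by blast
  have zd: "j < ncomp L" "double L (i, x) (j, y)" "s < x" "x < t" "lo j \<le> y" "y \<le> hi j"
    if "(j, x, y) \<in> Z" for j x y
  proof -
    have j: "j < ncomp L" and m: "(x, y) \<in> seg_meets L (i, s, t) j (lo j) (hi j)" using that by (auto simp: Z_def)
    show "j < ncomp L" by (rule j)
    show "double L (i, x) (j, y)" "s < x" "x < t" using seg_meets_double[OF sg j off[OF j] m] by simp_all
    show "lo j \<le> y" "y \<le> hi j" using m by (simp_all add: seg_meets_def)
  qed
  have bij: "bij_betw (\<lambda>(j, x, y). x) Z (T - S)"
    unfolding bij_betw_def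
  proof
    show "inj_on (\<lambda>(j, x, y). x) Z"
    proof (rule inj_onI)
      fix a b assume ab: "a \<in> Z" "b \<in> Z" "(case a of (j, x, y) \<Rightarrow> x) = (case b of (j, x, y) \<Rightarrow> x)"
      obtain j x y j' y' where e: "a = (j, x, y)" "b = (j', x, y')" using ab(3) by (cases a; cases b) auto
      note za = zd[OF ab(1)[unfolded e]] and zb = zd[OF ab(2)[unfolded e]]
      have sp: "same_point (j, y) (j', y')" by (rule double_unique[OF L za(2) zb(2)])
      then have jj: "j' = j" by (simp add: same_point_def)
      have "crossing L (j, y)" "crossing L (j', y')" using double_sym[OF za(2)] double_sym[OF zb(2)] unfolding crossing_def by blast+
      then have "y \<noteq> lo j" "y \<noteq> hi j" using lohi[OF za(1)] by auto
      then have "\<bar>y - y'\<bar> < 1" using lohi[OF za(1)] za(5,6) zb(5,6) unfolding jj by linarith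
      then have "y = y'" using same_point_close sp unfolding jj by blast
      then show "a = b" using e jj by simp
    qed
    show "(\<lambda>(j, x, y). x) ` Z = T - S"
    proof
      show "(\<lambda>(j, x, y). x) ` Z \<subseteq> T - S"
      proof
        fix x assume "x \<in> (\<lambda>(j, x, y). x) ` Z"
        then obtain j y where z: "(j, x, y) \<in> Z" by auto
        note d = zd[OF z]
        have "x \<notin> S"
        proof
          assume "x \<in> S"
          then obtain x' where x': "s < x'" "x' < t" "double L (i, x) (i, x')" by (auto simp: S_def)
          have "same_point (j, y) (i, x')" by (rule double_unique[OF L d(2) x'(3)])
          then have "(j, y) \<in> closed_seg (i, s, t)" unfolding closed_seg_iff using x' less_imp_le by blast
          then show False using off[OF d(1,5,6)] by blast
        qed
        moreover have "x \<in> T" using d(2-4) unfolding T_def crossing_def by blast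
        ultimately show "x \<in> T - S" by blast
      qed
      show "T - S \<subseteq> (\<lambda>(j, x, y). x) ` Z"
      proof
        fix x assume x: "x \<in> T - S"
        then have x': "s < x" "x < t" by (simp_all add: T_def)
        obtain q where q: "double L (i, x) q" using x unfolding T_def crossing_def by blast
        obtain j y where e: "q = (j, y)" by (cases q)
        have j: "j < ncomp L" using double_less(2)[OF q] e by simp
        have c: "crossing L (j, y)" using double_sym[OF q] unfolding crossing_def e by blast
        have "(j, y) \<notin> closed_seg (i, s, t)"
        proof
          assume "(j, y) \<in> closed_seg (i, s, t)"
          then obtain z where z: "s \<le> z" "z \<le> t" "same_point (j, y) (i, z)" by (auto simp: closed_seg_iff)
          have d: "double L (i, x) (i, z)" by (rule double_cong[OF L q same_point_refl z(3)[folded e]])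
          have "crossing L (i, z)" using double_sym[OF d] unfolding crossing_def by blast
          then have "z \<noteq> s" "z \<noteq> t" using sg by auto
          then show False using x x' z d by (auto simp: S_def)
        qed
        then obtain z where z: "lo j \<le> z" "z \<le> hi j" "same_point (j, y) (j, z)" using cover[OF j c] by blast
        have d: "double L (i, x) (j, z)" by (rule double_cong[OF L q same_point_refl]) (use z(3) e in simp)
        then have "(j, x, z) \<in> Z" using j x' z by (simp add: Z_def seg_meets_def double_def)
        then show "x \<in> (\<lambda>(j, x, y). x) ` Z" by force
      qed
    qed
  qed
  have "of_int (total_sign L (i, s, t)) = real_of_int (\<Sum>x\<in>T. crossing_sign L (i, x))"
    by (simp add: total_sign_def T_def)
  also have "(\<Sum>x\<in>T. crossing_sign L (i, x)) = (\<Sum>x\<in>T - S. crossing_sign L (i, x)) + (\<Sum>x\<in>S. crossing_sign L (i, x))"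
    by (rule sum.subset_diff[OF ST finT])
  also have "(\<Sum>x\<in>S. crossing_sign L (i, x)) = 0" unfolding S_def by (rule self_crossing_sum[OF L sg])
  also have "real_of_int ((\<Sum>x\<in>T - S. crossing_sign L (i, x)) + 0) = (\<Sum>x\<in>T - S. of_int (crossing_sign L (i, x)))" by simp
  also have "\<dots> = (\<Sum>z\<in>Z. of_int (crossing_sign L (i, (case z of (j, x, y) \<Rightarrow> x))))"
    by (rule sum.reindex_bij_betw[OF bij, symmetric])
  also have "\<dots> = (\<Sum>(j, x, y)\<in>Z. - sgn (det2 (tangent L (i, x)) (tangent L (j, y))))"
  proof (rule sum.cong[OF HOL.refl])
    fix z assume z: "z \<in> Z"
    obtain j x y where e: "z = (j, x, y)" by (cases z)
    have "of_int (crossing_sign L (i, x)) = sgn (det2 (tangent L (j, y)) (tangent L (i, x)))"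
      by (rule crossing_sign_sgn[OF L double_sym[OF zd(2)[OF z[unfolded e]]]])
    also have "\<dots> = - sgn (det2 (tangent L (i, x)) (tangent L (j, y)))"
      unfolding det2_antisym[of "tangent L (j, y)"] by (rule sgn_minus)
    finally show "real_of_int (crossing_sign L (i, (case z of (j, x, y) \<Rightarrow> x))) =
        (case z of (j, x, y) \<Rightarrow> - sgn (det2 (tangent L (i, x)) (tangent L (j, y))))" by (simp add: e)
  qed
  also have "\<dots> = (\<Sum>j<ncomp L. \<Sum>(x, y)\<in>seg_meets L (i, s, t) j (lo j) (hi j).
      - sgn (det2 (tangent L (i, x)) (tangent L (j, y))))"
    unfolding Z_def by (rule sum.Sigma[symmetric]) (use fin in auto)
  also have "\<dots> = (\<Sum>j<ncomp L. - meets_sum L (i, s, t) j (lo j) (hi j))"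
    by (simp add: meets_sum_def case_prod_unfold sum_negf)
  finally show ?thesis by (simp add: sum_negf)
qed

context detour
begin

text \<open>The winding number of the closed curve that runs along the old segment and back along the new one.\<close>

definition wind :: "complex \<Rightarrow> real" where
  "wind z = argch (\<lambda>x. pos K (i, x) - z) s t - argch (\<lambda>x. pos K' (i, x) - z) s t"

definition clear :: "complex \<Rightarrow> bool" where
  "clear z \<longleftrightarrow> (\<forall>x. s \<le> x \<longrightarrow> x \<le> t \<longrightarrow> pos K (i, x) \<noteq> z \<and> pos K' (i, x) \<noteq> z)"

lemma ends_same: "pos K' (i, s) = pos K (i, s)" "pos K' (i, t) = pos K (i, t)"
proof -
  have "(i, z) \<notin> open_seg g" if z: "z = s \<or> z = t" for z
  proof -
    have "\<not> same_point (i, z) (i, x)" if "s < x" "x < t" for x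
      using segment_point_unique[of t s z x i] that z st by auto
    then show ?thesis unfolding open_seg_iff by blast
  qed
  then have "(i, s) \<in> points K - \<Union> (open_seg ` {g})" "(i, t) \<in> points K - \<Union> (open_seg ` {g})"
    using st by (auto simp: points_def)
  then show "pos K' (i, s) = pos K (i, s)" "pos K' (i, t) = pos K (i, t)"
    using agree unfolding agree_off_def by metis+
qed

lemma wind_int:
  assumes "clear z"
  obtains n :: int where "wind z = of_int n"
proof -
  have nz: "pos K (i, x) - z \<noteq> 0" "pos K' (i, x) - z \<noteq> 0" if "x \<in> {s..t}" for x
    using assms that by (auto simp: clear_def)
  have cont: "continuous_on {s..t} (\<lambda>x. pos K (i, x) - z)" "continuous_on {s..t} (\<lambda>x. pos K' (i, x) - z)"
    by (intro continuous_intros pos_continuous[OF mvK] pos_continuous[OF mvK'] st)+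
  obtain L where L: "continuous_on {s..t} L" "\<And>x. x \<in> {s..t} \<Longrightarrow> pos K (i, x) - z = exp (L x)"
    using continuous_log_on_interval[OF cont(1) nz(1)] by blast
  obtain M where M: "continuous_on {s..t} M" "\<And>x. x \<in> {s..t} \<Longrightarrow> pos K' (i, x) - z = exp (M x)"
    using continuous_log_on_interval[OF cont(2) nz(2)] by blast
  have "exp (L s) = exp (M s)" "exp (L t) = exp (M t)"
    using L(2)[of s] L(2)[of t] M(2)[of s] M(2)[of t] ends_same st by simp_all
  then have "exp ((L t - L s) - (M t - M s)) = 1" by (simp add: exp_diff)
  then obtain n :: int where "Im ((L t - L s) - (M t - M s)) = of_int (2 * n) * pi"
    unfolding exp_eq_1 by blast
  then have "(Im (L t) - Im (L s)) / (2 * pi) - (Im (M t) - Im (M s)) / (2 * pi) = of_int n"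
    by (simp add: diff_divide_distrib[symmetric])
  moreover have "wind z = (Im (L t) - Im (L s)) / (2 * pi) - (Im (M t) - Im (M s)) / (2 * pi)"
    unfolding wind_def using argch_eqI[OF _ L] argch_eqI[OF _ M] st by simp
  ultimately show thesis using that by simp
qed

lemma clear_off:
  assumes p: "p \<in> points K" "p \<notin> closed_seg g"
    and n: "\<And>x. double K (i, x) p \<Longrightarrow> s \<le> x \<Longrightarrow> x \<le> t \<Longrightarrow> False" "\<And>x. double K' (i, x) p \<Longrightarrow> s \<le> x \<Longrightarrow> x \<le> t \<Longrightarrow> False"
  shows "clear (pos K p)"
  unfolding clear_def
proof (intro allI impI conjI)
  fix x assume x: "s \<le> x" "x \<le> t"
  have ns: "\<not> same_point (i, x) p" using mem_closed_seg[OF x, of i] p(2) closed_seg_cong by blast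
  show "pos K (i, x) \<noteq> pos K p"
    using n(1)[OF _ x] ns p st by (auto simp: double_def points_def)
  show "pos K' (i, x) \<noteq> pos K p"
    using n(2)[OF _ x] ns p st off_same(1)[OF p] same_points same_ncomp by (auto simp: double_def points_def)
qed

lemma wind_diff:
  assumes j: "j < ncomp K" and ab: "a < b" and off: "\<And>y. a \<le> y \<Longrightarrow> y \<le> b \<Longrightarrow> (j, y) \<notin> closed_seg g"
    and cl: "clear (pos K (j, a))" "clear (pos K (j, b))"
  shows "finite (seg_meets K g j a b)" "finite (seg_meets K' g j a b)"
    "wind (pos K (j, b)) - wind (pos K (j, a)) = meets_sum K g j a b - meets_sum K' g j a b"
proof -
  have pt: "(j, y) \<in> points K" for y using j by (simp add: points_def)
  have pos: "pos K' (j, y) = pos K (j, y)" if "a \<le> y" "y \<le> b" for y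
    by (rule off_same(1)[OF pt off[OF that]])
  have d: "\<not> same_point (i, x) (j, y)" if "s \<le> x" "x \<le> t" "a \<le> y" "y \<le> b" for x y
    using off[OF that(3,4)] mem_closed_seg[OF that(1,2), of i] closed_seg_cong by blast
  have o: "pos K (i, x) \<noteq> pos K (j, a) \<and> pos K (i, x) \<noteq> pos K (j, b)" if "s \<le> x" "x \<le> t" for x
    using cl that by (auto simp: clear_def)
  have o': "pos K' (i, x) \<noteq> pos K' (j, a) \<and> pos K' (i, x) \<noteq> pos K' (j, b)" if "s \<le> x" "x \<le> t" for x
    using cl that pos[of a] pos[of b] ab by (auto simp: clear_def)
  have e: "\<not> crossing K (i, s)" "\<not> crossing K (i, t)" "\<not> crossing K' (i, s)" "\<not> crossing K' (i, t)"
    using segK segK' by simp_all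
  have j': "j < ncomp K'" using j same_ncomp by simp
  note box = diagram_box[OF mvK st(1) j st(3,4) ab e(1,2) d o]
  note box' = diagram_box[OF mvK' st(2) j' st(3,4) ab e(3,4) d o']
  show "finite (seg_meets K g j a b)" "finite (seg_meets K' g j a b)"
    unfolding seg_meets_def fst_conv snd_conv using box(1) box'(1) by blast+
  have "boxdeg (\<lambda>x. pos K (i, x)) (\<lambda>y. pos K (j, y)) s t a b = - meets_sum K g j a b"
    unfolding meets_sum_def seg_meets_def fst_conv snd_conv by (rule box(2))
  moreover have "boxdeg (\<lambda>x. pos K' (i, x)) (\<lambda>y. pos K' (j, y)) s t a b = - meets_sum K' g j a b"
    unfolding meets_sum_def seg_meets_def fst_conv snd_conv by (rule box'(2))
  moreover have "argch (\<lambda>y. pos K' (i, s) - pos K' (j, y)) a b = argch (\<lambda>y. pos K (i, s) - pos K (j, y)) a b"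
    "argch (\<lambda>y. pos K' (i, t) - pos K' (j, y)) a b = argch (\<lambda>y. pos K (i, t) - pos K (j, y)) a b"
    by (rule argch_cong, simp add: pos ends_same)+
  ultimately show "wind (pos K (j, b)) - wind (pos K (j, a)) = meets_sum K g j a b - meets_sum K' g j a b"
    using pos[of a] pos[of b] ab unfolding boxdeg_def wind_def by simp
qed

lemma wind_const:
  assumes j: "j < ncomp K" and ab: "a \<le> b" and off: "\<And>y. a \<le> y \<Longrightarrow> y \<le> b \<Longrightarrow> (j, y) \<notin> closed_seg g"
    and cl: "\<And>y. a \<le> y \<Longrightarrow> y \<le> b \<Longrightarrow> clear (pos K (j, y))"
  shows "wind (pos K (j, b)) = wind (pos K (j, a))"
proof (cases "a = b")
  case False
  then have ab': "a < b" using ab by simp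
  have pt: "(j, y) \<in> points K" for y using j by (simp add: points_def)
  have "seg_meets K g j a b = {}" "seg_meets K' g j a b = {}"
    using cl off_same(1)[OF pt off] by (force simp: seg_meets_def clear_def)+
  then show ?thesis
    using wind_diff(3)[OF j ab' off cl[of a] cl[of b]] ab by (simp add: meets_sum_def)
qed simp

definition Nl :: "point \<Rightarrow> int" where
  "Nl p = (SOME n. \<exists>b<snd p. \<forall>y. b < y \<and> y < snd p \<longrightarrow> wind (pos K (fst p, y)) = of_int n)"

definition Nr :: "point \<Rightarrow> int" where
  "Nr p = (SOME n. \<exists>b>snd p. \<forall>y. snd p < y \<and> y < b \<longrightarrow> wind (pos K (fst p, y)) = of_int n)"

lemma NlI:
  assumes "b < x" "\<And>y. b < y \<Longrightarrow> y < x \<Longrightarrow> wind (pos K (j, y)) = of_int n"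
  shows "Nl (j, x) = n"
  unfolding Nl_def fst_conv snd_conv
proof (rule some_equality)
  fix m assume "\<exists>b<x. \<forall>y. b < y \<and> y < x \<longrightarrow> wind (pos K (j, y)) = of_int m"
  then obtain c where c: "c < x" "\<And>y. c < y \<Longrightarrow> y < x \<Longrightarrow> wind (pos K (j, y)) = of_int m" by blast
  obtain y where "max b c < y" "y < x" using dense[of "max b c" x] assms(1) c(1) by auto
  then have "of_int m = (of_int n :: real)" using assms(2)[of y] c(2)[of y] by simp
  then show "m = n" by simp
qed (use assms in blast)

lemma NrI:
  assumes "x < b" "\<And>y. x < y \<Longrightarrow> y < b \<Longrightarrow> wind (pos K (j, y)) = of_int n"
  shows "Nr (j, x) = n"
  unfolding Nr_def fst_conv snd_conv
proof (rule some_equality)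
  fix m assume "\<exists>b>x. \<forall>y. x < y \<and> y < b \<longrightarrow> wind (pos K (j, y)) = of_int m"
  then obtain c where c: "x < c" "\<And>y. x < y \<Longrightarrow> y < c \<Longrightarrow> wind (pos K (j, y)) = of_int m" by blast
  obtain y where "x < y" "y < min b c" using dense[of x "min b c"] assms(1) c(1) by auto
  then have "of_int m = (of_int n :: real)" using assms(2)[of y] c(2)[of y] by simp
  then show "m = n" by simp
qed (use assms in blast)

lemma off_near:
  assumes "(j, x) \<notin> closed_seg g"
  obtains e where "0 < e" "\<And>y. \<bar>y - x\<bar> < e \<Longrightarrow> (j, y) \<notin> closed_seg g"
  using not_closed_seg_near[OF st(4,3) assms] unfolding eventually_nhds_metric dist_real_def by blast

lemma int_between: "(0::real) < of_int k \<Longrightarrow> of_int k < (1::real) \<Longrightarrow> False"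
  by (simp only: of_int_0_less_iff of_int_less_1_iff)

lemma off_left:
  assumes "\<And>k::int. j = i \<Longrightarrow> \<not> (s < x + of_int k \<and> x + of_int k \<le> t)"
  obtains b where "b < x" "\<And>y. b < y \<Longrightarrow> y < x \<Longrightarrow> (j, y) \<notin> closed_seg g"
proof (cases "(j, x) \<in> closed_seg g")
  case False
  then obtain e where "0 < e" "\<And>y. \<bar>y - x\<bar> < e \<Longrightarrow> (j, y) \<notin> closed_seg g" by (rule off_near) blast
  then show thesis by (intro that[of "x - e"]) auto
next
  case True
  then obtain z and k :: int where z: "s \<le> z" "z \<le> t" "j = i" "x = z + of_int k"
    by (auto simp: closed_seg_iff same_point_iff)
  have "z = s" using assms[of "- k"] z by auto
  show thesis
  proof (rule that[of "x - (s + 1 - t)"])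
    fix y assume y: "x - (s + 1 - t) < y" "y < x"
    show "(j, y) \<notin> closed_seg g"
    proof
      assume "(j, y) \<in> closed_seg g"
      then obtain w and l :: int where w: "s \<le> w" "w \<le> t" "y = w + of_int l"
        by (auto simp: closed_seg_iff same_point_iff)
      have "0 < real_of_int (k - l)" "real_of_int (k - l) < 1" using w y z \<open>z = s\<close> by auto
      then show False by (rule int_between)
    qed
  qed (use st in simp)
qed

lemma off_right:
  assumes "\<And>k::int. j = i \<Longrightarrow> \<not> (s \<le> x + of_int k \<and> x + of_int k < t)"
  obtains b where "x < b" "\<And>y. x < y \<Longrightarrow> y < b \<Longrightarrow> (j, y) \<notin> closed_seg g"
proof (cases "(j, x) \<in> closed_seg g")
  case False
  then obtain e where "0 < e" "\<And>y. \<bar>y - x\<bar> < e \<Longrightarrow> (j, y) \<notin> closed_seg g" by (rule off_near) blast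
  then show thesis by (intro that[of "x + e"]) auto
next
  case True
  then obtain z and k :: int where z: "s \<le> z" "z \<le> t" "j = i" "x = z + of_int k"
    by (auto simp: closed_seg_iff same_point_iff)
  have "z = t" using assms[of "- k"] z by auto
  show thesis
  proof (rule that[of "x + (s + 1 - t)"])
    fix y assume y: "x < y" "y < x + (s + 1 - t)"
    show "(j, y) \<notin> closed_seg g"
    proof
      assume "(j, y) \<in> closed_seg g"
      then obtain w and l :: int where w: "s \<le> w" "w \<le> t" "y = w + of_int l"
        by (auto simp: closed_seg_iff same_point_iff)
      have "0 < real_of_int (l - k)" "real_of_int (l - k) < 1" using w y z \<open>z = t\<close> by auto
      then show False by (rule int_between)
    qed
  qed (use st in simp)
qed

lemma clear_noncrossing:
  assumes "j < ncomp K" "(j, y) \<notin> closed_seg g" "\<not> crossing K (j, y)" "\<not> crossing K' (j, y)"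
  shows "clear (pos K (j, y))"
proof (rule clear_off)
  show "(j, y) \<in> points K" using assms(1) by (simp add: points_def)
  show False if "double K (i, x) (j, y)" for x using double_sym[OF that] assms(3) unfolding crossing_def by blast
  show False if "double K' (i, x) (j, y)" for x using double_sym[OF that] assms(4) unfolding crossing_def by blast
qed (rule assms(2))

lemma wind_pieces_const:
  assumes j: "j < ncomp K" and "a < b"
    and off: "\<And>y. a < y \<Longrightarrow> y < b \<Longrightarrow> (j, y) \<notin> closed_seg g"
    and cl: "\<And>y. a < y \<Longrightarrow> y < b \<Longrightarrow> clear (pos K (j, y))"
  obtains n :: int where "\<And>y. a < y \<Longrightarrow> y < b \<Longrightarrow> wind (pos K (j, y)) = of_int n"
proof -
  obtain m where m: "a < m" "m < b" using dense[OF assms(2)] by blast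
  obtain n :: int where n: "wind (pos K (j, m)) = of_int n" using wind_int[OF cl[OF m]] by blast
  show thesis
  proof (rule that)
    fix y assume y: "a < y" "y < b"
    have "wind (pos K (j, y)) = wind (pos K (j, m))"
    proof (cases "m \<le> y")
      case True
      then show ?thesis by (intro wind_const j off cl) (use m y in simp_all)
    next
      case False
      then have "wind (pos K (j, m)) = wind (pos K (j, y))" by (intro wind_const j off cl) (use m y in simp_all)
      then show ?thesis by simp
    qed
    then show "wind (pos K (j, y)) = of_int n" using n by simp
  qed
qed

lemma left_piece:
  assumes j: "j < ncomp K" and "\<And>k::int. j = i \<Longrightarrow> \<not> (s < x + of_int k \<and> x + of_int k \<le> t)"
  obtains b where "b < x" "\<And>y. b < y \<Longrightarrow> y < x \<Longrightarrow> wind (pos K (j, y)) = of_int (Nl (j, x))"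
    "\<And>y. b < y \<Longrightarrow> y < x \<Longrightarrow> \<not> crossing K (j, y) \<and> \<not> crossing K' (j, y) \<and> (j, y) \<notin> closed_seg g"
proof -
  obtain b1 where b1: "b1 < x" "\<And>y. b1 < y \<Longrightarrow> y < x \<Longrightarrow> (j, y) \<notin> closed_seg g" using off_left[of j x] assms(2) by blast
  obtain b2 where b2: "b2 < x" "\<And>y. b2 < y \<Longrightarrow> y < x \<Longrightarrow> \<not> crossing K (j, y)" using no_crossing_left[OF mvK] by blast
  obtain b3 where b3: "b3 < x" "\<And>y. b3 < y \<Longrightarrow> y < x \<Longrightarrow> \<not> crossing K' (j, y)" using no_crossing_left[OF mvK'] by blast
  define b where "b = max b1 (max b2 b3)"
  have b: "b < x" using b1 b2 b3 by (simp add: b_def)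
  have good: "(j, y) \<notin> closed_seg g" "\<not> crossing K (j, y)" "\<not> crossing K' (j, y)" if "b < y" "y < x" for y
    using that b1(2)[of y] b2(2)[of y] b3(2)[of y] by (simp_all add: b_def)
  obtain n :: int where n: "\<And>y. b < y \<Longrightarrow> y < x \<Longrightarrow> wind (pos K (j, y)) = of_int n"
    using wind_pieces_const[OF j b good(1) clear_noncrossing[OF j good]] by blast
  have "Nl (j, x) = n" by (rule NlI[OF b n])
  then show thesis using that[OF b] n good by blast
qed

lemma right_piece:
  assumes j: "j < ncomp K" and "\<And>k::int. j = i \<Longrightarrow> \<not> (s \<le> x + of_int k \<and> x + of_int k < t)"
  obtains b where "x < b" "\<And>y. x < y \<Longrightarrow> y < b \<Longrightarrow> wind (pos K (j, y)) = of_int (Nr (j, x))"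
    "\<And>y. x < y \<Longrightarrow> y < b \<Longrightarrow> \<not> crossing K (j, y) \<and> \<not> crossing K' (j, y) \<and> (j, y) \<notin> closed_seg g"
proof -
  obtain b1 where b1: "x < b1" "\<And>y. x < y \<Longrightarrow> y < b1 \<Longrightarrow> (j, y) \<notin> closed_seg g" using off_right[of j x] assms(2) by blast
  obtain b2 where b2: "x < b2" "\<And>y. x < y \<Longrightarrow> y < b2 \<Longrightarrow> \<not> crossing K (j, y)" using no_crossing_right[OF mvK] by blast
  obtain b3 where b3: "x < b3" "\<And>y. x < y \<Longrightarrow> y < b3 \<Longrightarrow> \<not> crossing K' (j, y)" using no_crossing_right[OF mvK'] by blast
  define b where "b = min b1 (min b2 b3)"
  have b: "x < b" using b1 b2 b3 by (simp add: b_def)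
  have good: "(j, y) \<notin> closed_seg g" "\<not> crossing K (j, y)" "\<not> crossing K' (j, y)" if "x < y" "y < b" for y
    using that b1(2)[of y] b2(2)[of y] b3(2)[of y] by (simp_all add: b_def)
  obtain n :: int where n: "\<And>y. x < y \<Longrightarrow> y < b \<Longrightarrow> wind (pos K (j, y)) = of_int n"
    using wind_pieces_const[OF j b good(1) clear_noncrossing[OF j good]] by blast
  have "Nr (j, x) = n" by (rule NrI[OF b n])
  then show thesis using that[OF b] n good by blast
qed

lemma off_conditions:
  assumes "(j, x) \<notin> closed_seg g"
  shows "j = i \<Longrightarrow> \<not> (s < x + of_int k \<and> x + of_int k \<le> t)" "j = i \<Longrightarrow> \<not> (s \<le> x + of_int k \<and> x + of_int k < t)"
  using assms same_point_sym[OF same_point_shift[of i x k]] unfolding closed_seg_iff by auto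

lemma Nl_clear:
  assumes p: "p \<in> points K" "p \<notin> closed_seg g" and cl: "clear (pos K p)"
  shows "of_int (Nl p) = wind (pos K p)"
proof -
  obtain j x where e: "p = (j, x)" by (cases p)
  have j: "j < ncomp K" and off: "(j, x) \<notin> closed_seg g" using p by (simp_all add: e points_def)
  obtain b where b: "b < x" "\<And>y. b < y \<Longrightarrow> y < x \<Longrightarrow> wind (pos K (j, y)) = of_int (Nl (j, x))"
    "\<And>y. b < y \<Longrightarrow> y < x \<Longrightarrow> \<not> crossing K (j, y) \<and> \<not> crossing K' (j, y) \<and> (j, y) \<notin> closed_seg g"
    using left_piece[OF j off_conditions(1)[OF off]] by blast
  obtain m where m: "b < m" "m < x" using dense[OF b(1)] by blast
  have "wind (pos K (j, x)) = wind (pos K (j, m))"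
  proof (rule wind_const[OF j])
    fix y assume y: "m \<le> y" "y \<le> x"
    show "(j, y) \<notin> closed_seg g" using y m b(3)[of y] off by (cases "y = x") auto
    show "clear (pos K (j, y))" using y m b(3)[of y] cl e clear_noncrossing[OF j, of y] by (cases "y = x") auto
  qed (use m in simp)
  then show ?thesis using b(2)[OF m] e by simp
qed

lemma seg_sign_meets:
  assumes L: "mv_diagram A L" "is_segment L g" and j: "j < ncomp L" and ab: "a < x" "x < b"
    and off: "\<And>y. a \<le> y \<Longrightarrow> y \<le> b \<Longrightarrow> (j, y) \<notin> closed_seg g"
    and nc: "\<And>y. a \<le> y \<Longrightarrow> y \<le> b \<Longrightarrow> y \<noteq> x \<Longrightarrow> \<not> crossing L (j, y)"
  shows "meets_sum L g j a b = of_int (seg_sign L g (j, x))"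
proof (cases "\<exists>q\<in>closed_seg g. double L q (j, x)")
  case True
  then obtain q where q: "q \<in> closed_seg g" "double L q (j, x)" by blast
  obtain z where z: "s \<le> z" "z \<le> t" "same_point q (i, z)" using q(1) by (auto simp: closed_seg_iff)
  have d: "double L (i, z) (j, x)" by (rule double_cong[OF L(1) q(2) z(3) same_point_refl])
  have "seg_meets L g j a b = {(z, x)}"
  proof
    show "seg_meets L g j a b \<subseteq> {(z, x)}"
    proof
      fix w assume w: "w \<in> seg_meets L g j a b"
      obtain u y where e: "w = (u, y)" by (cases w)
      have du: "double L (i, u) (j, y)" "s < u" "u < t"
        using seg_meets_double[OF L(2) j off w[unfolded e]] by simp_all
      have "crossing L (j, y)" using double_sym[OF du(1)] unfolding crossing_def by blast
      then have yx: "y = x" using nc[of y] w by (auto simp: e seg_meets_def)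
      have "same_point (i, u) (i, z)"
        using double_unique[OF L(1) double_sym[OF du(1)]] double_sym[OF d] yx by blast
      then have "u = z" using segment_point_unique[of t s u z i] du z st by simp
      then show "w \<in> {(z, x)}" using e yx by simp
    qed
    show "{(z, x)} \<subseteq> seg_meets L g j a b" using z ab d by (simp add: seg_meets_def double_def)
  qed
  then have "meets_sum L g j a b = sgn (det2 (tangent L (i, z)) (tangent L (j, x)))"
    by (simp add: meets_sum_def)
  also have "\<dots> = of_int (crossing_sign L (j, x))" by (rule crossing_sign_sgn[OF L(1) d, symmetric])
  also have "crossing_sign L (j, x) = seg_sign L g (j, x)" by (rule seg_sign_eq[OF q(2,1), symmetric])
  finally show ?thesis .
next
  case False
  have "seg_meets L g j a b = {}"
  proof (rule ccontr)
    assume "seg_meets L g j a b \<noteq> {}"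
    then obtain u y where w: "(u, y) \<in> seg_meets L g j a b" by auto
    have du: "double L (i, u) (j, y)" "s < u" "u < t"
      using seg_meets_double[OF L(2) j off w] by simp_all
    have "crossing L (j, y)" using double_sym[OF du(1)] unfolding crossing_def by blast
    then have "y = x" using nc[of y] w by (auto simp: seg_meets_def)
    then show False using False du mem_closed_seg[of s u t i] by auto
  qed
  then show ?thesis using False by (auto simp: meets_sum_def seg_sign_def)
qed

lemma Nr_jump:
  assumes p: "p \<in> points K" "p \<notin> closed_seg g"
  shows "Nr p = Nl p + seg_sign K g p - seg_sign K' g p"
proof -
  obtain j x where e: "p = (j, x)" by (cases p)
  have j: "j < ncomp K" "j < ncomp K'" and off: "(j, x) \<notin> closed_seg g" using p same_ncomp by (simp_all add: e points_def)
  obtain b where b: "b < x" "\<And>y. b < y \<Longrightarrow> y < x \<Longrightarrow> wind (pos K (j, y)) = of_int (Nl (j, x))"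
    "\<And>y. b < y \<Longrightarrow> y < x \<Longrightarrow> \<not> crossing K (j, y) \<and> \<not> crossing K' (j, y) \<and> (j, y) \<notin> closed_seg g"
    using left_piece[OF j(1) off_conditions(1)[OF off]] by blast
  obtain c where c: "x < c" "\<And>y. x < y \<Longrightarrow> y < c \<Longrightarrow> wind (pos K (j, y)) = of_int (Nr (j, x))"
    "\<And>y. x < y \<Longrightarrow> y < c \<Longrightarrow> \<not> crossing K (j, y) \<and> \<not> crossing K' (j, y) \<and> (j, y) \<notin> closed_seg g"
    using right_piece[OF j(1) off_conditions(2)[OF off]] by blast
  obtain y1 where y1: "b < y1" "y1 < x" using dense[OF b(1)] by blast
  obtain y2 where y2: "x < y2" "y2 < c" using dense[OF c(1)] by blast
  have off': "(j, y) \<notin> closed_seg g" if "y1 \<le> y" "y \<le> y2" for y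
    using that y1 y2 b(3)[of y] c(3)[of y] off by (cases y x rule: linorder_cases) auto
  have nc: "\<not> crossing K (j, y)" "\<not> crossing K' (j, y)" if "y1 \<le> y" "y \<le> y2" "y \<noteq> x" for y
    using that y1 y2 b(3)[of y] c(3)[of y] by (cases y x rule: linorder_cases; simp)+
  have y12: "y1 < y2" using y1 y2 by simp
  have cl: "clear (pos K (j, y1))" "clear (pos K (j, y2))"
    by (rule clear_noncrossing[OF j(1) off' nc]; use y1 y2 in simp)+
  have "wind (pos K (j, y2)) - wind (pos K (j, y1)) = meets_sum K g j y1 y2 - meets_sum K' g j y1 y2"
    by (rule wind_diff(3)[OF j(1) y12 off' cl])
  also have "\<dots> = of_int (seg_sign K g p) - of_int (seg_sign K' g p)"
    using seg_sign_meets[OF mvK segK j(1) y1(2) y2(1) off' nc(1)]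
      seg_sign_meets[OF mvK' segK' j(2) y1(2) y2(1) off' nc(2)] by (simp add: e)
  finally have "real_of_int (Nr p) - of_int (Nl p) = of_int (seg_sign K g p) - of_int (seg_sign K' g p)"
    using b(2)[OF y1] c(2)[OF y2] by (simp add: e)
  then show ?thesis by linarith
qed

lemma total_balance: "Nl (i, s) + total_sign K g = Nr (i, t) + total_sign K' g"
proof -
  have is_s: "\<not> (s < s + of_int k \<and> s + of_int k \<le> t)" for k :: int
    using int_between[of k] st by auto
  have is_t: "\<not> (s \<le> t + of_int k \<and> t + of_int k < t)" for k :: int
    using int_between[of "- k"] st by auto
  obtain b where b: "b < s" "\<And>y. b < y \<Longrightarrow> y < s \<Longrightarrow> wind (pos K (i, y)) = of_int (Nl (i, s))"
    "\<And>y. b < y \<Longrightarrow> y < s \<Longrightarrow> \<not> crossing K (i, y) \<and> \<not> crossing K' (i, y) \<and> (i, y) \<notin> closed_seg g"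
    using left_piece[OF st(1) is_s] by blast
  obtain c where c: "t < c" "\<And>y. t < y \<Longrightarrow> y < c \<Longrightarrow> wind (pos K (i, y)) = of_int (Nr (i, t))"
    "\<And>y. t < y \<Longrightarrow> y < c \<Longrightarrow> \<not> crossing K (i, y) \<and> \<not> crossing K' (i, y) \<and> (i, y) \<notin> closed_seg g"
    using right_piece[OF st(1) is_t] by blast
  define e where "e = min ((s - b) / 2) (min ((c - t) / 2) ((s + 1 - t) / 3))"
  have e: "0 < e" "e < s - b" "e < c - t" "2 * e < s + 1 - t"
  proof -
    show "0 < e" using b(1) c(1) st by (simp add: e_def)
    have "e \<le> (s - b) / 2" "e \<le> (c - t) / 2" "e \<le> (s + 1 - t) / 3" unfolding e_def by linarith+
    then show "e < s - b" "e < c - t" "2 * e < s + 1 - t" using b(1) c(1) st by simp_all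
  qed
  have "\<exists>y. \<not> crossing K (j, y) \<and> \<not> crossing K' (j, y)" for j
  proof -
    obtain b1 where b1: "b1 < 0" "\<And>y. b1 < y \<Longrightarrow> y < 0 \<Longrightarrow> \<not> crossing K (j, y)" using no_crossing_left[OF mvK] by blast
    obtain b2 where b2: "b2 < 0" "\<And>y. b2 < y \<Longrightarrow> y < 0 \<Longrightarrow> \<not> crossing K' (j, y)" using no_crossing_left[OF mvK'] by blast
    obtain y where "max b1 b2 < y" "y < 0" using dense[of "max b1 b2" 0] b1 b2 by auto
    then show ?thesis using b1(2)[of y] b2(2)[of y] by auto
  qed
  then obtain base where base: "\<And>j. \<not> crossing K (j, base j) \<and> \<not> crossing K' (j, base j)" by metis
  define lo where "lo j = (if j = i then t + e else base j)" for j
  define hi where "hi j = (if j = i then s + 1 - e else base j + 1)" for j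
  have off: "(j, y) \<notin> closed_seg g" if "lo j \<le> y" "y \<le> hi j" for j y
  proof
    assume "(j, y) \<in> closed_seg g"
    then obtain z and k :: int where z: "s \<le> z" "z \<le> t" "j = i" "y = z + of_int k"
      by (auto simp: closed_seg_iff same_point_iff)
    then have "0 < real_of_int k" "real_of_int k < 1" using that e by (auto simp: lo_def hi_def)
    then show False by (rule int_between)
  qed
  have lohi: "lo j < hi j \<and> hi j \<le> lo j + 1 \<and> \<not> crossing L (j, lo j) \<and> \<not> crossing L (j, hi j)"
    if L: "L = K \<or> L = K'" for L j
  proof (cases "j = i")
    case True
    have mvL: "mv_diagram A L" using L mvK mvK' by blast
    have "\<not> crossing L (i, t + e)" "\<not> crossing L (i, s - e)"
      using b(3)[of "s - e"] c(3)[of "t + e"] e L by auto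
    moreover have "crossing L (i, (s - e) + of_int 1) \<longleftrightarrow> crossing L (i, s - e)" by (rule crossing_int[OF mvL])
    moreover have "(s - e) + of_int 1 = s + 1 - e" by simp
    ultimately have nc: "\<not> crossing L (i, t + e)" "\<not> crossing L (i, s + 1 - e)" by metis+
    have "t + e < s + 1 - e" "s + 1 - e \<le> t + e + 1" using e st by simp_all
    then show ?thesis using True nc by (simp add: lo_def hi_def)
  next
    case False
    have mvL: "mv_diagram A L" using L mvK mvK' by blast
    have "crossing L (j, base j + of_int 1) \<longleftrightarrow> crossing L (j, base j)" by (rule crossing_int[OF mvL])
    then show ?thesis using False base[of j] L by (auto simp: lo_def hi_def)
  qed
  have cover: "\<exists>z. lo j \<le> z \<and> z \<le> hi j \<and> same_point (j, y) (j, z)"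
    if L: "L = K \<or> L = K'" and c': "crossing L (j, y)" "(j, y) \<notin> closed_seg g" for L j y
  proof -
    have mvL: "mv_diagram A L" using L mvK mvK' by blast
    define o' where "o' = (if j = i then s else base j)"
    define k where "k = - \<lfloor>y - o'\<rfloor>"
    have k: "o' \<le> y + of_int k" "y + of_int k < o' + 1" unfolding k_def by linarith+
    have sp: "same_point (j, y) (j, y + of_int k)" by (rule same_point_sym[OF same_point_shift])
    have "lo j \<le> y + of_int k \<and> y + of_int k \<le> hi j"
    proof (cases "j = i")
      case False
      then show ?thesis using k by (simp add: lo_def hi_def o'_def)
    next
      case True
      have cz: "crossing L (i, y + of_int k)" "crossing L (i, y + of_int (k - 1))"
        using c'(1) True crossing_int[OF mvL, of i y k] crossing_int[OF mvL, of i y "k - 1"] by blast+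
      have "t < y + of_int k"
      proof (rule ccontr)
        assume "\<not> t < y + of_int k"
        then have "(j, y) \<in> closed_seg g"
          unfolding closed_seg_iff using k True sp by (intro exI[of _ "y + of_int k"]) (simp add: o'_def)
        then show False using c'(2) by blast
      qed
      moreover have "\<not> (t < y + of_int k \<and> y + of_int k < c)" using c(3)[of "y + of_int k"] cz(1) L by blast
      moreover have "\<not> (b < y + of_int (k - 1) \<and> y + of_int (k - 1) < s)"
        using b(3)[of "y + of_int (k - 1)"] cz(2) L by blast
      ultimately show ?thesis using k True e by (auto simp: lo_def hi_def o'_def)
    qed
    then show ?thesis using sp by blast
  qed
  have clear: "clear (pos K (j, lo j))" "clear (pos K (j, hi j))" if "j < ncomp K" for j
    by (rule clear_noncrossing[OF that off]; use lohi[of K j] lohi[of K' j] in simp)+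
  have diff: "finite (seg_meets K g j (lo j) (hi j))" "finite (seg_meets K' g j (lo j) (hi j))"
    "wind (pos K (j, hi j)) - wind (pos K (j, lo j)) = meets_sum K g j (lo j) (hi j) - meets_sum K' g j (lo j) (hi j)"
    if j: "j < ncomp K" for j
    using wind_diff[OF j conjunct1[OF lohi[OF disjI1[OF HOL.refl]]] off clear[OF j]] by simp_all
  have tot: "of_int (total_sign K g) = - (\<Sum>j<ncomp K. meets_sum K g j (lo j) (hi j))"
    by (rule total_sign_eq[OF mvK segK lohi[OF disjI1[OF HOL.refl]] off cover[OF disjI1[OF HOL.refl]] diff(1)])
  have fin': "finite (seg_meets K' g j (lo j) (hi j))" if "j < ncomp K'" for j
    using diff(2)[of j] that same_ncomp by simp
  have tot': "of_int (total_sign K' g) = - (\<Sum>j<ncomp K'. meets_sum K' g j (lo j) (hi j))"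
    by (rule total_sign_eq[OF mvK' segK' lohi[OF disjI2[OF HOL.refl]] off cover[OF disjI2[OF HOL.refl]] fin'])
  have jump: "meets_sum K g j (lo j) (hi j) - meets_sum K' g j (lo j) (hi j) =
      (if j = i then of_int (Nl (i, s)) - of_int (Nr (i, t)) else 0)" if j: "j < ncomp K" for j
  proof -
    have "meets_sum K g j (lo j) (hi j) - meets_sum K' g j (lo j) (hi j) =
        wind (pos K (j, hi j)) - wind (pos K (j, lo j))"
      using diff(3)[OF j] by simp
    also have "\<dots> = (if j = i then of_int (Nl (i, s)) - of_int (Nr (i, t)) else 0)"
    proof (cases "j = i")
      case True
      have "pos K (i, (s - e) + of_int 1) = pos K (i, s - e)" by (rule pos_int[OF mvK st(1)])
      moreover have "(s - e) + of_int 1 = s + 1 - e" by simp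
      ultimately have "pos K (i, s + 1 - e) = pos K (i, s - e)" by metis
      then have "pos K (i, hi i) = pos K (i, s - e)" by (simp add: hi_def)
      then show ?thesis using True b(2)[of "s - e"] c(2)[of "t + e"] e by (simp add: lo_def)
    next
      case False
      have "pos K (j, base j + of_int 1) = pos K (j, base j)" by (rule pos_int[OF mvK j])
      then show ?thesis using False by (simp add: lo_def hi_def)
    qed
    finally show ?thesis .
  qed
  have "real_of_int (total_sign K' g) - of_int (total_sign K g) =
      (\<Sum>j<ncomp K. meets_sum K g j (lo j) (hi j) - meets_sum K' g j (lo j) (hi j))"
    unfolding tot tot' same_ncomp sum_subtractf by simp
  also have "\<dots> = (\<Sum>j<ncomp K. if j = i then of_int (Nl (i, s)) - of_int (Nr (i, t)) else 0)"
    by (rule sum.cong[OF HOL.refl]) (use jump in simp)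
  also have "\<dots> = of_int (Nl (i, s)) - of_int (Nr (i, t))"
    using st(1) by (simp add: sum.delta)
  finally show ?thesis by linarith
qed

lemma twist_exists: "twist K K' i s t Nl Nr"
  unfolding twist_def
proof (intro conjI allI impI ballI total_balance Nr_jump)
  fix j x assume j: "j < ncomp K"
  have P: "pos K (j, y - 1) = pos K (j, y)" "pos K (j, y + 1) = pos K (j, y)" for y
    using pos_int[OF mvK j, of y "-1"] pos_int[OF mvK j, of y 1] by simp_all
  have l: "(\<exists>b<x + 1. \<forall>y. b < y \<and> y < x + 1 \<longrightarrow> wind (pos K (j, y)) = of_int n) \<longleftrightarrow>
      (\<exists>b<x. \<forall>y. b < y \<and> y < x \<longrightarrow> wind (pos K (j, y)) = of_int n)" for n
  proof
    assume "\<exists>b<x + 1. \<forall>y. b < y \<and> y < x + 1 \<longrightarrow> wind (pos K (j, y)) = of_int n"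
    then obtain b where b: "b < x + 1" "\<And>y. b < y \<Longrightarrow> y < x + 1 \<Longrightarrow> wind (pos K (j, y)) = of_int n" by blast
    show "\<exists>b<x. \<forall>y. b < y \<and> y < x \<longrightarrow> wind (pos K (j, y)) = of_int n"
    proof (intro exI[of _ "b - 1"] conjI allI impI)
      fix y assume "b - 1 < y \<and> y < x"
      then show "wind (pos K (j, y)) = of_int n" using b(2)[of "y + 1"] P(2)[of y] by simp
    qed (use b in simp)
  next
    assume "\<exists>b<x. \<forall>y. b < y \<and> y < x \<longrightarrow> wind (pos K (j, y)) = of_int n"
    then obtain b where b: "b < x" "\<And>y. b < y \<Longrightarrow> y < x \<Longrightarrow> wind (pos K (j, y)) = of_int n" by blast
    show "\<exists>b<x + 1. \<forall>y. b < y \<and> y < x + 1 \<longrightarrow> wind (pos K (j, y)) = of_int n"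
    proof (intro exI[of _ "b + 1"] conjI allI impI)
      fix y assume "b + 1 < y \<and> y < x + 1"
      then show "wind (pos K (j, y)) = of_int n" using b(2)[of "y - 1"] P(1)[of y] by simp
    qed (use b in simp)
  qed
  have r: "(\<exists>b>x + 1. \<forall>y. x + 1 < y \<and> y < b \<longrightarrow> wind (pos K (j, y)) = of_int n) \<longleftrightarrow>
      (\<exists>b>x. \<forall>y. x < y \<and> y < b \<longrightarrow> wind (pos K (j, y)) = of_int n)" for n
  proof
    assume "\<exists>b>x + 1. \<forall>y. x + 1 < y \<and> y < b \<longrightarrow> wind (pos K (j, y)) = of_int n"
    then obtain b where b: "b > x + 1" "\<And>y. x + 1 < y \<Longrightarrow> y < b \<Longrightarrow> wind (pos K (j, y)) = of_int n" by blast
    show "\<exists>b>x. \<forall>y. x < y \<and> y < b \<longrightarrow> wind (pos K (j, y)) = of_int n"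
    proof (intro exI[of _ "b - 1"] conjI allI impI)
      fix y assume "x < y \<and> y < b - 1"
      then show "wind (pos K (j, y)) = of_int n" using b(2)[of "y + 1"] P(2)[of y] by simp
    qed (use b in simp)
  next
    assume "\<exists>b>x. \<forall>y. x < y \<and> y < b \<longrightarrow> wind (pos K (j, y)) = of_int n"
    then obtain b where b: "b > x" "\<And>y. x < y \<Longrightarrow> y < b \<Longrightarrow> wind (pos K (j, y)) = of_int n" by blast
    show "\<exists>b>x + 1. \<forall>y. x + 1 < y \<and> y < b \<longrightarrow> wind (pos K (j, y)) = of_int n"
    proof (intro exI[of _ "b + 1"] conjI allI impI)
      fix y assume "x + 1 < y \<and> y < b + 1"
      then show "wind (pos K (j, y)) = of_int n" using b(2)[of "y - 1"] P(1)[of y] by simp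
    qed (use b in simp)
  qed
  show "Nl (j, x + 1) = Nl (j, x)" unfolding Nl_def fst_conv snd_conv l ..
  show "Nr (j, x + 1) = Nr (j, x)" unfolding Nr_def fst_conv snd_conv r ..
next
  fix j x assume j: "j < ncomp K" and h: "\<forall>k::int. j = i \<longrightarrow> \<not> (s < x + of_int k \<and> x + of_int k \<le> t)"
  have h': "\<not> (s < x + of_int k \<and> x + of_int k \<le> t)" if "j = i" for k :: int using h that by blast
  obtain b where b: "b < x" "\<And>y. b < y \<Longrightarrow> y < x \<Longrightarrow> wind (pos K (j, y)) = of_int (Nl (j, x))"
  proof (rule left_piece[OF j])
    show "\<not> (s < x + of_int k \<and> x + of_int k \<le> t)" if "j = i" for k :: int by (rule h'[OF that])
  qed (rule that; assumption)
  show "left_ok (\<lambda>y. Nl (j, y)) (\<lambda>y. Nr (j, y)) x"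
    unfolding left_ok_iff
  proof (intro exI[of _ b] conjI allI impI b(1))
    fix y assume y: "b < y \<and> y < x"
    show "Nl (j, y) = Nl (j, x)" by (rule NlI[of b]) (use y b(2) in auto)
    show "Nr (j, y) = Nl (j, x)" by (rule NrI[of _ x]) (use y b(2) in auto)
  qed
next
  fix j x assume j: "j < ncomp K" and h: "\<forall>k::int. j = i \<longrightarrow> \<not> (s \<le> x + of_int k \<and> x + of_int k < t)"
  have h': "\<not> (s \<le> x + of_int k \<and> x + of_int k < t)" if "j = i" for k :: int using h that by blast
  obtain b where b: "x < b" "\<And>y. x < y \<Longrightarrow> y < b \<Longrightarrow> wind (pos K (j, y)) = of_int (Nr (j, x))"
  proof (rule right_piece[OF j])
    show "\<not> (s \<le> x + of_int k \<and> x + of_int k < t)" if "j = i" for k :: int by (rule h'[OF that])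
  qed (rule that; assumption)
  show "right_ok (\<lambda>y. Nl (j, y)) (\<lambda>y. Nr (j, y)) x"
    unfolding right_ok_iff
  proof (intro exI[of _ b] conjI allI impI b(1))
    fix y assume y: "x < y \<and> y < b"
    show "Nl (j, y) = Nr (j, x)" by (rule NlI[of x]) (use y b(2) in auto)
    show "Nr (j, y) = Nr (j, x)" by (rule NrI[of _ b]) (use y b(2) in auto)
  qed
next
  fix p q assume d: "double K p q" and p: "p \<notin> closed_seg g" and q: "q \<notin> closed_seg g"
  have clear: "clear (pos K p)" if d: "double K p q" and p: "p \<notin> closed_seg g" and q: "q \<notin> closed_seg g" for p q
  proof (rule clear_off)
    show "p \<in> points K" using d by (simp add: double_def)
    have d': "double K' p q" using double_off[OF p q] d by blast
    show False if "double K (i, x) p" "s \<le> x" "x \<le> t" for x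
      using double_unique[OF mvK double_sym[OF that(1)] d] mem_closed_seg[OF that(2,3), of i] q closed_seg_cong by blast
    show False if "double K' (i, x) p" "s \<le> x" "x \<le> t" for x
      using double_unique[OF mvK' double_sym[OF that(1)] d'] mem_closed_seg[OF that(2,3), of i] q closed_seg_cong by blast
  qed (rule p)
  have "of_int (Nl p) = wind (pos K p)" "of_int (Nl q) = wind (pos K q)" "pos K p = pos K q"
    using Nl_clear[OF _ p clear[OF d p q]] Nl_clear[OF _ q clear[OF double_sym[OF d] q p]] d by (auto simp: double_def)
  then have "of_int (Nl p) = (of_int (Nl q) :: real)" by simp
  then show "Nl p = Nl q" by simp
qed

end

lemma detour_iso:
  fixes A :: "'v set" and K K' :: "'v diagram"
  assumes "detour_move A K K'"
  shows "quandle_iso (mv_quandle A K) (mv_quandle A K')"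
proof -
  obtain g \<alpha> where h: "mv_diagram A K" "mv_diagram A K'" "\<alpha> \<in> A" "is_segment K g" "is_segment K' g" "agree_off {g} K K'"
    "\<forall>p\<in>open_seg g. crossing K p \<longrightarrow> strand K p = Virt \<alpha>" "\<forall>p\<in>open_seg g. crossing K' p \<longrightarrow> strand K' p = Virt \<alpha>"
    using assms unfolding detour_move_def by blast
  obtain i s t where g: "g = (i, s, t)" by (cases g)
  have dt: "detour A K K' i s t \<alpha>" using h unfolding g by (intro detour.intro) auto
  show ?thesis by (rule twist_iso[OF dt detour.twist_exists[OF dt]])
qed

section \<open>Planar isotopy\<close>

lemma det2_scaleR: "det2 (a *\<^sub>R u) (b *\<^sub>R w) = a * b * det2 u w"
  by (simp add: det2_def algebra_simps)

lemma linear_det2: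
  fixes L :: "complex \<Rightarrow> complex"
  assumes "linear L"
  shows "det2 (L u) (L w) = det2 (L 1) (L \<i>) * det2 u w"
proof -
  have e: "L z = Re z *\<^sub>R L 1 + Im z *\<^sub>R L \<i>" for z
  proof -
    have "L z = L (Re z *\<^sub>R 1 + Im z *\<^sub>R \<i>)" by (rule arg_cong[of _ _ L]) (simp add: complex_eq_iff)
    then show ?thesis by (simp add: linear_add[OF assms] linear_scale[OF assms])
  qed
  show ?thesis unfolding e[of u] e[of w] by (simp add: det2_def algebra_simps)
qed

lemma linear_bij_det2:
  fixes L :: "complex \<Rightarrow> complex"
  assumes L: "linear L" and "bij L"
  shows "det2 (L 1) (L \<i>) \<noteq> 0"
proof
  assume d: "det2 (L 1) (L \<i>) = 0"
  have k: "z = 0" if "L z = 0" for z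
    using that linear_0[OF L] bij_is_inj[OF assms(2)] by (metis injD)
  have e: "L (Complex a b) = a *\<^sub>R L 1 + b *\<^sub>R L \<i>" for a b
  proof -
    have "L (Complex a b) = L (a *\<^sub>R 1 + b *\<^sub>R \<i>)" by (rule arg_cong[of _ _ L]) (simp add: complex_eq_iff)
    then show ?thesis by (simp add: linear_add[OF L] linear_scale[OF L])
  qed
  have "L (Complex (Re (L \<i>)) (- Re (L 1))) = 0" "L (Complex (Im (L \<i>)) (- Im (L 1))) = 0"
    unfolding e using d by (simp_all add: det2_def complex_eq_iff algebra_simps)
  from k[OF this(1)] k[OF this(2)] have "L 1 = 0" by (simp add: complex_eq_iff)
  then show False using k[of 1] by simp
qed

lemma diffeotopy_orientation:
  assumes H: "diffeotopy H"
  obtains L where "\<And>z. (H 1 has_derivative L z) (at z)" "\<And>z. 0 < det2 (L z 1) (L z \<i>)"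
proof -
  obtain H' where H': "\<And>t z. t \<in> {0..1} \<Longrightarrow> (H t has_derivative H' t z) (at z)"
      "\<And>t z. t \<in> {0..1} \<Longrightarrow> bij (H' t z)"
      "\<And>w. continuous_on ({0..1} \<times> UNIV) (\<lambda>(t, z). H' t z w)"
    using H unfolding diffeotopy_def by blast
  have pos: "0 < det2 (H' 1 z 1) (H' 1 z \<i>)" for z
  proof (rule ccontr)
    assume n: "\<not> 0 < det2 (H' 1 z 1) (H' 1 z \<i>)"
    define D where "D t = det2 (H' t z 1) (H' t z \<i>)" for t
    have c: "continuous_on {0..1} (\<lambda>t. H' t z w)" for w
    proof -
      have "continuous_on {0..1} ((\<lambda>(t, z). H' t z w) \<circ> (\<lambda>t. (t, z)))"
        by (intro continuous_on_compose continuous_on_subset[OF H'(3)] continuous_intros) auto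
      then show ?thesis by (simp add: o_def)
    qed
    have "continuous_on {0..1} D" unfolding D_def det2_def by (intro continuous_intros c)
    moreover have "H 0 = (\<lambda>z. z)" using H by (auto simp: diffeotopy_def)
    then have "H' 0 z = (\<lambda>w. w)"
      using has_derivative_unique[OF H'(1)[of 0 z]] has_derivative_ident[of "at z"] by simp
    then have "D 0 = 1" by (simp add: D_def det2_def)
    ultimately obtain t where "0 \<le> t" "t \<le> 1" "D t = 0"
      using IVT2'[of D 1 0 0] n by (auto simp: D_def)
    then show False
      using linear_bij_det2[OF has_derivative_linear[OF H'(1)[of t z]] H'(2)[of t z]] by (simp add: D_def)
  qed
  show thesis by (rule that[of "H' 1"]) (simp_all add: H'(1) pos)
qed

locale reparametrised =
  fixes A :: "'v set" and K K' :: "'v diagram" and \<sigma> :: "nat \<Rightarrow> nat" and \<phi> :: "nat \<Rightarrow> real \<Rightarrow> real" and \<psi> :: "point \<Rightarrow> point"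
  assumes mvK: "mv_diagram A K" and mvK': "mv_diagram A K'"
    and \<sigma>: "bij_betw \<sigma> {..<ncomp K'} {..<ncomp K}"
    and mono: "i < ncomp K' \<Longrightarrow> strict_mono (\<phi> i)" and surj: "i < ncomp K' \<Longrightarrow> surj (\<phi> i)"
    and shift: "i < ncomp K' \<Longrightarrow> \<phi> i (x + 1) = \<phi> i x + 1"
    and \<psi>: "\<psi> (i, x) = (\<sigma> i, \<phi> i x)"
    and double_map: "p \<in> points K' \<Longrightarrow> q \<in> points K' \<Longrightarrow> double K' p q \<longleftrightarrow> double K (\<psi> p) (\<psi> q)"
    and strand_map: "crossing K' p \<Longrightarrow> strand K' p = strand K (\<psi> p)"
    and sign_map: "double K' p q \<Longrightarrow>
      0 < det2 (tangent K' p) (tangent K' q) \<longleftrightarrow> 0 < det2 (tangent K (\<psi> p)) (tangent K (\<psi> q))"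
begin

lemma \<psi>_points: "p \<in> points K' \<Longrightarrow> \<psi> p \<in> points K"
  using bij_betwE[OF \<sigma>] by (cases p) (simp add: points_def \<psi>)

lemma \<psi>_onto:
  assumes "q \<in> points K"
  obtains p where "p \<in> points K'" "\<psi> p = q"
proof -
  obtain j y where q: "q = (j, y)" by (cases q)
  then have "j \<in> \<sigma> ` {..<ncomp K'}" using assms bij_betw_imp_surj_on[OF \<sigma>] by (simp add: points_def)
  then obtain i where i: "i < ncomp K'" "\<sigma> i = j" by auto
  obtain x where "y = \<phi> i x" using surjD[OF surj[OF i(1)]] by blast
  then show thesis using that[of "(i, x)"] i q by (simp add: points_def \<psi>)
qed

lemma cut_map:
  assumes p: "p \<in> points K'" and c: "cut K (\<psi> p)"
  shows "cut K' p"
proof -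
  obtain q where q: "double K (\<psi> p) q" using c unfolding cut_def crossing_def by blast
  then have "q \<in> points K" by (simp add: double_def)
  then obtain q' where q': "q' \<in> points K'" "\<psi> q' = q" by (rule \<psi>_onto)
  have "crossing K' p" using double_map[OF p q'(1)] q q'(2) unfolding crossing_def by blast
  then show ?thesis using c strand_map[of p] unfolding cut_def by simp
qed

lemma coloring_map:
  assumes c: "coloring A K X v l r"
  shows "coloring A K' X v (l \<circ> \<psi>) (r \<circ> \<psi>)"
  unfolding coloring_def
proof (intro conjI allI impI ballI)
  have lab: "labelling (ncomp K) (qcarrier X) l r" using c unfolding coloring_def by blast
  show "variables A X v" using c unfolding coloring_def by blast
  show "labelling (ncomp K') (qcarrier X) (l \<circ> \<psi>) (r \<circ> \<psi>)"
    unfolding labelling_def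
  proof (intro allI impI)
    fix i x assume i: "i < ncomp K'"
    then have j: "\<sigma> i < ncomp K" using bij_betwE[OF \<sigma>] by simp
    have L: "l (\<sigma> i, y) \<in> qcarrier X" "r (\<sigma> i, y) \<in> qcarrier X" "l (\<sigma> i, y + 1) = l (\<sigma> i, y)" "r (\<sigma> i, y + 1) = r (\<sigma> i, y)"
      "left_ok (\<lambda>y. l (\<sigma> i, y)) (\<lambda>y. r (\<sigma> i, y)) y" "right_ok (\<lambda>y. l (\<sigma> i, y)) (\<lambda>y. r (\<sigma> i, y)) y" for y
      using lab j unfolding labelling_def by blast+
    have "left_ok (\<lambda>y. l (\<sigma> i, \<phi> i y)) (\<lambda>y. r (\<sigma> i, \<phi> i y)) x"
    proof -
      obtain b where b: "b < \<phi> i x" "\<And>y. b < y \<Longrightarrow> y < \<phi> i x \<Longrightarrow> l (\<sigma> i, y) = l (\<sigma> i, \<phi> i x) \<and> r (\<sigma> i, y) = l (\<sigma> i, \<phi> i x)"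
        using L(5)[of "\<phi> i x"] unfolding left_ok_iff by blast
      obtain b' where b': "b = \<phi> i b'" using surjD[OF surj[OF i]] by blast
      show ?thesis unfolding left_ok_iff
        by (rule exI[of _ b']) (use b b' strict_mono_less[OF mono[OF i]] in simp)
    qed
    moreover have "right_ok (\<lambda>y. l (\<sigma> i, \<phi> i y)) (\<lambda>y. r (\<sigma> i, \<phi> i y)) x"
    proof -
      obtain b where b: "\<phi> i x < b" "\<And>y. \<phi> i x < y \<Longrightarrow> y < b \<Longrightarrow> l (\<sigma> i, y) = r (\<sigma> i, \<phi> i x) \<and> r (\<sigma> i, y) = r (\<sigma> i, \<phi> i x)"
        using L(6)[of "\<phi> i x"] unfolding right_ok_iff by blast
      obtain b' where b': "b = \<phi> i b'" using surjD[OF surj[OF i]] by blast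
      show ?thesis unfolding right_ok_iff
        by (rule exI[of _ b']) (use b b' strict_mono_less[OF mono[OF i]] in simp)
    qed
    ultimately show "(l \<circ> \<psi>) (i, x) \<in> qcarrier X \<and> (r \<circ> \<psi>) (i, x) \<in> qcarrier X \<and>
        (l \<circ> \<psi>) (i, x + 1) = (l \<circ> \<psi>) (i, x) \<and> (r \<circ> \<psi>) (i, x + 1) = (r \<circ> \<psi>) (i, x) \<and>
        left_ok (\<lambda>y. (l \<circ> \<psi>) (i, y)) (\<lambda>y. (r \<circ> \<psi>) (i, y)) x \<and> right_ok (\<lambda>y. (l \<circ> \<psi>) (i, y)) (\<lambda>y. (r \<circ> \<psi>) (i, y)) x"
      using L(1-4) by (simp add: \<psi> shift[OF i])
  qed
  show "(l \<circ> \<psi>) p = (r \<circ> \<psi>) p" if "p \<in> points K'" "\<not> cut K' p" for p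
  proof -
    have "\<not> cut K (\<psi> p)" using cut_map[OF that(1)] that(2) by blast
    then have "l (\<psi> p) = r (\<psi> p)" using c \<psi>_points[OF that(1)] unfolding coloring_def by blast
    then show ?thesis by simp
  qed
  show "passes K' X v (l \<circ> \<psi>) (r \<circ> \<psi>) p q" if "double K' p q \<and> strand K' q \<noteq> Over" for p q
  proof -
    have d: "double K' p q" using that by blast
    have s: "strand K' q = strand K (\<psi> q)"
      by (rule strand_map) (use double_sym[OF d] in \<open>unfold crossing_def, blast\<close>)
    have "double K (\<psi> p) (\<psi> q)" using double_map[of p q] d unfolding double_def by blast
    then have "passes K X v l r (\<psi> p) (\<psi> q)" using c that s unfolding coloring_def by metis
    then show ?thesis unfolding passes_def s sign_map[OF d] o_apply .
  qed
qed

end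

lemma (in reparametrised) inverse:
  fixes \<tau> \<psi>'
  assumes "\<tau> = inv_into {..<ncomp K'} \<sigma>" "\<psi>' = (\<lambda>(j, y). (\<tau> j, inv (\<phi> (\<tau> j)) y))"
  shows "reparametrised A K' K \<tau> (\<lambda>j. inv (\<phi> (\<tau> j))) \<psi>'" "p \<in> points K' \<Longrightarrow> \<psi>' (\<psi> p) = p" "q \<in> points K \<Longrightarrow> \<psi> (\<psi>' q) = q"
proof -
  have \<tau>: "bij_betw \<tau> {..<ncomp K} {..<ncomp K'}" unfolding assms(1) by (rule bij_betw_inv_into[OF \<sigma>])
  have \<tau>': "\<tau> j < ncomp K'" if "j < ncomp K" for j using bij_betwE[OF \<tau>] that by simp
  have inj: "inj (\<phi> i)" if "i < ncomp K'" for i by (rule strict_mono_imp_inj_on[OF mono[OF that]])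
  have \<phi>i: "\<phi> (\<tau> j) (inv (\<phi> (\<tau> j)) y) = y" if "j < ncomp K" for j y by (rule surj_f_inv_f[OF surj[OF \<tau>'[OF that]]])
  show back': "\<psi>' (\<psi> p) = p" if "p \<in> points K'" for p
  proof -
    obtain i x where p: "p = (i, x)" by (cases p)
    have i: "i < ncomp K'" using that p by (simp add: points_def)
    have "\<tau> (\<sigma> i) = i" unfolding assms(1) by (rule bij_betw_inv_into_left[OF \<sigma>]) (use i in simp)
    then show ?thesis by (simp add: p \<psi> assms(2) inv_f_f[OF inj[OF i]])
  qed
  show forth: "\<psi> (\<psi>' q) = q" if "q \<in> points K" for q
  proof -
    obtain j y where q: "q = (j, y)" by (cases q)
    have j: "j < ncomp K" using that q by (simp add: points_def)
    have "\<sigma> (\<tau> j) = j" unfolding assms(1) by (rule bij_betw_inv_into_right[OF \<sigma>]) (use j in simp)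
    then show ?thesis by (simp add: q \<psi> assms(2) \<phi>i[OF j])
  qed
  have pt: "\<psi>' q \<in> points K'" if "q \<in> points K" for q
    using that \<tau>' by (cases q) (simp add: points_def assms(2))
  have dbl: "double K p q \<longleftrightarrow> double K' (\<psi>' p) (\<psi>' q)" if "p \<in> points K" "q \<in> points K" for p q
    using double_map[OF pt[OF that(1)] pt[OF that(2)]] forth that by simp
  show "reparametrised A K' K \<tau> (\<lambda>j. inv (\<phi> (\<tau> j))) \<psi>'"
  proof
    fix j assume j: "j < ncomp K"
    note m = strict_mono_less[OF mono[OF \<tau>'[OF j]]]
    show "strict_mono (inv (\<phi> (\<tau> j)))"
    proof (rule strict_monoI)
      fix x y :: real assume "x < y"
      then have "\<phi> (\<tau> j) (inv (\<phi> (\<tau> j)) x) < \<phi> (\<tau> j) (inv (\<phi> (\<tau> j)) y)" unfolding \<phi>i[OF j] .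
      then show "inv (\<phi> (\<tau> j)) x < inv (\<phi> (\<tau> j)) y" unfolding m .
    qed
    show "surj (inv (\<phi> (\<tau> j)))" by (rule inj_imp_surj_inv[OF inj[OF \<tau>'[OF j]]])
    fix x
    show "inv (\<phi> (\<tau> j)) (x + 1) = inv (\<phi> (\<tau> j)) x + 1"
      by (rule injD[OF inj[OF \<tau>'[OF j]]]) (simp add: shift[OF \<tau>'[OF j]] \<phi>i[OF j])
  next
    fix p assume c: "crossing K p"
    then obtain q where q: "double K p q" unfolding crossing_def by blast
    then have pq: "p \<in> points K" "q \<in> points K" by (simp_all add: double_def)
    then have "crossing K' (\<psi>' p)" using dbl[OF pq] q unfolding crossing_def by blast
    then show "strand K p = strand K' (\<psi>' p)" using strand_map[of "\<psi>' p"] forth[OF pq(1)] by simp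
  next
    fix p q assume q: "double K p q"
    then have pq: "p \<in> points K" "q \<in> points K" by (simp_all add: double_def)
    show "0 < det2 (tangent K p) (tangent K q) \<longleftrightarrow> 0 < det2 (tangent K' (\<psi>' p)) (tangent K' (\<psi>' q))"
      using sign_map[of "\<psi>' p" "\<psi>' q"] dbl[OF pq] q forth pq by simp
  qed (use mvK mvK' \<tau> dbl in \<open>simp_all add: assms(2)\<close>)
qed

lemma (in reparametrised) iso: "quandle_iso (mv_quandle A K) (mv_quandle A K')"
proof -
  define \<tau> where "\<tau> = inv_into {..<ncomp K'} \<sigma>"
  define \<psi>' where "\<psi>' = (\<lambda>(j, y). (\<tau> j, inv (\<phi> (\<tau> j)) y))"
  note inv = inverse[OF \<tau>_def \<psi>'_def]
  show ?thesis
  proof (rule iso_by_transfer[where rel = "\<lambda>X v l r l' r'. \<forall>p\<in>points K'. l' p = l (\<psi> p) \<and> r' p = r (\<psi> p)", OF mvK mvK'])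
    show "\<exists>l' r'. coloring A K' X v l' r' \<and> (\<forall>p\<in>points K'. l' p = l (\<psi> p) \<and> r' p = r (\<psi> p))"
      if "coloring A K X v l r" for v l r and X :: "'v generator qterm set quandle"
      using coloring_map[OF that] by (intro exI[of _ "l \<circ> \<psi>"] exI[of _ "r \<circ> \<psi>"]) simp
    show "\<exists>l r. coloring A K X v l r \<and> (\<forall>p\<in>points K'. l' p = l (\<psi> p) \<and> r' p = r (\<psi> p))"
      if "coloring A K' X v l' r'" for v l' r' and X :: "'v generator qterm set quandle"
      using reparametrised.coloring_map[OF inv(1) that] inv(2)
      by (intro exI[of _ "l' \<circ> \<psi>'"] exI[of _ "r' \<circ> \<psi>'"]) simp
    show "la p = lb p" if "\<forall>p\<in>points K'. la' p = la (\<psi> p) \<and> ra' p = ra (\<psi> p)"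
      "\<forall>p\<in>points K'. lb' p = lb (\<psi> p) \<and> rb' p = rb (\<psi> p)"
      "\<And>p. p \<in> points K' \<Longrightarrow> la' p = lb' p \<and> ra' p = rb' p" and p: "p \<in> points K"
      for p and la ra la' ra' lb rb lb' rb' :: "point \<Rightarrow> 'v generator qterm set"
    proof -
      obtain q where q: "q \<in> points K'" "\<psi> q = p" by (rule \<psi>_onto[OF p])
      have "la' q = la p" "lb' q = lb p" "la' q = lb' q" using that(1,2) that(3)[OF q(1)] q by simp_all
      then show ?thesis by simp
    qed
  qed (use \<psi>_points in auto)
qed

lemma increasing_lift:
  fixes f :: "real \<Rightarrow> real"
  assumes f: "f C1_differentiable_on UNIV" "\<And>r. vector_derivative f (at r) > 0" "\<And>r. f (r + 1) = f r + 1"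
  shows "strict_mono f" "surj f" "f (x + of_int k) = f x + of_int k"
proof -
  have d: "(f has_real_derivative vector_derivative f (at r)) (at r)" for r
    using f(1) unfolding C1_differentiable_on_eq has_real_derivative_iff_has_vector_derivative
    by (simp add: vector_derivative_works)
  show "strict_mono f"
    by (rule strict_monoI, rule DERIV_pos_imp_increasing) (use d f(2) in blast)+
  have k: "f (x + of_int k) = f x + of_int k" for x k
    using periodic_int[of "\<lambda>x. f x - x" x k] f(3) by (simp add: algebra_simps)
  then show "f (x + of_int k) = f x + of_int k" .
  have c: "continuous_on S f" for S
    by (rule continuous_at_imp_continuous_on) (use d DERIV_isCont in blast)
  have "\<exists>x. y = f x" for y
  proof -
    define k where "k = \<lfloor>y - f 0\<rfloor>"
    have "f (of_int k) = f 0 + of_int k" using k[of 0 k] by simp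
    then have "f (of_int k) \<le> y" "y \<le> f (of_int k + 1)" unfolding f(3) k_def by (simp_all, linarith+)
    then show ?thesis using IVT'[of f "of_int k" y "of_int k + 1"] c by force
  qed
  then show "surj f" unfolding surj_def by blast
qed

lemma isotopy_iso:
  fixes A :: "'v set" and K K' :: "'v diagram"
  assumes iso: "planar_isotopic A K K'"
  shows "quandle_iso (mv_quandle A K) (mv_quandle A K')"
proof -
  obtain H \<sigma> \<phi> where h: "diffeotopy H" "bij_betw \<sigma> {..<ncomp K'} {..<ncomp K}"
    and \<phi>: "\<And>i. i < ncomp K' \<Longrightarrow> \<phi> i C1_differentiable_on UNIV"
      "\<And>i r. i < ncomp K' \<Longrightarrow> vector_derivative (\<phi> i) (at r) > (0::real)"
      "\<And>i r. i < ncomp K' \<Longrightarrow> \<phi> i (r + 1) = \<phi> i r + 1"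
      "\<And>i r. i < ncomp K' \<Longrightarrow> pos K' (i, r) = H 1 (pos K (\<sigma> i, \<phi> i r))"
      "\<And>i r. i < ncomp K' \<Longrightarrow> crossing K' (i, r) \<Longrightarrow> strand K' (i, r) = strand K (\<sigma> i, \<phi> i r)"
    using iso unfolding planar_isotopic_def by blast
  have K: "mv_diagram A K" and K': "mv_diagram A K'" using iso by (simp_all add: planar_isotopic_def)
  obtain L where L: "\<And>z. (H 1 has_derivative L z) (at z)" "\<And>z. 0 < det2 (L z 1) (L z \<i>)"
    by (rule diffeotopy_orientation[OF h(1)]) blast
  have injH: "inj (H 1)" using h(1) unfolding diffeotopy_def by (auto intro: bij_is_inj)
  define \<psi> where "\<psi> = (\<lambda>(i, x). (\<sigma> i, \<phi> i x))"
  note lift = increasing_lift[OF \<phi>(1-3)]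
  have \<sigma>: "\<sigma> i < ncomp K" if "i < ncomp K'" for i using bij_betwE[OF h(2)] that by simp
  have tan: "tangent K' (i, r) = vector_derivative (\<phi> i) (at r) *\<^sub>R L (pos K (\<sigma> i, \<phi> i r)) (tangent K (\<sigma> i, \<phi> i r))"
    if i: "i < ncomp K'" for i r
  proof -
    have "(\<phi> i has_vector_derivative vector_derivative (\<phi> i) (at r)) (at r)"
      using \<phi>(1)[OF i] unfolding C1_differentiable_on_eq by (simp add: vector_derivative_works)
    from vector_diff_chain_at[OF this pos_has_derivative[OF K \<sigma>[OF i]]]
    have "((\<lambda>x. pos K (\<sigma> i, \<phi> i x)) has_vector_derivative
        vector_derivative (\<phi> i) (at r) *\<^sub>R tangent K (\<sigma> i, \<phi> i r)) (at r)"
      by (simp add: o_def)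
    from has_derivative_compose[OF this[unfolded has_vector_derivative_def] L(1)]
    have "((\<lambda>x. pos K' (i, x)) has_vector_derivative
        vector_derivative (\<phi> i) (at r) *\<^sub>R L (pos K (\<sigma> i, \<phi> i r)) (tangent K (\<sigma> i, \<phi> i r))) (at r)"
      by (simp add: has_vector_derivative_def \<phi>(4)[OF i] linear_scale[OF has_derivative_linear[OF L(1)]])
    then show ?thesis unfolding tangent_def fst_conv snd_conv by (rule vector_derivative_at)
  qed
  have sp: "same_point p q \<longleftrightarrow> same_point (\<psi> p) (\<psi> q)" if pq: "p \<in> points K'" "q \<in> points K'" for p q
  proof -
    obtain i x j y where e: "p = (i, x)" "q = (j, y)" by (cases p; cases q)
    have ij: "i < ncomp K'" "j < ncomp K'" using pq by (simp_all add: e points_def)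
    have "\<sigma> i = \<sigma> j \<longleftrightarrow> i = j" using bij_betw_imp_inj_on[OF h(2)] ij by (simp add: inj_on_eq_iff)
    moreover have "\<phi> i x = \<phi> i y + of_int k \<longleftrightarrow> x = y + of_int k" for k
      unfolding lift(3)[OF ij(1) ij(1) ij(1), symmetric] by (rule strict_mono_eq[OF lift(1)[OF ij(1) ij(1) ij(1)]])
    ultimately show ?thesis by (auto simp: e \<psi>_def same_point_iff)
  qed
  interpret reparametrised A K K' \<sigma> \<phi> \<psi>
  proof
    fix p q
    show d: "double K' p q \<longleftrightarrow> double K (\<psi> p) (\<psi> q)" if pq: "p \<in> points K'" "q \<in> points K'" for p q
    proof -
      obtain i x j y where e: "p = (i, x)" "q = (j, y)" by (cases p; cases q)
      have ij: "i < ncomp K'" "j < ncomp K'" using pq by (simp_all add: e points_def)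
      have "pos K' p = pos K' q \<longleftrightarrow> pos K (\<psi> p) = pos K (\<psi> q)"
        by (simp add: e \<psi>_def \<phi>(4) ij inj_eq[OF injH])
      moreover have "\<psi> p \<in> points K" "\<psi> q \<in> points K" using \<sigma> ij by (simp_all add: e \<psi>_def points_def)
      ultimately show ?thesis using sp[OF pq] pq unfolding double_def by blast
    qed
    show "0 < det2 (tangent K' p) (tangent K' q) \<longleftrightarrow> 0 < det2 (tangent K (\<psi> p)) (tangent K (\<psi> q))"
      if dd: "double K' p q"
    proof -
      obtain i x j y where e: "p = (i, x)" "q = (j, y)" by (cases p; cases q)
      have pq: "p \<in> points K'" "q \<in> points K'" using dd by (simp_all add: double_def)
      then have ij: "i < ncomp K'" "j < ncomp K'" by (simp_all add: e points_def)
      have z: "pos K (\<sigma> i, \<phi> i x) = pos K (\<sigma> j, \<phi> j y)" using d[OF pq] dd by (simp add: e \<psi>_def double_def)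
      have t: "tangent K' p = vector_derivative (\<phi> i) (at x) *\<^sub>R L (pos K (\<sigma> i, \<phi> i x)) (tangent K (\<psi> p))"
        "tangent K' q = vector_derivative (\<phi> j) (at y) *\<^sub>R L (pos K (\<sigma> i, \<phi> i x)) (tangent K (\<psi> q))"
        using tan[OF ij(1), of x] tan[OF ij(2), of y] by (simp_all add: e \<psi>_def z)
      show ?thesis
        unfolding t det2_scaleR linear_det2[OF has_derivative_linear[OF L(1)], of _ "tangent K (\<psi> p)"]
        using \<phi>(2)[OF ij(1), of x] \<phi>(2)[OF ij(2), of y] L(2)[of "pos K (\<sigma> i, \<phi> i x)"]
        by (metis mult_pos_pos zero_less_mult_pos)
    qed
    show "strand K' p = strand K (\<psi> p)" if c: "crossing K' p"
    proof -
      obtain i x where e: "p = (i, x)" by (cases p)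
      have "p \<in> points K'" using c by (auto simp: crossing_def double_def)
      then show ?thesis using \<phi>(5)[of i x] c by (simp add: e \<psi>_def points_def)
    qed
  qed (use K K' h(2) lift \<phi>(3) in \<open>simp_all add: \<psi>_def\<close>)
  show ?thesis by (rule iso)
qed

theorem mainTheorem5:
  fixes A :: "'v set" and K K' :: "'v diagram"
  assumes "mv_diagram A K" and "mv_diagram A K'"
  shows "(reidemeister_move A K K' \<longrightarrow> quandle_iso (mv_quandle A K) (mv_quandle A K')) \<and>
         (detour_move A K K' \<longrightarrow> quandle_iso (mv_quandle A K) (mv_quandle A K')) \<and>
         (mv_equivalent A K K' \<longrightarrow> quandle_iso (mv_quandle A K) (mv_quandle A K'))"
proof (intro conjI impI)
  let ?step = "\<lambda>K K'. planar_isotopic A K K' \<or> reidemeister_move A K K' \<or> detour_move A K K'"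
  let ?iso = "\<lambda>K K'. quandle_iso (mv_quandle A K) (mv_quandle A K')"
  have step: "?iso L L'" if "?step L L'" for L L' :: "'v diagram"
    using that isotopy_iso reidemeister_iso detour_iso by blast
  show "?iso K K'" if "reidemeister_move A K K'" using step that by blast
  show "?iso K K'" if "detour_move A K K'" using step that by blast
  show "?iso K K'" if "mv_equivalent A K K'"
    using that unfolding mv_equivalent_def
  proof (induction rule: equivclp_induct)
    case base
    show ?case by (rule quandle_iso_refl)
  next
    case (step L L')
    have "?iso L L'"
      using step.hyps(2)
    proof
      assume "?step L' L"
      then show ?thesis by (rule quandle_iso_sym[OF mv_is_quandle \<open>?step L' L \<Longrightarrow> ?iso L' L\<close>])
    qed (rule \<open>?step L L' \<Longrightarrow> ?iso L L'\<close>)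
    then show ?case by (rule quandle_iso_trans[OF step.IH])
  qed
qed

end
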